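(* Let $\phi\in\mathcal{H}_d^*$ and assume that every point of $\Omega(\phi)=\{\xi_1,\dots,\xi_K\}$ is of positive-homogeneous type for $\widehat\phi$. For $k=1,\dots,K$, let $\alpha_k$, $P_k$, $\mu_k$, $\Upsilon_k$ be the associated data at $\xi_k$, let $A_k\in \mathrm{GL}_d(\mathbb{R})$ be such that $\xi\mapsto P_k(A_k\xi)$ is positive semi-elliptic with $\mathbf{m}_k=(m_{1,k},\dots,m_{d,k})\in\mathbb{N}_+^d$, set $m_k=\operatorname{lcm}(m_{1,k},\dots,m_{d,k})$, and let $Q_{\lambda,k}^n$ be the differential operators $Q_\lambda^n$ constructed from $(P_k,\Upsilon_k)$ and $A_k$. Given $1\leq p\leq q\leq\infty$ and orders of accuracy $\lambda_1,\dots,\lambda_K\in\mathbb{N}$, set $$\gamma=\min_{k}\left\{\mu_k\left(\frac1p-\frac1q\right)+\frac{\lambda_k+1}{2m_k}\right\}$$ and $$\mathcal{R}^n_{\lambda_1,\dots,\lambda_K}(x)=\phi^{(n)}(x)-\sum_{k=1}^K\sum_{\lambda=0}^{\lambda_k}e^{-ix\cdot\xi_k}\widehat\phi(\xi_k)^n(Q_{\lambda,k}^nH_{P_k}^n)(x-n\alpha_k),\qquad n\in\mathbb{N}_+,\ x\in\mathbb{Z}^d.$$ Then there is a constant $C=C_{p,q,\lambda_1,\dots,\lambda_K}>0$ (independent of $n$ and $u$) for which $$\left\|\mathcal{R}^n_{\lambda_1,\dots,\lambda_K}*u\right\|_q\leq\frac{C}{n^\gamma}\|u\|_p$$ for all $n\in\mathbb{N}_+$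 and $u\in\ell^p(\mathbb{Z}^d)$.
   Context: $\mathbb{N}=\{0,1,2,\dots\}$, $\mathbb{N}_+=\{1,2,\dots\}$, $\mathbb{T}^d=(-\pi,\pi]^d$, $\|\cdot\|_p$ is the usual norm of $\ell^p(\mathbb{Z}^d)$, and $1/\infty=0$. Convolution powers. For functions on $\mathbb{Z}^d$, $(\phi*\lambda)(x)=\sum_{y\in\mathbb{Z}^d}\phi(x-y)\lambda(y)$. For $\phi\in\ell^1(\mathbb{Z}^d)$ (complex-valued), $\phi^{(1)}=\phi$ and $\phi^{(n)}=\phi^{(n-1)}*\phi$ for $n\ge 2$. $\widehat{\phi}(\xi)=\sum_{x\in\mathbb{Z}^d}\phi(x)e^{ix\cdot\xi}$. $\mathcal{H}_d$ is the set of $\phi\in\ell^1(\mathbb{Z}^d)$ for which $\widehat\phi$ is holomorphic on (extends holomorphically to) a neighborhood of $\mathbb{T}^d$ in $\mathbb{C}^d$; $\mathcal{H}_d^*$ is the set of $\phi\in\mathcal{H}_d$ with $\sup_{\xi\in\mathbb{T}^d}|\widehat\phi(\xi)|=1$; $\Omega(\phi)=\{\xi\in\mathbb{T}^d:|\widehat\phi(\xi)|=1\}$. Positive-homogeneous polynomials. For a real $d\times d$ matrix $E$ and $t>0$, $t^E=\exp((\ln t)E)$. For $P:\mathbb{R}^d\to\mathbb{C}$, $\operatorname{Exp}(P)$ is the set of real $d\times d$ matrices $E$ with $tP(\xi)=P(t^E\xi)$ for all $t>0$, $\xi\in\mathbb{R}^d$. A complex polynomial $P$ in $d$ variables is positive-homogeneous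 if $\operatorname{Exp}(P)\neq\varnothing$ and $R=\operatorname{Re}P$ on $\mathbb{R}^d$ is positive-definite ($R\geq0$ and $R(\xi)=0$ only when $\xi=0$). Its homogeneous order is $\mu_P=\operatorname{tr}E$ for any $E\in\operatorname{Exp}(P)$ (positive and independent of $E$). For $\mathbf{n}\in\mathbb{N}_+^d$ and a multi-index $\beta\in\mathbb{N}^d$, $|\beta:\mathbf{n}|=\sum_j\beta_j/n_j$. A polynomial is positive semi-elliptic with $\mathbf{m}\in\mathbb{N}_+^d$ if it has the form $\sum_{|\beta:\mathbf{m}|=2}a_\beta\xi^\beta$, $a_\beta\in\mathbb{C}$, with positive-definite real part $\sum_{|\beta:\mathbf{m}|=2}\operatorname{Re}(a_\beta)\xi^\beta$. For every positive-homogeneous polynomial $P$ there is $A\in\mathrm{GL}_d(\mathbb{R})$ such that $P_A(\xi)=P(A\xi)$ is positive semi-elliptic with some $\mathbf{m}$. Type of points. For $\xi_0\in\Omega(\phi)$, $\Gamma_{\xi_0}(\xi)=\operatorname{Log}(\widehat\phi(\xi+\xi_0)/\widehat\phi(\xi_0))$ (principal branch), holomorphic near $0\in\mathbb{C}^d$. $\xi_0$ is of positive-homogeneous type for $\widehat\phi$ if $\Gamma_{\xi_0}(\xi)=i\alpha_{\xi_0}\cdot\xi-P_{\xi_0}(\xi)+\Upsilon_{\xi_0}(\xi)$ with $\alpha_{\xi_0}\in\mathbb{R}^d$, $P_{\xi_0}$ a positive-homogeneous polynomial, and $\Upsilon_{\xi_0}(\xi)=o(\operatorname{Re}P_{\xi_0}(\xi))$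 as $\xi\to0$ in $\mathbb{R}^d$. If all points of $\Omega(\phi)$ are of this type, $\Omega(\phi)$ is finite and one writes $\alpha_k=\alpha_{\xi_k}$, $P_k=P_{\xi_k}$, $\Upsilon_k=\Upsilon_{\xi_k}$, $\mu_k=\mu_{P_k}$. Attractors. For a positive-homogeneous polynomial $P$, $H_P^t(x)=\frac{1}{(2\pi)^d}\int_{\mathbb{R}^d}e^{-tP(\xi)}e^{-ix\cdot\xi}\,d\xi$ for $t>0$, $x\in\mathbb{R}^d$. Operators $Q_\lambda^n$. Complete Bell polynomials $B_\lambda$ are defined by the formal identity $\exp\left(\sum_{l\ge1}\frac{s_l}{l!}t^l\right)=\sum_{\lambda\ge0}\frac{B_\lambda(s_1,\dots,s_\lambda)}{\lambda!}t^\lambda$. Let $P$ be positive-homogeneous with $R=\operatorname{Re}P$, $\Upsilon$ holomorphic near $0\in\mathbb{C}^d$ with $\Upsilon(\xi)=o(R(\xi))$ as $\xi\to0$ in $\mathbb{R}^d$, and $A$ such that $P_A$ is positive semi-elliptic with $\mathbf{m}$. Set $m=\operatorname{lcm}(m_1,\dots,m_d)$, $\kappa=(\kappa_1,\dots,\kappa_d)\in\mathbb{N}_+^d$ with $m_j\kappa_j=m$, $\Lambda(\beta)=\beta\cdot\kappa-2m$. Then $\Upsilon_A(z)=\Upsilon(Az)=\sum_{|\beta:2\mathbf{m}|>1}b_\beta z^\beta$ near $0$ (all other Maclaurin coefficients vanish), and for $\lambda\in\mathbb{N}_+$ one sets $S_\lambda(z)=\lambda!\sum_{\Lambda(\beta)=\lambda}b_\beta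 z^\beta$. Then $Q_\lambda^n=\frac{1}{\lambda!}B_\lambda\big(nS_1(A^{-1}(i\partial)),\dots,nS_\lambda(A^{-1}(i\partial))\big)$, with $i\partial=(i\partial_1,\dots,i\partial_d)$, i.e. the constant-coefficient differential operator obtained from the polynomial $\xi\mapsto\frac1{\lambda!}B_\lambda(nS_1(A^{-1}\xi),\dots,nS_\lambda(A^{-1}\xi))$ by substituting $\xi_j\to i\partial_j$; $Q_0^n$ is the identity. $(Q_\lambda^nH_P^n)$ is $Q_\lambda^n$ applied to $x\mapsto H_P^n(x)$. *)

theory Defs
  imports
    "HOL-Analysis.Analysis"
    "HOL-Library.Poly_Mapping"
    "HOL-Library.Landau_Symbols"
    "HOL-Computational_Algebra.Formal_Power_Series"
begin

text \<open>
  The dimension is the cardinality of a finite index type: the lattice is \<^typ>\<open>int^'d\<close>, the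
  frequency space is \<^typ>\<open>real^'d\<close>, its complexification is \<^typ>\<open>complex^'d\<close>, and multi-indices
  are elements of \<^typ>\<open>nat^'d\<close>.
\<close>

definition real_vec :: "int^'d \<Rightarrow> real^'d" where
  "real_vec x = (\<chi> j. real_of_int (x $ j))"

definition complex_vec :: "real^'d \<Rightarrow> complex^'d" where
  "complex_vec \<xi> = (\<chi> j. complex_of_real (\<xi> $ j))"

text \<open>
  \<^term>\<open>lp_norm\<close> is meaningful only on \<^term>\<open>lp_space\<close>: outside of it \<^const>\<open>infsum\<close> is \<open>0\<close>
  and the supremum is unspecified.
\<close>

definition lp_space :: "ennreal \<Rightarrow> (int^'d \<Rightarrow> complex) set" where
  "lp_space p =
     (if p = \<infinity> then {u. bounded (range u)}
      else {u. (\<lambda>x. cmod (u x) powr enn2real p) summable_on UNIV})"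

definition lp_norm :: "ennreal \<Rightarrow> (int^'d \<Rightarrow> complex) \<Rightarrow> real" where
  "lp_norm p u =
     (if p = \<infinity> then (SUP x. cmod (u x))
      else (\<Sum>\<^sub>\<infinity>x. cmod (u x) powr enn2real p) powr (1 / enn2real p))"

definition conv :: "(int^'d \<Rightarrow> complex) \<Rightarrow> (int^'d \<Rightarrow> complex) \<Rightarrow> int^'d \<Rightarrow> complex" where
  "conv \<phi> \<psi> x = (\<Sum>\<^sub>\<infinity>y. \<phi> (x - y) * \<psi> y)"

fun conv_power :: "(int^'d \<Rightarrow> complex) \<Rightarrow> nat \<Rightarrow> int^'d \<Rightarrow> complex" where
  "conv_power \<phi> 0 = (\<lambda>x. if x = 0 then 1 else 0)"
| "conv_power \<phi> (Suc 0) = \<phi>"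
| "conv_power \<phi> (Suc (Suc n)) = conv (conv_power \<phi> (Suc n)) \<phi>"

definition fourier :: "(int^'d \<Rightarrow> complex) \<Rightarrow> real^'d \<Rightarrow> complex" where
  "fourier \<phi> \<xi> = (\<Sum>\<^sub>\<infinity>x. \<phi> x * exp (\<i> * complex_of_real (real_vec x \<bullet> \<xi>)))"

definition torus :: "(real^'d) set" where
  "torus = {\<xi>. \<forall>j. - pi < \<xi> $ j \<and> \<xi> $ j \<le> pi}"

text \<open>Holomorphy in several variables: a complex-linear total derivative at every point.\<close>

definition holomorphic_vec_on :: "(complex^'d \<Rightarrow> complex) \<Rightarrow> (complex^'d) set \<Rightarrow> bool" where
  "holomorphic_vec_on F U \<longleftrightarrow>
     (\<forall>z\<in>U. \<exists>c. (F has_derivative (\<lambda>h. \<Sum>j\<in>UNIV. c $ j * h $ j)) (at z within U))"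

text \<open>
  The extension agrees with the (periodic) Fourier transform at \<^emph>\<open>all\<close> real points of \<open>U\<close>, not
  merely on \<^const>\<open>torus\<close>. As the torus is represented by a half-open cube, the weaker
  requirement would ignore a failure of smoothness across the boundary of the cube.
\<close>

definition H_class :: "(int^'d \<Rightarrow> complex) set" where
  "H_class = {\<phi> \<in> lp_space 1.
     \<exists>U F. open U \<and> complex_vec ` torus \<subseteq> U \<and> holomorphic_vec_on F U \<and>
           (\<forall>\<xi>. complex_vec \<xi> \<in> U \<longrightarrow> F (complex_vec \<xi>) = fourier \<phi> \<xi>)}"

definition H_star :: "(int^'d \<Rightarrow> complex) set" where
  "H_star = {\<phi> \<in> H_class. (SUP \<xi>\<in>torus. cmod (fourier \<phi> \<xi>)) = 1}"

definition Omega :: "(int^'d \<Rightarrow> complex) \<Rightarrow> (real^'d) set" where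
  "Omega \<phi> = {\<xi> \<in> torus. cmod (fourier \<phi> \<xi>) = 1}"

text \<open>
  A polynomial is identified with the function on \<^typ>\<open>real^'d\<close> it induces; its coefficient
  family is a finitely supported map on multi-indices.
\<close>

definition mono_eval :: "nat^'d \<Rightarrow> complex^'d \<Rightarrow> complex" where
  "mono_eval \<beta> z = (\<Prod>j\<in>UNIV. z $ j ^ (\<beta> $ j))"

definition poly_eval :: "((nat^'d) \<Rightarrow>\<^sub>0 complex) \<Rightarrow> real^'d \<Rightarrow> complex" where
  "poly_eval a \<xi> =
     (\<Sum>\<beta>\<in>Poly_Mapping.keys a. Poly_Mapping.lookup a \<beta> * mono_eval \<beta> (complex_vec \<xi>))"

definition polynomial_fun :: "(real^'d \<Rightarrow> complex) \<Rightarrow> bool" where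
  "polynomial_fun f \<longleftrightarrow> (\<exists>a. f = poly_eval a)"

definition poly_coeffs :: "(real^'d \<Rightarrow> complex) \<Rightarrow> (nat^'d) \<Rightarrow>\<^sub>0 complex" where
  "poly_coeffs f = (THE a. f = poly_eval a)"

definition positive_definite :: "(real^'d \<Rightarrow> real) \<Rightarrow> bool" where
  "positive_definite R \<longleftrightarrow> (\<forall>\<xi>. R \<xi> \<ge> 0) \<and> (\<forall>\<xi>. R \<xi> = 0 \<longrightarrow> \<xi> = 0)"

text \<open>
  The library's multiplication on \<^typ>\<open>real^'d^'d\<close> is componentwise, so neither \<^const>\<open>power\<close>
  nor \<^const>\<open>exp\<close> can be used for matrices.
\<close>

definition mat_exp :: "real^'d^'d \<Rightarrow> real^'d^'d" where
  "mat_exp M = suminf (\<lambda>k. (1 / fact k) *\<^sub>R ((\<lambda>N. M ** N) ^^ k) (mat 1))"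

definition mat_powr :: "real \<Rightarrow> real^'d^'d \<Rightarrow> real^'d^'d" where
  "mat_powr t E = mat_exp (ln t *\<^sub>R E)"

definition Exp_set :: "(real^'d \<Rightarrow> complex) \<Rightarrow> (real^'d^'d) set" where
  "Exp_set P = {E. \<forall>t>0. \<forall>\<xi>. complex_of_real t * P \<xi> = P (mat_powr t E *v \<xi>)}"

definition positive_homogeneous :: "(real^'d \<Rightarrow> complex) \<Rightarrow> bool" where
  "positive_homogeneous P \<longleftrightarrow>
     polynomial_fun P \<and> Exp_set P \<noteq> {} \<and> positive_definite (\<lambda>\<xi>. Re (P \<xi>))"

text \<open>The trace is the same for all members of \<^term>\<open>Exp_set P\<close> if \<open>P\<close> is positive-homogeneous.\<close>

definition hom_order :: "(real^'d \<Rightarrow> complex) \<Rightarrow> real" where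
  "hom_order P = trace (SOME E. E \<in> Exp_set P)"

definition weighted_length :: "nat^'d \<Rightarrow> nat^'d \<Rightarrow> real" where
  "weighted_length \<beta> n = (\<Sum>j\<in>UNIV. real (\<beta> $ j) / real (n $ j))"

definition positive_semi_elliptic :: "nat^'d \<Rightarrow> (real^'d \<Rightarrow> complex) \<Rightarrow> bool" where
  "positive_semi_elliptic m f \<longleftrightarrow>
     (\<forall>j. m $ j \<ge> 1) \<and>
     (\<exists>a. f = poly_eval a \<and> (\<forall>\<beta>\<in>Poly_Mapping.keys a. weighted_length \<beta> m = 2)) \<and>
     positive_definite (\<lambda>\<xi>. Re (f \<xi>))"

definition Gamma_at :: "(int^'d \<Rightarrow> complex) \<Rightarrow> real^'d \<Rightarrow> real^'d \<Rightarrow> complex" where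
  "Gamma_at \<phi> \<xi>\<^sub>0 \<xi> = Ln (fourier \<phi> (\<xi> + \<xi>\<^sub>0) / fourier \<phi> \<xi>\<^sub>0)"

text \<open>
  \<open>\<xi>\<^sub>0\<close> is of positive-homogeneous type, with associated data \<open>\<alpha>\<close>, \<open>P\<close>, \<open>\<Upsilon>\<close>. The remainder \<open>\<Upsilon>\<close> is
  carried as a function holomorphic near the origin of \<^typ>\<open>complex^'d\<close>; its germ is determined
  by \<open>\<alpha>\<close>, \<open>P\<close> and the identity on real vectors.
\<close>

definition positive_homogeneous_type ::
  "(int^'d \<Rightarrow> complex) \<Rightarrow> real^'d \<Rightarrow> real^'d \<Rightarrow> (real^'d \<Rightarrow> complex) \<Rightarrow> (complex^'d \<Rightarrow> complex) \<Rightarrow> bool"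
where
  "positive_homogeneous_type \<phi> \<xi>\<^sub>0 \<alpha> P \<Upsilon> \<longleftrightarrow>
     positive_homogeneous P \<and>
     (\<exists>U. open U \<and> 0 \<in> U \<and> holomorphic_vec_on \<Upsilon> U) \<and>
     (\<forall>\<^sub>F \<xi> in nhds 0.
        Gamma_at \<phi> \<xi>\<^sub>0 \<xi> = \<i> * complex_of_real (\<alpha> \<bullet> \<xi>) - P \<xi> + \<Upsilon> (complex_vec \<xi>)) \<and>
     (\<lambda>\<xi>. \<Upsilon> (complex_vec \<xi>)) \<in> o[at 0](\<lambda>\<xi>. complex_of_real (Re (P \<xi>)))"

definition attractor :: "(real^'d \<Rightarrow> complex) \<Rightarrow> real \<Rightarrow> real^'d \<Rightarrow> complex" where
  "attractor P t x =
     complex_of_real (1 / (2 * pi) ^ CARD('d)) *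
     (LINT \<xi>|lborel. exp (- (complex_of_real t * P \<xi>)) * exp (- (\<i> * complex_of_real (x \<bullet> \<xi>))))"

text \<open>
  The complete Bell polynomial, read off from
  \<open>exp (\<Sum>l\<ge>1. s\<^sub>l / l! \<cdot> t\<^sup>l) = (\<Sum>k\<ge>0. B\<^sub>k(s\<^sub>1,\<dots>,s\<^sub>k) / k! \<cdot> t\<^sup>k)\<close>; the value \<open>s 0\<close> is not used.
\<close>

definition bell :: "nat \<Rightarrow> (nat \<Rightarrow> complex) \<Rightarrow> complex" where
  "bell k s = fact k *
     fps_nth (fps_exp 1 oo Abs_fps (\<lambda>l. if l = 0 then 0 else s l / fact l)) k"

definition maclaurin_coeff :: "(complex^'d \<Rightarrow> complex) \<Rightarrow> nat^'d \<Rightarrow> complex" where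
  "maclaurin_coeff F =
     (THE b. \<forall>\<^sub>F z in nhds 0. ((\<lambda>\<beta>. b \<beta> * mono_eval \<beta> z) has_sum F z) UNIV)"

definition lcm_vec :: "nat^'d \<Rightarrow> nat" where
  "lcm_vec m = Lcm (range (\<lambda>j. m $ j))"

definition kappa :: "nat^'d \<Rightarrow> nat^'d" where
  "kappa m = (\<chi> j. lcm_vec m div (m $ j))"

definition Lambda_index :: "nat^'d \<Rightarrow> nat^'d \<Rightarrow> int" where
  "Lambda_index m \<beta> = int (\<Sum>j\<in>UNIV. \<beta> $ j * kappa m $ j) - 2 * int (lcm_vec m)"

definition S_poly ::
  "(complex^'d \<Rightarrow> complex) \<Rightarrow> real^'d^'d \<Rightarrow> nat^'d \<Rightarrow> nat \<Rightarrow> complex^'d \<Rightarrow> complex" where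
  "S_poly \<Upsilon> A m l z = fact l *
     (\<Sum>\<beta> | Lambda_index m \<beta> = int l.
        maclaurin_coeff (\<lambda>w. \<Upsilon> (map_matrix complex_of_real A *v w)) \<beta> * mono_eval \<beta> z)"

definition Q_symbol ::
  "(complex^'d \<Rightarrow> complex) \<Rightarrow> real^'d^'d \<Rightarrow> nat^'d \<Rightarrow> nat \<Rightarrow> nat \<Rightarrow> real^'d \<Rightarrow> complex" where
  "Q_symbol \<Upsilon> A m l n \<xi> = 1 / fact l *
     bell l (\<lambda>r. of_nat n * S_poly \<Upsilon> A m r (complex_vec (matrix_inv A *v \<xi>)))"

definition partial_deriv :: "'d \<Rightarrow> (real^'d \<Rightarrow> complex) \<Rightarrow> real^'d \<Rightarrow> complex" where
  "partial_deriv j f x = vector_derivative (\<lambda>t. f (x + t *\<^sub>R axis j 1)) (at 0)"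

text \<open>
  \<open>\<partial>\<^sup>\<beta>\<close>, composing the partial derivatives in an arbitrary fixed order of the coordinates; the
  order is immaterial for smooth functions such as \<^const>\<open>attractor\<close>.
\<close>

definition multi_deriv :: "nat^'d \<Rightarrow> (real^'d \<Rightarrow> complex) \<Rightarrow> real^'d \<Rightarrow> complex" where
  "multi_deriv \<beta> f =
     foldr (\<lambda>j. partial_deriv j ^^ (\<beta> $ j)) (SOME js. distinct js \<and> set js = UNIV) f"

text \<open>The operator obtained from the polynomial \<open>q\<close> by substituting \<open>\<i> \<partial>\<^sub>j\<close> for the variable \<open>\<xi>\<^sub>j\<close>.\<close>

definition poly_diff_op :: "(real^'d \<Rightarrow> complex) \<Rightarrow> (real^'d \<Rightarrow> complex) \<Rightarrow> real^'d \<Rightarrow> complex" where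
  "poly_diff_op q f x =
     (\<Sum>\<beta>\<in>Poly_Mapping.keys (poly_coeffs q).
        Poly_Mapping.lookup (poly_coeffs q) \<beta> * \<i> ^ (\<Sum>j\<in>UNIV. \<beta> $ j) * multi_deriv \<beta> f x)"

definition Q_op ::
  "(complex^'d \<Rightarrow> complex) \<Rightarrow> real^'d^'d \<Rightarrow> nat^'d \<Rightarrow> nat \<Rightarrow> nat \<Rightarrow>
   (real^'d \<Rightarrow> complex) \<Rightarrow> real^'d \<Rightarrow> complex" where
  "Q_op \<Upsilon> A m l n = poly_diff_op (Q_symbol \<Upsilon> A m l n)"

text \<open>The data \<open>\<alpha>\<close>, \<open>P\<close>, \<open>\<Upsilon>\<close>, \<open>A\<close>, \<open>m\<close>, \<open>ord\<close> are families indexed by the points of \<^term>\<open>Omega \<phi>\<close>.\<close>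

definition remainder ::
  "(int^'d \<Rightarrow> complex) \<Rightarrow> (real^'d \<Rightarrow> real^'d) \<Rightarrow> (real^'d \<Rightarrow> real^'d \<Rightarrow> complex) \<Rightarrow>
   (real^'d \<Rightarrow> complex^'d \<Rightarrow> complex) \<Rightarrow> (real^'d \<Rightarrow> real^'d^'d) \<Rightarrow> (real^'d \<Rightarrow> nat^'d) \<Rightarrow>
   (real^'d \<Rightarrow> nat) \<Rightarrow> nat \<Rightarrow> int^'d \<Rightarrow> complex" where
  "remainder \<phi> \<alpha> P \<Upsilon> A m ord n x =
     conv_power \<phi> n x -
     (\<Sum>\<xi>\<in>Omega \<phi>. \<Sum>l = 0..ord \<xi>.
        exp (- (\<i> * complex_of_real (real_vec x \<bullet> \<xi>))) * fourier \<phi> \<xi> ^ n *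
        Q_op (\<Upsilon> \<xi>) (A \<xi>) (m \<xi>) l n (attractor (P \<xi>) (real n)) (real_vec x - real n *\<^sub>R \<alpha> \<xi>))"

definition decay_exponent ::
  "(int^'d \<Rightarrow> complex) \<Rightarrow> (real^'d \<Rightarrow> real^'d \<Rightarrow> complex) \<Rightarrow> (real^'d \<Rightarrow> nat^'d) \<Rightarrow>
   (real^'d \<Rightarrow> nat) \<Rightarrow> ennreal \<Rightarrow> ennreal \<Rightarrow> real" where
  "decay_exponent \<phi> P m ord p q =
     Min ((\<lambda>\<xi>. hom_order (P \<xi>) * (enn2real (1 / p) - enn2real (1 / q)) +
                real (ord \<xi> + 1) / (2 * real (lcm_vec (m \<xi>)))) ` Omega \<phi>)"

end

theory Submission
  imports Defs "HOL-Complex_Analysis.Complex_Analysis" "HOL-Real_Asymp.Real_Asymp"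
begin

text \<open>
  Fourier inversion on the torus writes \<open>(2\<pi>)\<^sup>d \<phi>\<^sup>(\<^sup>n\<^sup>)(x)\<close> as the integral of the \<open>n\<close>-th power of the
  transform against a character. Away from \<open>Omega \<phi>\<close> the integrand is exponentially small in \<open>n\<close>, so
  only small cells around the finitely many points of \<open>Omega \<phi>\<close> count. At such a point choose
  \<open>t\<close> with \<open>n t\<^sup>2\<^sup>m = 1\<close> and substitute \<open>\<xi> = A \<zeta>'\<close>, where \<open>\<zeta>'\<^sub>j = t ^ \<kappa>\<^sub>j * \<zeta>\<^sub>j\<close>. Weighted homogeneity
  turns \<open>n P\<close> into \<open>P (A \<zeta>)\<close>, independent of \<open>n\<close>, and turns \<open>n\<close> times the remainder into a power
  series in \<open>t\<close> without constant term. Expanding its exponential in powers of \<open>t\<close>, the coefficient of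
  \<open>t\<^sup>l\<close> is exactly the symbol of \<open>Q\<^sub>l\<close> in the new coordinates (\<open>Q_symbol_tmap\<close>), so the partial sums of the
  asserted expansion are the integrals of the Taylor polynomials (\<open>expansion_terms\<close>). The Jacobian
  contributes \<open>n\<close> to the power minus the homogeneous order (\<open>hom_order_eq\<close>), and the Taylor remainder of
  order \<open>\<lambda> + 1\<close> contributes \<open>n ^ (- (\<lambda> + 1) / (2 m))\<close>.

  The spatial decay of these integrals is usually obtained by moving the contour. Here an elementary
  device replaces this (\<open>fourier_integral_decay\<close>): the \<open>N\<close>-fold difference with step \<open>\<pi> / y\<^sub>j\<close> multiplies a
  Fourier integral by \<open>(-2)\<^sup>N\<close>, while it does not increase the integrand as long as that is
  holomorphic and bounded in unit discs and \<open>N\<close> is at most proportional to \<open>y\<^sub>j\<close>. Choosing \<open>N\<close> of that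
  size gives exponential decay, and it also tolerates the cut-off at the boundary of a cell, where
  the integrand is itself exponentially small in \<open>n\<close> (\<open>kernel_estimates\<close>).

  The outcome is a pointwise bound for the remainder kernel by finitely many nonnegative kernels
  whose suprema and sums are known (\<open>point_estimate\<close>, \<open>pointwise_remainder_bound\<close>). Where \<open>x\<close> is large
  compared with \<open>n\<close> the bounds for the cells do not suffice, and the crude estimate
  \<open>W\<^sup>n e\<^sup>-\<^sup>\<epsilon>\<^sup>|\<^sup>x\<^sup>|\<close> of \<open>conv_power_exponential_bound\<close> takes over. Young's inequality, in the form
  \<open>young_dominated\<close>, interpolates between supremum and sum and yields the exponent \<open>\<gamma>\<close>.
\<close>

no_notation fps_nth (infixl \<open>$\<close> 75)

section \<open>Young's inequality\<close>

text \<open>Jensen's inequality for weights of total mass at most \<open>b\<close>; the power \<open>b powr (P - 1)\<close> makes up for their missing normalisation.\<close>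
lemma jensen_infsum:
 fixes K v :: "'a => real" and P b :: real
 assumes K0: "!!y. 0 <= K y" and Ks: "K summable_on UNIV" and Kb: "infsum K UNIV <= b" and b: "0 < b"
  and v0: "!!y. 0 <= v y" and P: "1 <= P"
  and Vs: "(%y. K y * v y powr P) summable_on UNIV"
 shows "(%y. K y * v y) summable_on UNIV"
  and "infsum (%y. K y * v y) UNIV powr P <= b powr (P - 1) * infsum (%y. K y * v y powr P) UNIV"
proof -
 have tangent: "v y <= r powr (1 - P) * v y powr P / P + (1 - 1 / P) * r" if r: "r > 0" for y r
 proof (cases "P = 1")
  case True then show ?thesis using v0[of y] r by simp
 next
  case False
  then have P1: "P > 1" using P by simp
  have "(v y / r) * 1 <= (v y / r) powr P / P + 1 powr (P / (P - 1)) / (P / (P - 1))"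
   by (rule Youngs_inequality) (use P1 v0[of y] r in \<open>auto simp: field_simps\<close>)
  then have "r * (v y / r) <= r * ((v y / r) powr P / P + (1 - 1 / P))"
   using P1 r by (intro mult_left_mono) (auto simp: field_simps)
  also have "r * ((v y / r) powr P / P + (1 - 1 / P)) = r powr (1 - P) * v y powr P / P + (1 - 1 / P) * r"
   using r v0[of y] by (simp add: powr_divide powr_diff field_simps)
  finally show ?thesis using r by simp
 qed
 have maj: "K y * v y <= r powr (1 - P) / P * (K y * v y powr P) + (1 - 1 / P) * r * K y" if "r > 0" for y r
  using mult_left_mono[OF tangent[OF that, of y] K0[of y]] by (simp add: algebra_simps)
 have ms: "(%y. r powr (1 - P) / P * (K y * v y powr P) + (1 - 1 / P) * r * K y) summable_on UNIV" for r
  by (intro summable_on_add summable_on_cmult_right Vs Ks)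
 show ws: "(%y. K y * v y) summable_on UNIV"
  by (rule summable_on_comparison_test[OF ms[of 1]]) (use maj[of 1] K0 v0 in auto)
 let ?W = "infsum (%y. K y * v y) UNIV" and ?V = "infsum (%y. K y * v y powr P) UNIV"
 have W0: "?W >= 0" by (intro infsum_nonneg) (use K0 v0 in auto)
 have V0: "?V >= 0" by (intro infsum_nonneg) (use K0 in auto)
 have bound: "?W <= r powr (1 - P) / P * ?V + (1 - 1 / P) * r * b" if r: "r > 0" for r
 proof -
  have "?W <= infsum (%y. r powr (1 - P) / P * (K y * v y powr P) + (1 - 1 / P) * r * K y) UNIV"
   by (intro infsum_mono ws ms maj r)
  also have "... = r powr (1 - P) / P * ?V + (1 - 1 / P) * r * infsum K UNIV"
   by (subst infsum_add[OF summable_on_cmult_right[OF Vs] summable_on_cmult_right[OF Ks]])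
     (simp only: infsum_cmult_right')
  also have "... <= r powr (1 - P) / P * ?V + (1 - 1 / P) * r * b"
   using Kb r P by (intro add_left_mono mult_left_mono) auto
  finally show ?thesis .
 qed
 show "?W powr P <= b powr (P - 1) * ?V"
 proof (cases "?V = 0")
  case True
  have "?W <= 0"
  proof (cases "P = 1")
   case True
   then show ?thesis using bound[of 1] \<open>?V = 0\<close> by simp
  next
   case False
   have Ky: "K y * v y powr P = 0" for y
    using nonneg_infsum_le_0D[of "%y. K y * v y powr P" UNIV y] True Vs K0 by auto
   have "K y * v y = 0" for y using Ky[of y] by auto
   then have "(%y. K y * v y) = (%_. 0)" by blast
   then show ?thesis by simp
  qed
  then have "?W = 0" using W0 by simp
  then show ?thesis using True by simp
 next
  case False
  then have V: "?V > 0" using V0 by simp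
  define r where "r = (?V / b) powr (1 / P)"
  have r: "r > 0" using V b by (simp add: r_def)
  have rP: "r powr P = ?V / b" using V b P by (simp add: r_def powr_powr)
  have "r powr (1 - P) * ?V = r * b"
   using rP r V b by (simp add: powr_diff field_simps)
  then have "?W <= r * b / P + (1 - 1 / P) * r * b" using bound[OF r] by simp
  also have "... = r * b" using P by (simp add: field_simps)
  finally have "?W powr P <= (r * b) powr P" using W0 P by (intro powr_mono2) auto
  also have "... = b powr (P - 1) * ?V"
   using r b rP V by (simp add: powr_mult powr_diff field_simps)
  finally show ?thesis .
 qed
qed

lemma summable_on_translate_reflect:
 fixes K :: "int^'d => 'b::real_normed_vector"
 shows "(%y. K (x - y)) summable_on UNIV \<longleftrightarrow> K summable_on UNIV"
  and "infsum (%y. K (x - y)) UNIV = infsum K UNIV"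
proof -
 have b: "bij_betw (%y. x - y) UNIV (UNIV :: (int^'d) set)"
  by (rule bij_betw_byWitness[of _ "%y. x - y"]) auto
 show "(%y. K (x - y)) summable_on UNIV \<longleftrightarrow> K summable_on UNIV"
  using summable_on_reindex_bij_betw[OF b, of K] by simp
 show "infsum (%y. K (x - y)) UNIV = infsum K UNIV"
  using infsum_reindex_bij_betw[OF b, of K] by simp
qed

lemma summable_on_translate:
 fixes K :: "int^'d => 'b::real_normed_vector"
 shows "(%x. K (x - y)) summable_on UNIV \<longleftrightarrow> K summable_on UNIV"
  and "infsum (%x. K (x - y)) UNIV = infsum K UNIV"
proof -
 have b: "bij_betw (%x. x - y) UNIV (UNIV :: (int^'d) set)"
  by (rule bij_betw_byWitness[of _ "%x. x + y"]) auto
 show "(%x. K (x - y)) summable_on UNIV \<longleftrightarrow> K summable_on UNIV"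
  using summable_on_reindex_bij_betw[OF b, of K] by simp
 show "infsum (%x. K (x - y)) UNIV = infsum K UNIV"
  using infsum_reindex_bij_betw[OF b, of K] by simp
qed

text \<open>Fubini for convolution of nonnegative functions.\<close>
lemma conv_nonneg_summable:
 fixes K g :: "int^'d => real"
 assumes K0: "!!y. 0 <= K y" and Ks: "K summable_on UNIV"
  and g0: "!!y. 0 <= g y" and gs: "g summable_on UNIV"
 shows "(%(x, y). K (x - y) * g y) summable_on UNIV"
  and "(%x. \<Sum>\<^sub>\<infinity>y. K (x - y) * g y) summable_on UNIV"
  and "infsum (%x. \<Sum>\<^sub>\<infinity>y. K (x - y) * g y) UNIV = infsum K UNIV * infsum g UNIV"
proof -
 have s: "(%(y, x). K (x - y) * g y) summable_on (UNIV \<times> UNIV)"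
 proof (rule summable_on_SigmaI)
  show "((%x. case (y, x) of (y, x) => K (x - y) * g y) has_sum (infsum K UNIV * g y)) UNIV" for y
   using summable_on_translate[of K y] Ks has_sum_cmult_left[OF has_sum_infsum, of "%x. K (x - y)" UNIV "g y"] by simp
  show "(%y. infsum K UNIV * g y) summable_on UNIV" by (intro summable_on_cmult_right gs)
 qed (use K0 g0 in auto)
 then show s': "(%(x, y). K (x - y) * g y) summable_on UNIV"
  by (subst (asm) summable_on_swap) (simp add: case_prod_beta)
 show "(%x. \<Sum>\<^sub>\<infinity>y. K (x - y) * g y) summable_on UNIV"
  using summable_on_Sigma_banach[of "%x y. K (x - y) * g y" UNIV "%_. UNIV"] s' by simp
 have "infsum (%x. \<Sum>\<^sub>\<infinity>y. K (x - y) * g y) UNIV = infsum (%y. \<Sum>\<^sub>\<infinity>x. K (x - y) * g y) UNIV"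
  using infsum_swap_banach[of "%x y. K (x - y) * g y" UNIV UNIV] s' by simp
 also have "... = infsum (%y. infsum K UNIV * g y) UNIV"
  by (simp add: infsum_cmult_left' summable_on_translate)
 finally show "infsum (%x. \<Sum>\<^sub>\<infinity>y. K (x - y) * g y) UNIV = infsum K UNIV * infsum g UNIV"
  by (simp add: infsum_cmult_right')
qed

lemma kernel_inf_bound:
 fixes K v :: "int^'d => real"
 assumes K0: "!!y. 0 <= K y" and Ks: "K summable_on UNIV" and Kb: "infsum K UNIV <= b"
  and v0: "!!y. 0 <= v y" and vB: "!!y. v y <= B"
 shows "(%y. K (x - y) * v y) summable_on UNIV" and "(\<Sum>\<^sub>\<infinity>y. K (x - y) * v y) <= b * B"
proof -
 have s: "(%y. K (x - y) * B) summable_on UNIV"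
  by (intro summable_on_cmult_left) (use Ks summable_on_translate_reflect[of K x] in simp)
 show s1: "(%y. K (x - y) * v y) summable_on UNIV"
  by (rule summable_on_comparison_test[OF s]) (use K0 v0 vB in \<open>auto intro: mult_left_mono\<close>)
 have "(\<Sum>\<^sub>\<infinity>y. K (x - y) * v y) <= (\<Sum>\<^sub>\<infinity>y. K (x - y) * B)"
  by (intro infsum_mono s s1 mult_left_mono vB K0)
 also have "... = infsum K UNIV * B"
  by (simp add: infsum_cmult_left' summable_on_translate_reflect)
 also have "... <= b * B"
  using Kb order_trans[OF v0[of 0] vB[of 0]] by (intro mult_right_mono) auto
 finally show "(\<Sum>\<^sub>\<infinity>y. K (x - y) * v y) <= b * B" .
qed

lemma kernel_sup_bound:
 fixes K v :: "int^'d => real" and P :: real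
 assumes K0: "!!y. 0 <= K y" and Ks: "K summable_on UNIV" and Kb: "infsum K UNIV <= b" and b: "0 < b"
  and Ka: "!!y. K y <= a" and a: "0 < a"
  and v0: "!!y. 0 <= v y" and P: "1 <= P" and vs: "(%y. v y powr P) summable_on UNIV"
 defines "S \<equiv> infsum (%y. v y powr P) UNIV"
 defines "V \<equiv> (%x. \<Sum>\<^sub>\<infinity>y. K (x - y) * v y powr P)"
 shows "(%y. K (x - y) * v y) summable_on UNIV"
  and "(\<Sum>\<^sub>\<infinity>y. K (x - y) * v y) powr P <= b powr (P - 1) * V x"
  and "V x <= a * S" and "V x >= 0" and "V summable_on UNIV" and "infsum V UNIV <= b * S"
proof -
 have Vs: "(%y. K (x - y) * v y powr P) summable_on UNIV"
  by (rule summable_on_comparison_test[OF summable_on_cmult_right[OF vs, of a]])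
    (use K0 Ka in \<open>auto intro: mult_right_mono\<close>)
 note J = jensen_infsum[of "%y. K (x - y)" b v P, OF _ _ _ b v0 P Vs]
 show "(%y. K (x - y) * v y) summable_on UNIV"
  by (rule J) (use K0 Ks Kb in \<open>simp_all add: summable_on_translate_reflect\<close>)
 show "(\<Sum>\<^sub>\<infinity>y. K (x - y) * v y) powr P <= b powr (P - 1) * V x"
  unfolding V_def by (rule J) (use K0 Ks Kb in \<open>simp_all add: summable_on_translate_reflect\<close>)
 have "V x <= (\<Sum>\<^sub>\<infinity>y. a * v y powr P)"
  unfolding V_def by (intro infsum_mono Vs summable_on_cmult_right vs mult_right_mono Ka) auto
 then show "V x <= a * S" by (simp add: S_def infsum_cmult_right')
 show "V x >= 0" unfolding V_def by (intro infsum_nonneg) (use K0 in auto)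
 show "V summable_on UNIV"
  unfolding V_def by (rule conv_nonneg_summable) (use K0 Ks vs in auto)
 have "infsum V UNIV = infsum K UNIV * S"
  unfolding V_def S_def by (rule conv_nonneg_summable) (use K0 Ks vs in auto)
 also have "... <= b * S"
  unfolding S_def by (intro mult_right_mono Kb infsum_nonneg) auto
 finally show "infsum V UNIV <= b * S" .
qed

text \<open>The \<open>P\<close>-th power of the convolution is bounded pointwise and in sum; the \<open>Q\<close>-th powers follow by pulling out \<open>Q - P\<close> factors at their supremum.\<close>
lemma kernel_Lp_bound:
 fixes K v :: "int^'d => real" and P Q :: real
 assumes K0: "!!y. 0 <= K y" and Ks: "K summable_on UNIV" and Kb: "infsum K UNIV <= b" and b: "0 < b"
  and Ka: "!!y. K y <= a" and a: "0 < a"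
  and v0: "!!y. 0 <= v y" and P: "1 <= P" and PQ: "P <= Q" and vs: "(%y. v y powr P) summable_on UNIV"
 defines "S \<equiv> infsum (%y. v y powr P) UNIV"
 defines "w \<equiv> (%x. \<Sum>\<^sub>\<infinity>y. K (x - y) * v y)"
 shows "w x <= a powr (1 / P) * b powr (1 - 1 / P) * S powr (1 / P)"
  and "(%x. w x powr Q) summable_on UNIV"
  and "infsum (%x. w x powr Q) UNIV <= (a powr (1 / P - 1 / Q) * b powr (1 - (1 / P - 1 / Q)) * S powr (1 / P)) powr Q"
proof -
 define V where "V = (%x. \<Sum>\<^sub>\<infinity>y. K (x - y) * v y powr P)"
 note sup0 = kernel_sup_bound[OF K0 Ks Kb b Ka a v0 P vs]
 have sup: "(\<Sum>\<^sub>\<infinity>y. K (x - y) * v y) powr P <= b powr (P - 1) * V x" "V x <= a * S" "V x >= 0"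
  "V summable_on UNIV" "infsum V UNIV <= b * S" for x
  unfolding V_def S_def using sup0(2-6) by blast+
 have wx: "w x = (\<Sum>\<^sub>\<infinity>y. K (x - y) * v y)" for x by (simp add: w_def)
 have wP: "w x powr P <= b powr (P - 1) * V x" for x using sup(1)[of x] by (simp add: w_def)
 have w0: "w x >= 0" for x unfolding w_def by (intro infsum_nonneg) (use K0 v0 in auto)
 have S0: "S >= 0" unfolding S_def by (intro infsum_nonneg) auto
 have Q: "Q >= 1" using P PQ by simp
 have wPS: "w x powr P <= b powr (P - 1) * (a * S)" for x
  using wP[of x] sup(2)[of x] by (meson mult_left_mono order_trans powr_ge_zero)
 have "w x = (w x powr P) powr (1 / P)" using w0 P by (simp add: powr_powr)
 also have "... <= (b powr (P - 1) * (a * S)) powr (1 / P)"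
  by (intro powr_mono2 wPS) (use P in auto)
 also have "... = a powr (1 / P) * b powr (1 - 1 / P) * S powr (1 / P)"
  using a b S0 P by (simp add: powr_mult powr_powr diff_divide_distrib)
 finally show "w x <= a powr (1 / P) * b powr (1 - 1 / P) * S powr (1 / P)" .
 define c where "c = (b powr (P - 1)) powr (Q / P) * (a * S) powr (Q / P - 1)"
 have c0: "c >= 0" by (simp add: c_def)
 have QP: "Q / P >= 1" using P PQ by simp
 have main: "w x powr Q <= c * V x" for x
 proof -
  have "w x powr Q = (w x powr P) powr (Q / P)" using P by (simp add: powr_powr)
  also have "... <= (b powr (P - 1) * V x) powr (Q / P)"
   by (intro powr_mono2 wP) (use P PQ in auto)
  also have "... = (b powr (P - 1)) powr (Q / P) * (V x powr (Q / P - 1) * V x)"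
   using sup(3)[of x] powr_mult_base[of "V x" "Q / P - 1"] by (simp add: powr_mult mult.commute)
  also have "... <= (b powr (P - 1)) powr (Q / P) * ((a * S) powr (Q / P - 1) * V x)"
   using sup(2,3)[of x] QP by (intro mult_left_mono mult_right_mono powr_mono2) auto
  finally show ?thesis by (simp add: c_def)
 qed
 show s: "(%x. w x powr Q) summable_on UNIV"
  by (rule summable_on_comparison_test[OF summable_on_cmult_right[OF sup(4), of c]]) (use main in auto)
 have "infsum (%x. w x powr Q) UNIV <= (\<Sum>\<^sub>\<infinity>x. c * V x)"
  by (intro infsum_mono s summable_on_cmult_right sup(4) main)
 also have "... = c * infsum V UNIV" by (simp add: infsum_cmult_right')
 also have "... <= c * (b * S)" by (intro mult_left_mono sup(5) c0)
 also have "... = (a powr (1 / P - 1 / Q) * b powr (1 - (1 / P - 1 / Q)) * S powr (1 / P)) powr Q"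
 proof (cases "S = 0")
  case True then show ?thesis by simp
 next
  case False
  then have S: "S > 0" using S0 by simp
  have e1: "(P - 1) * (Q / P) + 1 = (1 - (1 / P - 1 / Q)) * Q" using P Q by (simp add: field_simps)
  have e2: "Q / P - 1 = (1 / P - 1 / Q) * Q" using P Q by (simp add: field_simps)
  have "c * (b * S) = b powr ((P - 1) * (Q / P) + 1) * a powr (Q / P - 1) * S powr (Q / P)"
   using a b S powr_mult_base[of S "Q / P - 1"]
   by (simp add: c_def powr_powr powr_mult powr_add mult_ac)
  also have "... = (a powr (1 / P - 1 / Q) * b powr (1 - (1 / P - 1 / Q)) * S powr (1 / P)) powr Q"
   unfolding e1 e2 using a b S by (simp add: powr_powr powr_mult)
  finally show ?thesis .
 qed
 finally show "infsum (%x. w x powr Q) UNIV <= ..." .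
qed
lemma lp_space_finite:
 "p ~= \<infinity> ==> u \<in> lp_space p \<longleftrightarrow> (%x. cmod (u x) powr enn2real p) summable_on UNIV"
 by (simp add: lp_space_def)

lemma enn2real_ge_1: "1 <= p ==> p ~= \<infinity> ==> 1 <= enn2real p"
 by (cases p) (auto simp: ennreal_le_iff2 simp flip: ennreal_1)

lemma enn2real_inverse: "1 <= p ==> p ~= \<infinity> ==> enn2real (1 / p) = 1 / enn2real p"
proof -
 assume "1 <= p" "p ~= \<infinity>"
 then have "enn2real p >= 1" "p = ennreal (enn2real p)" using enn2real_ge_1 by (auto simp: less_top)
 then have "1 / p = ennreal (1 / enn2real p)"
  by (metis divide_ennreal ennreal_1 less_le_trans zero_le_one zero_less_one)
 then show ?thesis by (simp add: enn2real_nonneg)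
qed

lemma sum_infsum_swap:
 fixes f :: "'i => 'a => real"
 assumes "!!i. i \<in> I ==> f i summable_on A"
 shows "(%x. \<Sum>i\<in>I. f i x) summable_on A"
  and "infsum (%x. \<Sum>i\<in>I. f i x) A = (\<Sum>i\<in>I. infsum (f i) A)"
proof -
 have "(%x. \<Sum>i\<in>I. f i x) summable_on A \<and> infsum (%x. \<Sum>i\<in>I. f i x) A = (\<Sum>i\<in>I. infsum (f i) A)"
  using assms by (induction I rule: infinite_finite_induct) (auto simp: summable_on_add infsum_add)
 then show "(%x. \<Sum>i\<in>I. f i x) summable_on A"
  and "infsum (%x. \<Sum>i\<in>I. f i x) A = (\<Sum>i\<in>I. infsum (f i) A)" by auto
qed

text \<open>
  Young's inequality for a kernel dominated by a finite sum of nonnegative kernels, for each of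
  which both the supremum and the sum are known.
\<close>
lemma young_dominated:
 fixes f :: "int^'d => complex" and K :: "'i => int^'d => real" and p q :: ennreal
 assumes I: "finite I" "I ~= {}"
  and fK: "!!x. cmod (f x) <= (\<Sum>i\<in>I. K i x)"
  and K0: "!!i x. i \<in> I ==> 0 <= K i x"
  and Ks: "!!i. i \<in> I ==> K i summable_on UNIV"
  and Kb: "!!i. i \<in> I ==> infsum (K i) UNIV <= b i" and b: "!!i. i \<in> I ==> 0 < b i"
  and Ka: "!!i x. i \<in> I ==> K i x <= a i" and a: "!!i. i \<in> I ==> 0 < a i"
  and p: "1 <= p" and pq: "p <= q" and u: "u \<in> lp_space p"
 defines "theta \<equiv> enn2real (1 / p) - enn2real (1 / q)"
 shows "conv f u \<in> lp_space q"
  and "lp_norm q (conv f u)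
   <= real (card I) ^ 2 * (\<Sum>i\<in>I. a i powr theta * b i powr (1 - theta)) * lp_norm p u"
proof -
 define v where "v = (%y. cmod (u y))"
 have v0: "v y >= 0" for y by (simp add: v_def)
 define w where "w = (%i x. \<Sum>\<^sub>\<infinity>y. K i (x - y) * v y)"
 define c where "c = (%i. a i powr theta * b i powr (1 - theta))"
 have c0: "c i >= 0" for i by (simp add: c_def)
 define N where "N = real (card I)"
 have N: "N >= 1" using I by (simp add: N_def Suc_leI card_gt_0_iff)
 have ws: "(%y. K i (x - y) * v y) summable_on UNIV" if i: "i \<in> I" for i x
 proof (cases "p = \<infinity>")
  case True
  then obtain B where "!!y. v y <= B" using u by (auto simp: lp_space_def bounded_iff v_def)
  then show ?thesis by (intro kernel_inf_bound[OF K0 Ks Kb v0]) (use i in auto)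
 next
  case False
  show ?thesis
   by (rule kernel_sup_bound(1)[OF K0 Ks Kb b Ka a v0 enn2real_ge_1[OF p False]])
     (use i u False in \<open>auto simp: lp_space_finite v_def\<close>)
 qed
 have w0: "w i x >= 0" if "i \<in> I" for i x unfolding w_def by (intro infsum_nonneg) (use K0 v0 that in auto)
 have ptw: "cmod (conv f u x) <= (\<Sum>i\<in>I. w i x)" for x
 proof -
  have s: "(%y. \<Sum>i\<in>I. K i (x - y) * v y) summable_on UNIV"
   by (intro sum_infsum_swap ws)
  have le: "cmod (f (x - y) * u y) <= (\<Sum>i\<in>I. K i (x - y) * v y)" for y
   using mult_right_mono[OF fK[of "x - y"] v0[of y]] by (simp add: norm_mult v_def sum_distrib_right)
  have s2: "(%y. cmod (f (x - y) * u y)) summable_on UNIV"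
   by (rule summable_on_comparison_test[OF s]) (use le in auto)
  have "cmod (conv f u x) <= (\<Sum>\<^sub>\<infinity>y. cmod (f (x - y) * u y))"
   unfolding conv_def by (rule norm_infsum_bound[OF s2])
  also have "... <= (\<Sum>\<^sub>\<infinity>y. \<Sum>i\<in>I. K i (x - y) * v y)"
   by (intro infsum_mono s s2 le)
  also have "... = (\<Sum>i\<in>I. w i x)" unfolding w_def by (intro sum_infsum_swap ws)
  finally show ?thesis .
 qed
 have main: "conv f u \<in> lp_space q \<and> lp_norm q (conv f u) <= N ^ 2 * (\<Sum>i\<in>I. c i) * lp_norm p u"
 proof (cases "q = \<infinity>")
  case True
  have bd: "\<exists>L. L >= 0 \<and> (\<forall>i\<in>I. \<forall>x. w i x <= c i * L) \<and> L = lp_norm p u"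
  proof (cases "p = \<infinity>")
   case p: True
   have bdd: "bdd_above (range v)"
    using u p by (auto simp: lp_space_def bounded_iff v_def bdd_above_def)
   have vL: "v y <= lp_norm p u" for y
    using cSUP_upper[OF UNIV_I bdd, of y] p by (simp add: lp_norm_def v_def)
   have "w i x <= c i * lp_norm p u" if "i \<in> I" for i x
    using kernel_inf_bound(2)[OF K0 Ks Kb v0 vL, OF that that that, of x] a[OF that] b[OF that] p True
    by (simp add: c_def theta_def w_def)
   then show ?thesis using vL[of 0] v0[of 0] by auto
  next
   case False
   have th: "theta = 1 / enn2real p" using p True False by (simp add: theta_def enn2real_inverse)
   have L: "lp_norm p u = (infsum (%y. v y powr enn2real p) UNIV) powr (1 / enn2real p)"
    using False by (simp add: lp_norm_def v_def)
   have "w i x <= c i * lp_norm p u" if i: "i \<in> I" for i x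
    unfolding c_def th L w_def
    by (rule kernel_Lp_bound(1)[OF K0 Ks Kb b Ka a v0 enn2real_ge_1[OF p False] order_refl])
      (use i u False in \<open>auto simp: lp_space_finite v_def\<close>)
   then show ?thesis by (auto simp: L)
  qed
  then obtain L where L: "L >= 0" "!!i x. i \<in> I ==> w i x <= c i * L" "L = lp_norm p u" by auto
  have B: "cmod (conv f u x) <= (\<Sum>i\<in>I. c i) * L" for x
   using order_trans[OF ptw sum_mono[OF L(2)]] by (simp add: sum_distrib_right)
  have 1: "conv f u \<in> lp_space q" using B True by (auto simp: lp_space_def bounded_iff)
  have "lp_norm q (conv f u) <= (\<Sum>i\<in>I. c i) * L"
   using True B by (auto simp: lp_norm_def intro!: cSUP_least)
  also have "... <= N^2 * ((\<Sum>i\<in>I. c i) * L)"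
   using mult_right_mono[of 1 "N^2" "(\<Sum>i\<in>I. c i) * L"] N L(1) c0
   by (simp add: one_le_power sum_nonneg)
  finally show ?thesis using 1 L by (simp add: mult_ac)
 next
  case False
  then have pf: "p ~= \<infinity>" using pq by (auto simp: top_unique)
  define P Q where "P = enn2real p" and "Q = enn2real q"
  have P: "P >= 1" using enn2real_ge_1[OF p pf] by (simp add: P_def)
  have PQ: "P <= Q" using pq pf False by (auto simp: P_def Q_def intro!: enn2real_mono simp: less_top)
  have Q: "Q >= 1" using P PQ by simp
  have th: "theta = 1 / P - 1 / Q"
   using p pf pq False by (auto simp: theta_def P_def Q_def enn2real_inverse[OF _ pf] enn2real_inverse[of q])
  define S where "S = infsum (%y. v y powr P) UNIV"
  define U where "U = S powr (1 / P)"
  have U: "lp_norm p u = U" using pf by (simp add: lp_norm_def v_def P_def U_def S_def)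
  have vs: "(%y. v y powr P) summable_on UNIV" using u pf by (simp add: lp_space_finite v_def P_def)
  have wQ: "(%x. w i x powr Q) summable_on UNIV" "infsum (%x. w i x powr Q) UNIV <= (c i * U) powr Q"
   if i: "i \<in> I" for i
  proof -
   show "(%x. w i x powr Q) summable_on UNIV"
    unfolding w_def by (rule kernel_Lp_bound(2)[OF K0 Ks Kb b Ka a v0 P PQ vs]) (use i in auto)
   show "infsum (%x. w i x powr Q) UNIV <= (c i * U) powr Q"
    unfolding w_def c_def U_def S_def th
    by (rule kernel_Lp_bound(3)[OF K0 Ks Kb b Ka a v0 P PQ vs]) (use i in auto)
  qed
  define X where "X = (\<Sum>i\<in>I. c i) * U"
  have X0: "X >= 0" using c0 by (auto simp: X_def U_def intro!: mult_nonneg_nonneg sum_nonneg)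
  have pQ: "cmod (conv f u x) powr Q <= N powr Q * (\<Sum>i\<in>I. w i x powr Q)" for x
  proof -
   have "\<exists>i\<in>I. \<forall>j\<in>I. w j x <= w i x"
   proof -
    have "Max ((%i. w i x) ` I) \<in> (%i. w i x) ` I" using I by (intro Max_in) auto
    then obtain i where "i \<in> I" "Max ((%i. w i x) ` I) = w i x" by auto
    then show ?thesis using I by (metis Max_ge finite_imageI imageI)
   qed
   then obtain i where i: "i \<in> I" "!!j. j \<in> I ==> w j x <= w i x" by auto
   have "cmod (conv f u x) <= N * w i x"
    using order_trans[OF ptw sum_bounded_above[of I "%j. w j x" "w i x"]] i by (auto simp: N_def)
   then have "cmod (conv f u x) powr Q <= (N * w i x) powr Q" using Q by (intro powr_mono2) auto
   also have "... = N powr Q * w i x powr Q" using N w0[OF i(1)] by (simp add: powr_mult)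
   also have "... <= N powr Q * (\<Sum>i\<in>I. w i x powr Q)"
    using I i by (intro mult_left_mono member_le_sum) auto
   finally show ?thesis .
  qed
  have s: "(%x. N powr Q * (\<Sum>i\<in>I. w i x powr Q)) summable_on UNIV"
   by (intro summable_on_cmult_right sum_infsum_swap wQ)
  have s2: "(%x. cmod (conv f u x) powr Q) summable_on UNIV"
   by (rule summable_on_comparison_test[OF s]) (use pQ in auto)
  have "infsum (%x. cmod (conv f u x) powr Q) UNIV <= (\<Sum>\<^sub>\<infinity>x. N powr Q * (\<Sum>i\<in>I. w i x powr Q))"
   by (intro infsum_mono s s2 pQ)
  also have "... = N powr Q * (\<Sum>i\<in>I. infsum (%x. w i x powr Q) UNIV)"
   by (simp add: infsum_cmult_right' sum_infsum_swap(2) wQ(1))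
  also have "... <= N powr Q * (\<Sum>i\<in>I. X powr Q)"
  proof (intro mult_left_mono sum_mono)
   fix i assume i: "i \<in> I"
   have "c i * U <= X" unfolding X_def using I i c0
    by (intro mult_right_mono member_le_sum) (auto simp: U_def)
   then have "(c i * U) powr Q <= X powr Q"
    using c0[of i] Q by (intro powr_mono2) (auto simp: U_def)
   then show "infsum (%x. w i x powr Q) UNIV <= X powr Q" using wQ(2)[OF i] by simp
  qed auto
  also have "... = N powr Q * (N * X powr Q)" by (simp add: N_def)
  also have "... <= N powr Q * (N powr Q * X powr Q)"
   using N Q powr_mono[of 1 Q N] by (intro mult_left_mono mult_right_mono) auto
  also have "... = (N ^ 2 * X) powr Q"
   using N X0 by (simp add: powr_mult power2_eq_square)
  finally have "(infsum (%x. cmod (conv f u x) powr Q) UNIV) powr (1 / Q) <= ((N ^ 2 * X) powr Q) powr (1 / Q)"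
   using Q by (intro powr_mono2) (auto intro!: infsum_nonneg)
  also have "... = N ^ 2 * X" using N X0 Q by (simp add: powr_powr)
  finally have "lp_norm q (conv f u) <= N ^ 2 * X" using False by (simp add: lp_norm_def Q_def)
  then show ?thesis using s2 False U by (simp add: lp_space_finite Q_def X_def mult_ac)
 qed
 then show "conv f u \<in> lp_space q" by simp
 show "lp_norm q (conv f u)
   <= real (card I) ^ 2 * (\<Sum>i\<in>I. a i powr theta * b i powr (1 - theta)) * lp_norm p u"
  using main by (simp add: N_def c_def)
qed

section \<open>Linear substitutions and lattice sums\<close>

lemma nn_integral_translate:
 fixes g :: "'a::euclidean_space => ennreal"
 assumes [measurable]: "g \<in> borel_measurable borel"
 shows "(\<integral>\<^sup>+x. g (c + x) \<partial>lborel) = (\<integral>\<^sup>+x. g x \<partial>lborel)"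
proof -
 have "(\<integral>\<^sup>+x. g x \<partial>lborel) = (\<integral>\<^sup>+x. g x \<partial>distr lborel borel ((+) c))" by (simp add: lborel_distr_plus)
 also have "... = (\<integral>\<^sup>+x. g (c + x) \<partial>lborel)" by (subst nn_integral_distr) auto
 finally show ?thesis by simp
qed

text \<open>Tonelli's theorem and translation invariance compare the two products, so that the quotient of the two integrals of \<open>g\<close> does not depend on \<open>g\<close>. This is the uniqueness of Lebesgue measure up to a factor.\<close>
lemma nn_integral_linear_swap:
 fixes f g :: "'a::euclidean_space => ennreal" and A A' :: "'a => 'a"
 assumes [measurable]: "f \<in> borel_measurable borel" "g \<in> borel_measurable borel"
  and A: "linear A" "linear A'" "!!x. A (A' x) = x"
 shows "(\<integral>\<^sup>+x. f x \<partial>lborel) * (\<integral>\<^sup>+x. g (A x) \<partial>lborel) = (\<integral>\<^sup>+x. g x \<partial>lborel) * (\<integral>\<^sup>+x. f (- A x) \<partial>lborel)"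
proof -
 have [measurable]: "A \<in> borel_measurable borel"
  using A(1) by (intro borel_measurable_continuous_onI linear_continuous_on) (simp add: linear_conv_bounded_linear)
 have 1: "(\<integral>\<^sup>+y. f x * g (x + A y) \<partial>lborel) = f x * (\<integral>\<^sup>+y. g (A y) \<partial>lborel)" for x
 proof -
  have "(\<integral>\<^sup>+y. g (x + A y) \<partial>lborel) = (\<integral>\<^sup>+y. g (A (A' x + y)) \<partial>lborel)"
   using A by (simp add: linear_add)
  also have "... = (\<integral>\<^sup>+y. g (A y) \<partial>lborel)"
   by (rule nn_integral_translate[of "%y. g (A y)"]) measurable
  finally show ?thesis by (simp add: nn_integral_cmult)
 qed
 have 2: "(\<integral>\<^sup>+x. f x * g (x + A y) \<partial>lborel) = (\<integral>\<^sup>+x. f (x - A y) * g x \<partial>lborel)" for y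
  using nn_integral_translate[of "%x. f (x - A y) * g x" "A y"] by (simp add: add.commute)
 have 3: "(\<integral>\<^sup>+y. f (x - A y) * g x \<partial>lborel) = g x * (\<integral>\<^sup>+y. f (- A y) \<partial>lborel)" for x
 proof -
  have "(\<integral>\<^sup>+y. f (- A y) \<partial>lborel) = (\<integral>\<^sup>+y. f (- A (- A' x + y)) \<partial>lborel)"
   by (rule nn_integral_translate[of "%y. f (- A y)", symmetric]) measurable
  also have "... = (\<integral>\<^sup>+y. f (x - A y) \<partial>lborel)"
   using A by (simp add: linear_add linear_neg linear_diff)
  finally show ?thesis by (subst nn_integral_multc) (measurable, simp add: mult.commute)
 qed
 have "(\<integral>\<^sup>+x. f x \<partial>lborel) * (\<integral>\<^sup>+x. g (A x) \<partial>lborel) = (\<integral>\<^sup>+x. \<integral>\<^sup>+y. f x * g (x + A y) \<partial>lborel \<partial>lborel)"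
  by (simp add: 1 nn_integral_multc)
 also have "... = (\<integral>\<^sup>+y. \<integral>\<^sup>+x. f x * g (x + A y) \<partial>lborel \<partial>lborel)"
  by (rule lborel_pair.Fubini'[symmetric]) measurable
 also have "... = (\<integral>\<^sup>+y. \<integral>\<^sup>+x. f (x - A y) * g x \<partial>lborel \<partial>lborel)" by (simp add: 2)
 also have "... = (\<integral>\<^sup>+x. \<integral>\<^sup>+y. f (x - A y) * g x \<partial>lborel \<partial>lborel)"
  by (rule lborel_pair.Fubini') measurable
 also have "... = (\<integral>\<^sup>+x. g x \<partial>lborel) * (\<integral>\<^sup>+x. f (- A x) \<partial>lborel)"
  by (simp add: 3 nn_integral_multc)
 finally show ?thesis .
qed

lemma emeasure_ball_nonzero: "r > 0 ==> emeasure lborel (ball (x::'a::euclidean_space) r) ~= 0"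
 using content_ball_pos[of r x] by (auto simp: measure_def simp del: content_ball_pos)

text \<open>An unspecified positive constant stands for the absolute value of the determinant.\<close>
lemma nn_integral_linear:
 fixes A A' :: "'a::euclidean_space => 'a"
 assumes A: "linear A" "linear A'" "!!x. A (A' x) = x" "!!x. A' (A x) = x"
 obtains c :: real where "c > 0"
  "!!g. g \<in> borel_measurable borel ==> (\<integral>\<^sup>+x. g x \<partial>lborel) = ennreal c * (\<integral>\<^sup>+x. g (A x) \<partial>lborel)"
proof -
 have contA: "continuous_on UNIV A" "continuous_on UNIV A'"
  using A by (auto intro!: linear_continuous_on simp: linear_conv_bounded_linear)
 let ?B = "ball (0::'a) 1" and ?C = "(%x. - A x) -` ball 0 1"
 have opC: "open ?C" using contA by (intro continuous_open_vimage continuous_intros) auto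
 have C0: "0 \<in> ?C" using A by (simp add: linear_0)
 have "?C \<subseteq> A' ` ball 0 1"
 proof
  fix x assume "x \<in> ?C"
  then show "x \<in> A' ` ball 0 1" using A(4)[of x] by (intro image_eqI[of _ _ "A x"]) auto
 qed
 also have "bounded (A' ` ball 0 1)"
  using A by (intro bounded_linear_image) (auto simp: linear_conv_bounded_linear)
 ultimately have bC: "bounded ?C" using bounded_subset by blast
 obtain r where r: "r > 0" "ball 0 r \<subseteq> ?C" using opC C0 by (meson openE)
 then have "emeasure lborel (ball (0::'a) r) <= emeasure lborel ?C"
  using opC by (intro emeasure_mono) auto
 then have "emeasure lborel ?C ~= 0"
  using emeasure_ball_nonzero[OF r(1), of "0::'a"] by (metis le_zero_eq)
 moreover have "emeasure lborel ?C < \<infinity>" by (rule emeasure_bounded_finite[OF bC])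
 ultimately have mC: "emeasure lborel ?C < \<infinity>" "emeasure lborel ?C ~= 0" by auto
 have mB: "emeasure lborel ?B < \<infinity>" "emeasure lborel ?B ~= 0"
  using emeasure_bounded_finite[of ?B] emeasure_ball_nonzero[of 1 "0::'a"] by auto
 define b where "b = measure lborel ?B"
 define e where "e = measure lborel ?C"
 have b: "emeasure lborel ?B = ennreal b" "b > 0" and e: "emeasure lborel ?C = ennreal e" "e > 0"
  using mB mC unfolding b_def e_def measure_def
  by (simp_all add: enn2real_positive_iff zero_less_iff_neq_zero)
 have main: "(\<integral>\<^sup>+x. g x \<partial>lborel) = ennreal (b / e) * (\<integral>\<^sup>+x. g (A x) \<partial>lborel)" if [measurable]: "g \<in> borel_measurable borel" for g
 proof -
  have [measurable]: "A \<in> borel_measurable borel" using contA by (intro borel_measurable_continuous_onI)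
  have "(\<integral>\<^sup>+x. indicator ?B x \<partial>lborel) * (\<integral>\<^sup>+x. g (A x) \<partial>lborel)
    = (\<integral>\<^sup>+x. g x \<partial>lborel) * (\<integral>\<^sup>+x. indicator ?B (- A x) \<partial>lborel)"
   by (rule nn_integral_linear_swap[OF borel_measurable_indicator that A(1,2,3)]) simp
  also have "(\<integral>\<^sup>+x. indicator ?B (- A x) \<partial>lborel) = (\<integral>\<^sup>+x. indicator ?C x \<partial>lborel)"
   by (intro nn_integral_cong) (auto simp: indicator_def)
  finally have "ennreal b * (\<integral>\<^sup>+x. g (A x) \<partial>lborel) = (\<integral>\<^sup>+x. g x \<partial>lborel) * ennreal e"
   using b e opC by simp
  then have "ennreal (1 / e) * (ennreal b * (\<integral>\<^sup>+x. g (A x) \<partial>lborel)) = (ennreal (1 / e) * ennreal e) * (\<integral>\<^sup>+x. g x \<partial>lborel)"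
   by (simp add: mult_ac)
  also have "ennreal (1 / e) * ennreal e = 1" using e by (simp flip: ennreal_mult)
  finally have "(\<integral>\<^sup>+x. g x \<partial>lborel) = ennreal (1 / e) * ennreal b * (\<integral>\<^sup>+x. g (A x) \<partial>lborel)"
   by (simp add: mult.assoc)
  also have "ennreal (1 / e) * ennreal b = ennreal (b / e)" using b e by (simp flip: ennreal_mult)
  finally show ?thesis .
 qed
 show thesis by (rule that[of "b / e"]) (use b e main in auto)
qed

lemma nn_integral_diag:
 fixes g :: "real^'d => ennreal" and r :: "'d => real"
 assumes [measurable]: "g \<in> borel_measurable borel" and r: "!!j. r j > 0"
 shows "(\<integral>\<^sup>+x. g x \<partial>lborel) = ennreal (\<Prod>j\<in>UNIV. r j) * (\<integral>\<^sup>+x. g (\<chi> j. r j * x $ j) \<partial>lborel)"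
proof -
 define c where "c = (%b :: real^'d. \<Sum>j\<in>UNIV. r j * b $ j)"
 have c_axis: "c (axis j 1) = r j" for j by (simp add: c_def axis_def if_distrib sum.delta cong: if_cong)
 define T where "T = (%x::real^'d. 0 + (\<Sum>b\<in>Basis. (c b * (x \<bullet> b)) *\<^sub>R b))"
 have Basis: "(Basis :: (real^'d) set) = (%j. axis j 1) ` UNIV" by (auto simp: Basis_vec_def)
 have inj: "inj (%j. axis j (1::real) :: real^'d)" by (auto simp: inj_on_def axis_eq_axis)
 have "T x = (\<Sum>j\<in>UNIV. (r j * x $ j) *\<^sub>R axis j 1)" for x
  unfolding T_def Basis by (subst sum.reindex[OF inj]) (simp add: c_axis inner_axis)
 then have T: "T x = (\<chi> j. r j * x $ j)" for x
  by (auto simp: vec_eq_iff axis_def if_distrib sum.delta cong: if_cong)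
 have [measurable]: "T \<in> borel_measurable borel" by (simp add: T_def)
 have "!!b. b \<in> Basis ==> c b ~= 0" using r c_axis by (auto simp: Basis less_le)
 then have "lborel = density (distr lborel borel T) (%_. ennreal (\<Prod>b\<in>Basis. \<bar>c b\<bar>))"
  unfolding T_def by (intro lborel_affine_euclidean)
 also have "(\<Prod>b\<in>Basis. \<bar>c b\<bar>) = (\<Prod>j\<in>UNIV. r j)"
  unfolding Basis using r by (subst prod.reindex[OF inj]) (auto simp: c_axis less_imp_le abs_of_pos)
 finally have L: "lborel = density (distr lborel borel T) (%_. ennreal (\<Prod>j\<in>UNIV. r j))" .
 have "(\<integral>\<^sup>+x. g x \<partial>lborel) = (\<integral>\<^sup>+x. g x \<partial>density (distr lborel borel T) (%_. ennreal (\<Prod>j\<in>UNIV. r j)))"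
  using L by simp
 also have "... = ennreal (\<Prod>j\<in>UNIV. r j) * (\<integral>\<^sup>+x. g (T x) \<partial>lborel)"
  by (subst nn_integral_density; simp) (simp add: nn_integral_cmult nn_integral_distr)
 finally show ?thesis by (simp add: T)
qed

text \<open>Passing from scaling of \<^const>\<open>nn_integral\<close> to scaling of the Bochner integral.\<close>
lemma integral_scaling:
 fixes T :: "'a::euclidean_space => 'a" and f :: "'a => 'b::{banach, second_countable_topology}"
 assumes c: "c > 0" and T[measurable]: "T \<in> borel_measurable borel"
  and sc: "!!g. g \<in> borel_measurable borel ==> (\<integral>\<^sup>+x. g x \<partial>lborel) = ennreal c * (\<integral>\<^sup>+x. g (T x) \<partial>lborel)"
  and f[measurable]: "f \<in> borel_measurable borel"
 shows "integral\<^sup>L lborel f = c *\<^sub>R (LINT x|lborel. f (T x))"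
  and "integrable lborel f \<longleftrightarrow> integrable lborel (%x. f (T x))"
proof -
 have L: "(lborel :: 'a measure) = density (distr lborel borel T) (%_. ennreal c)"
 proof (rule measure_eqI)
  fix X :: "'a set" assume "X \<in> sets lborel"
  then have [measurable]: "X \<in> sets borel" by simp
  have "emeasure lborel X = (\<integral>\<^sup>+x. indicator X x \<partial>lborel)" by simp
  also have "... = ennreal c * (\<integral>\<^sup>+x. indicator X (T x) \<partial>lborel)" by (rule sc) measurable
  also have "... = emeasure (density (distr lborel borel T) (%_. ennreal c)) X"
   by (simp add: emeasure_density nn_integral_distr nn_integral_cmult flip: nn_integral_cmult)
  finally show "emeasure lborel X = emeasure (density (distr lborel borel T) (%_. ennreal c)) X" .
 qed simp
 have "integral\<^sup>L lborel f = integral\<^sup>L (density (distr lborel borel T) (%_. ennreal c)) f"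
  using L by simp
 also have "... = c *\<^sub>R (LINT x|lborel. f (T x))"
  using c by (subst integral_density) (auto simp: integral_distr)
 finally show "integral\<^sup>L lborel f = c *\<^sub>R (LINT x|lborel. f (T x))" .
 have "integrable lborel f \<longleftrightarrow> integrable (density (distr lborel borel T) (%_. ennreal c)) f"
  using L by simp
 also have "... \<longleftrightarrow> integrable lborel (%x. f (T x))"
  using c integrable_scaleR_right[of "1 / c" lborel "%x. c *\<^sub>R f (T x)"]
  by (subst integrable_density) (auto simp: integrable_distr_eq)
 finally show "integrable lborel f \<longleftrightarrow> integrable lborel (%x. f (T x))" .
qed

lemma power_le_fact_exp:
 fixes x :: real
 assumes "x >= 0" shows "x ^ n <= fact n * exp x"
proof -
 have "(\<Sum>k\<in>{n}. x ^ k /\<^sub>R fact k) <= exp x"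
  unfolding exp_def by (rule sum_le_suminf[OF summable_exp_generic]) (use assms in auto)
 then show ?thesis by (simp add: field_simps)
qed

lemma nn_integral_exp_norm_finite:
 fixes c :: real assumes c: "c > 0"
 shows "(\<integral>\<^sup>+x. ennreal (exp (- c * norm (x::'a::euclidean_space))) \<partial>lborel) < \<infinity>"
proof -
 let ?D = "DIM('a)"
 have "ennreal (exp (- c * norm x)) <= suminf (%k. ennreal (exp (- c * real k)) * indicator (cball 0 (real (Suc k))) x)" for x :: 'a
 proof -
  define k where "k = nat \<lfloor>norm x\<rfloor>"
  have k: "real k <= norm x" "norm x <= real (Suc k)" by (auto simp: k_def) linarith
  have "ennreal (exp (- c * norm x)) <= ennreal (exp (- c * real k)) * indicator (cball 0 (real (Suc k))) x"
   using k c by (auto simp: indicator_def intro!: ennreal_leI)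
  also have "... <= suminf (%k. ennreal (exp (- c * real k)) * indicator (cball 0 (real (Suc k))) x)"
  proof -
   define h :: "nat => ennreal" where "h = (%k. ennreal (exp (- c * real k)) * indicator (cball 0 (real (Suc k))) x)"
   have "h k <= suminf h" using sum_le_suminf[OF summableI, of "{k}" h] by simp
   then show ?thesis by (simp add: h_def)
  qed
  finally show ?thesis .
 qed
 then have "(\<integral>\<^sup>+x. ennreal (exp (- c * norm (x::'a))) \<partial>lborel)
   <= (\<integral>\<^sup>+x. suminf (%k. ennreal (exp (- c * real k)) * indicator (cball 0 (real (Suc k))) (x::'a)) \<partial>lborel)"
  by (intro nn_integral_mono) auto
 also have "... = suminf (%k. ennreal (exp (- c * real k)) * emeasure lborel (cball (0::'a) (real (Suc k))))"
 proof -
  have "(%x::'a. ennreal (exp (- c * real k)) * indicator (cball 0 (real (Suc k))) x) \<in> borel_measurable lborel" for k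
   by (rule borel_measurable_times_ennreal[OF borel_measurable_const borel_measurable_indicator]) simp
  then have "(\<integral>\<^sup>+x. suminf (%k. ennreal (exp (- c * real k)) * indicator (cball 0 (real (Suc k))) (x::'a)) \<partial>lborel)
   = suminf (%k. \<integral>\<^sup>+x. ennreal (exp (- c * real k)) * indicator (cball 0 (real (Suc k))) (x::'a) \<partial>lborel)"
   by (rule nn_integral_suminf)
  moreover have "(\<integral>\<^sup>+x. ennreal (exp (- c * real k)) * indicator (cball 0 (real (Suc k))) (x::'a) \<partial>lborel)
   = ennreal (exp (- c * real k)) * emeasure lborel (cball (0::'a) (real (Suc k)))" for k
   by (rule nn_integral_cmult_indicator) simp
  ultimately show ?thesis by (simp only:)
 qed
 also have "... <= suminf (%k. ennreal (exp (- c * real k) * (2 * real (Suc k)) ^ ?D))"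
 proof (intro suminf_le summableI)
  fix k
  define b :: 'a where "b = (\<Sum>i\<in>Basis. real (Suc k) *\<^sub>R i)"
  have bi: "b \<bullet> i = real (Suc k)" if "i \<in> Basis" for i
   unfolding b_def inner_sum_left using that by (subst sum.remove[of _ i]) (auto simp: inner_Basis)
  have "x \<in> cbox (- b) b" if x: "x \<in> cball 0 (real (Suc k))" for x
   unfolding mem_box
  proof
   fix i :: 'a assume i: "i \<in> Basis"
   have "\<bar>x \<bullet> i\<bar> <= real (Suc k)" using Basis_le_norm[OF i, of x] x by simp
   then show "- b \<bullet> i <= x \<bullet> i \<and> x \<bullet> i <= b \<bullet> i"
    unfolding inner_minus_left bi[OF i] by linarith
  qed
  then have "emeasure lborel (cball (0::'a) (real (Suc k))) <= emeasure lborel (cbox (- b) b)"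
   by (intro emeasure_mono) auto
  also have "... = ennreal (\<Prod>i\<in>Basis. (b - - b) \<bullet> i)"
   by (rule emeasure_lborel_cbox) (use bi in \<open>auto simp: inner_minus_left\<close>)
  also have "(\<Prod>i\<in>Basis. (b - - b) \<bullet> i) = (2 * real (Suc k)) ^ ?D"
   by (simp add: inner_add_left bi del: of_nat_Suc)
  finally have "ennreal (exp (- c * real k)) * emeasure lborel (cball (0::'a) (real (Suc k)))
    <= ennreal (exp (- c * real k)) * ennreal ((2 * real (Suc k)) ^ ?D)"
   by (rule mult_left_mono) simp
  also have "... = ennreal (exp (- c * real k) * (2 * real (Suc k)) ^ ?D)"
   by (rule ennreal_mult[symmetric]) simp_all
  finally show "ennreal (exp (- c * real k)) * emeasure lborel (cball (0::'a) (real (Suc k))) <= ..." .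
 qed
 also have "... < \<infinity>"
 proof -
  define f where "f = (%k. exp (- c * real k) * (2 * real (Suc k)) ^ ?D)"
  define C where "C = (4 / c) ^ ?D * fact ?D * exp (c / 2)"
  have le: "f k <= C * exp (- (c / 2)) ^ k" for k
  proof -
   have "(2 * real (Suc k)) ^ ?D = (4 / c) ^ ?D * (c / 2 * real (Suc k)) ^ ?D"
    unfolding power_mult_distrib[symmetric] using c by (intro arg_cong[of _ _ "%x. x ^ ?D"]) (simp add: field_simps)
   also have "... <= (4 / c) ^ ?D * (fact ?D * exp (c / 2 * real (Suc k)))"
    using c by (intro mult_left_mono power_le_fact_exp) auto
   finally have "f k <= exp (- c * real k) * ((4 / c) ^ ?D * (fact ?D * exp (c / 2 * real (Suc k))))"
    unfolding f_def by (intro mult_left_mono) auto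
   also have "exp (c / 2 * real (Suc k)) = exp (c / 2) * exp (c / 2 * real k)"
    by (simp add: algebra_simps flip: exp_add)
   also have "exp (- c * real k) * ((4 / c) ^ ?D * (fact ?D * (exp (c / 2) * exp (c / 2 * real k))))
     = C * (exp (- c * real k) * exp (c / 2 * real k))" by (simp add: C_def)
   also have "exp (- c * real k) * exp (c / 2 * real k) = exp (- (c / 2) * real k)"
    by (simp add: algebra_simps flip: exp_add)
   also have "... = exp (- (c / 2)) ^ k" by (metis exp_of_nat2_mult)
   finally show ?thesis .
  qed
  have f0: "f k >= 0" for k by (simp add: f_def)
  have "summable f"
   by (rule summable_comparison_test'[of "%k. C * exp (- (c / 2)) ^ k" 0])
     (use c le f0 in \<open>auto intro!: summable_mult summable_geometric\<close>)
  then have "suminf (%k. ennreal (f k)) = ennreal (suminf f)" using f0 by (intro suminf_ennreal2) auto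
  then have "suminf (%k. ennreal (f k)) < \<infinity>" by simp
  then show ?thesis unfolding f_def .
 qed
 finally show ?thesis .
qed
lemma integrable_exp_norm:
 fixes c :: real assumes c: "c > 0"
 shows "integrable lborel (%x::'a::euclidean_space. exp (- c * norm x))"
 using nn_integral_exp_norm_finite[OF c, where 'a='a] by (intro integrableI_bounded) auto

lemma disjoint_unit_cubes:
 fixes x y :: "int^'d"
 assumes "z \<in> {z. \<forall>j. real_of_int (x $ j) <= z $ j \<and> z $ j < real_of_int (x $ j) + 1}"
  and "z \<in> {z. \<forall>j. real_of_int (y $ j) <= z $ j \<and> z $ j < real_of_int (y $ j) + 1}"
 shows "x = y"
proof -
 have "x $ j = y $ j" for j
 proof -
  have "real_of_int (x $ j) <= z $ j" "z $ j < real_of_int (x $ j) + 1"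
   "real_of_int (y $ j) <= z $ j" "z $ j < real_of_int (y $ j) + 1" using assms by auto
  then show ?thesis by linarith
 qed
 then show ?thesis by (simp add: vec_eq_iff)
qed

text \<open>
  A lattice sum of a slowly varying function is controlled by its integral: compare the value at a
  lattice point with the mean over the unit cube based there.
\<close>
lemma lattice_sum_le_integral:
 fixes w :: "real^'d => real"
 assumes w[measurable]: "w \<in> borel_measurable borel" and w0: "!!x. w x >= 0" and C: "C >= 0"
  and slow: "!!x y. (!!j. \<bar>x $ j - y $ j\<bar> <= 1) ==> w x <= C * w y"
  and I: "(\<integral>\<^sup>+x. ennreal (w x) \<partial>lborel) <= ennreal I" and I0: "I >= 0"
 shows "(%x::int^'d. w (real_vec x)) summable_on UNIV"
  and "infsum (%x::int^'d. w (real_vec x)) UNIV <= C * I"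
proof -
 define Q where "Q = (%x::int^'d. {z::real^'d. \<forall>j. real_of_int (x $ j) <= z $ j \<and> z $ j < real_of_int (x $ j) + 1})"
 have Qm[measurable]: "Q x \<in> sets borel" for x
  unfolding Q_def by measurable
 have QQ: "emeasure lborel (Q x) >= 1" for x
 proof -
  have "1 = ennreal (\<Prod>b\<in>Basis. ((\<chi> j. 1) :: real^'d) \<bullet> b)"
   by (subst prod.neutral) (auto simp: Basis_vec_def inner_axis)
  also have "... = emeasure lborel (box (real_vec x) (real_vec x + (\<chi> j. 1)))"
   by (subst emeasure_lborel_box) (auto simp: Basis_vec_def inner_axis inner_add_left)
  also have "emeasure lborel (box (real_vec x) (real_vec x + (\<chi> j. 1))) <= emeasure lborel (Q x)"
   by (intro emeasure_mono) (auto simp: Q_def box_def Basis_vec_def inner_axis real_vec_def less_imp_le)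
  finally show ?thesis .
 qed
 have fin: "(\<Sum>x\<in>F. w (real_vec x)) <= C * I" if F: "finite F" for F :: "(int^'d) set"
 proof -
  have one: "ennreal (w (real_vec x)) <= (\<integral>\<^sup>+z. ennreal C * ennreal (w z) * indicator (Q x) z \<partial>lborel)" for x
  proof -
   have "ennreal (w (real_vec x)) * 1 <= ennreal (w (real_vec x)) * emeasure lborel (Q x)"
    by (intro mult_left_mono QQ) auto
   also have "... = (\<integral>\<^sup>+z. ennreal (w (real_vec x)) * indicator (Q x) z \<partial>lborel)"
    by (simp add: nn_integral_cmult)
   also have "... <= (\<integral>\<^sup>+z. ennreal C * ennreal (w z) * indicator (Q x) z \<partial>lborel)"
   proof (intro nn_integral_mono)
    fix z
    have "w (real_vec x) <= C * w z" if "z \<in> Q x"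
    proof (rule slow)
     fix j
     have "real_of_int (x $ j) <= z $ j" "z $ j < real_of_int (x $ j) + 1" using that by (auto simp: Q_def)
     then show "\<bar>real_vec x $ j - z $ j\<bar> <= 1" by (simp add: real_vec_def)
    qed
    then show "ennreal (w (real_vec x)) * indicator (Q x) z <= ennreal C * ennreal (w z) * indicator (Q x) z"
     using C w0 by (auto simp: indicator_def intro!: ennreal_leI simp flip: ennreal_mult)
   qed
   finally show ?thesis by simp
  qed
  have disj: "(\<Sum>x\<in>F. indicator (Q x) z) <= (1::ennreal)" for z
  proof (cases "\<exists>x\<in>F. z \<in> Q x")
   case True
   then obtain x where x: "x \<in> F" "z \<in> Q x" by auto
   have dQ: "z \<in> Q y ==> z \<in> Q x ==> y = x" for z y
    unfolding Q_def by (rule disjoint_unit_cubes)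
   have "(\<Sum>y\<in>F. indicator (Q y) z) = (\<Sum>y\<in>F. if y = x then 1 else (0::ennreal))"
   proof (intro sum.cong refl)
    fix y assume "y \<in> F"
    show "indicator (Q y) z = (if y = x then 1 else (0::ennreal))"
     using x(2) dQ[of z y] by (cases "z \<in> Q y") auto
   qed
   then show ?thesis using F x by simp
  qed (auto simp: indicator_def)
  have "ennreal (\<Sum>x\<in>F. w (real_vec x)) = (\<Sum>x\<in>F. ennreal (w (real_vec x)))" using w0 by simp
  also have "... <= (\<Sum>x\<in>F. \<integral>\<^sup>+z. ennreal C * ennreal (w z) * indicator (Q x) z \<partial>lborel)"
   by (intro sum_mono one)
  also have "... = (\<integral>\<^sup>+z. (\<Sum>x\<in>F. ennreal C * ennreal (w z) * indicator (Q x) z) \<partial>lborel)"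
   by (subst nn_integral_sum) auto
  also have "... = (\<integral>\<^sup>+z. ennreal C * ennreal (w z) * (\<Sum>x\<in>F. indicator (Q x) z) \<partial>lborel)"
   by (simp add: sum_distrib_left)
  also have "... <= (\<integral>\<^sup>+z. ennreal C * ennreal (w z) * 1 \<partial>lborel)"
   by (intro nn_integral_mono mult_left_mono disj) auto
  also have "... = ennreal C * (\<integral>\<^sup>+z. ennreal (w z) \<partial>lborel)" by (simp add: nn_integral_cmult)
  also have "... <= ennreal C * ennreal I" by (intro mult_left_mono I) auto
  finally show ?thesis using C I0 by (simp flip: ennreal_mult)
 qed
 show s: "(%x::int^'d. w (real_vec x)) summable_on UNIV"
  by (rule nonneg_bdd_above_summable_on) (use w0 fin in \<open>auto simp: bdd_above_def\<close>)
 show "infsum (%x::int^'d. w (real_vec x)) UNIV <= C * I"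
  by (rule infsum_le_finite_sums[OF s]) (use fin in auto)
qed

section \<open>Decay of Fourier integrals by finite differences\<close>

definition shift_diff :: "'a::ab_group_add => ('a => 'b::ab_group_add) => 'a => 'b" where
 "shift_diff h g x = g (x + h) - g x"

lemma shift_diff_Suc: "(shift_diff h ^^ Suc N) F x = (shift_diff h ^^ N) F (x + h) - (shift_diff h ^^ N) F x"
 by (simp add: shift_diff_def)

text \<open>Moves differences in a coordinate direction of the real space to differences of a holomorphic function of one variable.\<close>
lemma shift_diff_transfer:
 fixes F :: "'a::real_vector => 'b::ab_group_add" and f :: "'c::real_vector => 'b"
 assumes "!!k. k <= N ==> F (x + real k *\<^sub>R h) = f (y + real k *\<^sub>R h')"
 shows "(shift_diff h ^^ N) F x = (shift_diff h' ^^ N) f y"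
 using assms
proof (induction N arbitrary: x y)
 case 0
 then show ?case using 0[of 0] by simp
next
 case (Suc N)
 have "F (x + h + real k *\<^sub>R h) = f (y + h' + real k *\<^sub>R h')" if "k <= N" for k
  using Suc.prems[of "Suc k"] that by (simp add: algebra_simps)
 moreover have "F (x + real k *\<^sub>R h) = f (y + real k *\<^sub>R h')" if "k <= N" for k
  using Suc.prems[of k] that by simp
 ultimately show ?case using Suc.IH[of "x + h" "y + h'"] Suc.IH[of x y] by (simp add: shift_diff_def)
qed

lemma shift_diff_trivial_bound:
 fixes F :: "'a::real_vector => 'b::real_normed_vector"
 assumes "!!k. k <= N ==> norm (F (x + real k *\<^sub>R h)) <= M"
 shows "norm ((shift_diff h ^^ N) F x) <= 2 ^ N * M"
 using assms
proof (induction N arbitrary: x)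
 case 0
 then show ?case using 0[of 0] by simp
next
 case (Suc N)
 have "norm (F (x + h + real k *\<^sub>R h)) <= M" if "k <= N" for k
  using Suc.prems[of "Suc k"] that by (simp add: algebra_simps)
 then have "norm ((shift_diff h ^^ N) F (x + h)) <= 2 ^ N * M" by (rule Suc.IH)
 moreover have "norm ((shift_diff h ^^ N) F x) <= 2 ^ N * M" by (rule Suc.IH) (use Suc.prems in auto)
 ultimately show ?case
  unfolding shift_diff_Suc
  using norm_triangle_ineq4[of "(shift_diff h ^^ N) F (x + h)" "(shift_diff h ^^ N) F x"] by simp
qed

text \<open>
  Each difference costs a step \<open>2delta\<close> of the radius: by Cauchy's inequality the derivative is at most
  \<open>B / delta\<close> there, and the step length is at most \<open>delta\<close>.
\<close>
lemma shift_diff_holomorphic_bound: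
 fixes f :: "complex => complex" and s R B :: real
 assumes f: "f holomorphic_on ball 0 R" and fB: "!!w. w \<in> ball 0 R ==> cmod (f w) <= B"
  and s: "2 * real N * \<bar>s\<bar> < R" and R: "0 < R"
 shows "cmod ((shift_diff (of_real s) ^^ N) f 0) <= B"
proof (cases "N = 0")
 case True
 then show ?thesis using fB[of 0] R by simp
next
 case False
 then have N: "real N >= 1" by simp
 define delta where "delta = (\<bar>s\<bar> + R / (2 * real N)) / 2"
 have sR: "\<bar>s\<bar> < R / (2 * real N)" using s N by (simp add: field_simps)
 have delta: "0 < delta" "\<bar>s\<bar> <= delta" "delta < R / (2 * real N)"
  using sR N R by (auto simp: delta_def add_nonneg_pos)
 have deltaR: "2 * real N * delta < R" using delta(3) N by (simp add: field_simps)
 have "(shift_diff (of_real s) ^^ k) f holomorphic_on ball 0 (R - 2 * real k * delta) \<and>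
   (\<forall>w\<in>ball 0 (R - 2 * real k * delta). cmod ((shift_diff (of_real s) ^^ k) f w) <= B)" for k
 proof (induction k)
  case 0
  then show ?case using f fB by simp
 next
  case (Suc k)
  define g where "g = (shift_diff (of_real s) ^^ k) f"
  define rho where "rho = R - 2 * real k * delta"
  have g: "g holomorphic_on ball 0 rho" and gB: "!!w. w \<in> ball 0 rho ==> cmod (g w) <= B"
   using Suc by (auto simp: g_def rho_def)
  have rho': "R - 2 * real (Suc k) * delta = rho - 2 * delta" by (simp add: rho_def algebra_simps)
  have shift_in: "w + of_real s \<in> ball 0 (rho - delta)" "w \<in> ball 0 (rho - delta)" if w: "w \<in> ball 0 (rho - 2 * delta)" for w :: complex
   using w delta norm_triangle_ineq[of w "of_real s"] by auto
  have big: "ball 0 (rho - delta) \<subseteq> ball 0 rho" using delta by auto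
  have dB: "cmod (deriv g w) <= B / delta" if w: "w \<in> ball 0 (rho - delta)" for w :: complex
  proof -
   have sub: "cball w delta \<subseteq> ball 0 rho"
   proof
    fix x assume "x \<in> cball w delta"
    then show "x \<in> ball 0 rho" using w norm_triangle_ineq[of "x - w" w] by (auto simp: dist_norm norm_minus_commute)
   qed
   have "cmod ((deriv ^^ 1) g w) <= fact 1 * B / delta ^ 1"
   proof (rule Cauchy_inequality)
    show "g holomorphic_on ball w delta" using g sub by (meson ball_subset_cball holomorphic_on_subset)
    show "continuous_on (cball w delta) g" using holomorphic_on_imp_continuous_on[OF g] sub continuous_on_subset by blast
    show "cmod (g x) <= B" if "cmod (w - x) = delta" for x
     by (rule gB) (use sub that in \<open>auto simp: dist_norm\<close>)
   qed (use delta in auto)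
   then show ?thesis by simp
  qed
  have "cmod (g (w + of_real s) - g w) <= B" if w: "w \<in> ball 0 (rho - 2 * delta)" for w
  proof -
   have "cmod (g (w + of_real s) - g w) <= B / delta * cmod (w + of_real s - w)"
   proof (rule field_differentiable_bound[of "ball 0 (rho - delta)"])
    fix z :: complex assume z: "z \<in> ball 0 (rho - delta)"
    have "(g has_field_derivative deriv g z) (at z)"
     using holomorphic_derivI[OF g open_ball] z big by blast
    then show "(g has_field_derivative deriv g z) (at z within ball 0 (rho - delta))"
     by (rule has_field_derivative_at_within)
   qed (use dB shift_in[OF w] in auto)
   also have "... = B / delta * \<bar>s\<bar>" by simp
   also have "... <= B / delta * delta"
   proof (intro mult_left_mono)
    have "0 <= cmod (g w)" by simp
    also have "... <= B" by (rule gB) (use w delta in auto)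
    finally have "0 <= B" .
    then show "0 <= B / delta" using delta by simp
   qed (use delta in auto)
   finally show ?thesis using delta by simp
  qed
  moreover have "(%w. g (w + of_real s) - g w) holomorphic_on ball 0 (rho - 2 * delta)"
  proof (intro holomorphic_intros)
   have "g \<circ> (%w. w + of_real s) holomorphic_on ball 0 (rho - 2 * delta)"
    by (rule holomorphic_on_compose_gen[OF _ g]) (use shift_in big in \<open>auto intro!: holomorphic_intros\<close>)
   then show "(%w. g (w + of_real s)) holomorphic_on ball 0 (rho - 2 * delta)" by (simp add: o_def)
   show "g holomorphic_on ball 0 (rho - 2 * delta)"
    by (rule holomorphic_on_subset[OF g]) (use delta in auto)
  qed
  moreover have "(shift_diff (of_real s) ^^ Suc k) f = (%w. g (w + of_real s) - g w)"
   by (auto simp: g_def shift_diff_def)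
  ultimately show ?case unfolding rho' by simp
 qed
 from this[of N] show ?thesis using deltaR by auto
qed

lemma lborel_integral_translate:
 fixes f :: "'a::euclidean_space => 'b::{banach, second_countable_topology}"
 assumes [measurable]: "f \<in> borel_measurable borel"
 shows "(LINT x|lborel. f (x + h)) = integral\<^sup>L lborel f"
  and "integrable lborel f ==> integrable lborel (%x. f (x + h))"
proof -
 have L: "lborel = distr lborel borel ((+) h)" by (simp add: lborel_distr_plus)
 have "integral\<^sup>L lborel f = integral\<^sup>L (distr lborel borel ((+) h)) f" using L by simp
 also have "... = (LINT x|lborel. f (x + h))" by (subst integral_distr) (auto simp: add.commute)
 finally show "(LINT x|lborel. f (x + h)) = integral\<^sup>L lborel f" by simp
 assume "integrable lborel f"
 then have "integrable (distr lborel borel ((+) h)) f" using L by simp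
 then show "integrable lborel (%x. f (x + h))" by (subst (asm) integrable_distr_eq) (auto simp: add.commute)
qed

text \<open>A shift by \<open>h\<close> with \<open>y \<bullet> h = \<pi>\<close> changes the sign of the character, so that each difference contributes the factor \<open>-2\<close>.\<close>
lemma fourier_shift_diff:
 fixes F :: "real^'d => complex"
 assumes [measurable]: "F \<in> borel_measurable borel" and F: "integrable lborel F"
  and h: "y \<bullet> h = pi"
 shows "integrable lborel ((shift_diff h ^^ N) F)"
  and "(shift_diff h ^^ N) F \<in> borel_measurable borel"
  and "(LINT xi|lborel. (shift_diff h ^^ N) F xi * exp (- (\<i> * complex_of_real (y \<bullet> xi))))
   = (-2) ^ N * (LINT xi|lborel. F xi * exp (- (\<i> * complex_of_real (y \<bullet> xi))))"
proof -
 have "integrable lborel ((shift_diff h ^^ N) F) \<and> (shift_diff h ^^ N) F \<in> borel_measurable borel \<and>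
  (LINT xi|lborel. (shift_diff h ^^ N) F xi * exp (- (\<i> * complex_of_real (y \<bullet> xi))))
   = (-2) ^ N * (LINT xi|lborel. F xi * exp (- (\<i> * complex_of_real (y \<bullet> xi))))"
 proof (induction N)
  case 0
  then show ?case using F by simp
 next
  case (Suc N)
  define G where "G = (shift_diff h ^^ N) F"
  have G[measurable]: "G \<in> borel_measurable borel" and Gi: "integrable lborel G" using Suc by (auto simp: G_def)
  let ?e = "%xi::real^'d. exp (- (\<i> * complex_of_real (y \<bullet> xi)))"
  have Gh: "integrable lborel (%xi. G (xi + h))" by (rule lborel_integral_translate(2)[OF G Gi])
  have m: "(%xi. shift_diff h G xi) \<in> borel_measurable borel" unfolding shift_diff_def by measurable
  have mult: "integrable lborel (%xi. K xi * ?e xi)" if "integrable lborel K" "K \<in> borel_measurable borel" for K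
   by (rule Bochner_Integration.integrable_bound[OF that(1)]) (use that(2) in \<open>auto simp: norm_mult\<close>)
  have shift: "(LINT xi|lborel. G (xi + h) * ?e xi) = - (LINT xi|lborel. G xi * ?e xi)"
  proof -
   have "?e xi = - ?e (xi + h)" for xi
    proof -
    have "- (\<i> * complex_of_real (y \<bullet> (xi + h))) = - (\<i> * complex_of_real (y \<bullet> xi)) + - (\<i> * complex_of_real pi)"
     by (simp add: inner_add_right h algebra_simps)
    also have "exp ... = ?e xi * exp (- (\<i> * complex_of_real pi))" by (rule exp_add)
    also have "exp (- (\<i> * complex_of_real pi)) = - 1" by (simp add: exp_minus)
    finally show ?thesis by simp
   qed
   then have "(LINT xi|lborel. G (xi + h) * ?e xi) = (LINT xi|lborel. - (G (xi + h) * ?e (xi + h)))"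
    by (metis mult_minus_right)
   also have "... = - (LINT xi|lborel. G xi * ?e xi)"
    using lborel_integral_translate(1)[of "%xi. G xi * ?e xi" h] by simp
   finally show ?thesis .
  qed
  have "(LINT xi|lborel. shift_diff h G xi * ?e xi) = (LINT xi|lborel. G (xi + h) * ?e xi - G xi * ?e xi)"
   by (simp add: shift_diff_def algebra_simps)
  also have "... = (LINT xi|lborel. G (xi + h) * ?e xi) - (LINT xi|lborel. G xi * ?e xi)"
   by (rule Bochner_Integration.integral_diff) (use Gi Gh in \<open>auto intro!: mult\<close>)
  also have "... = (-2) * (LINT xi|lborel. G xi * ?e xi)" unfolding shift by simp
  finally have "(LINT xi|lborel. shift_diff h G xi * ?e xi) = (-2) * (LINT xi|lborel. G xi * ?e xi)" .
  moreover have "integrable lborel (%xi. shift_diff h G xi)"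
   unfolding shift_diff_def by (intro Bochner_Integration.integrable_diff Gh Gi)
  ultimately show ?case using Suc m by (simp add: G_def mult_ac)
 qed
 then show "integrable lborel ((shift_diff h ^^ N) F)"
  and "(shift_diff h ^^ N) F \<in> borel_measurable borel"
  and "(LINT xi|lborel. (shift_diff h ^^ N) F xi * exp (- (\<i> * complex_of_real (y \<bullet> xi))))
   = (-2) ^ N * (LINT xi|lborel. F xi * exp (- (\<i> * complex_of_real (y \<bullet> xi))))" by auto
qed

lemma half_power_floor_bound:
 assumes x: "x >= 0" and N: "N = nat \<lfloor>x\<rfloor>"
 shows "(1 / 2 :: real) ^ N <= 2 * exp (- (ln 2 * x))"
proof -
 have "x <= real N + 1" using x N by simp
 then have "(1 / 2) powr (real N + 1) <= (1 / 2 :: real) powr x" by (intro powr_mono') auto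
 moreover have "(1 / 2 :: real) powr (real N + 1) = (1 / 2) ^ N / 2" by (simp add: powr_add powr_realpow)
 moreover have "(1 / 2 :: real) powr x = exp (- (ln 2 * x))" by (simp add: powr_def ln_div mult.commute)
 ultimately show ?thesis by simp
qed

lemma max_component:
 fixes y :: "real^'d"
 obtains j where "norm y <= real CARD('d) * \<bar>y $ j\<bar>"
proof -
 obtain j where j: "!!i. \<bar>y $ i\<bar> <= \<bar>y $ j\<bar>"
 proof -
  have "Max (range (%i. \<bar>y $ i\<bar>)) \<in> range (%i. \<bar>y $ i\<bar>)" by (intro Max_in) auto
  then obtain j where "Max (range (%i. \<bar>y $ i\<bar>)) = \<bar>y $ j\<bar>" by (rule rangeE)
  then show thesis by (intro that[of j]) (metis Max_ge finite finite_imageI rangeI)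
 qed
 have "norm y <= (\<Sum>i\<in>UNIV. \<bar>y $ i\<bar>)" by (rule norm_le_l1_cart)
 also have "... <= (\<Sum>i\<in>(UNIV :: 'd set). \<bar>y $ j\<bar>)" by (intro sum_mono j)
 finally show thesis by (intro that[of j]) simp
qed

text \<open>
  The substitute for a contour shift: with step \<open>\<pi> / y\<^sub>j\<close> the \<open>N\<close>-fold difference multiplies the
  transform by \<open>(-2)\<^sup>N\<close>, whereas at the points of the first kind it does not increase the
  bound as long as \<open>N\<close> is at most proportional to \<open>\<bar>y\<^sub>j\<bar>\<close>.
\<close>
theorem fourier_integral_decay:
 fixes F :: "real^'d => complex" and w :: "real^'d => real"
 assumes Fm[measurable]: "F \<in> borel_measurable borel" and w: "integrable lborel w" and w0: "!!xi. w xi >= 0"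
  and B: "B1 >= 0" "B2 >= 0"
  and alt: "!!xi j. (\<exists>f. f holomorphic_on ball 0 1 \<and> (\<forall>u\<in>ball 0 1. cmod (f u) <= B1 * w xi) \<and>
         (\<forall>x. \<bar>x\<bar> <= 1 / 2 --> F (xi + x *\<^sub>R axis j 1) = f (of_real x))) \<or>
       (\<forall>x. \<bar>x\<bar> <= 1 / 2 --> cmod (F (xi + x *\<^sub>R axis j 1)) <= B2 * w xi)"
 shows "integrable lborel F"
  and "cmod (LINT xi|lborel. F xi * exp (- (\<i> * complex_of_real (y \<bullet> xi))))
   <= 2 * (B1 * exp (- (ln 2 / (4 * pi * real CARD('d)) * norm y)) + B2) * integral\<^sup>L lborel w"
proof -
 have F1: "cmod (F xi) <= (B1 + B2) * w xi" for xi
 proof -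
  fix j :: 'd
  from alt[of xi undefined] show "cmod (F xi) <= (B1 + B2) * w xi"
  proof (elim disjE exE conjE)
   fix f assume "\<forall>u\<in>ball 0 1. cmod (f u) <= B1 * w xi" "\<forall>x. \<bar>x\<bar> <= 1 / 2 --> F (xi + x *\<^sub>R axis undefined 1) = f (of_real x)"
   then have "cmod (F xi) <= B1 * w xi" by (metis (no_types, lifting) abs_0 add.right_neutral centre_in_ball divide_nonneg_nonneg of_real_0 scaleR_zero_left zero_le_numeral zero_le_one zero_less_one)
   then show ?thesis using B w0[of xi] by (simp add: distrib_right add_increasing2)
  next
   assume "\<forall>x. \<bar>x\<bar> <= 1 / 2 --> cmod (F (xi + x *\<^sub>R axis undefined 1)) <= B2 * w xi"
   from this[rule_format, of 0] have "cmod (F xi) <= B2 * w xi" by simp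
   then show ?thesis using B w0[of xi] by (simp add: distrib_right add_increasing)
  qed
 qed
 show Fi: "integrable lborel F"
  by (rule Bochner_Integration.integrable_bound[of _ "%xi. (B1 + B2) * w xi"])
    (use w F1 w0 B in \<open>auto simp: abs_mult\<close>)
 let ?e = "%xi::real^'d. exp (- (\<i> * complex_of_real (y \<bullet> xi)))"
 obtain j where j: "norm y <= real CARD('d) * \<bar>y $ j\<bar>" by (rule max_component)
 define N where "N = nat \<lfloor>\<bar>y $ j\<bar> / (4 * pi)\<rfloor>"
 define s where "s = pi / y $ j"
 define h where "h = s *\<^sub>R (axis j 1 :: real^'d)"
 define I where "I = integral\<^sup>L lborel w"
 have I0: "I >= 0" unfolding I_def using w0 by simp
 have N4: "real N <= \<bar>y $ j\<bar> / (4 * pi)" unfolding N_def by (simp add: of_nat_nat)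
 have Ns: "real N * \<bar>s\<bar> <= 1 / 4"
  using N4 by (cases "y $ j = 0") (auto simp: s_def abs_divide field_simps)
 have main: "cmod (LINT xi|lborel. F xi * ?e xi) <= (B1 * (1 / 2) ^ N + B2) * I"
 proof -
  have bnd: "cmod ((shift_diff h ^^ N) F xi) <= (B1 + 2 ^ N * B2) * w xi" for xi
  proof -
   have kN: "\<bar>real k * s\<bar> <= 1 / 2" if "k <= N" for k
   proof -
    have "real k * \<bar>s\<bar> <= real N * \<bar>s\<bar>" using that by (intro mult_right_mono) auto
    then show ?thesis using Ns by (simp add: abs_mult)
   qed
   have Fk: "F (xi + real k *\<^sub>R h) = F (xi + (real k * s) *\<^sub>R axis j 1)" for k by (simp add: h_def)
   have fk: "f (0 + real k *\<^sub>R of_real s) = f (of_real (real k * s))" for f :: "complex => complex" and k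
    by (simp add: scaleR_conv_of_real)
   from alt[of xi j] show ?thesis
   proof (elim disjE exE conjE)
    fix f assume f: "f holomorphic_on ball 0 1" "\<forall>u\<in>ball 0 1. cmod (f u) <= B1 * w xi"
     "\<forall>x. \<bar>x\<bar> <= 1 / 2 --> F (xi + x *\<^sub>R axis j 1) = f (of_real x)"
    have "(shift_diff h ^^ N) F xi = (shift_diff (of_real s) ^^ N) f 0"
    proof (rule shift_diff_transfer)
     fix k assume "k <= N"
     then show "F (xi + real k *\<^sub>R h) = f (0 + real k *\<^sub>R of_real s)"
      unfolding Fk fk using f(3) kN by blast
    qed
    also have "cmod ... <= B1 * w xi"
     by (rule shift_diff_holomorphic_bound[OF f(1)]) (use f(2) Ns in auto)
    finally show ?thesis using B w0[of xi] by (simp add: distrib_right add_increasing2)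
   next
    assume "\<forall>x. \<bar>x\<bar> <= 1 / 2 --> cmod (F (xi + x *\<^sub>R axis j 1)) <= B2 * w xi"
    then have "cmod ((shift_diff h ^^ N) F xi) <= 2 ^ N * (B2 * w xi)"
     by (intro shift_diff_trivial_bound) (use Fk kN in auto)
    then show ?thesis using B w0[of xi] by (simp add: distrib_right add_increasing mult.assoc)
   qed
  qed
  have eq: "cmod (LINT xi|lborel. (shift_diff h ^^ N) F xi * ?e xi) = 2 ^ N * cmod (LINT xi|lborel. F xi * ?e xi)"
   and m: "(shift_diff h ^^ N) F \<in> borel_measurable borel"
  proof -
   have "cmod (LINT xi|lborel. (shift_diff h ^^ N) F xi * ?e xi) = 2 ^ N * cmod (LINT xi|lborel. F xi * ?e xi) \<and> (shift_diff h ^^ N) F \<in> borel_measurable borel"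
   proof (cases "N = 0")
    case False
    then have "y $ j ~= 0" by (auto simp: N_def)
    then have "y \<bullet> h = pi" by (simp add: h_def s_def inner_axis)
    from fourier_shift_diff[OF Fm Fi this, of N] show ?thesis by (simp add: norm_mult norm_power)
   qed simp
   then show "cmod (LINT xi|lborel. (shift_diff h ^^ N) F xi * ?e xi) = 2 ^ N * cmod (LINT xi|lborel. F xi * ?e xi)"
    and "(shift_diff h ^^ N) F \<in> borel_measurable borel" by auto
  qed
  have "cmod (LINT xi|lborel. (shift_diff h ^^ N) F xi * ?e xi) <= (LINT xi|lborel. (B1 + 2 ^ N * B2) * w xi)"
  proof (rule Bochner_Integration.integral_norm_bound_integral)
   show "integrable lborel (%xi. (B1 + 2 ^ N * B2) * w xi)" using w by simp
   show "integrable lborel (%xi. (shift_diff h ^^ N) F xi * ?e xi)"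
    by (rule Bochner_Integration.integrable_bound[of _ "%xi. (B1 + 2 ^ N * B2) * w xi"])
      (use m w bnd B w0 in \<open>auto simp: norm_mult abs_mult\<close>)
  qed (use bnd in \<open>auto simp: norm_mult\<close>)
  then have "2 ^ N * cmod (LINT xi|lborel. F xi * ?e xi) <= (B1 + 2 ^ N * B2) * I"
   unfolding eq by (simp add: I_def)
  then have "cmod (LINT xi|lborel. F xi * ?e xi) <= (B1 + 2 ^ N * B2) * I / 2 ^ N"
   by (simp add: field_simps)
  also have "... = (B1 * (1 / 2) ^ N + B2) * I" by (simp add: field_simps)
  finally show ?thesis .
 qed
 have "(1 / 2 :: real) ^ N <= 2 * exp (- (ln 2 * (\<bar>y $ j\<bar> / (4 * pi))))"
  by (rule half_power_floor_bound) (auto simp: N_def)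
 also have "... <= 2 * exp (- (ln 2 / (4 * pi * real CARD('d)) * norm y))"
 proof -
  have "ln 2 / (4 * pi * real CARD('d)) * norm y <= ln 2 / (4 * pi * real CARD('d)) * (real CARD('d) * \<bar>y $ j\<bar>)"
   by (intro mult_left_mono j) auto
  then show ?thesis by (simp add: field_simps)
 qed
 finally have "B1 * (1 / 2) ^ N + B2 <= B1 * (2 * exp (- (ln 2 / (4 * pi * real CARD('d)) * norm y))) + 2 * B2"
  using B by (intro add_mono mult_left_mono) auto
 then have "(B1 * (1 / 2) ^ N + B2) * I <= (B1 * (2 * exp (- (ln 2 / (4 * pi * real CARD('d)) * norm y))) + 2 * B2) * I"
  using I0 by (rule mult_right_mono)
 with main show "cmod (LINT xi|lborel. F xi * ?e xi)
   <= 2 * (B1 * exp (- (ln 2 / (4 * pi * real CARD('d)) * norm y)) + B2) * integral\<^sup>L lborel w"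
  by (simp add: I_def algebra_simps)
qed

section \<open>Power series in several complex variables\<close>

lemma cauchy_coefficient_bound:
 fixes f :: "complex => complex"
 assumes "f holomorphic_on ball 0 r" "!!u. u \<in> ball 0 r ==> cmod (f u) <= B" "0 < rho" "rho < r"
 shows "cmod ((deriv ^^ k) f 0 / fact k) <= B / rho ^ k"
proof -
 have "cmod ((deriv ^^ k) f 0) <= fact k * B / rho ^ k"
 proof (rule Cauchy_inequality)
  show "f holomorphic_on ball 0 rho" using assms by (auto intro: holomorphic_on_subset)
  show "continuous_on (cball 0 rho) f"
   by (rule holomorphic_on_imp_continuous_on, rule holomorphic_on_subset[OF assms(1)]) (use assms in auto)
 qed (use assms in auto)
 then show ?thesis by (simp add: norm_divide field_simps)
qed

lemma taylor_remainder_bound: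
 fixes f :: "complex => complex"
 assumes f: "f holomorphic_on ball 0 r" and fB: "!!u. u \<in> ball 0 r ==> cmod (f u) <= B" and rho: "0 < rho" "rho < r"
  and u: "2 * cmod u <= rho"
 shows "cmod (f u - (\<Sum>n<k. (deriv ^^ n) f 0 / fact n * u ^ n)) <= 2 * B * (cmod u / rho) ^ k"
proof -
 define a where "a = (%n. (deriv ^^ n) f 0 / fact n)"
 have B: "B >= 0" using fB[of 0] rho norm_ge_zero[of "f 0"] by (simp add: order_trans[of 0 "cmod (f 0)"])
 have aB: "cmod (a n) <= B / rho ^ n" for n unfolding a_def by (rule cauchy_coefficient_bound[OF f fB rho])
 have "(%n. a n * (u - 0) ^ n) sums f u"
  unfolding a_def by (rule holomorphic_power_series[OF f]) (use u rho in auto)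
 then have "(%n. a n * u ^ n) sums ((f u - (\<Sum>n<k. a n * u ^ n)) + (\<Sum>n<k. a n * u ^ n))" by simp
 then have "(%n. a (n + k) * u ^ (n + k)) sums (f u - (\<Sum>n<k. a n * u ^ n))"
  by (subst (asm) sums_iff_shift[symmetric])
 then have eq: "f u - (\<Sum>n<k. a n * u ^ n) = (suminf (%n. a (n + k) * u ^ (n + k)))" by (simp add: sums_iff)
 define x where "x = cmod u / rho"
 have x: "0 <= x" "x <= 1 / 2" using u rho by (auto simp: x_def field_simps)
 have gs: "(%n. B * x ^ k * x ^ n) sums (B * x ^ k * (1 / (1 - x)))"
  using x by (intro sums_mult geometric_sums) auto
 have "cmod (a (n + k) * u ^ (n + k)) <= B * x ^ k * x ^ n" for n
 proof -
  have "cmod (a (n + k) * u ^ (n + k)) <= B / rho ^ (n + k) * cmod u ^ (n + k)"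
   unfolding norm_mult norm_power by (rule mult_right_mono[OF aB]) simp
  also have "... = B * x ^ k * x ^ n" by (simp add: x_def power_add power_divide mult_ac)
  finally show ?thesis .
 qed
 then have "cmod (suminf (%n. a (n + k) * u ^ (n + k))) <= suminf (%n. B * x ^ k * x ^ n)"
  using gs by (intro norm_suminf_le) (auto simp: sums_iff)
 also have "... = B * x ^ k * (1 / (1 - x))" using gs by (simp add: sums_iff)
 also have "... <= B * x ^ k * 2" using x B by (intro mult_left_mono) (auto simp: field_simps)
 finally show ?thesis using eq by (simp add: a_def x_def)
qed

text \<open>In the induction over the coordinates, the Taylor coefficients in one coordinate are the functions expanded in the next one.\<close>
lemma taylor_coefficient_holomorphic:
 fixes H :: "complex => complex => complex"
 assumes S: "open S" and r: "0 < r"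
  and h1: "!!u. u \<in> ball 0 r ==> (%w. H w u) holomorphic_on S"
  and h2: "!!w. w \<in> S ==> H w holomorphic_on ball 0 r"
  and B: "!!w u. w \<in> S ==> u \<in> ball 0 r ==> cmod (H w u) <= B"
 shows "(%w. (deriv ^^ k) (H w) 0 / fact k) holomorphic_on S"
proof (induction k rule: less_induct)
 case (less k)
 define a where "a = (%n w. (deriv ^^ n) (H w) 0 / fact n)"
 define rho where "rho = r / 2"
 have rho: "0 < rho" "rho < r" using r by (auto simp: rho_def)
 define v where "v = (%l::nat. rho / 2 / real (Suc l))"
 have v: "0 < v l" "v l <= rho / 2" for l using rho by (auto simp: v_def field_simps)
 define g where "g = (%l w. (H w (of_real (v l)) - (\<Sum>n<k. a n w * of_real (v l) ^ n)) / of_real (v l) ^ k)"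
 have v0: "v \<longlonglongrightarrow> 0" unfolding v_def by real_asymp
 have err: "cmod (g l w - a k w) <= 2 * B / rho ^ Suc k * v l" if w: "w \<in> S" for l w
 proof -
  define N where "N = H w (of_real (v l)) - (\<Sum>n<Suc k. a n w * of_real (v l) ^ n)"
  have 1: "cmod N <= 2 * B * (cmod (of_real (v l)) / rho) ^ Suc k"
   unfolding N_def a_def by (rule taylor_remainder_bound[OF h2[OF w] B[OF w] rho]) (use v[of l] in auto)
  have "g l w - a k w = N / of_real (v l) ^ k"
   using v[of l] by (simp add: g_def N_def field_simps)
  then have "cmod (g l w - a k w) = cmod N / v l ^ k"
   using v[of l] by (simp add: norm_divide norm_power)
  also have "... <= 2 * B * (cmod (of_real (v l)) / rho) ^ Suc k / v l ^ k"
   using v[of l] by (intro divide_right_mono 1) auto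
  also have "... = 2 * B * (v l / rho) ^ Suc k / v l ^ k" using v[of l] by simp
  also have "... = 2 * B / rho ^ Suc k * v l" using v[of l] rho by (simp add: field_simps power_divide)
  finally show ?thesis .
 qed
 have "a k holomorphic_on S"
 proof (rule holomorphic_uniform_sequence[OF S, of g])
  show "g l holomorphic_on S" for l
   unfolding g_def using less v[of l] rho by (intro holomorphic_intros h1) (auto simp: a_def)
  fix x assume "x \<in> S"
  then obtain d where d: "d > 0" "cball x d \<subseteq> S" using S open_contains_cball by blast
  have "uniform_limit (cball x d) g (a k) sequentially"
  proof (rule uniform_limitI)
   fix e :: real assume e: "e > 0"
   have "(%l. 2 * B / rho ^ Suc k * v l) \<longlonglongrightarrow> 2 * B / rho ^ Suc k * 0" by (intro tendsto_intros v0)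
   then have "\<forall>\<^sub>F l in sequentially. 2 * B / rho ^ Suc k * v l < e" using e by (intro order_tendstoD) auto
   then show "\<forall>\<^sub>F l in sequentially. \<forall>w\<in>cball x d. dist (g l w) (a k w) < e"
    by eventually_elim (use err d in \<open>auto simp: dist_norm intro: le_less_trans\<close>)
  qed
  then show "\<exists>d>0. cball x d \<subseteq> S \<and> uniform_limit (cball x d) g (a k) sequentially" using d by blast
 qed
 then show ?case by (simp add: a_def)
qed

definition vupd :: "'a^'d => 'd => 'a => 'a^'d" where
 "vupd z j w = (\<chi> i. if i = j then w else z $ i)"

lemma vupd_nth [simp]: "vupd z j w $ i = (if i = j then w else z $ i)"
 by (simp add: vupd_def)

lemma vupd_same [simp]: "vupd z j (z $ j) = z"
 by (simp add: vec_eq_iff)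

lemma vupd_vupd_same [simp]: "vupd (vupd z j a) j b = vupd z j b"
 by (simp add: vec_eq_iff)

definition supp_on :: "'d set => (nat^'d) set" where
 "supp_on J = {beta. \<forall>j. j \<notin> J --> beta $ j = 0}"

lemma bij_betw_supp_on_insert:
 assumes "i \<notin> J"
 shows "bij_betw (%(beta, k). vupd beta i k) (supp_on J \<times> UNIV) (supp_on (insert i J))"
 by (rule bij_betw_byWitness[of _ "%beta. (vupd beta i 0, beta $ i)"])
   (use assms in \<open>auto simp: supp_on_def vec_eq_iff\<close>)

lemma prod_vupd_supp:
 fixes x :: "'d::finite => 'a::comm_monoid_mult"
 assumes "i \<notin> J" "beta \<in> supp_on J"
 shows "(\<Prod>j\<in>UNIV. x j ^ (vupd beta i k $ j)) = (\<Prod>j\<in>UNIV. x j ^ (beta $ j)) * x i ^ k"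
proof -
 have "(\<Prod>j\<in>UNIV. x j ^ (vupd beta i k $ j)) = x i ^ k * (\<Prod>j\<in>UNIV - {i}. x j ^ (vupd beta i k $ j))"
  by (subst prod.remove[of _ i]) auto
 also have "(\<Prod>j\<in>UNIV - {i}. x j ^ (vupd beta i k $ j)) = (\<Prod>j\<in>UNIV - {i}. x j ^ (beta $ j))"
  by (intro prod.cong) auto
 also have "... = (\<Prod>j\<in>UNIV. x j ^ (beta $ j))"
  using assms by (subst (2) prod.remove[of _ i]) (auto simp: supp_on_def)
 finally show ?thesis by (simp add: mult.commute)
qed

lemma mono_eval_vupd_supp:
 assumes "i \<notin> J" "beta \<in> supp_on J"
 shows "mono_eval (vupd beta i k) z = mono_eval beta z * z $ i ^ k"
 unfolding mono_eval_def by (rule prod_vupd_supp[OF assms])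

lemma sum_vupd_supp:
 assumes "i \<notin> J" "beta \<in> supp_on J"
 shows "(\<Sum>j\<in>UNIV. vupd beta i k $ j) = (\<Sum>j\<in>UNIV. beta $ j) + (k::nat)"
proof -
 have "(\<Sum>j\<in>UNIV. vupd beta i k $ j) = k + (\<Sum>j\<in>UNIV - {i}. vupd beta i k $ j)"
  by (subst sum.remove[of _ i]) auto
 also have "(\<Sum>j\<in>UNIV - {i}. vupd beta i k $ j) = (\<Sum>j\<in>UNIV - {i}. beta $ j)"
  by (intro sum.cong) auto
 also have "... = (\<Sum>j\<in>UNIV. beta $ j)"
  using assms by (subst (2) sum.remove[of _ i]) (auto simp: supp_on_def)
 finally show ?thesis by simp
qed

lemma multi_geometric_summable:
 fixes x :: "'d::finite => real"
 assumes x: "!!j. 0 <= x j" "!!j. x j < 1"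
 shows "(%beta::nat^'d. \<Prod>j\<in>UNIV. x j ^ (beta $ j)) summable_on UNIV"
proof -
 have "(%beta::nat^'d. \<Prod>j\<in>UNIV. x j ^ (beta $ j)) summable_on supp_on J" for J :: "'d set"
 proof (induction J rule: finite_induct[OF finite])
  case 1
  have "supp_on ({} :: 'd set) = {0}" by (auto simp: supp_on_def vec_eq_iff)
  then show ?case by simp
 next
  case (2 i J)
  obtain G where g: "((%k. x i ^ k) has_sum G) UNIV"
   using x[of i] sums_nonneg_imp_has_sum[OF geometric_sums[of "x i"]] by auto
  have "(%(beta, k). (\<Prod>j\<in>UNIV. x j ^ (beta $ j)) * x i ^ k) summable_on supp_on J \<times> UNIV"
   by (rule summable_on_SigmaI[where g = "%beta. (\<Prod>j\<in>UNIV. x j ^ (beta $ j)) * G"])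
     (use 2 x in \<open>auto intro!: has_sum_cmult_right g summable_on_cmult_left mult_nonneg_nonneg prod_nonneg\<close>)
  then have "(%(beta, k). \<Prod>j\<in>UNIV. x j ^ (vupd beta i k $ j)) summable_on supp_on J \<times> UNIV"
   by (rule summable_on_cong[THEN iffD1, rotated]) (auto simp: prod_vupd_supp[OF 2(2)] simp del: vupd_nth)
  then show ?case
   using summable_on_reindex_bij_betw[OF bij_betw_supp_on_insert[OF 2(2)], of "%beta. \<Prod>j\<in>UNIV. x j ^ (beta $ j)"]
   by (simp add: case_prod_unfold del: vupd_nth)
 qed
 from this[of UNIV] show ?thesis by (simp add: supp_on_def)
qed

lemma monomial_bound_summable:
 assumes r: "0 < r" and z: "!!j. cmod (z $ j) < r"
 shows "(%beta::nat^'d. B / r ^ (\<Sum>j\<in>UNIV. beta $ j) * cmod (mono_eval beta z)) summable_on UNIV"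
proof -
 have "(%beta::nat^'d. B * (\<Prod>j\<in>UNIV. (cmod (z $ j) / r) ^ (beta $ j))) summable_on UNIV"
  by (intro summable_on_cmult_right multi_geometric_summable) (use r z in auto)
 then show ?thesis
  by (simp add: mono_eval_def power_sum power_divide prod_dividef norm_power flip: prod_norm)
qed

text \<open>Induction over the set of coordinates in which the expansion has been carried out. Cauchy's estimate bounds each new coefficient by a power of the radius, which keeps the family absolutely summable on the smaller polydisc.\<close>
theorem separately_holomorphic_power_series:
 fixes F :: "complex^'d => complex"
 assumes r: "0 < r'" "r' < r"
  and FB: "!!z. (!!j. cmod (z $ j) < r) ==> cmod (F z) <= B"
  and Fh: "!!z j. (!!j. cmod (z $ j) < r) ==> (%w. F (vupd z j w)) holomorphic_on ball 0 r"
 obtains b where "!!beta. cmod (b beta) <= B / r' ^ (\<Sum>j\<in>UNIV. beta $ j)"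
  "!!z. (!!j. cmod (z $ j) < r') ==> ((%beta. b beta * mono_eval beta z) has_sum F z) UNIV"
proof -
 define D where "D = {z::complex^'d. \<forall>j. cmod (z $ j) < r}"
 have Dupd: "vupd z i w \<in> D" if "z \<in> D" "w \<in> ball 0 r" for z i w using that by (auto simp: D_def)
 have "\<exists>c. (\<forall>beta\<in>supp_on J. \<forall>z\<in>D. cmod (c beta z) <= B / r' ^ (\<Sum>j\<in>UNIV. beta $ j)) \<and>
    (\<forall>beta\<in>supp_on J. \<forall>z\<in>D. \<forall>j. (%w. c beta (vupd z j w)) holomorphic_on ball 0 r) \<and>
    (\<forall>beta. \<forall>z z'. (\<forall>j. j \<notin> J --> z $ j = z' $ j) --> c beta z = c beta z') \<and>
    (\<forall>z. (\<forall>j. cmod (z $ j) < r') --> ((%beta. c beta z * mono_eval beta z) has_sum F z) (supp_on J))"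
  for J :: "'d set"
 proof (induction J rule: finite_induct[OF finite])
  case 1
  have s0: "supp_on ({} :: 'd set) = {0}" by (auto simp: supp_on_def vec_eq_iff)
  show ?case
   using FB Fh by (intro exI[of _ "%_. F"]) (auto simp: s0 D_def mono_eval_def has_sum_finite_iff simp flip: vec_eq_iff)
 next
  case (2 i J)
  from 2(3) obtain c where c1: "\<forall>beta\<in>supp_on J. \<forall>z\<in>D. cmod (c beta z) <= B / r' ^ (\<Sum>j\<in>UNIV. beta $ j)"
    and c2: "\<forall>beta\<in>supp_on J. \<forall>z\<in>D. \<forall>j. (%w. c beta (vupd z j w)) holomorphic_on ball 0 r"
    and c3: "\<forall>beta. \<forall>z z'. (\<forall>j. j \<notin> J --> z $ j = z' $ j) --> c beta z = c beta z'"
    and c4: "\<forall>z. (\<forall>j. cmod (z $ j) < r') --> ((%beta. c beta z * mono_eval beta z) has_sum F z) (supp_on J)"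
   by (elim exE conjE) (rule that)
  note c = c1[rule_format] c2[rule_format] c3[rule_format] c4[rule_format]
  define c' where "c' = (%beta z. (deriv ^^ (beta $ i)) (%u. c (vupd beta i 0) (vupd z i u)) 0 / fact (beta $ i))"
  have sub: "vupd beta i 0 \<in> supp_on J" if "beta \<in> supp_on (insert i J)" for beta using that by (auto simp: supp_on_def)
  have c'1: "cmod (c' beta z) <= B / r' ^ (\<Sum>j\<in>UNIV. beta $ j)" if b: "beta \<in> supp_on (insert i J)" and z: "z \<in> D" for beta z
  proof -
   let ?beta = "vupd beta i 0"
   have "cmod (c' beta z) <= (B / r' ^ (\<Sum>j\<in>UNIV. ?beta $ j)) / r' ^ (beta $ i)"
    unfolding c'_def by (rule cauchy_coefficient_bound[OF c(2)[OF sub[OF b] z] c(1)[OF sub[OF b] Dupd[OF z]]]) (use r in auto)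
   also have "... = B / r' ^ (\<Sum>j\<in>UNIV. beta $ j)"
    using sum_vupd_supp[OF 2(2) sub[OF b], of "beta $ i"] by (simp add: power_add)
   finally show ?thesis .
  qed
  have c'3: "c' beta z = c' beta z'" if "!!j. j \<notin> insert i J ==> z $ j = z' $ j" for beta z z'
  proof -
   have "c (vupd beta i 0) (vupd z i u) = c (vupd beta i 0) (vupd z' i u)" for u
    by (rule c(3)) (use that in auto)
   then show ?thesis by (simp add: c'_def)
  qed
  have c'2: "(%w. c' beta (vupd z j w)) holomorphic_on ball 0 r"
   if b: "beta \<in> supp_on (insert i J)" and z: "z \<in> D" for beta z j
  proof (cases "j = i")
   case True
   have "c' beta (vupd z j w) = c' beta z" for w by (rule c'3) (use True in auto)
   then show ?thesis by simp
  next
   case False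
   have sw: "vupd (vupd z j w) i u = vupd (vupd z i u) j w" for w u using False by (auto simp: vec_eq_iff)
   show ?thesis unfolding c'_def
   proof (rule taylor_coefficient_holomorphic)
    show "(%w. c (vupd beta i 0) (vupd (vupd z j w) i u)) holomorphic_on ball 0 r" if "u \<in> ball 0 r" for u
     unfolding sw by (rule c(2)[OF sub[OF b] Dupd[OF z that]])
    show "(%u. c (vupd beta i 0) (vupd (vupd z j w) i u)) holomorphic_on ball 0 r" if "w \<in> ball 0 r" for w
     by (rule c(2)[OF sub[OF b] Dupd[OF z that]])
    show "cmod (c (vupd beta i 0) (vupd (vupd z j w) i u)) <= B / r' ^ (\<Sum>j\<in>UNIV. vupd beta i 0 $ j)"
     if "w \<in> ball 0 r" "u \<in> ball 0 r" for w u
     by (rule c(1)[OF sub[OF b]]) (use that z Dupd in auto)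
   qed (use r in auto)
  qed
  have c'4: "((%beta. c' beta z * mono_eval beta z) has_sum F z) (supp_on (insert i J))"
   if z: "!!j. cmod (z $ j) < r'" for z
  proof -
   have zD: "z \<in> D" using z r by (auto simp: D_def intro: less_trans)
   have B0: "B >= 0" using FB[of 0] r norm_ge_zero[of "F 0"] by (simp add: order_trans[of 0 "cmod (F 0)"])
   have abs: "(%beta. c' beta z * mono_eval beta z) summable_on supp_on (insert i J)"
   proof (rule abs_summable_summable, rule summable_on_comparison_test)
    show "(%beta::nat^'d. B / r' ^ (\<Sum>j\<in>UNIV. beta $ j) * cmod (mono_eval beta z)) summable_on supp_on (insert i J)"
     using summable_on_subset_banach[OF monomial_bound_summable[OF r(1) z]] by blast
    fix beta assume b: "beta \<in> supp_on (insert i J)"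
    show "norm (c' beta z * mono_eval beta z) <= B / r' ^ (\<Sum>j\<in>UNIV. beta $ j) * cmod (mono_eval beta z)"
     unfolding norm_mult by (rule mult_right_mono[OF c'1[OF b zD]]) simp
   qed simp
   have abs2: "(%(beta, k). c' (vupd beta i k) z * mono_eval (vupd beta i k) z) summable_on supp_on J \<times> UNIV"
    using abs summable_on_reindex_bij_betw[OF bij_betw_supp_on_insert[OF 2(2)], of "%beta. c' beta z * mono_eval beta z"]
    by (simp add: case_prod_unfold)
   have inner: "((%k. c' (vupd beta i k) z * mono_eval (vupd beta i k) z) has_sum (c beta z * mono_eval beta z)) UNIV"
    if b: "beta \<in> supp_on J" for beta
   proof -
    have b0: "vupd beta i 0 = beta" using b 2(2) by (auto simp: supp_on_def vec_eq_iff)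
    have c'v: "c' (vupd beta i k) z = (deriv ^^ k) (%u. c beta (vupd z i u)) 0 / fact k" for k
     by (simp add: c'_def b0)
    have "(%k. (deriv ^^ k) (%u. c beta (vupd z i u)) 0 / fact k * (z $ i - 0) ^ k) sums c beta (vupd z i (z $ i))"
     by (rule holomorphic_power_series[OF c(2)[OF b zD]]) (use zD in \<open>auto simp: D_def\<close>)
    then have s: "(%k. c' (vupd beta i k) z * mono_eval (vupd beta i k) z) sums (c beta z * mono_eval beta z)"
     unfolding c'v mono_eval_vupd_supp[OF 2(2) b]
     using sums_mult[of _ _ "mono_eval beta z"] by (fastforce simp: mult_ac)
    have "(%k. c' (vupd beta i k) z * mono_eval (vupd beta i k) z) summable_on UNIV"
     using summable_on_SigmaD1[OF abs2 b] by simp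
    then show ?thesis using s by (metis has_sum_imp_sums has_sum_infsum sums_unique2)
   qed
   have "((%(beta, k). c' (vupd beta i k) z * mono_eval (vupd beta i k) z) has_sum F z) (supp_on J \<times> UNIV)"
    by (rule has_sum_SigmaI[OF _ c(4)[OF z] abs2]) (use inner in auto)
   then show ?thesis
    using has_sum_reindex_bij_betw[OF bij_betw_supp_on_insert[OF 2(2)], of "%beta. c' beta z * mono_eval beta z" "F z"]
    by (simp add: case_prod_unfold)
  qed
  show ?case by (rule exI[of _ c']) (use c'1 c'2 c'3 c'4 in blast)
 qed
 from this[of UNIV] obtain c where c1: "\<forall>beta\<in>supp_on UNIV. \<forall>z\<in>D. cmod (c beta z) <= B / r' ^ (\<Sum>j\<in>UNIV. beta $ j)"
   and c3: "\<forall>beta. \<forall>z z'. (\<forall>j. j \<notin> UNIV --> z $ j = z' $ j) --> c beta z = c beta z'"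
   and c4: "\<forall>z. (\<forall>j. cmod (z $ j) < r') --> ((%beta. c beta z * mono_eval beta z) has_sum F z) (supp_on UNIV)"
  by (elim exE conjE) (rule that)
 have U: "supp_on UNIV = UNIV" by (auto simp: supp_on_def)
 have c: "!!beta z. z \<in> D ==> cmod (c beta z) <= B / r' ^ (\<Sum>j\<in>UNIV. beta $ j)"
    "!!beta z z'. c beta z = c beta z'"
    "!!z. (!!j. cmod (z $ j) < r') ==> ((%beta. c beta z * mono_eval beta z) has_sum F z) UNIV"
  using c1 c3 c4 unfolding U by blast+
 have "0 \<in> D" using r by (simp add: D_def)
 show thesis
 proof (rule that[of "%beta. c beta 0"])
  show "cmod (c beta 0) <= B / r' ^ (\<Sum>j\<in>UNIV. beta $ j)" for beta using c(1) \<open>0 \<in> D\<close> .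
  show "((%beta. c beta 0 * mono_eval beta z) has_sum F z) UNIV" if "!!j. cmod (z $ j) < r'" for z
  proof -
   have e: "c beta 0 = c beta z" for beta by (rule c(2))
   show ?thesis unfolding e by (rule c(3)[OF that])
  qed
 qed
qed

lemma holomorphic_vec_on_line:
 assumes U: "open U" "holomorphic_vec_on F U" and S: "!!w. w \<in> S ==> a + w *s v \<in> U"
 shows "(%w. F (a + w *s v)) holomorphic_on S"
 unfolding holomorphic_on_def
proof
 fix w assume w: "w \<in> S"
 obtain c where "(F has_derivative (%h. \<Sum>j\<in>UNIV. c $ j * h $ j)) (at (a + w *s v) within U)"
  using U(2) S[OF w] by (auto simp: holomorphic_vec_on_def)
 then have F: "(F has_derivative (%h. \<Sum>j\<in>UNIV. c $ j * h $ j)) (at (a + w *s v))"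
  using at_within_open[OF S[OF w] U(1)] by simp
 have "linear (%h::complex. h *s v)"
  by (auto intro!: linearI simp: vec_eq_iff algebra_simps)
 then have "bounded_linear (%h::complex. h *s v)" by (simp add: linear_conv_bounded_linear)
 then have "((%w. w *s v) has_derivative (%h. h *s v)) (at w)" by (rule bounded_linear_imp_has_derivative)
 then have g: "((%w. a + w *s v) has_derivative (%h. h *s v)) (at w)"
  using has_derivative_add[OF has_derivative_const[of a "at w"]] by fastforce
 have "((%w. F (a + w *s v)) has_derivative (%h. \<Sum>j\<in>UNIV. c $ j * (h *s v) $ j)) (at w)"
  using diff_chain_at[OF g F] by (simp add: o_def)
 also have "(%h. \<Sum>j\<in>UNIV. c $ j * (h *s v) $ j) = (*) (\<Sum>j\<in>UNIV. c $ j * v $ j)"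
  by (auto simp: sum_distrib_right sum_distrib_left mult_ac intro!: sum.cong ext)
 finally have "((%w. F (a + w *s v)) has_field_derivative (\<Sum>j\<in>UNIV. c $ j * v $ j)) (at w)"
  by (simp add: has_field_derivative_def)
 then show "(%w. F (a + w *s v)) field_differentiable at w within S"
  by (meson field_differentiable_at_within field_differentiable_def)
qed

lemma vupd_line: "vupd z j w = vupd z j 0 + w *s axis j (1::'a::semiring_1)"
 by (simp add: vec_eq_iff axis_def)

lemma norm_le_of_components:
 fixes z :: "complex^'d"
 assumes "!!j. cmod (z $ j) <= e"
 shows "norm z <= real CARD('d) * e"
proof -
 have "norm z <= (\<Sum>j\<in>UNIV. cmod (z $ j))" unfolding norm_vec_def by (rule L2_set_le_sum) simp
 also have "... <= (\<Sum>j\<in>(UNIV :: 'd set). e)" by (intro sum_mono assms)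
 finally show ?thesis by simp
qed

lemma holomorphic_vec_polydisc:
 fixes F :: "complex^'d => complex"
 assumes U: "open U" "holomorphic_vec_on F U" "a \<in> U"
 obtains r B where "r > 0" "B >= 0" "!!z. (!!j. cmod (z $ j - a $ j) <= r) ==> z \<in> U"
  "!!z. (!!j. cmod (z $ j - a $ j) <= r) ==> cmod (F z) <= B"
proof -
 obtain e where e: "e > 0" "cball a e \<subseteq> U" using U open_contains_cball by blast
 have "F differentiable (at z within U)" if "z \<in> U" for z
  using U(2) that unfolding holomorphic_vec_on_def differentiable_def by blast
 then have "continuous_on U F"
  by (simp add: continuous_on_eq_continuous_within differentiable_imp_continuous_within)
 then have "compact (F ` cball a e)"
  by (intro compact_continuous_image continuous_on_subset[OF _ e(2)] compact_cball)
 then obtain B where B: "!!z. z \<in> cball a e ==> cmod (F z) <= B"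
  using compact_imp_bounded[of "F ` cball a e"] unfolding bounded_iff by blast
 define r where "r = e / real CARD('d)"
 have r: "r > 0" using e by (simp add: r_def)
 have "z \<in> cball a e" if "!!j. cmod (z $ j - a $ j) <= r" for z
  using norm_le_of_components[of "z - a" r] that by (simp add: r_def dist_norm norm_minus_commute)
 moreover have "B >= 0" using B[of a] e norm_ge_zero[of "F a"] by (simp add: order_trans[of 0 "cmod (F a)"])
 ultimately show thesis using r e B by (intro that[of r B]) auto
qed

theorem holomorphic_vec_power_series:
 fixes F :: "complex^'d => complex"
 assumes U: "open U" "holomorphic_vec_on F U" "0 \<in> U"
 obtains r B b where "0 < r" "r <= 1" "B >= 0" "!!z. (!!j. cmod (z $ j) < r) ==> z \<in> U"
  "!!beta. cmod (b beta) <= B / r ^ (\<Sum>j\<in>UNIV. beta $ j)"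
  "!!z. (!!j. cmod (z $ j) < r) ==> ((%beta. b beta * mono_eval beta z) has_sum F z) UNIV"
proof -
 obtain r0 B where r0: "r0 > 0" "B >= 0" "!!z. (!!j. cmod (z $ j) <= r0) ==> z \<in> U"
  "!!z. (!!j. cmod (z $ j) <= r0) ==> cmod (F z) <= B"
  using holomorphic_vec_polydisc[OF U] by auto
 define r where "r = min (r0 / 2) 1"
 have r: "0 < r" "r < r0" "r <= 1" using r0(1) by (auto simp: r_def min_def)
 have h: "(%w. F (vupd z j w)) holomorphic_on ball 0 r0" if "!!j. cmod (z $ j) < r0" for z j
 proof -
  have eq: "(%w. F (vupd z j w)) = (%w. F (vupd z j 0 + w *s axis j 1))"
   by (rule ext, rule arg_cong[OF vupd_line])
  show ?thesis unfolding eq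
  proof (rule holomorphic_vec_on_line[OF U(1,2)])
   fix w :: complex assume w: "w \<in> ball 0 r0"
   have "vupd z j w \<in> U"
   proof (rule r0(3))
    fix i show "cmod (vupd z j w $ i) <= r0"
     using that[of i] w by (cases "i = j") auto
   qed
   moreover have "vupd z j w = vupd z j 0 + w *s axis j 1" by (rule vupd_line)
   ultimately show "vupd z j 0 + w *s axis j 1 \<in> U" by metis
  qed
 qed
 obtain b where "!!beta. cmod (b beta) <= B / r ^ (\<Sum>j\<in>UNIV. beta $ j)"
  "!!z. (!!j. cmod (z $ j) < r) ==> ((%beta. b beta * mono_eval beta z) has_sum F z) UNIV"
  by (rule separately_holomorphic_power_series[OF r(1,2) r0(4) h]) (auto intro: less_imp_le)
 moreover have "z \<in> U" if "!!j. cmod (z $ j) < r" for z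
  by (rule r0(3)) (use that r in \<open>meson less_imp_le less_trans\<close>)
 ultimately show thesis using r r0(2) by (intro that[of r B b]) auto
qed

lemma power_series_zero_on_interval:
 fixes a :: "nat => complex"
 assumes r: "0 < r" and s: "!!x::real. 0 < x ==> x < r ==> (%k. a k * of_real x ^ k) sums 0"
 shows "a k = 0"
proof -
 define f where "f = (%z. suminf (%k. a k * z ^ k))"
 have sm: "(%k. a k * z ^ k) sums f z" if z: "cmod z < r" for z
 proof -
  obtain x where x: "cmod z < x" "x < r" using z dense by blast
  then have "0 < x" using norm_ge_zero[of z] by linarith
  have "summable (%k. a k * of_real x ^ k)" using s[OF \<open>0 < x\<close> x(2)] by (simp add: sums_iff)
  then have "summable (%k. a k * z ^ k)" by (rule powser_inside) (use x \<open>0 < x\<close> in auto)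
  then show ?thesis by (simp add: f_def summable_sums)
 qed
 have fx: "f (of_real x) = 0" if "0 < x" "x < r" for x
  using sm[of "of_real x"] s[OF that] that sums_unique2 by fastforce
 have f0: "f 0 = a 0" using sm[of 0] r by (simp add: f_def)
 have "isCont f 0"
  unfolding f_def
  by (rule isCont_powser[of _ "of_real (r / 2)"]) (use s[of "r / 2"] r in \<open>auto simp: sums_iff\<close>)
 moreover have "(%n. complex_of_real (r / 2 / real (Suc n))) \<longlonglongrightarrow> of_real 0"
  by (intro tendsto_of_real LIMSEQ_Suc[OF lim_const_over_n])
 ultimately have "((%n. f (of_real (r / 2 / real (Suc n)))) \<longlongrightarrow> f 0) sequentially"
  using isCont_tendsto_compose[of 0 f] by simp
 moreover have "f (of_real (r / 2 / real (Suc n))) = 0" for n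
  by (rule fx) (use r in \<open>auto simp: field_simps intro!: add_pos_nonneg\<close>)
 ultimately have "f 0 = 0" by (simp add: LIMSEQ_const_iff)
 show ?thesis
 proof (rule ccontr)
  assume nz: "a k ~= 0"
  then have "k > 0" using f0 \<open>f 0 = 0\<close> by (cases k) auto
  obtain t where t: "0 < t" "!!z. z \<in> cball 0 t - {0} ==> f z ~= 0"
   by (rule powser_0_nonzero[of r 0 a f k]) (use sm r nz \<open>f 0 = 0\<close> \<open>k > 0\<close> in auto)
  have "f (of_real (min t (r / 2))) = 0" by (rule fx) (use r t in auto)
  moreover have "of_real (min t (r / 2)) \<in> cball 0 t - {0::complex}" using r t by auto
  ultimately show False using t(2) by blast
 qed
qed

lemma mono_eval_vupd_one:
 assumes "beta $ i = k"
 shows "mono_eval beta z = mono_eval beta (vupd z i 1) * z $ i ^ k"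
proof -
 have "mono_eval beta z = z $ i ^ k * (\<Prod>j\<in>UNIV - {i}. z $ j ^ (beta $ j))"
  unfolding mono_eval_def using assms by (subst prod.remove[of _ i]) auto
 moreover have "mono_eval beta (vupd z i 1) = (\<Prod>j\<in>UNIV - {i}. z $ j ^ (beta $ j))"
  unfolding mono_eval_def by (subst prod.remove[of _ i]) (auto intro!: prod.cong)
 ultimately show ?thesis by simp
qed

lemma complex_vec_nth [simp]: "complex_vec xi $ j = of_real (xi $ j)"
 by (simp add: complex_vec_def)

text \<open>Uniqueness already holds when the series vanishes at small positive real vectors.\<close>
theorem multi_power_series_unique:
 fixes c :: "nat^'d => complex"
 assumes r: "0 < r"
  and z: "!!xi::real^'d. (!!j. 0 < xi $ j \<and> xi $ j < r) ==> ((%beta. c beta * mono_eval beta (complex_vec xi)) has_sum 0) UNIV"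
 shows "c beta = 0"
proof -
 define T where "T = (%(J :: 'd set) gam. {beta :: nat^'d. \<forall>j. j \<notin> J --> beta $ j = gam $ j})"
 define Dp where "Dp = {xi::real^'d. \<forall>j. 0 < xi $ j \<and> xi $ j < r}"
 have "\<forall>gam. (\<forall>xi\<in>Dp. ((%beta. c beta * mono_eval beta (complex_vec xi)) has_sum 0) (T J gam)) --> (\<forall>beta\<in>T J gam. c beta = 0)" for J
 proof (induction J rule: finite_induct[OF finite])
  case 1
  show ?case
  proof (intro allI impI)
   fix gam assume a: "\<forall>xi\<in>Dp. ((%beta. c beta * mono_eval beta (complex_vec xi)) has_sum 0) (T {} gam)"
   have T: "T {} gam = {gam}" by (auto simp: T_def vec_eq_iff)
   define xi where "xi = ((\<chi> j. r / 2) :: real^'d)"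
   have "xi \<in> Dp" using r by (simp add: Dp_def xi_def)
   then have "c gam * mono_eval gam (complex_vec xi) = 0" using a T by (auto simp: has_sum_finite_iff)
   moreover have "mono_eval gam (complex_vec xi) ~= 0" using r by (simp add: mono_eval_def xi_def)
   ultimately show "\<forall>beta\<in>T {} gam. c beta = 0" by (simp add: T)
  qed
 next
  case (2 i J)
  show ?case
  proof (intro allI impI ballI)
   fix gam beta0 assume a: "\<forall>xi\<in>Dp. ((%beta. c beta * mono_eval beta (complex_vec xi)) has_sum 0) (T (insert i J) gam)"
    and b0: "beta0 \<in> T (insert i J) gam"
   define Tk where "Tk = (%k. T J (vupd gam i k))"
   have Tk: "beta \<in> Tk k \<longleftrightarrow> beta \<in> T (insert i J) gam \<and> beta $ i = k" for beta k
    using 2(2) by (auto simp: Tk_def T_def)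
   have bij: "bij_betw snd (Sigma UNIV Tk) (T (insert i J) gam)"
    by (rule bij_betw_byWitness[of _ "%beta. (beta $ i, beta)"]) (auto simp: Tk)
   define s where "s = (%xi k. infsum (%beta. c beta * mono_eval beta (complex_vec xi)) (Tk k))"
   have inner: "((%beta. c beta * mono_eval beta (complex_vec xi)) has_sum s xi k) (Tk k)"
    and outer: "(s xi has_sum 0) UNIV" if xi: "xi \<in> Dp" for xi k
   proof -
    have sig: "((%x. c (snd x) * mono_eval (snd x) (complex_vec xi)) has_sum 0) (Sigma UNIV Tk)"
     using a xi has_sum_reindex_bij_betw[OF bij, of "%beta. c beta * mono_eval beta (complex_vec xi)" 0] by simp
    then have "(%(k, beta). c beta * mono_eval beta (complex_vec xi)) summable_on (Sigma UNIV Tk)"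
     by (auto simp: case_prod_unfold summable_on_def)
    from summable_on_SigmaD1[OF this]
    show in1: "((%beta. c beta * mono_eval beta (complex_vec xi)) has_sum s xi k) (Tk k)" for k
     unfolding s_def by (intro has_sum_infsum) auto
    show "(s xi has_sum 0) UNIV"
     by (rule has_sum_SigmaD[OF sig]) (use in1 in auto)
   qed
   have s0: "s xi k = 0" if xi: "xi \<in> Dp" for xi k
   proof -
    define a where "a = (%k. infsum (%beta. c beta * mono_eval beta (vupd (complex_vec xi) i 1)) (Tk k))"
    have sa: "s (vupd xi i x) k = a k * of_real x ^ k" for x k
    proof -
     have "mono_eval beta (complex_vec (vupd xi i x)) = mono_eval beta (vupd (complex_vec xi) i 1) * of_real x ^ k"
      if "beta \<in> Tk k" for beta
     proof -
      have "vupd (complex_vec (vupd xi i x)) i 1 = vupd (complex_vec xi) i 1" by (simp add: vec_eq_iff)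
      then show ?thesis using mono_eval_vupd_one[of beta i k "complex_vec (vupd xi i x)"] that by (simp add: Tk)
     qed
     then have "s (vupd xi i x) k = infsum (%beta. (c beta * mono_eval beta (vupd (complex_vec xi) i 1)) * of_real x ^ k) (Tk k)"
      unfolding s_def by (intro infsum_cong) simp
     then show ?thesis by (simp add: a_def infsum_cmult_left')
    qed
    have "(%k. a k * of_real x ^ k) sums 0" if "0 < x" "x < r" for x
    proof -
     have "vupd xi i x \<in> Dp" using xi that by (auto simp: Dp_def)
     from outer[OF this] show ?thesis unfolding sa by (rule has_sum_imp_sums)
    qed
    from power_series_zero_on_interval[OF r this] have "a k = 0" by blast
    then show ?thesis using sa[of "xi $ i" k] by simp
   qed
   have "\<forall>beta\<in>Tk k. c beta = 0" for k
    using 2(3) inner s0 unfolding Tk_def by metis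
   then show "c beta0 = 0" using b0 Tk by blast
  qed
 qed
 from this[of UNIV] have "(\<forall>xi\<in>Dp. ((%beta. c beta * mono_eval beta (complex_vec xi)) has_sum 0) (T UNIV 0)) --> (\<forall>beta\<in>T UNIV 0. c beta = 0)"
  by blast
 moreover have "T UNIV 0 = UNIV" by (auto simp: T_def)
 ultimately show ?thesis using z by (simp add: Dp_def)
qed

lemma maclaurin_coeff_eqI:
 fixes F :: "complex^'d => complex"
 assumes r: "0 < r"
  and s: "!!z. (!!j. cmod (z $ j) < r) ==> ((%beta. b beta * mono_eval beta z) has_sum F z) UNIV"
 shows "maclaurin_coeff F = b"
 unfolding maclaurin_coeff_def
proof (rule the_equality)
 have "((%beta. b beta * mono_eval beta z) has_sum F z) UNIV" if "z \<in> ball 0 r" for z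
  by (rule s) (use that Finite_Cartesian_Product.norm_nth_le[of z] in \<open>auto intro: le_less_trans\<close>)
 then show "\<forall>\<^sub>F z in nhds 0. ((%beta. b beta * mono_eval beta z) has_sum F z) UNIV"
  using eventually_nhds_ball[OF r, of "0::complex^'d"] by (rule eventually_mono[rotated]) auto
next
 fix b' assume "\<forall>\<^sub>F z in nhds 0. ((%beta. b' beta * mono_eval beta z) has_sum F z) UNIV"
 then obtain e where e: "e > 0" "!!z. dist z 0 < e ==> ((%beta. b' beta * mono_eval beta z) has_sum F z) UNIV"
  unfolding eventually_nhds_metric by blast
 define rho where "rho = min r (e / (2 * real CARD('d)))"
 have rho: "rho > 0" using r e by (simp add: rho_def)
 have "b' beta - b beta = 0" for beta
 proof (rule multi_power_series_unique[OF rho, of "%beta. b' beta - b beta"])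
  fix xi :: "real^'d" assume xi: "!!j. 0 < xi $ j \<and> xi $ j < rho"
  have c: "cmod (complex_vec xi $ j) < rho" for j using xi[of j] by simp
  have "norm (complex_vec xi) <= real CARD('d) * (e / (2 * real CARD('d)))"
   using c by (intro norm_le_of_components) (simp add: rho_def less_imp_le)
  then have "dist (complex_vec xi) 0 < e" using e by simp
  from e(2)[OF this] s[of "complex_vec xi"] c
  have "((%beta. b' beta * mono_eval beta (complex_vec xi) + - (b beta * mono_eval beta (complex_vec xi))) has_sum (F (complex_vec xi) + - F (complex_vec xi))) UNIV"
   by (intro has_sum_add has_sum_uminusI) (auto simp: rho_def)
  then show "((%beta. (b' beta - b beta) * mono_eval beta (complex_vec xi)) has_sum 0) UNIV"
   by (simp add: algebra_simps)
 qed
 then show "b' = b" by (simp add: fun_eq_iff)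
qed

section \<open>Fourier series on the torus\<close>

definition periodic :: "(real^'d => 'a) => bool" where
 "periodic f \<longleftrightarrow> (\<forall>xi l. f (xi + (2 * pi) *\<^sub>R real_vec l) = f xi)"

lemma periodicD: "periodic f ==> f (xi + (2 * pi) *\<^sub>R real_vec l) = f xi"
 by (simp add: periodic_def)

lemma real_vec_nth [simp]: "real_vec x $ j = real_of_int (x $ j)"
 by (simp add: real_vec_def)

lemma real_vec_simps: "real_vec (x - y) = real_vec x - real_vec y" "real_vec (x + y) = real_vec x + real_vec y"
 "real_vec (- x) = - real_vec x" "real_vec 0 = 0"
 by (simp_all add: vec_eq_iff)

lemma torus_representative:
 obtains l where "xi + (2 * pi) *\<^sub>R real_vec l \<in> torus"
proof (rule that[of "\<chi> j. - \<lceil>(xi $ j - pi) / (2 * pi)\<rceil>"])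
 have "- pi < xi $ j - 2 * pi * \<lceil>(xi $ j - pi) / (2 * pi)\<rceil> \<and> xi $ j - 2 * pi * \<lceil>(xi $ j - pi) / (2 * pi)\<rceil> <= pi" for j
 proof -
  define c where "c = \<lceil>(xi $ j - pi) / (2 * pi)\<rceil>"
  have "(xi $ j - pi) / (2 * pi) <= real_of_int c" "real_of_int c < (xi $ j - pi) / (2 * pi) + 1"
   unfolding c_def by linarith+
  then show ?thesis unfolding c_def[symmetric] by (simp add: field_simps)
 qed
 then show "xi + (2 * pi) *\<^sub>R real_vec (\<chi> j. - \<lceil>(xi $ j - pi) / (2 * pi)\<rceil>) \<in> torus"
  by (simp add: torus_def)
qed

lemma torus_measurable [measurable]: "torus \<in> sets borel"
 unfolding torus_def by measurable

lemma torus_subset_cbox: "torus \<subseteq> cbox (\<chi> j. - pi) (\<chi> j. pi)"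
 by (auto simp: torus_def mem_box_cart less_imp_le)

lemma emeasure_torus: "emeasure lborel (torus :: (real^'d) set) = ennreal ((2 * pi) ^ CARD('d))"
proof (rule antisym)
 have p: "(\<Prod>b\<in>Basis. ((\<chi> j. pi) - (\<chi> j. - pi) :: real^'d) \<bullet> b) = (2 * pi) ^ CARD('d)"
 proof -
  have "(\<Prod>b\<in>Basis. ((\<chi> j. pi) - (\<chi> j. - pi) :: real^'d) \<bullet> b) = (\<Prod>b\<in>(Basis::(real^'d) set). 2 * pi)"
   by (intro prod.cong) (auto simp: Basis_vec_def inner_axis)
  then show ?thesis by simp
 qed
 have le: "!!b. b \<in> Basis ==> ((\<chi> j. - pi) :: real^'d) \<bullet> b <= (\<chi> j. pi) \<bullet> b"
  by (auto simp: Basis_vec_def inner_axis)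
 have "emeasure lborel (torus :: (real^'d) set) <= emeasure lborel (cbox (\<chi> j. - pi) (\<chi> j. pi) :: (real^'d) set)"
  by (intro emeasure_mono torus_subset_cbox) auto
 also have "... = ennreal ((2 * pi) ^ CARD('d))" using emeasure_lborel_cbox[OF le] p by simp
 finally show "emeasure lborel (torus :: (real^'d) set) <= ennreal ((2 * pi) ^ CARD('d))" .
 have "ennreal ((2 * pi) ^ CARD('d)) = emeasure lborel (box (\<chi> j. - pi) (\<chi> j. pi) :: (real^'d) set)"
  using emeasure_lborel_box[OF le] p by simp
 also have "... <= emeasure lborel (torus :: (real^'d) set)"
  by (intro emeasure_mono) (auto simp: torus_def mem_box_cart less_imp_le)
 finally show "ennreal ((2 * pi) ^ CARD('d)) <= emeasure lborel (torus :: (real^'d) set)" .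
qed

lemma bounded_set_integrable:
 fixes f :: "real^'d => complex"
 assumes [measurable]: "S \<in> sets borel" "f \<in> borel_measurable borel" and S: "emeasure lborel S < \<infinity>"
  and B: "!!xi. xi \<in> S ==> cmod (f xi) <= B"
 shows "set_integrable lborel S f"
 unfolding set_integrable_def
 by (rule integrableI_bounded_set[of S _ _ B]) (use S B in \<open>auto simp: indicator_def\<close>)

lemma set_integral_norm_le:
 fixes f :: "real^'d => complex"
 assumes [measurable]: "S \<in> sets borel" "f \<in> borel_measurable borel" and S: "emeasure lborel S < \<infinity>"
  and B: "!!xi. xi \<in> S ==> cmod (f xi) <= B"
 shows "cmod (LINT xi:S|lborel. f xi) <= B * measure lborel S"
proof -
 have "cmod (LINT xi:S|lborel. f xi) <= (LINT xi|lborel. indicator S xi * B)"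
  unfolding set_lebesgue_integral_def
 proof (rule Bochner_Integration.integral_norm_bound_integral)
  show "integrable lborel (%xi. indicator S xi *\<^sub>R f xi)"
   using bounded_set_integrable[OF assms] by (simp add: set_integrable_def)
  show "integrable lborel (%xi. indicator S xi * B)" using S by simp
 qed (use B in \<open>auto simp: indicator_def\<close>)
 then show ?thesis by (simp add: mult.commute)
qed

lemma measure_torus: "measure lborel (torus :: (real^'d) set) = (2 * pi) ^ CARD('d)"
 using emeasure_torus[where 'd='d] by (simp add: measure_def)

abbreviation torus_integral :: "(real^'d => complex) => complex" where
 "torus_integral f \<equiv> (LINT xi:torus|lborel. f xi)"

lemma set_integral_shift:
 fixes f :: "real^'d => complex"
 assumes [measurable]: "S \<in> sets borel" "f \<in> borel_measurable borel"
 shows "(LINT xi:S|lborel. f (xi + h)) = (LINT xi:{xi. xi - h \<in> S}|lborel. f xi)"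
proof -
 have "(LINT xi|lborel. indicator {xi. xi - h \<in> S} (xi + h) *\<^sub>R f (xi + h)) = (LINT xi|lborel. indicator {xi. xi - h \<in> S} xi *\<^sub>R f xi)"
  by (rule lborel_integral_translate(1)[of "%xi. indicator {xi. xi - h \<in> S} xi *\<^sub>R f xi" h]) measurable
 then show ?thesis by (simp add: set_lebesgue_integral_def indicator_def)
qed

text \<open>The slab that leaves the torus on one side is a period translate of the slab that is missing on the other.\<close>
lemma torus_integral_shift_axis:
 fixes f :: "real^'d => complex"
 assumes [measurable]: "f \<in> borel_measurable borel" and per: "periodic f" and B: "!!xi. cmod (f xi) <= B"
  and s: "0 <= s" "s <= 2 * pi"
 shows "torus_integral (%xi. f (xi + axis j s)) = torus_integral f"
proof -
 let ?h = "axis j s :: real^'d" and ?p = "axis j (2 * pi) :: real^'d"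
 define X where "X = {xi \<in> (torus :: (real^'d) set). xi $ j > - pi + s}"
 define X' where "X' = {xi \<in> (torus :: (real^'d) set). xi $ j <= - pi + s}"
 define Y where "Y = {xi :: real^'d. xi - ?p \<in> X'}"
 have [measurable]: "X \<in> sets borel" "X' \<in> sets borel" unfolding X_def X'_def by measurable
 have [measurable]: "Y \<in> sets borel" unfolding Y_def by measurable
 have finX: "emeasure lborel X < \<infinity>" "emeasure lborel X' < \<infinity>"
  using emeasure_mono[of X torus lborel] emeasure_mono[of X' torus lborel]
  by (auto simp: X_def X'_def emeasure_torus intro: le_less_trans)
 have "Y \<subseteq> cbox (\<chi> j. - 4 * pi) (\<chi> j. 4 * pi)"
 proof
  fix xi assume "xi \<in> Y"
  then have "xi - ?p \<in> torus" by (auto simp: Y_def X'_def)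
  then have "- pi < xi $ i - ?p $ i \<and> xi $ i - ?p $ i <= pi" for i by (simp add: torus_def)
  moreover have "0 <= ?p $ i" "?p $ i <= 2 * pi" for i by (auto simp: axis_def)
  ultimately have "- 4 * pi <= xi $ i \<and> xi $ i <= 4 * pi" for i
   by (smt (verit) pi_gt_zero)
  then show "xi \<in> cbox (\<chi> j. - 4 * pi) (\<chi> j. 4 * pi)" by (simp add: mem_box_cart)
 qed
 then have finY: "emeasure lborel Y < \<infinity>"
  using bounded_cbox bounded_subset emeasure_bounded_finite by blast
 have Teq: "{xi. xi - ?h \<in> torus} = X \<union> Y"
 proof -
  have "xi - ?h \<in> torus \<longleftrightarrow> xi \<in> X \<or> xi \<in> Y" for xi
  proof -
   define R where "R \<longleftrightarrow> (\<forall>i. i ~= j --> - pi < xi $ i \<and> xi $ i <= pi)"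
   have 1: "xi - axis j a \<in> torus \<longleftrightarrow> R \<and> - pi < xi $ j - a \<and> xi $ j - a <= pi" for a
    unfolding torus_def R_def by (auto simp: axis_def)
   have 2: "xi \<in> torus \<longleftrightarrow> R \<and> - pi < xi $ j \<and> xi $ j <= pi"
    unfolding torus_def R_def by auto
   have "xi \<in> X \<longleftrightarrow> R \<and> - pi + s < xi $ j \<and> xi $ j <= pi" unfolding X_def using 2 s by auto
   moreover have "xi \<in> Y \<longleftrightarrow> R \<and> pi < xi $ j \<and> xi $ j <= pi + s"
    unfolding Y_def X'_def using 1[of "2 * pi"] s by auto
   ultimately show ?thesis using 1[of s] s by auto
  qed
  then show ?thesis by auto
 qed
 have XY: "X \<inter> Y = {}"
  by (auto simp: X_def Y_def X'_def torus_def) (smt (verit) axis_nth)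
 have "torus_integral (%xi. f (xi + ?h)) = (LINT xi:X \<union> Y|lborel. f xi)"
  by (subst set_integral_shift) (auto simp: Teq)
 also have "... = (LINT xi:X|lborel. f xi) + (LINT xi:Y|lborel. f xi)"
  by (rule set_integral_Un[OF XY]) (use finX finY B in \<open>auto intro!: bounded_set_integrable\<close>)
 also have "(LINT xi:Y|lborel. f xi) = (LINT xi:X'|lborel. f (xi + ?p))"
  unfolding Y_def by (rule set_integral_shift[symmetric]) auto
 also have "... = (LINT xi:X'|lborel. f xi)"
 proof -
  have "?p = (2 * pi) *\<^sub>R real_vec (axis j 1)" by (simp add: vec_eq_iff axis_def)
  then show ?thesis using periodicD[OF per, of _ "axis j 1"] by simp
 qed
 also have "(LINT xi:X|lborel. f xi) + (LINT xi:X'|lborel. f xi) = (LINT xi:X \<union> X'|lborel. f xi)"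
  by (rule set_integral_Un[symmetric]) (use finX B in \<open>auto intro!: bounded_set_integrable simp: X_def X'_def\<close>)
 also have "X \<union> X' = torus" by (auto simp: X_def X'_def)
 finally show ?thesis .
qed

lemma periodic_shift: "periodic f ==> periodic (%xi. f (xi + h))"
 unfolding periodic_def by (metis add.assoc add.commute)

lemma torus_integral_shift:
 fixes f :: "real^'d => complex"
 assumes f[measurable]: "f \<in> borel_measurable borel" and per: "periodic f" and B: "!!xi. cmod (f xi) <= B"
 shows "torus_integral (%xi. f (xi + h)) = torus_integral f"
proof -
 have one: "torus_integral (%xi. g (xi + axis j s)) = torus_integral g"
  if g[measurable]: "g \<in> borel_measurable borel" and per: "periodic g" and B: "!!xi. cmod (g xi) <= B" for g :: "real^'d => complex" and j s
 proof -
  define k where "k = \<lfloor>s / (2 * pi)\<rfloor>"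
  define t where "t = s - 2 * pi * real_of_int k"
  have t: "0 <= t" "t <= 2 * pi"
  proof -
   have "real_of_int k <= s / (2 * pi)" "s / (2 * pi) < real_of_int k + 1" unfolding k_def by linarith+
   then show "0 <= t" "t <= 2 * pi" by (auto simp: t_def field_simps)
  qed
  have "axis j s = axis j t + (2 * pi) *\<^sub>R real_vec (axis j k)"
   by (simp add: t_def vec_eq_iff axis_def)
  then have "g (xi + axis j s) = g (xi + axis j t)" for xi
   using periodicD[OF per, of "xi + axis j t" "axis j k"] by (simp add: add.assoc)
  then show ?thesis using torus_integral_shift_axis[OF g per B t] by simp
 qed
 have "torus_integral (%xi. f (xi + (\<Sum>j\<in>J. axis j (h $ j)))) = torus_integral f" for J :: "'d set"
 proof (induction J rule: finite_induct[OF finite])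
  case 1
  show ?case by simp
 next
  case (2 i J)
  have "torus_integral (%xi. f (xi + (\<Sum>j\<in>insert i J. axis j (h $ j))))
    = torus_integral (%xi. f ((xi + axis i (h $ i)) + (\<Sum>j\<in>J. axis j (h $ j))))"
   using 2 by (simp add: add.assoc)
  also have "... = torus_integral (%xi. f (xi + (\<Sum>j\<in>J. axis j (h $ j))))"
   by (rule one[of "%xi. f (xi + (\<Sum>j\<in>J. axis j (h $ j)))"]) (use per B in \<open>auto intro: periodic_shift\<close>)
  finally show ?case using 2 by simp
 qed
 moreover have "(\<Sum>j\<in>UNIV. axis j (h $ j)) = h"
  by (simp add: vec_eq_iff axis_def sum.delta if_distrib cong: if_cong)
 ultimately show ?thesis by metis
qed

definition character :: "real^'d => real^'d => complex" where
 "character x xi = exp (- (\<i> * complex_of_real (x \<bullet> xi)))"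

lemma norm_character [simp]: "cmod (character x xi) = 1"
 by (simp add: character_def)

lemma character_measurable [measurable]: "character x \<in> borel_measurable borel"
 unfolding character_def by measurable

lemma character_add: "character x (xi + eta) = character x xi * character x eta"
 by (simp add: character_def inner_add_right algebra_simps flip: exp_add)

lemma character_add_left: "character (x + y) xi = character x xi * character y xi"
 by (simp add: character_def inner_add_left algebra_simps flip: exp_add)

lemma character_half_turn: "x \<bullet> h = pi ==> character x h = - 1"
 by (simp add: character_def exp_minus)

lemma character_lattice: "character (real_vec x) ((2 * pi) *\<^sub>R real_vec l) = 1"
proof -
 have "real_vec x \<bullet> ((2 * pi) *\<^sub>R real_vec l) = 2 * pi * real_of_int (\<Sum>j\<in>UNIV. x $ j * l $ j)"
  by (simp add: inner_vec_def sum_distrib_left mult_ac)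
 moreover define K where "K = (\<Sum>j\<in>UNIV. x $ j * l $ j)"
 ultimately have "character (real_vec x) ((2 * pi) *\<^sub>R real_vec l) = exp (- (\<i> * complex_of_real (2 * pi * real_of_int K)))"
  by (simp only: character_def)
 also have "- (\<i> * complex_of_real (2 * pi * real_of_int K)) = complex_of_real (2 * real_of_int (- K) * pi) * \<i>" by simp
 also have "exp ... = 1" by (rule exp_integer_2pi) simp
 finally show ?thesis .
qed

lemma periodic_character: "periodic (character (real_vec x))"
 by (simp add: periodic_def character_add character_lattice)

lemma periodic_mult: "periodic f ==> periodic g ==> periodic (%xi. f xi * g xi :: complex)"
 by (simp add: periodic_def)

lemma torus_integral_character:
 "torus_integral (character (real_vec x :: real^'d)) = (if x = 0 then (2 * pi) ^ CARD('d) else 0)"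
proof (cases "x = 0")
 case True
 have "measure lborel (torus :: (real^'d) set) = (2 * pi) ^ CARD('d)"
  using emeasure_torus by (simp add: measure_def)
 then have "torus_integral (%xi::real^'d. 1 :: complex) = of_real ((2 * pi) ^ CARD('d))"
  by (simp add: set_lebesgue_integral_def emeasure_torus scaleR_conv_of_real)
 moreover have "character (real_vec x) = (%xi::real^'d. 1)" using True by (simp add: character_def real_vec_simps fun_eq_iff)
 ultimately show ?thesis using True by simp
next
 case False
 then obtain j where j: "x $ j ~= 0" by (auto simp: vec_eq_iff)
 define h where "h = (axis j (pi / real_of_int (x $ j)) :: real^'d)"
 have "real_vec x \<bullet> h = pi" using j by (simp add: h_def inner_axis)
 then have "torus_integral (%xi. character (real_vec x) (xi + h)) = - torus_integral (character (real_vec x))"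
  by (simp add: character_add character_half_turn set_lebesgue_integral_def)
 moreover have "torus_integral (%xi. character (real_vec x) (xi + h)) = torus_integral (character (real_vec x))"
  by (rule torus_integral_shift[of _ 1]) (auto simp: periodic_character)
 ultimately have "torus_integral (character (real_vec x :: real^'d)) = 0" by simp
 then show ?thesis using False by simp
qed

lemma lp_space_1: "phi \<in> lp_space 1 \<longleftrightarrow> (%x. cmod (phi x)) summable_on UNIV"
 by (simp add: lp_space_def)

lemma fourier_alt: "fourier phi xi = (\<Sum>\<^sub>\<infinity>x. phi x * character (- real_vec x) xi)"
 by (simp add: fourier_def character_def)

lemma fourier_summable:
 assumes "phi \<in> lp_space 1"
 shows "(%x. norm (phi x * character (- real_vec x) xi)) summable_on UNIV"
 using assms by (simp add: lp_space_1 norm_mult)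

lemma fourier_bound: "phi \<in> lp_space 1 ==> cmod (fourier phi xi) <= (\<Sum>\<^sub>\<infinity>x. cmod (phi x))"
 unfolding fourier_alt using norm_infsum_bound[OF fourier_summable] by (simp add: norm_mult)

lemma periodic_fourier:
 fixes phi :: "int^'d => complex"
 shows "periodic (fourier phi)"
proof -
 have "character (- real_vec x) ((2 * pi) *\<^sub>R real_vec l) = 1" for x l :: "int^'d"
  using character_lattice[of "- x" l] by (simp add: real_vec_simps)
 then show ?thesis by (simp add: periodic_def fourier_alt character_add)
qed

lemma continuous_on_character: "continuous_on S (character x)"
 unfolding character_def by (intro continuous_intros)

lemma fourier_uniform_limit:
 assumes "phi \<in> lp_space 1"
 shows "uniform_limit UNIV (%F xi. \<Sum>x\<in>F. phi x * character (- real_vec x) xi) (fourier phi) (finite_subsets_at_top UNIV)"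
 unfolding fourier_alt
 by (rule Weierstrass_m_test_general[where M = "%x. cmod (phi x)"]) (use assms in \<open>auto simp: lp_space_1 norm_mult\<close>)

lemma continuous_on_fourier:
 assumes "phi \<in> lp_space 1"
 shows "continuous_on UNIV (fourier phi)"
 by (rule uniform_limit_theorem[OF _ fourier_uniform_limit[OF assms]])
   (auto intro!: always_eventually continuous_intros continuous_on_character)

lemma fourier_measurable: "phi \<in> lp_space 1 ==> fourier phi \<in> borel_measurable borel"
 by (intro borel_measurable_continuous_onI continuous_on_fourier)

text \<open>The series converges uniformly, so that it may be integrated term by term.\<close>
theorem fourier_inversion:
 fixes phi :: "int^'d => complex"
 assumes phi: "phi \<in> lp_space 1"
 shows "torus_integral (%xi. fourier phi xi * character (real_vec x) xi) = (2 * pi) ^ CARD('d) * phi x"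
proof -
 let ?T = "(2 * pi) ^ CARD('d) :: real"
 have [measurable]: "fourier phi \<in> borel_measurable borel" by (rule fourier_measurable[OF phi])
 let ?s = "%F xi. \<Sum>y\<in>F. phi y * character (- real_vec y) xi"
 define J where "J = torus_integral (%xi. fourier phi xi * character (real_vec x) xi)"
 have fin: "emeasure lborel (torus :: (real^'d) set) < \<infinity>" by (simp add: emeasure_torus)
 have part: "torus_integral (%xi. ?s F xi * character (real_vec x) xi) = (if x \<in> F then ?T * phi x else 0)" if F: "finite F" for F
 proof -
  have "torus_integral (%xi. ?s F xi * character (real_vec x) xi)
    = (\<Sum>y\<in>F. torus_integral (%xi. phi y * character (real_vec (x - y)) xi))"
   unfolding sum_distrib_right set_lebesgue_integral_def scaleR_sum_right
  proof (subst Bochner_Integration.integral_sum)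
   fix y
   have "set_integrable lborel torus (%xi. phi y * character (- real_vec y) xi * character (real_vec x) xi)"
    by (rule bounded_set_integrable[of _ _ "cmod (phi y)"]) (auto simp: emeasure_torus norm_mult)
   then show "integrable lborel (%xi. indicat_real torus xi *\<^sub>R (phi y * character (- real_vec y) xi * character (real_vec x) xi))"
    by (simp add: set_integrable_def)
  qed (simp add: real_vec_simps diff_conv_add_uminus character_add_left mult_ac del: add_uminus_conv_diff)
  also have "... = (\<Sum>y\<in>F. phi y * torus_integral (character (real_vec (x - y))))"
   by simp
  also have "... = (\<Sum>y\<in>F. if y = x then phi y * ?T else 0)"
   unfolding torus_integral_character by (intro sum.cong) auto
  finally show ?thesis using F by (simp add: mult.commute)
 qed
 have "cmod (J - ?T * phi x) <= ?T * e" if e: "e > 0" for e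
 proof -
  have "\<forall>\<^sub>F F in finite_subsets_at_top UNIV. \<forall>xi\<in>UNIV. dist (?s F xi) (fourier phi xi) < e"
   using uniform_limitD[OF fourier_uniform_limit[OF phi] e] .
  moreover have "\<forall>\<^sub>F F in finite_subsets_at_top UNIV. finite F \<and> {x} \<subseteq> F"
   unfolding eventually_finite_subsets_at_top by (intro exI[of _ "{x}"]) auto
  ultimately have "\<forall>\<^sub>F F in finite_subsets_at_top UNIV. (\<forall>xi\<in>UNIV. dist (?s F xi) (fourier phi xi) < e) \<and> finite F \<and> {x} \<subseteq> F"
   by eventually_elim auto
  from eventually_happens'[OF finite_subsets_at_top_neq_bot this]
  obtain F where F0: "(\<forall>xi\<in>UNIV. dist (?s F xi) (fourier phi xi) < e) \<and> finite F \<and> {x} \<subseteq> F" by (elim exE)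
  then have F: "!!xi. dist (?s F xi) (fourier phi xi) < e" "finite F" "x \<in> F" by auto
  have "J - ?T * phi x = J - torus_integral (%xi. ?s F xi * character (real_vec x) xi)"
   using part[OF F(2)] F(3) by simp
  also have "... = torus_integral (%xi. fourier phi xi * character (real_vec x) xi - ?s F xi * character (real_vec x) xi)"
   unfolding J_def
  proof (rule set_integral_diff(2)[symmetric])
   show "set_integrable lborel torus (%xi. fourier phi xi * character (real_vec x) xi)"
    by (rule bounded_set_integrable[of _ _ "\<Sum>\<^sub>\<infinity>x. cmod (phi x)"]) (use fourier_bound[OF phi] in \<open>auto simp: emeasure_torus norm_mult\<close>)
   have "cmod (?s F xi) <= (\<Sum>y\<in>F. cmod (phi y))" for xi
    by (rule order_trans[OF norm_sum]) (simp add: norm_mult)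
   then show "set_integrable lborel torus (%xi. ?s F xi * character (real_vec x) xi)"
    by (intro bounded_set_integrable[of _ _ "\<Sum>y\<in>F. cmod (phi y)"]) (auto simp: emeasure_torus norm_mult)
  qed
  also have "cmod ... <= e * measure lborel (torus :: (real^'d) set)"
  proof (rule set_integral_norm_le)
   show "cmod (fourier phi xi * character (real_vec x) xi - ?s F xi * character (real_vec x) xi) <= e" for xi
    using F(1)[of xi] by (simp add: dist_norm norm_minus_commute norm_mult flip: left_diff_distrib)
  qed (auto simp: emeasure_torus)
  also have "... = ?T * e" by (simp add: measure_torus)
  finally show ?thesis .
 qed
 then have "cmod (J - ?T * phi x) <= e" if "e > 0" for e
 proof -
  have T: "?T > 0" by simp
  then have "cmod (J - ?T * phi x) <= ?T * (e / ?T)" using that \<open>!!e. e > 0 ==> cmod (J - ?T * phi x) <= ?T * e\<close> divide_pos_pos by blast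
  then show ?thesis using T by simp
 qed
 then have "cmod (J - ?T * phi x) <= 0" by (rule field_le_epsilon) simp
 then show ?thesis by (simp add: J_def)
qed

section \<open>Convolution powers\<close>

lemma conv_abs_bound:
 fixes f g :: "int^'d => complex"
 assumes f: "f \<in> lp_space 1" and g: "g \<in> lp_space 1"
 shows "(%(x, y). f (x - y) * g y) summable_on UNIV"
  and "(%y. norm (f (x - y) * g y)) summable_on UNIV"
  and "conv f g \<in> lp_space 1"
proof -
 note K = conv_nonneg_summable[of "%x. cmod (f x)" "%x. cmod (g x)"]
 have s1: "(%(x, y). cmod (f (x - y)) * cmod (g y)) summable_on UNIV"
  and s2: "(%x. \<Sum>\<^sub>\<infinity>y. cmod (f (x - y)) * cmod (g y)) summable_on UNIV"
  using f g by (auto simp: lp_space_1 intro!: K)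
 have "(%p. norm (case p of (x, y) => f (x - y) * g y)) summable_on UNIV"
  using s1 by (simp add: case_prod_unfold norm_mult)
 then show "(%(x, y). f (x - y) * g y) summable_on UNIV" by (rule abs_summable_summable)
 have sy: "(%y. cmod (f (x - y)) * cmod (g y)) summable_on UNIV" for x
  using summable_on_SigmaD1[of "%x y. cmod (f (x - y)) * cmod (g y)" UNIV "%_. UNIV" x] s1 by simp
 then show sy': "(%y. norm (f (x - y) * g y)) summable_on UNIV" for x by (simp add: norm_mult)
 have "cmod (conv f g x) <= (\<Sum>\<^sub>\<infinity>y. cmod (f (x - y)) * cmod (g y))" for x
  unfolding conv_def using norm_infsum_bound[OF sy'[of x]] by (simp add: norm_mult)
 then show "conv f g \<in> lp_space 1"
  unfolding lp_space_1 by (intro summable_on_comparison_test[OF s2]) auto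
qed

lemma fourier_conv:
 fixes f g :: "int^'d => complex"
 assumes f: "f \<in> lp_space 1" and g: "g \<in> lp_space 1"
 shows "fourier (conv f g) xi = fourier f xi * fourier g xi"
proof -
 let ?c = "%x::int^'d. character (- real_vec x) xi"
 have "(%(x, y). cmod (f (x - y)) * cmod (g y)) summable_on UNIV"
  using f g conv_nonneg_summable(1)[of "%x. cmod (f x)" "%x. cmod (g x)"] by (simp add: lp_space_1)
 then have "(%p. norm (case p of (x, y) => f (x - y) * g y * ?c x)) summable_on UNIV"
  by (simp add: case_prod_unfold norm_mult)
 then have s: "(%(x, y). f (x - y) * g y * ?c x) summable_on UNIV \<times> UNIV"
  using abs_summable_summable by simp
 have "fourier (conv f g) xi = (\<Sum>\<^sub>\<infinity>x. \<Sum>\<^sub>\<infinity>y. f (x - y) * g y * ?c x)"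
  unfolding fourier_alt conv_def by (simp add: infsum_cmult_left')
 also have "... = (\<Sum>\<^sub>\<infinity>y. \<Sum>\<^sub>\<infinity>x. f (x - y) * g y * ?c x)"
  by (rule infsum_swap_banach[OF s])
 also have "... = (\<Sum>\<^sub>\<infinity>y. fourier f xi * (g y * ?c y))"
 proof (rule infsum_cong)
  fix y
  have e: "?c x = ?c (x - y) * ?c y" for x
  proof -
   have "- real_vec x = - real_vec (x - y) + - real_vec y" by (simp add: real_vec_simps)
   then show ?thesis by (subst \<open>- real_vec x = _\<close>) (rule character_add_left)
  qed
  have "(\<Sum>\<^sub>\<infinity>x. f (x - y) * g y * ?c x) = (\<Sum>\<^sub>\<infinity>x. (f (x - y) * ?c (x - y)) * (g y * ?c y))"
  proof (rule infsum_cong)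
   fix x show "f (x - y) * g y * ?c x = (f (x - y) * ?c (x - y)) * (g y * ?c y)"
    by (subst e[of x]) (simp only: mult_ac)
  qed
  also have "... = (\<Sum>\<^sub>\<infinity>x. (f (x - y) * ?c (x - y))) * (g y * ?c y)"
   by (rule infsum_cmult_left')
  also have "(\<Sum>\<^sub>\<infinity>x. (f (x - y) * ?c (x - y))) = fourier f xi"
   unfolding fourier_alt using summable_on_translate(2)[of "%x. f x * ?c x" y] by simp
  finally show "(\<Sum>\<^sub>\<infinity>x. f (x - y) * g y * ?c x) = fourier f xi * (g y * ?c y)" .
 qed
 also have "... = fourier f xi * fourier g xi"
  unfolding fourier_alt[of g] by (rule infsum_cmult_right')
 finally show ?thesis .
qed

lemma conv_power_step: "n >= 1 ==> conv_power phi (Suc n) = conv (conv_power phi n) phi"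
 by (cases n) auto

lemma conv_power_fourier:
 fixes phi :: "int^'d => complex"
 assumes phi: "phi \<in> lp_space 1" and n: "n >= 1"
 shows "conv_power phi n \<in> lp_space 1" and "fourier (conv_power phi n) xi = fourier phi xi ^ n"
proof -
 have "conv_power phi n \<in> lp_space 1 \<and> fourier (conv_power phi n) xi = fourier phi xi ^ n"
  using n
 proof (induction n rule: nat_induct_at_least)
  case base
  then show ?case using phi by simp
 next
  case (Suc n)
  then show ?case
   using conv_abs_bound(3)[of "conv_power phi n" phi] fourier_conv[of "conv_power phi n" phi] phi
   by (simp add: conv_power_step mult.commute)
 qed
 then show "conv_power phi n \<in> lp_space 1" and "fourier (conv_power phi n) xi = fourier phi xi ^ n" by auto
qed

theorem conv_power_inversion:
 fixes phi :: "int^'d => complex"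
 assumes phi: "phi \<in> lp_space 1" and n: "n >= 1"
 shows "(2 * pi) ^ CARD('d) * conv_power phi n x = torus_integral (%xi. fourier phi xi ^ n * character (real_vec x) xi)"
 using fourier_inversion[OF conv_power_fourier(1)[OF phi n], of x] conv_power_fourier(2)[OF phi n] by simp

text \<open>
  The transform is holomorphic in discs of a fixed radius in each coordinate direction, by
  compactness of the torus.
\<close>
lemma fourier_uniform_disc:
 fixes phi :: "int^'d => complex"
 assumes phi: "phi \<in> H_class"
 obtains r B where "r > 0" "B >= 0"
  "!!xi j. \<exists>f. f holomorphic_on ball 0 r \<and> (\<forall>w\<in>ball 0 r. cmod (f w) <= B) \<and>
    (\<forall>x. \<bar>x\<bar> < r --> fourier phi (xi + x *\<^sub>R axis j 1) = f (of_real x))"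
proof -
 obtain U F where U: "open U" "complex_vec ` torus \<subseteq> U" "holomorphic_vec_on F U"
  "!!xi. complex_vec xi \<in> U ==> F (complex_vec xi) = fourier phi xi"
  using phi by (auto simp: H_class_def)
 define good where "good = (%r B xi. \<forall>j. \<exists>f. f holomorphic_on ball 0 r \<and> (\<forall>w\<in>ball 0 r. cmod (f w) <= B) \<and>
    (\<forall>x. \<bar>x\<bar> < r --> fourier phi (xi + x *\<^sub>R axis j 1) = f (of_real x)))"
 have good_per: "good r B (xi + (2 * pi) *\<^sub>R real_vec l) \<longleftrightarrow> good r B xi" for r B xi l
 proof -
  have "fourier phi (xi + (2 * pi) *\<^sub>R real_vec l + h) = fourier phi (xi + h)" for h
   using periodicD[OF periodic_fourier, of phi "xi + h" l] by (simp add: add_ac)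
  then show ?thesis by (simp add: good_def)
 qed
 have good_mono: "good r' B' xi" if g: "good r B xi" and le: "r' <= r" "B <= B'" for r B r' B' xi
  unfolding good_def
 proof
  fix j
  obtain f where f: "f holomorphic_on ball 0 r" "\<forall>w\<in>ball 0 r. cmod (f w) <= B"
   "\<forall>x. \<bar>x\<bar> < r --> fourier phi (xi + x *\<^sub>R axis j 1) = f (of_real x)" using g unfolding good_def by blast
  have sub: "ball 0 r' \<subseteq> (ball 0 r :: complex set)" by (rule subset_ball[OF le(1)])
  show "\<exists>f. f holomorphic_on ball 0 r' \<and> (\<forall>w\<in>ball 0 r'. cmod (f w) <= B') \<and>
    (\<forall>x. \<bar>x\<bar> < r' --> fourier phi (xi + x *\<^sub>R axis j 1) = f (of_real x))"
  proof (intro exI conjI allI ballI impI)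
   show "f holomorphic_on ball 0 r'" by (rule holomorphic_on_subset[OF f(1) sub])
   show "cmod (f w) <= B'" if "w \<in> ball 0 r'" for w
    using f(2) sub that le(2) order_trans by blast
   show "fourier phi (xi + x *\<^sub>R axis j 1) = f (of_real x)" if "\<bar>x\<bar> < r'" for x
    by (rule f(3)[rule_format]) (use that le(1) in linarith)
  qed
 qed
 have loc: "\<exists>r>0. \<exists>B\<ge>0. \<forall>xi. dist xi1 xi < r --> good r B xi" for xi1
 proof -
  obtain l where l: "xi1 + (2 * pi) *\<^sub>R real_vec l \<in> torus" by (rule torus_representative)
  define xi0 where "xi0 = xi1 + (2 * pi) *\<^sub>R real_vec l"
  have "complex_vec xi0 \<in> U" using l U(2) by (auto simp: xi0_def)
  then obtain r B where r: "r > 0" "B >= 0" "!!z. (!!j. cmod (z $ j - complex_vec xi0 $ j) <= r) ==> z \<in> U"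
   "!!z. (!!j. cmod (z $ j - complex_vec xi0 $ j) <= r) ==> cmod (F z) <= B"
   using holomorphic_vec_polydisc[OF U(1,3)] by blast
  have "good (r / 2) B (xi + (2 * pi) *\<^sub>R real_vec l)" if d: "dist xi1 xi < r / 2" for xi
   unfolding good_def
  proof
   fix j
   let ?xi = "xi + (2 * pi) *\<^sub>R real_vec l"
   define g where "g = (%w. complex_vec ?xi + w *s axis j 1)"
   have near: "cmod (g w $ i - complex_vec xi0 $ i) <= r" if w: "w \<in> ball 0 (r / 2)" for w i
   proof -
    have "\<bar>(xi - xi1) $ i\<bar> <= r / 2" using d component_le_norm_cart[of "xi - xi1" i] by (simp add: dist_norm norm_minus_commute)
    moreover have eq: "g w $ i - complex_vec xi0 $ i = of_real ((xi - xi1) $ i) + w * axis j 1 $ i"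
     by (simp add: g_def xi0_def)
    moreover have "cmod (w * axis j 1 $ i) <= r / 2" using w r(1) by (auto simp: axis_def)
    ultimately have "cmod (of_real ((xi - xi1) $ i)) + cmod (w * axis j 1 $ i) <= r / 2 + r / 2"
     by (intro add_mono) (simp_all only: norm_of_real)
    moreover have "cmod (g w $ i - complex_vec xi0 $ i) <= cmod (of_real ((xi - xi1) $ i)) + cmod (w * axis j 1 $ i)"
     unfolding eq by (rule norm_triangle_ineq)
    ultimately show ?thesis by linarith
   qed
   have gU: "g w \<in> U" if "w \<in> ball 0 (r / 2)" for w by (rule r(3)) (rule near[OF that])
   have "(%w. F (g w)) holomorphic_on ball 0 (r / 2)"
    unfolding g_def by (rule holomorphic_vec_on_line[OF U(1,3)]) (use gU in \<open>simp add: g_def\<close>)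
   moreover have "\<forall>w\<in>ball 0 (r / 2). cmod (F (g w)) <= B" using r(4) near by blast
   moreover have "fourier phi (?xi + x *\<^sub>R axis j 1) = F (g (of_real x))" if "\<bar>x\<bar> < r / 2" for x
   proof -
    have "g (of_real x) = complex_vec (?xi + x *\<^sub>R axis j 1)" by (simp add: g_def vec_eq_iff axis_def)
    moreover have "g (of_real x) \<in> U" by (rule gU) (use that in simp)
    ultimately show ?thesis using U(4) by metis
   qed
   ultimately show "\<exists>f. f holomorphic_on ball 0 (r / 2) \<and> (\<forall>w\<in>ball 0 (r / 2). cmod (f w) <= B) \<and>
    (\<forall>x. \<bar>x\<bar> < r / 2 --> fourier phi (?xi + x *\<^sub>R axis j 1) = f (of_real x))"
    by (intro exI[of _ "%w. F (g w)"]) auto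
  qed
  then show ?thesis using r by (intro exI[of _ "r / 2"] conjI exI[of _ B]) (auto simp: good_per)
 qed
 then have "\<forall>xi1. \<exists>p. fst p > 0 \<and> snd p >= 0 \<and> (\<forall>xi. dist xi1 xi < fst p --> good (fst p) (snd p) xi)"
  by (metis fst_conv snd_conv)
 from choice[OF this] obtain p where p: "\<forall>xi1. fst (p xi1) > 0 \<and> snd (p xi1) >= 0 \<and>
   (\<forall>xi. dist xi1 xi < fst (p xi1) --> good (fst (p xi1)) (snd (p xi1)) xi)" by (elim exE)
 define r where "r = (%xi1. fst (p xi1))"
 define B where "B = (%xi1. snd (p xi1))"
 have rB: "!!xi1. r xi1 > 0" "!!xi1. B xi1 >= 0" "!!xi1 xi. dist xi1 xi < r xi1 ==> good (r xi1) (B xi1) xi"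
  using p unfolding r_def B_def by blast+
 have "compact (cbox (\<chi> j. - pi) (\<chi> j. pi) :: (real^'d) set)" by (rule compact_cbox)
 then obtain D where D: "finite D" "cbox (\<chi> j. - pi) (\<chi> j. pi) \<subseteq> (\<Union>xi1\<in>D. ball xi1 (r xi1))"
 proof (rule compactE_image[of _ UNIV "%xi1. ball xi1 (r xi1)"])
  show "cbox (\<chi> j. - pi) (\<chi> j. pi) \<subseteq> (\<Union>xi1. ball xi1 (r xi1))"
  proof
   fix xi :: "real^'d"
   have "xi \<in> ball xi (r xi)" using rB(1) by simp
   then show "xi \<in> (\<Union>xi1. ball xi1 (r xi1))" by (rule UN_I[OF UNIV_I])
  qed
 qed (auto intro: that)
 have "(0::real^'d) \<in> cbox (\<chi> j. - pi) (\<chi> j. pi)" by (simp add: mem_box_cart)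
 then have "D ~= {}" using D by auto
 define R where "R = Min (r ` D)"
 define C where "C = Max (B ` D)"
 have R: "R > 0" "!!d. d \<in> D ==> R <= r d" using D \<open>D ~= {}\<close> rB(1) by (auto simp: R_def)
 have C: "!!d. d \<in> D ==> B d <= C" using D by (auto simp: C_def)
 have "C >= 0" using C rB(2) \<open>D ~= {}\<close> by (meson all_not_in_conv order_trans)
 have "good R C xi" for xi
 proof -
  obtain l where l: "xi + (2 * pi) *\<^sub>R real_vec l \<in> torus" by (rule torus_representative)
  then have "xi + (2 * pi) *\<^sub>R real_vec l \<in> (\<Union>xi1\<in>D. ball xi1 (r xi1))" using torus_subset_cbox D by blast
  then obtain d where "d \<in> D" "dist d (xi + (2 * pi) *\<^sub>R real_vec l) < r d" by auto
  then have "good R C (xi + (2 * pi) *\<^sub>R real_vec l)" using rB(3) good_mono R C by blast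
  then show ?thesis by (simp add: good_per)
 qed
 then show thesis using R \<open>C >= 0\<close> by (intro that[of R C]) (auto simp: good_def)
qed

text \<open>The periodic counterpart of \<open>fourier_shift_diff\<close>: integrals of periodic functions over the torus are invariant under all translations.\<close>
lemma torus_shift_diff:
 fixes F :: "real^'d => complex"
 assumes Fm: "F \<in> borel_measurable borel" and F: "periodic F" and B: "!!xi. cmod (F xi) <= B"
  and h: "real_vec x \<bullet> h = pi"
 shows "(shift_diff h ^^ N) F \<in> borel_measurable borel \<and> periodic ((shift_diff h ^^ N) F) \<and>
  (\<forall>xi. cmod ((shift_diff h ^^ N) F xi) <= 2 ^ N * B) \<and>
  torus_integral (%xi. (shift_diff h ^^ N) F xi * character (real_vec x) xi)
   = (-2) ^ N * torus_integral (%xi. F xi * character (real_vec x) xi)"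
proof (induction N)
 case 0
 then show ?case using Fm F B by simp
next
 case (Suc N)
 define G where "G = (shift_diff h ^^ N) F"
 have G[measurable]: "G \<in> borel_measurable borel" and Gp: "periodic G" and GB: "!!xi. cmod (G xi) <= 2 ^ N * B"
  using Suc by (auto simp: G_def)
 let ?e = "character (real_vec x)"
 have m: "(%xi. shift_diff h G xi) \<in> borel_measurable borel" unfolding shift_diff_def by measurable
 have p: "periodic (%xi. shift_diff h G xi)"
  using periodic_shift[OF Gp, of h] Gp by (simp add: periodic_def shift_diff_def)
 have b: "cmod (shift_diff h G xi) <= 2 ^ Suc N * B" for xi
  using norm_triangle_ineq4[of "G (xi + h)" "G xi"] GB[of xi] GB[of "xi + h"] by (simp add: shift_diff_def)
 have int: "set_integrable lborel torus (%xi. G (xi + h) * ?e xi)" "set_integrable lborel torus (%xi. G xi * ?e xi)"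
  by (rule bounded_set_integrable[of _ _ "2 ^ N * B"]; use GB in \<open>simp add: emeasure_torus norm_mult\<close>)+
 have "torus_integral (%xi. G (xi + h) * ?e xi) = torus_integral (%xi. - (G (xi + h) * ?e (xi + h)))"
  by (simp add: character_add character_half_turn[OF h])
 also have "... = - torus_integral (%xi. G (xi + h) * ?e (xi + h))"
  by (simp add: set_lebesgue_integral_def)
 also have "torus_integral (%xi. G (xi + h) * ?e (xi + h)) = torus_integral (%xi. G xi * ?e xi)"
  by (rule torus_integral_shift[of "%xi. G xi * ?e xi" "2 ^ N * B"])
    (use GB Gp in \<open>auto simp: norm_mult intro!: periodic_mult periodic_character\<close>)
 finally have sh: "torus_integral (%xi. G (xi + h) * ?e xi) = - torus_integral (%xi. G xi * ?e xi)" .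
 have "torus_integral (%xi. shift_diff h G xi * ?e xi) = torus_integral (%xi. G (xi + h) * ?e xi - G xi * ?e xi)"
  by (simp add: shift_diff_def algebra_simps)
 also have "... = (-2) * torus_integral (%xi. G xi * ?e xi)"
  by (subst set_integral_diff(2)[OF int]) (simp add: sh)
 finally show ?case using m p b Suc by (simp add: G_def mult_ac)
qed

text \<open>The argument of \<open>fourier_integral_decay\<close> on the torus, where the uniform discs cover all points and no exceptional set occurs.\<close>
theorem exponential_decay:
 fixes phi :: "int^'d => complex"
 assumes phi: "phi \<in> H_class"
 obtains C eps where "C > 0" "eps > 0" "!!x. cmod (phi x) <= C * exp (- eps * norm (real_vec x))"
proof -
 obtain r B where r: "r > 0" "B >= 0"
  "!!xi j. \<exists>f. f holomorphic_on ball 0 r \<and> (\<forall>w\<in>ball 0 r. cmod (f w) <= B) \<and>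
    (\<forall>x. \<bar>x\<bar> < r --> fourier phi (xi + x *\<^sub>R axis j 1) = f (of_real x))"
  by (rule fourier_uniform_disc[OF phi]) (rule that)
 have l1: "phi \<in> lp_space 1" using phi by (simp add: H_class_def)
 define L where "L = (\<Sum>\<^sub>\<infinity>x. cmod (phi x))"
 define a where "a = r / (4 * pi)"
 have a: "a > 0" using r by (simp add: a_def)
 define eps where "eps = ln 2 * a / real CARD('d)"
 have eps: "eps > 0" using a by (simp add: eps_def)
 have "cmod (phi x) <= (2 * B + 1) * exp (- eps * norm (real_vec x))" for x
 proof -
  obtain j where j: "norm (real_vec x) <= real CARD('d) * \<bar>real_vec x $ j\<bar>" by (rule max_component)
  define X where "X = \<bar>real_vec x $ j\<bar>"
  define N where "N = nat \<lfloor>a * X\<rfloor>"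
  define s where "s = pi / real_vec x $ j"
  define h where "h = s *\<^sub>R (axis j 1 :: real^'d)"
  have N4: "real N <= a * X" using a by (simp add: N_def X_def of_nat_nat)
  have Ns: "2 * real N * \<bar>s\<bar> < r"
  proof (cases "X = 0")
   case True
   then show ?thesis using r by (simp add: s_def X_def)
  next
   case False
   then have "X > 0" by (simp add: X_def)
   have "2 * real N * \<bar>s\<bar> <= 2 * (a * X) * \<bar>s\<bar>" using N4 by (intro mult_right_mono mult_left_mono) auto
   also have "... = r / 2" using \<open>X > 0\<close> by (simp add: s_def X_def a_def abs_divide)
   finally show ?thesis using r by simp
  qed
  have bnd: "cmod ((shift_diff h ^^ N) (fourier phi) xi) <= B" for xi
  proof -
   obtain f where f: "f holomorphic_on ball 0 r" "!!w. w \<in> ball 0 r ==> cmod (f w) <= B"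
    "!!x. \<bar>x\<bar> < r ==> fourier phi (xi + x *\<^sub>R axis j 1) = f (of_real x)" using r(3)[of xi j] by blast
   have "(shift_diff h ^^ N) (fourier phi) xi = (shift_diff (of_real s) ^^ N) f 0"
   proof (rule shift_diff_transfer)
    fix k assume k: "k <= N"
    have "real k * \<bar>s\<bar> <= real N * \<bar>s\<bar>" using k by (intro mult_right_mono) auto
    then have ks: "\<bar>real k * s\<bar> < r" using Ns r(1) by (simp add: abs_mult)
    have "fourier phi (xi + real k *\<^sub>R h) = fourier phi (xi + (real k * s) *\<^sub>R axis j 1)" by (simp add: h_def)
    also have "... = f (of_real (real k * s))" by (rule f(3)[OF ks])
    also have "of_real (real k * s) = 0 + real k *\<^sub>R (of_real s :: complex)" by (simp add: scaleR_conv_of_real)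
    finally show "fourier phi (xi + real k *\<^sub>R h) = f (0 + real k *\<^sub>R of_real s)" .
   qed
   also have "cmod ... <= B" by (rule shift_diff_holomorphic_bound[OF f(1,2) Ns r(1)])
   finally show ?thesis .
  qed
  let ?J = "%N. torus_integral (%xi. (shift_diff h ^^ N) (fourier phi) xi * character (real_vec x) xi)"
  have m: "(shift_diff h ^^ N) (fourier phi) \<in> borel_measurable borel" and e: "?J N = (-2) ^ N * ?J 0"
  proof -
   have "(shift_diff h ^^ N) (fourier phi) \<in> borel_measurable borel \<and> ?J N = (-2) ^ N * ?J 0"
   proof (cases "N = 0")
    case False
    then have "real_vec x $ j ~= 0" using a by (auto simp: N_def X_def)
    then have "real_vec x \<bullet> h = pi" by (simp add: h_def s_def inner_axis)
    from torus_shift_diff[OF fourier_measurable[OF l1] periodic_fourier fourier_bound[OF l1] this, of N]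
    show ?thesis by simp
   qed (use fourier_measurable[OF l1] in simp)
   then show "(shift_diff h ^^ N) (fourier phi) \<in> borel_measurable borel" "?J N = (-2) ^ N * ?J 0" by auto
  qed
  let ?T = "(2 * pi) ^ CARD('d) :: real"
  have "cmod (?J N) <= B * measure lborel (torus :: (real^'d) set)"
   by (rule set_integral_norm_le) (use m bnd in \<open>auto simp: emeasure_torus norm_mult\<close>)
  also have "... = ?T * B" by (simp add: measure_torus)
  finally have "2 ^ N * (?T * cmod (phi x)) <= ?T * B"
   unfolding e using fourier_inversion[OF l1, of x] by (simp add: norm_mult norm_power)
  then have "?T * (2 ^ N * cmod (phi x)) <= ?T * B" by (simp add: mult_ac)
  then have "2 ^ N * cmod (phi x) <= B" by (rule mult_left_le_imp_le) simp
  then have "cmod (phi x) <= B * (1 / 2) ^ N" by (simp add: field_simps power_one_over)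
  also have "... <= B * (2 * exp (- (ln 2 * (a * X))))"
   by (intro mult_left_mono half_power_floor_bound) (use a r in \<open>auto simp: N_def X_def\<close>)
  also have "exp (- (ln 2 * (a * X))) <= exp (- eps * norm (real_vec x))"
  proof -
   have "eps * norm (real_vec x) <= eps * (real CARD('d) * X)" using j eps by (simp add: X_def)
   then show ?thesis by (simp add: eps_def mult_ac)
  qed
  finally have "cmod (phi x) <= 2 * B * exp (- eps * norm (real_vec x))" using r(2) by (simp add: mult_left_mono)
  also have "... <= (2 * B + 1) * exp (- eps * norm (real_vec x))" by (intro mult_right_mono) auto
  finally show ?thesis .
 qed
 then show thesis using eps r(2) by (intro that[of "2 * B + 1" eps]) auto
qed

lemma lattice_exp_summable:
 assumes eps: "eps > 0"
 shows "(%x::int^'d. exp (- eps * norm (real_vec x))) summable_on UNIV"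
proof -
 let ?w = "%x::real^'d. exp (- eps * norm x)"
 have slow: "?w x <= exp (eps * real CARD('d)) * ?w y" if "!!j. \<bar>x $ j - y $ j\<bar> <= 1" for x y
 proof -
  have "norm (y - x) <= (\<Sum>j\<in>UNIV. \<bar>(y - x) $ j\<bar>)" by (rule norm_le_l1_cart)
  also have "... <= (\<Sum>j\<in>(UNIV::'d set). 1)" using that by (intro sum_mono) (simp add: abs_minus_commute)
  finally have "norm y <= norm x + real CARD('d)" using norm_triangle_ineq[of "y - x" x] by simp
  then have "eps * norm y <= eps * (norm x + real CARD('d))" using eps by simp
  then show ?thesis by (simp add: algebra_simps flip: exp_add)
 qed
 have fin: "(\<integral>\<^sup>+x. ennreal (?w x) \<partial>lborel) < \<infinity>" by (rule nn_integral_exp_norm_finite[OF eps])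
 then obtain I where "I >= 0" "(\<integral>\<^sup>+x. ennreal (?w x) \<partial>lborel) = ennreal I"
  by (cases "\<integral>\<^sup>+x. ennreal (?w x) \<partial>lborel") auto
 then have I: "I >= 0" "(\<integral>\<^sup>+x. ennreal (?w x) \<partial>lborel) <= ennreal I" by simp_all
 show ?thesis
 proof (rule lattice_sum_le_integral(1)[where w = ?w and C = "exp (eps * real CARD('d))" and I = I])
  show "?w \<in> borel_measurable borel" by measurable
  show "?w x <= exp (eps * real CARD('d)) * ?w y" if "!!j. \<bar>x $ j - y $ j\<bar> <= 1" for x y
   by (rule slow[OF that])
 qed (use I in auto)
qed

text \<open>Exponential weights are submultiplicative, so that every convolution costs only a constant factor. The bound is of use where \<open>x\<close> is large compared with \<open>n\<close>.\<close>
theorem conv_power_exponential_bound: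
 fixes phi :: "int^'d => complex"
 assumes phi: "phi \<in> H_class"
 obtains W eps where "W >= 1" "eps > 0" "!!n x. n >= 1 ==> cmod (conv_power phi n x) <= W ^ n * exp (- eps * norm (real_vec x))"
proof -
 obtain C e where C: "C > 0" and e: "e > 0" and d: "!!x. cmod (phi x) <= C * exp (- e * norm (real_vec x))"
  by (rule exponential_decay[OF phi]) (rule that)
 define eps where "eps = e / 2"
 have eps: "eps > 0" using e by (simp add: eps_def)
 define S where "S = (\<Sum>\<^sub>\<infinity>x::int^'d. exp (- eps * norm (real_vec x)))"
 have s: "(%x::int^'d. exp (- eps * norm (real_vec x))) summable_on UNIV" by (rule lattice_exp_summable[OF eps])
 have S0: "S >= 0" unfolding S_def by (intro infsum_nonneg) auto
 define W where "W = 1 + C + C * S"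
 have W: "W >= 1" "W >= C" "W >= C * S" using C S0 by (auto simp: W_def)
 have "cmod (conv_power phi n x) <= W ^ n * exp (- eps * norm (real_vec x))" if "n >= 1" for n x
  using that
 proof (induction n arbitrary: x rule: nat_induct_at_least)
  case base
  have "cmod (phi x) <= C * exp (- e * norm (real_vec x))" by (rule d)
  also have "... <= W * exp (- eps * norm (real_vec x))"
   using W C e by (intro mult_mono) (auto simp: eps_def)
  finally show ?case by simp
 next
  case (Suc n)
  have le: "cmod (conv_power phi n (x - y) * phi y) <= W ^ n * C * exp (- eps * norm (real_vec x)) * exp (- eps * norm (real_vec y))" for y
  proof -
   have "cmod (conv_power phi n (x - y) * phi y) <= (W ^ n * exp (- eps * norm (real_vec (x - y)))) * (C * exp (- e * norm (real_vec y)))"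
    unfolding norm_mult using W C by (intro mult_mono Suc d) auto
   also have "... = W ^ n * C * exp (- eps * (norm (real_vec (x - y)) + norm (real_vec y)) - eps * norm (real_vec y))"
    by (simp add: eps_def field_simps flip: exp_add)
   also have "... <= W ^ n * C * exp (- eps * norm (real_vec x) - eps * norm (real_vec y))"
   proof -
    have "norm (real_vec x) <= norm (real_vec (x - y)) + norm (real_vec y)"
     using norm_triangle_ineq[of "real_vec (x - y)" "real_vec y"] by (simp add: real_vec_simps)
    then have "eps * norm (real_vec x) <= eps * (norm (real_vec (x - y)) + norm (real_vec y))" using eps by simp
    then show ?thesis using W C by (intro mult_left_mono) auto
   qed
   finally show ?thesis by (simp add: exp_diff exp_minus field_simps)
  qed
  have s': "(%y::int^'d. W ^ n * C * exp (- eps * norm (real_vec x)) * exp (- eps * norm (real_vec y))) summable_on UNIV"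
   by (intro summable_on_cmult_right s)
  have s'': "(%y. cmod (conv_power phi n (x - y) * phi y)) summable_on UNIV"
   by (rule summable_on_comparison_test[OF s']) (use le in auto)
  have "cmod (conv_power phi (Suc n) x) <= (\<Sum>\<^sub>\<infinity>y. cmod (conv_power phi n (x - y) * phi y))"
   using Suc(1) norm_infsum_bound[OF s''] by (simp add: conv_power_step conv_def)
  also have "... <= (\<Sum>\<^sub>\<infinity>y::int^'d. W ^ n * C * exp (- eps * norm (real_vec x)) * exp (- eps * norm (real_vec y)))"
   by (intro infsum_mono s' s'' le)
  also have "... = W ^ n * (C * S) * exp (- eps * norm (real_vec x))"
   unfolding infsum_cmult_right' S_def by (simp add: mult_ac)
  also have "... <= W ^ n * W * exp (- eps * norm (real_vec x))"
   using W by (intro mult_right_mono mult_left_mono) auto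
  finally show ?case by (simp add: mult_ac)
 qed
 then show thesis using W eps by (intro that[of W eps]) auto
qed

section \<open>Polynomials and constant-coefficient operators\<close>

lemma mono_eval_add: "mono_eval (beta + gam) z = mono_eval beta z * mono_eval gam z"
 by (simp add: mono_eval_def power_add prod.distrib)

lemma mono_eval_zero [simp]: "mono_eval 0 z = 1"
 by (simp add: mono_eval_def)

lemma mono_eval_axis [simp]: "mono_eval (axis j (Suc 0)) z = z $ j"
proof -
 have "mono_eval (axis j (Suc 0)) z = (\<Prod>i\<in>UNIV. if i = j then z $ i else 1)"
  unfolding mono_eval_def by (intro prod.cong) (auto simp: axis_def)
 then show ?thesis by simp
qed

lemma mono_eval_measurable [measurable]: "(%xi. mono_eval beta (complex_vec xi)) \<in> borel_measurable borel"
 unfolding mono_eval_def complex_vec_nth by measurable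

lemma poly_eval_superset:
 assumes "finite S" "Poly_Mapping.keys a \<subseteq> S"
 shows "poly_eval a xi = (\<Sum>beta\<in>S. Poly_Mapping.lookup a beta * mono_eval beta (complex_vec xi))"
 unfolding poly_eval_def using assms by (intro sum.mono_neutral_left) (auto simp: in_keys_iff)

lemma poly_eval_add: "poly_eval (a + b) xi = poly_eval a xi + poly_eval b xi"
proof -
 let ?S = "Poly_Mapping.keys a \<union> Poly_Mapping.keys b"
 have "Poly_Mapping.keys (a + b) \<subseteq> ?S" by (rule Poly_Mapping.keys_add)
 then have "poly_eval (a + b) xi = (\<Sum>beta\<in>?S. Poly_Mapping.lookup (a + b) beta * mono_eval beta (complex_vec xi))"
  by (intro poly_eval_superset) auto
 also have "... = poly_eval a xi + poly_eval b xi"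
  by (simp add: lookup_add distrib_right sum.distrib poly_eval_superset[of ?S])
 finally show ?thesis .
qed

lemma polynomial_fun_mono: "polynomial_fun (%xi. c * mono_eval beta (complex_vec xi))"
proof -
 have "poly_eval (Poly_Mapping.single beta c) xi = c * mono_eval beta (complex_vec xi)" for xi
  by (subst poly_eval_superset[of "{beta}"]) auto
 then show ?thesis unfolding polynomial_fun_def by (intro exI[of _ "Poly_Mapping.single beta c"]) auto
qed

lemma polynomial_fun_const: "polynomial_fun (%xi. c)"
 using polynomial_fun_mono[of c 0] by simp

lemma polynomial_fun_coord: "polynomial_fun (%xi. complex_of_real (xi $ j))"
 using polynomial_fun_mono[of 1 "axis j (Suc 0)"] by simp

lemma polynomial_fun_add:
 assumes "polynomial_fun f" "polynomial_fun g" shows "polynomial_fun (%xi. f xi + g xi)"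
proof -
 obtain a b where "f = poly_eval a" "g = poly_eval b" using assms by (auto simp: polynomial_fun_def)
 then have "(%xi. f xi + g xi) = poly_eval (a + b)" by (simp add: poly_eval_add fun_eq_iff)
 then show ?thesis by (auto simp: polynomial_fun_def)
qed

lemma polynomial_fun_sum:
 assumes "!!i. i \<in> I ==> polynomial_fun (f i)" shows "polynomial_fun (%xi. \<Sum>i\<in>I. f i xi)"
 using assms by (induction I rule: infinite_finite_induct) (auto intro: polynomial_fun_const polynomial_fun_add)

lemma polynomial_fun_mult:
 assumes "polynomial_fun f" "polynomial_fun g" shows "polynomial_fun (%xi. f xi * g xi)"
proof -
 obtain a b where ab: "f = poly_eval a" "g = poly_eval b" using assms by (auto simp: polynomial_fun_def)
 have "f xi * g xi = (\<Sum>beta\<in>Poly_Mapping.keys a. \<Sum>gam\<in>Poly_Mapping.keys b.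
   (Poly_Mapping.lookup a beta * Poly_Mapping.lookup b gam) * mono_eval (beta + gam) (complex_vec xi))" for xi
  unfolding ab poly_eval_def sum_product by (intro sum.cong refl) (simp add: mono_eval_add)
 then show ?thesis by (simp only:) (intro polynomial_fun_sum polynomial_fun_mono)
qed

lemma polynomial_fun_power: "polynomial_fun f ==> polynomial_fun (%xi. f xi ^ n)"
 by (induction n) (auto intro: polynomial_fun_const polynomial_fun_mult)

lemma polynomial_fun_prod:
 assumes "!!i. i \<in> I ==> polynomial_fun (f i)" shows "polynomial_fun (%xi. \<Prod>i\<in>I. f i xi)"
 using assms by (induction I rule: infinite_finite_induct) (auto intro: polynomial_fun_const polynomial_fun_mult)

lemma polynomial_fun_mono_linear: "polynomial_fun (%xi. c * mono_eval beta (complex_vec (M *v xi)))"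
proof -
 have "polynomial_fun (%xi. c * (\<Prod>j\<in>UNIV. (\<Sum>k\<in>UNIV. complex_of_real (M $ j $ k) * complex_of_real (xi $ k)) ^ (beta $ j)))"
  by (intro polynomial_fun_mult polynomial_fun_const polynomial_fun_prod polynomial_fun_power polynomial_fun_sum polynomial_fun_coord)
 then show ?thesis by (simp add: mono_eval_def matrix_vector_mult_def)
qed

lemma finite_support_has_sum:
 fixes c :: "nat^'d => complex"
 assumes "finite S" "!!beta. beta \<notin> S ==> c beta = 0"
 shows "((%beta. c beta * mono_eval beta z) has_sum (\<Sum>beta\<in>S. c beta * mono_eval beta z)) UNIV"
 by (rule has_sum_finite_neutralI[OF assms(1)]) (use assms(2) in auto)

text \<open>Makes \<^const>\<open>poly_coeffs\<close>, a definite description, meaningful.\<close>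
lemma poly_eval_inject:
 assumes "poly_eval a = poly_eval b" shows "a = b"
proof (rule poly_mapping_eqI)
 fix beta
 let ?S = "Poly_Mapping.keys a \<union> Poly_Mapping.keys b"
 have "Poly_Mapping.lookup a beta - Poly_Mapping.lookup b beta = 0"
 proof (rule multi_power_series_unique[of 1 "%beta. Poly_Mapping.lookup a beta - Poly_Mapping.lookup b beta"])
  fix xi
  have "(\<Sum>beta\<in>?S. (Poly_Mapping.lookup a beta - Poly_Mapping.lookup b beta) * mono_eval beta (complex_vec xi)) = poly_eval a xi - poly_eval b xi"
   by (simp add: left_diff_distrib sum_subtractf poly_eval_superset[of ?S])
  also have "... = 0" using assms by simp
  finally show "((%beta. (Poly_Mapping.lookup a beta - Poly_Mapping.lookup b beta) * mono_eval beta (complex_vec xi)) has_sum 0) UNIV"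
   using finite_support_has_sum[of ?S "%beta. Poly_Mapping.lookup a beta - Poly_Mapping.lookup b beta" "complex_vec xi"]
   by (simp add: in_keys_iff)
 qed simp
 then show "Poly_Mapping.lookup a beta = Poly_Mapping.lookup b beta" by simp
qed

lemma poly_coeffs_eval:
 assumes "polynomial_fun f" shows "poly_eval (poly_coeffs f) = f"
proof -
 obtain a where a: "f = poly_eval a" using assms unfolding polynomial_fun_def by blast
 have "poly_coeffs f = a"
  unfolding poly_coeffs_def
 proof (rule the_equality)
  show "f = poly_eval a" by (rule a)
  show "b = a" if "f = poly_eval b" for b using that a by (intro poly_eval_inject) simp
 qed
 then show ?thesis by (simp add: a)
qed

text \<open>Integrability against all polynomial weights is what repeated differentiation under the integral sign requires.\<close>
definition rapid :: "(real^'d => complex) => bool" where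
 "rapid g \<longleftrightarrow> g \<in> borel_measurable borel \<and> (\<forall>k. integrable lborel (%xi. (1 + norm xi) ^ k * cmod (g xi)))"

definition inv_fourier :: "(real^'d => complex) => real^'d => complex" where
 "inv_fourier g x = (LINT xi|lborel. g xi * character x xi)"

lemma rapid_integrable:
 assumes "rapid g"
 shows "integrable lborel g" and "integrable lborel (%xi. norm xi * cmod (g xi))"
proof -
 have [measurable]: "g \<in> borel_measurable borel" and i: "!!k. integrable lborel (%xi. (1 + norm xi) ^ k * cmod (g xi))"
  using assms by (auto simp: rapid_def)
 show "integrable lborel g"
  by (rule Bochner_Integration.integrable_bound[OF i[of 0]]) auto
 show "integrable lborel (%xi. norm xi * cmod (g xi))"
  by (rule Bochner_Integration.integrable_bound[OF i[of 1]]) (auto intro!: AE_I2 mult_right_mono)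
qed

lemma rapid_mult_coord:
 assumes "rapid g" shows "rapid (%xi. c * complex_of_real (xi $ j) * g xi)"
proof -
 have [measurable]: "g \<in> borel_measurable borel" and i: "!!k. integrable lborel (%xi. (1 + norm xi) ^ k * cmod (g xi))"
  using assms by (auto simp: rapid_def)
 have "integrable lborel (%xi. (1 + norm xi) ^ k * cmod (c * complex_of_real (xi $ j) * g xi))" for k
 proof (rule Bochner_Integration.integrable_bound)
  show "integrable lborel (%xi. cmod c * ((1 + norm xi) ^ Suc k * cmod (g xi)))" by (intro integrable_mult_right i)
  have "(1 + norm xi) ^ k * (cmod c * \<bar>xi $ j\<bar> * cmod (g xi)) <= cmod c * ((1 + norm xi) ^ Suc k * cmod (g xi))" for xi
  proof -
   have "\<bar>xi $ j\<bar> <= 1 + norm xi" using component_le_norm_cart[of xi j] by simp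
   then have "\<bar>xi $ j\<bar> * ((1 + norm xi) ^ k * (cmod c * cmod (g xi))) <= (1 + norm xi) * ((1 + norm xi) ^ k * (cmod c * cmod (g xi)))"
    by (rule mult_right_mono) simp
   then show ?thesis by (simp add: mult_ac)
  qed
  then show "AE xi in lborel. norm ((1 + norm xi) ^ k * cmod (c * complex_of_real (xi $ j) * g xi)) <= norm (cmod c * ((1 + norm xi) ^ Suc k * cmod (g xi)))"
   by (intro AE_I2) (simp add: norm_mult abs_mult)
 qed measurable
 then show ?thesis unfolding rapid_def by auto
qed

lemma norm_exp_ii_minus_1: "cmod (exp (- (\<i> * complex_of_real a)) - 1) <= \<bar>a\<bar>"
proof -
 have "cmod (exp (\<i> * complex_of_real (- a)) - 1) = 2 * \<bar>sin (- a / 2)\<bar>" by (rule dist_exp_i_1)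
 also have "... <= 2 * \<bar>- a / 2\<bar>" by (intro mult_left_mono abs_sin_x_le_abs_x) simp
 finally have "cmod (exp (\<i> * complex_of_real (- a)) - 1) <= \<bar>a\<bar>" by simp
 then show ?thesis by simp
qed

lemma has_vector_derivative_limit:
 fixes G :: "real => 'a::real_normed_vector"
 shows "(G has_vector_derivative D) (at 0) \<longleftrightarrow> ((%h. (G h - G 0) /\<^sub>R h) \<longlongrightarrow> D) (at 0)"
proof -
 have bl: "bounded_linear (%h. h *\<^sub>R D)" by (rule bounded_linear_scaleR_left)
 have "norm (G h - G 0 - h *\<^sub>R D) / norm h = norm ((G h - G 0) /\<^sub>R h - D)" if "h ~= 0" for h :: real
 proof -
  have "(G h - G 0) /\<^sub>R h - D = (G h - G 0 - h *\<^sub>R D) /\<^sub>R h"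
   using that by (simp add: scaleR_diff_right)
  then show ?thesis using that by (simp add: divide_inverse mult.commute)
 qed
 then have ev: "\<forall>\<^sub>F h in at 0. norm (G h - G 0 - h *\<^sub>R D) / norm h = norm ((G h - G 0) /\<^sub>R h - D)"
  by (auto simp: eventually_at_filter)
 have "(G has_vector_derivative D) (at 0) \<longleftrightarrow> ((%h. norm (G h - G 0 - h *\<^sub>R D) / norm h) \<longlongrightarrow> 0) (at 0)"
  using bl by (simp add: has_vector_derivative_def has_derivative_iff_norm)
 also have "... \<longleftrightarrow> ((%h. norm ((G h - G 0) /\<^sub>R h - D)) \<longlongrightarrow> 0) (at 0)"
  by (rule tendsto_cong[OF ev])
 also have "... \<longleftrightarrow> ((%h. (G h - G 0) /\<^sub>R h) \<longlongrightarrow> D) (at 0)"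
  unfolding tendsto_norm_zero_iff by (rule Lim_null[symmetric])
 finally show ?thesis .
qed

text \<open>Dominated convergence for the difference quotients of the character.\<close>
lemma partial_deriv_inv_fourier:
 fixes g :: "real^'d => complex"
 assumes g: "rapid g"
 shows "partial_deriv j (inv_fourier g) x = inv_fourier (%xi. - \<i> * complex_of_real (xi $ j) * g xi) x"
proof -
 have gm[measurable]: "g \<in> borel_measurable borel" using g by (simp add: rapid_def)
 note ri = rapid_integrable[OF g]
 define G where "G = (%t. inv_fourier g (x + t *\<^sub>R axis j 1))"
 define D where "D = inv_fourier (%xi. - \<i> * complex_of_real (xi $ j) * g xi) x"
 have ch: "character (x + t *\<^sub>R axis j 1) xi = character x xi * exp (- (\<i> * complex_of_real (t * xi $ j)))" for t xi
 proof -
  have "(t *\<^sub>R axis j 1) \<bullet> xi = t * xi $ j" by (subst inner_commute) (simp add: inner_axis)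
  then show ?thesis unfolding character_add_left by (simp only: character_def)
 qed
 have int: "integrable lborel (%xi. g xi * character y xi)" for y
  by (rule Bochner_Integration.integrable_bound[OF ri(1)]) (auto simp: norm_mult)
 have "((%h. (G h - G 0) /\<^sub>R h) \<longlongrightarrow> D) (at 0)"
  unfolding tendsto_at_iff_sequentially
 proof (intro allI impI)
  fix h :: "nat => real" assume h: "\<forall>i. h i \<in> UNIV - {0}" "h \<longlonglongrightarrow> 0"
  have eq: "(G (h n) - G 0) /\<^sub>R h n = (LINT xi|lborel. g xi * character x xi * ((exp (- (\<i> * complex_of_real (h n * xi $ j))) - 1) /\<^sub>R h n))" for n
  proof -
   have "(G (h n) - G 0) = (LINT xi|lborel. g xi * character (x + h n *\<^sub>R axis j 1) xi - g xi * character x xi)"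
    unfolding G_def inv_fourier_def using int by (subst Bochner_Integration.integral_diff) auto
   also have "... = (LINT xi|lborel. g xi * character x xi * (exp (- (\<i> * complex_of_real (h n * xi $ j))) - 1))"
    unfolding ch by (simp add: algebra_simps)
   finally have "(G (h n) - G 0) /\<^sub>R h n = (LINT xi|lborel. (g xi * character x xi * (exp (- (\<i> * complex_of_real (h n * xi $ j))) - 1)) /\<^sub>R h n)"
    by simp
   then show ?thesis by simp
  qed
  have "(%n. LINT xi|lborel. g xi * character x xi * ((exp (- (\<i> * complex_of_real (h n * xi $ j))) - 1) /\<^sub>R h n))
    \<longlonglongrightarrow> (LINT xi|lborel. g xi * character x xi * (- \<i> * complex_of_real (xi $ j)))"
  proof (rule integral_dominated_convergence[where w = "%xi. norm xi * cmod (g xi)"])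
   show "AE xi in lborel. (%n. g xi * character x xi * ((exp (- (\<i> * complex_of_real (h n * xi $ j))) - 1) /\<^sub>R h n))
     \<longlonglongrightarrow> g xi * character x xi * (- \<i> * complex_of_real (xi $ j))"
   proof (intro AE_I2 tendsto_intros)
    fix xi :: "real^'d"
    have "((%t. exp (- (\<i> * complex_of_real (t * xi $ j)))) has_vector_derivative (- \<i> * complex_of_real (xi $ j))) (at 0)"
    proof -
     have "((%z. exp (- (\<i> * (z * complex_of_real (xi $ j))))) has_field_derivative (- \<i> * complex_of_real (xi $ j))) (at (complex_of_real 0))"
      by (auto intro!: derivative_eq_intros)
     from has_vector_derivative_real_field[OF this] show ?thesis by simp
    qed
    then have "((%t. (exp (- (\<i> * complex_of_real (t * xi $ j))) - 1) /\<^sub>R t) \<longlongrightarrow> - \<i> * complex_of_real (xi $ j)) (at 0)"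
     by (subst (asm) has_vector_derivative_limit) simp
    then show "(%n. (exp (- (\<i> * complex_of_real (h n * xi $ j))) - 1) /\<^sub>R h n) \<longlonglongrightarrow> - \<i> * complex_of_real (xi $ j)"
     using h unfolding tendsto_at_iff_sequentially o_def by blast
   qed
   have "cmod (g xi * character x xi * ((exp (- (\<i> * complex_of_real (h n * xi $ j))) - 1) /\<^sub>R h n)) <= norm xi * cmod (g xi)" for n xi
   proof -
    have h0: "h n ~= 0" using h by auto
    have "cmod ((exp (- (\<i> * complex_of_real (h n * xi $ j))) - 1) /\<^sub>R h n) <= \<bar>h n * xi $ j\<bar> / \<bar>h n\<bar>"
     using norm_exp_ii_minus_1[of "h n * xi $ j"] h0 by (simp add: divide_inverse mult.commute mult_left_mono)
    also have "... <= norm xi" using h0 component_le_norm_cart[of xi j] by (simp add: abs_mult)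
    finally have "cmod ((exp (- (\<i> * complex_of_real (h n * xi $ j))) - 1) /\<^sub>R h n) * cmod (g xi) <= norm xi * cmod (g xi)"
     by (rule mult_right_mono) simp
    then show ?thesis by (simp add: norm_mult mult_ac)
   qed
   then show "!!n. AE xi in lborel. cmod (g xi * character x xi * ((exp (- (\<i> * complex_of_real (h n * xi $ j))) - 1) /\<^sub>R h n)) <= norm xi * cmod (g xi)"
    by (intro AE_I2)
  qed (use ri in measurable)
  also have "(LINT xi|lborel. g xi * character x xi * (- \<i> * complex_of_real (xi $ j))) = D"
   unfolding D_def inv_fourier_def by (simp add: mult_ac)
  finally show "((%h. (G h - G 0) /\<^sub>R h) \<circ> h) \<longlonglongrightarrow> D"
   unfolding o_def eq .
 qed
 then have "(G has_vector_derivative D) (at 0)"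
  by (simp only: has_vector_derivative_limit)
 then show ?thesis
  unfolding partial_deriv_def G_def D_def by (rule vector_derivative_at)
qed

lemma multi_deriv_inv_fourier:
 fixes g :: "real^'d => complex"
 assumes g: "rapid g"
 shows "multi_deriv beta (inv_fourier g) = inv_fourier (%xi. (- \<i>) ^ (\<Sum>j\<in>UNIV. beta $ j) * mono_eval beta (complex_vec xi) * g xi)"
proof -
 let ?f = "%j xi. - \<i> * complex_of_real (xi $ j)"
 have pow: "rapid (%xi. ?f j xi ^ k * g xi) \<and> (partial_deriv j ^^ k) (inv_fourier g) = inv_fourier (%xi. ?f j xi ^ k * g xi)"
  if "rapid g" for k j and g :: "real^'d => complex"
 proof (induction k)
  case 0
  then show ?case using that by simp
 next
  case (Suc k)
  have "rapid (%xi. - \<i> * complex_of_real (xi $ j) * (?f j xi ^ k * g xi))" by (rule rapid_mult_coord) (use Suc in blast)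
  moreover have "partial_deriv j (inv_fourier (%xi. ?f j xi ^ k * g xi)) = inv_fourier (%xi. - \<i> * complex_of_real (xi $ j) * (?f j xi ^ k * g xi))"
   using Suc by (intro ext partial_deriv_inv_fourier) blast
  ultimately show ?case using Suc by (simp add: mult.assoc)
 qed
 have fold: "rapid (%xi. (\<Prod>j\<leftarrow>js. ?f j xi ^ (beta $ j)) * g xi) \<and>
   foldr (%j. partial_deriv j ^^ (beta $ j)) js (inv_fourier g) = inv_fourier (%xi. (\<Prod>j\<leftarrow>js. ?f j xi ^ (beta $ j)) * g xi)" for js
 proof (induction js)
  case Nil
  then show ?case using g by simp
 next
  case (Cons j js)
  with pow[of "%xi. (\<Prod>j\<leftarrow>js. ?f j xi ^ (beta $ j)) * g xi" j "beta $ j"] show ?case by (simp add: mult.assoc)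
 qed
 define js where "js = (SOME js. distinct js \<and> set js = (UNIV :: 'd set))"
 have "\<exists>js. distinct js \<and> set js = (UNIV :: 'd set)" using finite_distinct_list[of "UNIV :: 'd set"] by auto
 then have js: "distinct js \<and> set js = UNIV" unfolding js_def by (rule someI_ex)
 have "(\<Prod>j\<leftarrow>js. ?f j xi ^ (beta $ j)) = (- \<i>) ^ (\<Sum>j\<in>UNIV. beta $ j) * mono_eval beta (complex_vec xi)" for xi :: "real^'d"
 proof -
  have "(\<Prod>j\<leftarrow>js. ?f j xi ^ (beta $ j)) = (\<Prod>j\<in>UNIV. ?f j xi ^ (beta $ j))"
   using js prod.distinct_set_conv_list[of js "%j. ?f j xi ^ (beta $ j)"] by simp
  also have "... = (\<Prod>j\<in>UNIV. (- \<i>) ^ (beta $ j)) * (\<Prod>j\<in>UNIV. complex_of_real (xi $ j) ^ (beta $ j))"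
   unfolding power_mult_distrib prod.distrib ..
  finally show ?thesis by (simp add: mono_eval_def power_sum)
 qed
 then show ?thesis using fold[of js] by (simp add: multi_deriv_def js_def)
qed

theorem poly_diff_op_inv_fourier:
 fixes g :: "real^'d => complex"
 assumes g: "rapid g" and q: "polynomial_fun q"
 shows "integrable lborel (%xi. q xi * g xi)"
  and "poly_diff_op q (inv_fourier g) x = inv_fourier (%xi. q xi * g xi) x"
proof -
 define a where "a = poly_coeffs q"
 have q: "q = poly_eval a" using poly_coeffs_eval[OF q] by (simp add: a_def)
 have [measurable]: "g \<in> borel_measurable borel" using g by (simp add: rapid_def)
 have mint: "integrable lborel (%xi. mono_eval beta (complex_vec xi) * g xi)" for beta
 proof (rule Bochner_Integration.integrable_bound)
  let ?k = "\<Sum>j\<in>UNIV. beta $ j"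
  show "integrable lborel (%xi. (1 + norm xi) ^ ?k * cmod (g xi))" using g by (simp add: rapid_def)
  have "cmod (mono_eval beta (complex_vec xi)) <= (1 + norm xi) ^ ?k" for xi
  proof -
   have "cmod (mono_eval beta (complex_vec xi)) = (\<Prod>j\<in>UNIV. \<bar>xi $ j\<bar> ^ (beta $ j))"
    by (simp add: mono_eval_def norm_power flip: prod_norm)
   also have "... <= (\<Prod>j\<in>UNIV. (1 + norm xi) ^ (beta $ j))"
    using component_le_norm_cart[of xi] by (intro prod_mono conjI power_mono) (auto intro: add_increasing)
   finally show ?thesis by (simp add: power_sum)
  qed
  then show "AE xi in lborel. norm (mono_eval beta (complex_vec xi) * g xi) <= norm ((1 + norm xi) ^ ?k * cmod (g xi))"
   by (intro AE_I2) (simp add: norm_mult abs_mult mult_right_mono)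
  show "(%xi. mono_eval beta (complex_vec xi) * g xi) \<in> borel_measurable lborel"
   by measurable
 qed
 have int: "integrable lborel (%xi. Poly_Mapping.lookup a beta * mono_eval beta (complex_vec xi) * g xi)" for beta
  using integrable_mult_right[OF mint[of beta], of "Poly_Mapping.lookup a beta"] by (simp add: mult.assoc)
 show "integrable lborel (%xi. q xi * g xi)"
  unfolding q poly_eval_def sum_distrib_right by (intro Bochner_Integration.integrable_sum int)
 have one: "Poly_Mapping.lookup a beta * \<i> ^ (\<Sum>j\<in>UNIV. beta $ j) * multi_deriv beta (inv_fourier g) x
   = (LINT xi|lborel. Poly_Mapping.lookup a beta * mono_eval beta (complex_vec xi) * g xi * character x xi)" for beta
 proof -
  let ?k = "\<Sum>j\<in>UNIV. beta $ j"
  have "Poly_Mapping.lookup a beta * \<i> ^ ?k * multi_deriv beta (inv_fourier g) x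
    = (LINT xi|lborel. (Poly_Mapping.lookup a beta * \<i> ^ ?k) * ((- \<i>) ^ ?k * mono_eval beta (complex_vec xi) * g xi * character x xi))"
   unfolding multi_deriv_inv_fourier[OF g] inv_fourier_def by (rule integral_mult_right_zero[symmetric])
  also have "... = (LINT xi|lborel. (\<i> ^ ?k * (- \<i>) ^ ?k) * (Poly_Mapping.lookup a beta * mono_eval beta (complex_vec xi) * g xi * character x xi))"
   by (intro Bochner_Integration.integral_cong) (simp_all only: mult_ac)
  also have "\<i> ^ ?k * (- \<i>) ^ ?k = 1" by (simp flip: power_mult_distrib)
  finally show ?thesis by simp
 qed
 have intc: "integrable lborel (%xi. Poly_Mapping.lookup a beta * mono_eval beta (complex_vec xi) * g xi * character x xi)" for beta
  by (rule Bochner_Integration.integrable_bound[OF int[of beta]])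
    (auto simp: norm_mult intro!: borel_measurable_times borel_measurable_integrable[OF int[of beta]])
 have "poly_diff_op q (inv_fourier g) x = (\<Sum>beta\<in>Poly_Mapping.keys a.
   LINT xi|lborel. Poly_Mapping.lookup a beta * mono_eval beta (complex_vec xi) * g xi * character x xi)"
  unfolding poly_diff_op_def a_def[symmetric] one ..
 also have "... = inv_fourier (%xi. q xi * g xi) x"
  unfolding inv_fourier_def q poly_eval_def sum_distrib_right
  by (rule Bochner_Integration.integral_sum[symmetric]) (rule intc)
 finally show "poly_diff_op q (inv_fourier g) x = inv_fourier (%xi. q xi * g xi) x" .
qed

lemma polynomial_fun_fps_exp:
 assumes F: "!!k. polynomial_fun (%xi. fps_nth (F xi) k)"
 shows "polynomial_fun (%xi. fps_nth (fps_exp 1 oo F xi) l)"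
proof -
 have "polynomial_fun (%xi. fps_nth (F xi ^ i) k)" for i k
 proof (induction i arbitrary: k)
  case 0
  show ?case by (auto intro: polynomial_fun_const)
 next
  case (Suc i)
  show ?case unfolding power_Suc fps_mult_nth by (intro polynomial_fun_sum polynomial_fun_mult F Suc)
 qed
 then show ?thesis
  unfolding fps_compose_nth by (intro polynomial_fun_sum polynomial_fun_mult polynomial_fun_const)
qed

lemma polynomial_fun_Q_symbol: "polynomial_fun (Q_symbol Ups A m l n)"
proof -
 let ?S = "%r xi. of_nat n * S_poly Ups A m r (complex_vec (matrix_inv A *v xi))"
 have S: "polynomial_fun (?S r)" for r
  unfolding S_poly_def by (intro polynomial_fun_mult polynomial_fun_const polynomial_fun_sum polynomial_fun_mono_linear)
 have "polynomial_fun (%xi. fps_nth (Abs_fps (%l. if l = 0 then 0 else ?S l xi / fact l)) k)" for k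
  using polynomial_fun_mult[OF polynomial_fun_const[of "1 / fact k"] S[of k]] polynomial_fun_const[of 0] by (cases "k = 0") simp_all
 then have "polynomial_fun (%xi. fps_nth (fps_exp 1 oo Abs_fps (%l. if l = 0 then 0 else ?S l xi / fact l)) l)"
  by (rule polynomial_fun_fps_exp)
 then show ?thesis
  unfolding Q_symbol_def bell_def by (intro polynomial_fun_mult polynomial_fun_const)
qed

lemma attractor_inv_fourier:
 "attractor P t = inv_fourier (%xi::real^'d. complex_of_real (1 / (2 * pi) ^ CARD('d)) * exp (- (complex_of_real t * P xi)))"
 by (simp add: fun_eq_iff attractor_def inv_fourier_def character_def mult.assoc)

section \<open>Anisotropic dilations\<close>

definition cpoly :: "((nat^'d) \<Rightarrow>\<^sub>0 complex) => complex^'d => complex" where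
 "cpoly a z = (\<Sum>beta\<in>Poly_Mapping.keys a. Poly_Mapping.lookup a beta * mono_eval beta z)"

lemma poly_eval_cpoly: "poly_eval a xi = cpoly a (complex_vec xi)"
 by (simp add: poly_eval_def cpoly_def)

definition wt :: "nat^'d => nat^'d => nat" where
 "wt kap beta = (\<Sum>j\<in>UNIV. beta $ j * kap $ j)"

definition dil :: "nat^'d => 'a::real_normed_field => 'a^'d => 'a^'d" where
 "dil kap t z = (\<chi> j. t ^ (kap $ j) * z $ j)"

lemma dil_nth [simp]: "dil kap t z $ j = t ^ (kap $ j) * z $ j"
 by (simp add: dil_def)

lemma mono_eval_dil: "mono_eval beta (dil kap t z) = t ^ wt kap beta * mono_eval beta z"
 by (simp add: mono_eval_def wt_def power_mult_distrib prod.distrib power_sum mult.commute flip: power_mult)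

lemma complex_vec_dil: "complex_vec (dil kap t xi) = dil kap (of_real t) (complex_vec xi)"
 by (simp add: vec_eq_iff)

lemma norm_mono_eval_le:
 assumes u: "u >= 0" and z: "!!j. cmod (z $ j) <= u ^ (kap $ j)"
 shows "cmod (mono_eval beta z) <= u ^ wt kap beta"
proof -
 have "cmod (mono_eval beta z) = (\<Prod>j\<in>UNIV. cmod (z $ j) ^ (beta $ j))"
  by (simp add: mono_eval_def norm_power flip: prod_norm)
 also have "... <= (\<Prod>j\<in>UNIV. (u ^ (kap $ j)) ^ (beta $ j))"
  by (intro prod_mono conjI power_mono z) auto
 also have "... = u ^ wt kap beta"
  by (simp add: wt_def power_sum mult.commute flip: power_mult)
 finally show ?thesis .
qed

text \<open>The quasi-norm adapted to the dilations.\<close>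
definition qn :: "nat^'d => complex^'d => real" where
 "qn kap z = (\<Sum>j\<in>UNIV. root (kap $ j) (cmod (z $ j)))"

lemma sum_abs_weighted_mono: "finite {beta :: nat^'d. wt kap beta = k}" if "!!j. kap $ j >= 1"
proof -
 have "{beta :: nat^'d. wt kap beta = k} \<subseteq> {beta. \<forall>j. beta $ j \<in> {..k}}"
 proof
  fix beta :: "nat^'d" assume b: "beta \<in> {beta. wt kap beta = k}"
  have "beta $ j <= k" for j
  proof -
   have "beta $ j <= beta $ j * kap $ j" using that[of j] by simp
   also have "... <= wt kap beta" unfolding wt_def by (rule member_le_sum) auto
   finally show ?thesis using b by simp
  qed
  then show "beta \<in> {beta. \<forall>j. beta $ j \<in> {..k}}" by simp
 qed
 moreover have "finite {beta :: nat^'d. \<forall>j. beta $ j \<in> {..k}}"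
 proof (rule finite_subset)
  show "{beta :: nat^'d. \<forall>j. beta $ j \<in> {..k}} \<subseteq> vec_lambda ` (PiE UNIV (%_. {..k}))"
  proof
   fix beta :: "nat^'d" assume "beta \<in> {beta. \<forall>j. beta $ j \<in> {..k}}"
   then show "beta \<in> vec_lambda ` (PiE UNIV (%_. {..k}))"
    by (intro image_eqI[of _ _ "vec_nth beta"]) auto
  qed
  show "finite (vec_lambda ` (PiE (UNIV :: 'd set) (%_. {..k})))"
   by (intro finite_imageI finite_PiE) auto
 qed
 ultimately show ?thesis by (rule finite_subset)
qed

lemma power_plus_one_le:
 fixes x :: real
 assumes "x >= 0" "k >= 1" shows "x ^ k + 1 <= (x + 1) ^ k"
 using assms(2)
proof (induction k rule: nat_induct_at_least)
 case base
 show ?case by simp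
next
 case (Suc k)
 have "x ^ Suc k + 1 <= (x + 1) * (x ^ k + 1)" using assms(1) by (simp add: algebra_simps)
 also have "... <= (x + 1) * (x + 1) ^ k" using Suc assms(1) by (intro mult_left_mono) auto
 finally show ?case by simp
qed

text \<open>A polynomial whose monomials have weighted length \<open>2\<close> is homogeneous of degree \<open>2 * m\<close> under the dilations with integer exponents \<open>kap\<close>. Integer exponents make everything a power series in the dilation parameter.\<close>
locale dilation =
 fixes kap :: "nat^'d" and m :: nat
 assumes kappa_ge: "!!j. kap $ j >= 1" and kappa_le: "!!j. kap $ j <= m"
begin

lemma kappa_pos [simp]: "kap $ j > 0" "kap $ j ~= 0" using kappa_ge[of j] by simp_all

lemma m_ge: "m >= 1" using kappa_ge kappa_le le_trans by blast

lemma qn_nonneg: "qn kap z >= 0"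
 unfolding qn_def by (intro sum_nonneg) (simp add: real_root_ge_zero)

lemma component_le_qn: "cmod (z $ j) <= qn kap z ^ (kap $ j)"
proof -
 have "root (kap $ j) (cmod (z $ j)) <= qn kap z"
  unfolding qn_def by (rule member_le_sum) (auto simp: real_root_ge_zero)
 then have "root (kap $ j) (cmod (z $ j)) ^ (kap $ j) <= qn kap z ^ (kap $ j)"
  by (intro power_mono) (auto simp: real_root_ge_zero)
 then show ?thesis by simp
qed

lemma qn_dil: "t >= 0 ==> qn kap (dil kap (complex_of_real t) z) = t * qn kap z"
 by (simp add: qn_def norm_mult norm_power real_root_mult real_root_power_cancel sum_distrib_left)

lemma continuous_on_qn: "continuous_on S (qn kap)"
 unfolding qn_def by (intro continuous_intros)

text \<open>This is why unit discs are a harmless scale for the difference argument.\<close>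
lemma qn_perturb:
 assumes "!!j. cmod (z' $ j - z $ j) <= 1"
 shows "qn kap z' <= qn kap z + real CARD('d)"
proof -
 have "root (kap $ j) (cmod (z' $ j)) <= root (kap $ j) (cmod (z $ j)) + 1" for j
 proof -
  define x where "x = root (kap $ j) (cmod (z $ j))"
  have x: "x >= 0" "x ^ (kap $ j) = cmod (z $ j)" by (auto simp: x_def real_root_ge_zero)
  have "cmod (z' $ j) <= cmod (z $ j) + 1"
   using norm_triangle_ineq[of "z $ j" "z' $ j - z $ j"] assms[of j] by simp
  also have "... <= (x + 1) ^ (kap $ j)"
   using power_plus_one_le[OF x(1) kappa_ge[of j]] x(2) by simp
  finally have "root (kap $ j) (cmod (z' $ j)) <= root (kap $ j) ((x + 1) ^ (kap $ j))"
   by (intro real_root_le_mono) auto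
  also have "... = x + 1" using x by (intro real_root_power_cancel) auto
  finally show ?thesis by (simp add: x_def)
 qed
 then have "qn kap z' <= (\<Sum>j\<in>UNIV. root (kap $ j) (cmod (z $ j)) + 1)" unfolding qn_def by (intro sum_mono)
 then show ?thesis by (simp add: qn_def sum.distrib)
qed

lemma dil_dil_inverse: "t > 0 ==> dil kap (complex_of_real t) (dil kap (complex_of_real (1 / t)) z) = z"
 by (simp add: vec_eq_iff power_one_over)

lemma compact_qn_sphere: "compact {z. qn kap z = 1}"
proof -
 have "norm z <= real CARD('d) * 1" if "qn kap z = 1" for z
  by (rule norm_le_of_components) (use component_le_qn[of z] that in simp)
 then have "bounded {z. qn kap z = 1}" by (auto simp: bounded_iff)
 moreover have "closed {z. qn kap z = 1}"
  using continuous_closed_preimage_constant[OF continuous_on_qn[of UNIV] closed_UNIV, of 1] by simp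
 ultimately show ?thesis by (simp add: compact_eq_bounded_closed)
qed

end

section \<open>Lower bounds in a complex strip\<close>

locale homogeneous_poly = dilation +
 fixes a :: "(nat^'d) \<Rightarrow>\<^sub>0 complex"
 assumes hom: "!!beta. beta \<in> Poly_Mapping.keys a ==> wt kap beta = 2 * m"
  and pd: "positive_definite (%xi. Re (poly_eval a xi))"
begin

lemma cpoly_dil: "cpoly a (dil kap t z) = t ^ (2 * m) * cpoly a z"
 unfolding cpoly_def sum_distrib_left
 by (intro sum.cong refl) (simp add: mono_eval_dil hom)

lemma continuous_on_cpoly: "continuous_on S (cpoly a)"
 unfolding cpoly_def mono_eval_def by (intro continuous_intros)

text \<open>
  On the compact unit sphere of the quasi-norm the real part is positive at real vectors, hence
  bounded below on a neighbourhood of them; dilating carries this to the strip.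
\<close>
lemma strip_lower_bound:
 obtains c C where "c > 0" "C >= 0"
  "!!z. (!!j. \<bar>Im (z $ j)\<bar> <= 1) ==> Re (cpoly a z) >= c * qn kap z ^ (2 * m) - C"
proof -
 define f where "f = (%z. Re (cpoly a z))"
 define g where "g = (%z::complex^'d. \<Sum>j\<in>UNIV. \<bar>Im (z $ j)\<bar>)"
 let ?S = "{z. qn kap z = 1}"
 have contf: "continuous_on A f" for A unfolding f_def by (intro continuous_intros continuous_on_cpoly)
 have contg: "continuous_on A g" for A unfolding g_def by (intro continuous_intros)
 have g0: "g z >= 0" for z unfolding g_def by (intro sum_nonneg) auto
 have real_vec_of: "\<exists>xi. z = complex_vec xi" if "g z = 0" for z
 proof -
  have "!!j. Im (z $ j) = 0" using that unfolding g_def by (subst (asm) sum_nonneg_eq_0_iff) auto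
  then show ?thesis by (intro exI[of _ "\<chi> j. Re (z $ j)"]) (simp add: vec_eq_iff complex_eq_iff)
 qed
 have fpos: "f z > 0" if "z \<in> ?S" "g z = 0" for z
 proof -
  obtain xi where xi: "z = complex_vec xi" using real_vec_of \<open>g z = 0\<close> by blast
  have "xi ~= 0"
  proof
   assume "xi = 0"
   then have "qn kap z = 0" by (simp add: xi qn_def)
   then show False using that by simp
  qed
  then have "Re (poly_eval a xi) >= 0" "Re (poly_eval a xi) ~= 0" using pd unfolding positive_definite_def by auto
  then show ?thesis by (simp add: f_def xi poly_eval_cpoly)
 qed
 have "\<exists>c>0. \<forall>z\<in>?S. g z = 0 --> f z > c"
 proof (cases "{z \<in> ?S. g z = 0} = {}")
  case False
  have "closed {z. g z = 0}"
   using continuous_closed_preimage_constant[OF contg[of UNIV] closed_UNIV, of 0] by simp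
  then have cpt: "compact (?S \<inter> {z. g z = 0})" by (intro compact_Int_closed compact_qn_sphere)
  have ne: "?S \<inter> {z. g z = 0} ~= {}" using False by auto
  from continuous_attains_inf[OF cpt ne contf]
  obtain x where x: "x \<in> ?S \<inter> {z. g z = 0}" and x': "\<forall>z \<in> ?S \<inter> {z. g z = 0}. f x <= f z"
   by (elim bexE)
  have "f x > 0" using x fpos[of x] by simp
  have "f x / 2 < f z" if "z \<in> ?S" "g z = 0" for z
   using x'[rule_format, of z] that \<open>f x > 0\<close> by simp
  then show ?thesis using \<open>f x > 0\<close> by (intro exI[of _ "f x / 2"]) simp
 qed (auto intro: exI[of _ 1])
 then obtain c where c: "c > 0" "!!z. z \<in> ?S ==> g z = 0 ==> f z > c" by blast
 have "\<exists>e>0. \<forall>z\<in>?S. g z < e --> f z > c"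
 proof (cases "{z \<in> ?S. f z <= c} = {}")
  case False
  have "closed {z. f z <= c}"
   using continuous_closed_preimage[OF contf[of UNIV] closed_UNIV closed_atMost[of c]] by (simp add: vimage_def)
  then have cpt: "compact (?S \<inter> {z. f z <= c})" by (intro compact_Int_closed compact_qn_sphere)
  have ne: "?S \<inter> {z. f z <= c} ~= {}" using False by auto
  from continuous_attains_inf[OF cpt ne contg]
  obtain x where x: "x \<in> ?S \<inter> {z. f z <= c}" and x': "\<forall>z \<in> ?S \<inter> {z. f z <= c}. g x <= g z"
   by (elim bexE)
  have "g x ~= 0" using c(2)[of x] x by auto
  then have "g x > 0" using g0[of x] by simp
  moreover have "\<forall>z\<in>?S. g z < g x --> f z > c"
  proof (intro ballI impI)
   fix z assume z: "z \<in> ?S" "g z < g x"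
   show "f z > c"
   proof (rule ccontr)
    assume "\<not> f z > c"
    then have "g x <= g z" using x' z by simp
    then show False using z by simp
   qed
  qed
  ultimately show ?thesis by blast
 next
  case True
  then have "\<forall>z\<in>?S. f z > c" by (auto simp: not_le)
  then show ?thesis by (intro exI[of _ 1]) simp
 qed
 then obtain e where e: "e > 0" "!!z. z \<in> ?S ==> g z < e ==> f z > c" by blast
 define u0 where "u0 = 1 + real CARD('d) / e"
 have u0: "u0 >= 1" using e by (simp add: u0_def)
 define L where "L = (\<Sum>beta\<in>Poly_Mapping.keys a. cmod (Poly_Mapping.lookup a beta))"
 have L0: "L >= 0" unfolding L_def by (intro sum_nonneg) auto
 have "f z >= c * qn kap z ^ (2 * m) - (c + L) * u0 ^ (2 * m)" if im: "!!j. \<bar>Im (z $ j)\<bar> <= 1" for z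
 proof (cases "qn kap z >= u0")
  case True
  define u where "u = qn kap z"
  have u: "u >= u0" "u > 0" "u >= 1" using True u0 by (auto simp: u_def)
  define z' where "z' = dil kap (complex_of_real (1 / u)) z"
  have z': "z = dil kap (complex_of_real u) z'" unfolding z'_def using dil_dil_inverse[OF u(2)] by simp
  have "qn kap z' = 1" using u qn_dil[of "1 / u" z] by (simp add: z'_def flip: u_def)
  moreover have "g z' < e"
  proof -
   have "\<bar>Im (z' $ j)\<bar> <= 1 / u" for j
   proof -
    have "Im (z' $ j) = (1 / u) ^ (kap $ j) * Im (z $ j)"
     by (simp add: z'_def flip: of_real_power of_real_divide)
    moreover have "(1 / u) ^ (kap $ j) <= (1 / u) ^ 1" using u kappa_ge by (intro power_decreasing) auto
    ultimately have "\<bar>Im (z' $ j)\<bar> = (1 / u) ^ (kap $ j) * \<bar>Im (z $ j)\<bar>"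
     using u by (simp add: abs_mult)
    also have "... <= (1 / u) ^ 1 * 1"
     using \<open>(1 / u) ^ (kap $ j) <= (1 / u) ^ 1\<close> im[of j] u by (intro mult_mono) auto
    finally show ?thesis by simp
   qed
   then have "g z' <= (\<Sum>j\<in>(UNIV :: 'd set). 1 / u)" unfolding g_def by (intro sum_mono)
   also have "... = real CARD('d) / u" by simp
   also have "... < e"
   proof -
    have "real CARD('d) / e < u" using u(1) by (simp add: u0_def)
    then show ?thesis using e(1) u(2) by (simp add: field_simps)
   qed
   finally show ?thesis .
  qed
  ultimately have "f z' > c" using e(2) by simp
  have "f z = u ^ (2 * m) * f z'"
   unfolding f_def z' cpoly_dil by (simp flip: of_real_power)
  also have "... >= u ^ (2 * m) * c" using \<open>f z' > c\<close> u by (intro mult_left_mono) auto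
  finally have "f z >= c * u ^ (2 * m)" by (simp add: mult.commute)
  moreover have "(c + L) * u0 ^ (2 * m) >= 0" using c L0 u0 by simp
  ultimately show ?thesis unfolding u_def by linarith
 next
  case False
  define u where "u = qn kap z"
  have u: "0 <= u" "u <= u0" using False qn_nonneg by (auto simp: u_def)
  have "cmod (cpoly a z) <= (\<Sum>beta\<in>Poly_Mapping.keys a. cmod (Poly_Mapping.lookup a beta) * u ^ (2 * m))"
   unfolding cpoly_def
  proof (rule sum_norm_le)
   fix beta assume b: "beta \<in> Poly_Mapping.keys a"
   have "cmod (mono_eval beta z) <= u ^ wt kap beta"
    by (rule norm_mono_eval_le[OF u(1)]) (simp add: u_def component_le_qn)
   then show "cmod (Poly_Mapping.lookup a beta * mono_eval beta z) <= cmod (Poly_Mapping.lookup a beta) * u ^ (2 * m)"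
    unfolding norm_mult hom[OF b] by (intro mult_left_mono) auto
  qed
  also have "... = L * u ^ (2 * m)" by (simp add: L_def sum_distrib_right)
  also have "... <= L * u0 ^ (2 * m)" using u L0 by (intro mult_left_mono power_mono) auto
  finally have "f z >= - (L * u0 ^ (2 * m))" unfolding f_def using abs_Re_le_cmod[of "cpoly a z"] by linarith
  moreover have "c * u ^ (2 * m) <= c * u0 ^ (2 * m)" using u c by (intro mult_left_mono power_mono) auto
  ultimately show ?thesis unfolding u_def by (simp add: algebra_simps)
 qed
 then show thesis using c L0 u0 by (intro that[of c "(c + L) * u0 ^ (2 * m)"]) (auto simp: f_def)
qed

end

section \<open>The exponential of the remainder\<close>

text \<open>The remainder begins in weighted degree \<open>2 * m + 1\<close>.\<close>
locale remainder_series = dilation +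
 fixes b :: "nat^'d => complex" and r B :: real
 assumes r: "0 < r" "r <= 1" and B: "0 <= B" and bB: "!!beta. cmod (b beta) <= B / r ^ (\<Sum>j\<in>UNIV. beta $ j)"
  and b0: "!!beta. wt kap beta <= 2 * m ==> b beta = 0"
begin

definition V :: "nat => complex^'d => complex" where
 "V k z = (\<Sum>beta | wt kap beta = k. b beta * mono_eval beta z)"

lemma fin_wt: "finite {beta :: nat^'d. wt kap beta = k}"
 by (rule sum_abs_weighted_mono) (rule kappa_ge)

definition G :: real where "G = B * (\<Sum>\<^sub>\<infinity>beta::nat^'d. \<Prod>j\<in>UNIV. (1 / 2) ^ (beta $ j))"

definition M :: real where "M = 2 / r"

lemma G_nonneg: "G >= 0"
 unfolding G_def using B by (intro mult_nonneg_nonneg infsum_nonneg prod_nonneg) auto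

lemma M_ge: "M >= 2" using r by (simp add: M_def field_simps)

lemma V_bound:
 assumes u: "u >= 0" and z: "!!j. cmod (z $ j) <= u ^ (kap $ j)"
 shows "cmod (V k z) <= G * (M * u) ^ k"
proof -
 have s: "(%beta::nat^'d. \<Prod>j\<in>UNIV. (1 / 2 :: real) ^ (beta $ j)) summable_on UNIV"
  by (rule multi_geometric_summable) auto
 have "cmod (V k z) <= (\<Sum>beta | wt kap beta = k. B * (\<Prod>j\<in>UNIV. (1 / 2) ^ (beta $ j)) * (M * u) ^ k)"
  unfolding V_def
 proof (rule sum_norm_le)
  fix beta assume "beta \<in> {beta. wt kap beta = k}"
  then have k: "wt kap beta = k" by simp
  let ?l = "\<Sum>j\<in>UNIV. beta $ j"
  have "?l <= k" unfolding k[symmetric] wt_def by (intro sum_mono) (use kappa_ge in simp)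
  have "1 / r ^ ?l = (1 / 2) ^ ?l * M ^ ?l" by (simp add: M_def power_divide flip: power_mult_distrib)
  also have "... <= (1 / 2) ^ ?l * M ^ k"
   using \<open>?l <= k\<close> M_ge by (intro mult_left_mono power_increasing) auto
  finally have "B / r ^ ?l <= B * ((1 / 2) ^ ?l * M ^ k)"
   using B mult_left_mono[of "1 / r ^ ?l" "(1 / 2) ^ ?l * M ^ k" B] by simp
  then have "cmod (b beta) <= B * ((1 / 2) ^ ?l * M ^ k)" using bB[of beta] by linarith
  moreover have "cmod (mono_eval beta z) <= u ^ k" using norm_mono_eval_le[OF u z, of beta] k by simp
  ultimately have "cmod (b beta * mono_eval beta z) <= B * ((1 / 2) ^ ?l * M ^ k) * u ^ k"
   unfolding norm_mult using B M_ge by (intro mult_mono) auto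
  also have "... = B * (\<Prod>j\<in>UNIV. (1 / 2) ^ (beta $ j)) * (M * u) ^ k"
   by (simp add: power_sum power_mult_distrib mult_ac)
  finally show "cmod (b beta * mono_eval beta z) <= B * (\<Prod>j\<in>UNIV. (1 / 2) ^ (beta $ j)) * (M * u) ^ k" .
 qed
 also have "... = B * (\<Sum>beta | wt kap beta = k. \<Prod>j\<in>UNIV. (1 / 2) ^ (beta $ j)) * (M * u) ^ k"
  by (simp add: sum_distrib_left sum_distrib_right)
 also have "... <= G * (M * u) ^ k"
  unfolding G_def using B M_ge u
  by (intro mult_right_mono mult_left_mono finite_sum_le_infsum[OF s fin_wt]) (auto intro!: prod_nonneg)
 finally show ?thesis .
qed

definition W :: "complex^'d => nat => complex" where
 "W z l = (if l = 0 then 0 else V (2 * m + l) z)"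

definition Wfps :: "complex^'d => complex fps" where
 "Wfps z = Abs_fps (W z)"

text \<open>The coefficients of \<open>exp (\<Sum>l\<ge>1. tau\<^sup>l V\<^sub>2\<^sub>m\<^sub>+\<^sub>l)\<close>.\<close>
definition wcoef :: "nat => complex^'d => complex" where
 "wcoef l z = fps_nth (fps_exp 1 oo Wfps z) l"

lemma Wfps_sums:
 assumes u: "u >= 0" and z: "!!j. cmod (z $ j) <= u ^ (kap $ j)" and tau: "2 * cmod tau * M * u <= 1"
 shows "summable (%l. W z l * tau ^ l)"
  and "cmod (eval_fps (Wfps z) tau) <= 2 * G * (M * u) ^ (2 * m) * (cmod tau * M * u)"
proof -
 define x where "x = cmod tau * M * u"
 have x: "0 <= x" "x <= 1 / 2" using tau u M_ge by (auto simp: x_def)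
 define Q where "Q = G * (M * u) ^ (2 * m)"
 have Q: "Q >= 0" using G_nonneg M_ge u by (simp add: Q_def)
 have le: "cmod (W z (Suc l) * tau ^ Suc l) <= Q * x * x ^ l" for l
 proof -
  have "cmod (W z (Suc l) * tau ^ Suc l) <= (G * (M * u) ^ (2 * m + Suc l)) * cmod tau ^ Suc l"
   unfolding norm_mult norm_power W_def using V_bound[OF u z, of "2 * m + Suc l"] by (simp only: if_False nat.distinct) (rule mult_right_mono, auto)
  also have "... = Q * x ^ Suc l" unfolding Q_def x_def power_add power_mult_distrib by (simp only: mult_ac)
  finally show ?thesis by (simp add: mult_ac)
 qed
 have gs: "(%l. Q * x * x ^ l) sums (Q * x * (1 / (1 - x)))"
  by (intro sums_mult geometric_sums) (use x in auto)
 have s1: "summable (%l. W z (Suc l) * tau ^ Suc l)"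
  by (rule summable_comparison_test'[OF sums_summable[OF gs], of 0]) (rule le)
 then show s: "summable (%l. W z l * tau ^ l)" by (subst (asm) summable_Suc_iff)
 have "eval_fps (Wfps z) tau = suminf (%l. W z l * tau ^ l)" by (simp add: eval_fps_def Wfps_def)
 also have "... = suminf (%l. W z (Suc l) * tau ^ Suc l)"
  using suminf_split_head[OF s] by (simp add: W_def)
 also have "cmod ... <= suminf (%l. Q * x * x ^ l)"
  by (rule norm_suminf_le[OF le sums_summable[OF gs]])
 also have "... = Q * x * (1 / (1 - x))" using gs by (simp add: sums_iff)
 also have "... <= Q * x * 2" using x Q by (intro mult_left_mono) (auto simp: field_simps)
 finally show "cmod (eval_fps (Wfps z) tau) <= 2 * G * (M * u) ^ (2 * m) * (cmod tau * M * u)"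
  by (simp add: Q_def x_def mult_ac)
qed

text \<open>
  A radius of order \<open>s\<^sup>-\<^sup>(\<^sup>2\<^sup>m\<^sup>+\<^sup>1\<^sup>)\<close> keeps the exponent bounded by \<open>1\<close>, and Cauchy's estimates on that
  disc control both the coefficients and the Taylor remainder.
\<close>
lemma exp_series_expansion:
 obtains C c where "c > 0" "C >= 0"
  "!!z s l. s >= 1 ==> (!!j. cmod (z $ j) <= s ^ (kap $ j)) ==> cmod (wcoef l z) <= C * (s ^ (2 * m + 1) / c) ^ l"
  "!!z u s t k. s >= 1 ==> 0 <= u ==> u <= s ==> (!!j. cmod (z $ j) <= u ^ (kap $ j)) ==> 0 <= t ==> 2 * t * M * u <= 1 ==>
   cmod (exp (eval_fps (Wfps z) (of_real t)) - (\<Sum>l<k. wcoef l z * of_real t ^ l))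
    <= C * real (k + 2) * (t * s ^ (2 * m + 1) / c) ^ k * exp (2 * G * (M * u) ^ (2 * m) * (t * M * u))"
proof -
 define c0 where "c0 = 1 / (2 * M * (1 + 2 * G * M ^ (2 * m)))"
 have c0: "c0 > 0" using M_ge G_nonneg by (auto simp: c0_def intro!: mult_pos_pos add_pos_nonneg)
 have wexp: "wcoef l z = (deriv ^^ l) (%tau. exp (eval_fps (Wfps z) tau)) 0 / fact l"
  and hol: "(%tau. exp (eval_fps (Wfps z) tau)) holomorphic_on ball 0 (c0 / s ^ (2 * m + 1))"
  and bd: "!!tau. tau \<in> ball 0 (c0 / s ^ (2 * m + 1)) ==> cmod (exp (eval_fps (Wfps z) tau)) <= exp 1"
  if s: "s >= 1" and z: "!!j. cmod (z $ j) <= s ^ (kap $ j)" for z s l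
 proof -
  define R where "R = c0 / s ^ (2 * m + 1)"
  have R: "R > 0" using c0 s by (simp add: R_def)
  have Rs: "R * s ^ (2 * m + 1) = c0" using s by (simp add: R_def)
  have sle: "s <= s ^ (2 * m + 1)" using s self_le_power[of s "2 * m + 1"] by simp
  have tau: "2 * cmod tau * M * s <= 1" "2 * G * (M * s) ^ (2 * m) * (cmod tau * M * s) <= 1" if t: "cmod tau <= R" for tau
  proof -
   have "cmod tau * s <= R * s ^ (2 * m + 1)" using t sle R s by (intro mult_mono) auto
   then have 1: "cmod tau * s <= c0" using Rs by simp
   have "2 * M * c0 = 1 / (1 + 2 * G * M ^ (2 * m))" using M_ge by (simp add: c0_def)
   also have "... <= 1" using G_nonneg M_ge by (simp add: divide_le_eq add_pos_nonneg)
   finally have "2 * M * c0 <= 1" .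
   moreover have "2 * M * (cmod tau * s) <= 2 * M * c0" using 1 M_ge by (intro mult_left_mono) auto
   ultimately show "2 * cmod tau * M * s <= 1" by (simp add: mult_ac)
   have "2 * G * (M * s) ^ (2 * m) * (cmod tau * M * s) = (2 * G * M ^ (2 * m)) * (M * (cmod tau * s ^ (2 * m + 1)))"
    by (simp add: power_mult_distrib mult_ac)
   also have "... <= (2 * G * M ^ (2 * m)) * (M * c0)"
   proof -
    have "cmod tau * s ^ (2 * m + 1) <= R * s ^ (2 * m + 1)" using t s by (intro mult_right_mono) auto
    then show ?thesis using G_nonneg M_ge Rs by (intro mult_left_mono) auto
   qed
   also have "M * c0 = (1 / 2) / (1 + 2 * G * M ^ (2 * m))" using M_ge by (simp add: c0_def)
   also have "(2 * G * M ^ (2 * m)) * ((1 / 2) / (1 + 2 * G * M ^ (2 * m))) <= 1"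
   proof -
    define y where "y = 2 * G * M ^ (2 * m)"
    have "y >= 0" using G_nonneg M_ge by (simp add: y_def)
    then show ?thesis unfolding y_def[symmetric] by (simp add: field_simps)
   qed
   finally show "2 * G * (M * s) ^ (2 * m) * (cmod tau * M * s) <= 1" .
  qed
  have rad: "fps_conv_radius (Wfps z) >= ereal R"
  proof -
   have "summable (%l. W z l * complex_of_real R ^ l)"
    by (rule Wfps_sums(1)[OF _ z]) (use s R tau(1)[of "of_real R"] in auto)
   then have "ereal (norm (complex_of_real R)) <= conv_radius (fps_nth (Wfps z))"
    by (intro conv_radius_geI) (simp add: Wfps_def)
   then show ?thesis using R by (simp add: fps_conv_radius_def)
  qed
  have "fps_conv_radius (Wfps z) > 0" using rad R by (meson ereal_less(2) less_le_trans)
  then have "(exp \<circ> eval_fps (Wfps z)) has_fps_expansion (fps_exp 1 oo Wfps z)"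
   by (intro has_fps_expansion_compose eval_fps_has_fps_expansion has_fps_expansion_exp1)
     (auto simp: Wfps_def W_def)
  then show "wcoef l z = (deriv ^^ l) (%tau. exp (eval_fps (Wfps z) tau)) 0 / fact l"
   unfolding wcoef_def by (subst fps_nth_fps_expansion) (auto simp: o_def)
  have "ball (0::complex) R \<subseteq> eball 0 (fps_conv_radius (Wfps z))"
  proof
   fix x :: complex assume "x \<in> ball 0 R"
   then have "ereal (dist 0 x) < ereal R" by simp
   from less_le_trans[OF this rad] show "x \<in> eball 0 (fps_conv_radius (Wfps z))" by simp
  qed
  then show "(%tau. exp (eval_fps (Wfps z) tau)) holomorphic_on ball 0 (c0 / s ^ (2 * m + 1))"
   unfolding R_def[symmetric] by (intro holomorphic_intros)
  show "cmod (exp (eval_fps (Wfps z) tau)) <= exp 1" if "tau \<in> ball 0 (c0 / s ^ (2 * m + 1))" for tau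
  proof -
   have t: "cmod tau <= R" using that by (simp add: R_def)
   have "cmod (eval_fps (Wfps z) tau) <= 2 * G * (M * s) ^ (2 * m) * (cmod tau * M * s)"
    by (rule Wfps_sums(2)[OF _ z]) (use s tau(1)[OF t] in auto)
   then have "cmod (eval_fps (Wfps z) tau) <= 1" using tau(2)[OF t] by linarith
   then have "Re (eval_fps (Wfps z) tau) <= 1" using complex_Re_le_cmod order_trans by blast
   then show ?thesis by simp
  qed
 qed
 define c where "c = c0 / 4"
 have c: "c > 0" using c0 by (simp add: c_def)
 have radii: "0 < 2 * c / s ^ (2 * m + 1)" "2 * c / s ^ (2 * m + 1) < c0 / s ^ (2 * m + 1)" if "s >= 1" for s
 proof -
  have pos: "0 < c0 / s ^ (2 * m + 1)" using that c0 by simp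
  have half: "2 * c / s ^ (2 * m + 1) = (c0 / s ^ (2 * m + 1)) / 2" by (simp add: c_def)
  have lt: "0 < a / 2" "a / 2 < a" if "0 < a" for a :: real using that by simp_all
  show "0 < 2 * c / s ^ (2 * m + 1)" unfolding half by (rule lt(1)[OF pos])
  show "2 * c / s ^ (2 * m + 1) < c0 / s ^ (2 * m + 1)" unfolding half by (rule lt(2)[OF pos])
 qed
 have coef: "cmod (wcoef l z) <= exp 1 * (s ^ (2 * m + 1) / (2 * c)) ^ l"
  if s: "s >= 1" and z: "!!j. cmod (z $ j) <= s ^ (kap $ j)" for z s l
 proof -
  have "cmod (wcoef l z) <= exp 1 / (2 * c / s ^ (2 * m + 1)) ^ l"
   unfolding wexp[OF s z] by (rule cauchy_coefficient_bound[OF hol[OF s z] bd[OF s z] radii[OF s]])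
  then show ?thesis by (simp add: power_divide)
 qed
 show thesis
 proof (rule that[of c "2 * exp 1"])
  show "c > 0" by (rule c)
  show "cmod (wcoef l z) <= 2 * exp 1 * (s ^ (2 * m + 1) / c) ^ l"
   if s: "s >= 1" and z: "!!j. cmod (z $ j) <= s ^ (kap $ j)" for z s l
  proof -
   have "(s ^ (2 * m + 1) / (2 * c)) ^ l <= (s ^ (2 * m + 1) / c) ^ l"
    using s c by (intro power_mono) (auto simp: field_simps)
   then have "exp 1 * (s ^ (2 * m + 1) / (2 * c)) ^ l <= 2 * exp 1 * (s ^ (2 * m + 1) / c) ^ l"
    using s c by (intro mult_mono) auto
   then show ?thesis using coef[OF s z, of l] by linarith
  qed
  fix z u s t k
  assume s: "s >= 1" and u: "0 <= u" "u <= s" and zu: "!!j. cmod (z $ j) <= u ^ (kap $ j)"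
   and t: "0 <= t" "2 * t * M * u <= 1"
  have z: "cmod (z $ j) <= s ^ (kap $ j)" for j using zu[of j] u power_mono[of u s "kap $ j"] by linarith
  define T where "T = t * s ^ (2 * m + 1) / c"
  have T0: "T >= 0" using t s c by (simp add: T_def)
  define EE where "EE = exp (2 * G * (M * u) ^ (2 * m) * (t * M * u))"
  have EE: "EE >= 1" unfolding EE_def using G_nonneg M_ge u t by simp
  let ?f = "%tau. exp (eval_fps (Wfps z) tau)"
  show "cmod (?f (of_real t) - (\<Sum>l<k. wcoef l z * of_real t ^ l)) <= 2 * exp 1 * real (k + 2) * T ^ k * EE"
  proof (cases "2 * t <= 2 * c / s ^ (2 * m + 1)")
   case True
   define rho where "rho = 2 * c / s ^ (2 * m + 1)"
   have rho: "0 < rho" "rho < c0 / s ^ (2 * m + 1)" unfolding rho_def by (rule radii[OF s])+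
   have "cmod (?f (of_real t) - (\<Sum>l<k. wcoef l z * of_real t ^ l)) <= 2 * exp 1 * (cmod (complex_of_real t) / rho) ^ k"
    unfolding wexp[OF s z] by (rule taylor_remainder_bound[OF hol[OF s z] bd[OF s z] rho]) (use t True in \<open>auto simp: rho_def\<close>)
   also have "... <= 2 * exp 1 * T ^ k"
   proof -
    have "t / rho <= T" using t s c by (simp add: rho_def T_def field_simps)
    then show ?thesis using t rho by (intro mult_left_mono power_mono) auto
   qed
   also have "... <= 2 * exp 1 * T ^ k * (real (k + 2) * EE)"
   proof -
    have "1 * 1 <= real (k + 2) * EE" using EE by (intro mult_mono) auto
    then show ?thesis using mult_left_mono[of 1 "real (k + 2) * EE" "2 * exp 1 * T ^ k"] T0 by simp
   qed
   finally show ?thesis by (simp only: mult_ac)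
  next
   case False
   have T1: "T > 1" using False s c by (simp add: T_def field_simps)
   have "cmod (?f (of_real t)) <= EE"
   proof -
    have "cmod (eval_fps (Wfps z) (of_real t)) <= 2 * G * (M * u) ^ (2 * m) * (cmod (of_real t) * M * u)"
     by (rule Wfps_sums(2)[OF u(1) zu]) (use t in auto)
    then have "Re (eval_fps (Wfps z) (of_real t)) <= 2 * G * (M * u) ^ (2 * m) * (t * M * u)"
     using complex_Re_le_cmod[of "eval_fps (Wfps z) (of_real t)"] t by simp
    then show ?thesis by (simp add: EE_def)
   qed
   also have "... <= EE * (exp 1 * T ^ k)"
   proof -
    have "1 * 1 <= exp 1 * T ^ k" using T1 by (intro mult_mono) auto
    then show ?thesis using EE mult_left_mono[of 1 "exp 1 * T ^ k" EE] by simp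
   qed
   finally have 1: "cmod (?f (of_real t)) <= EE * (exp 1 * T ^ k)" .
   have "cmod (\<Sum>l<k. wcoef l z * of_real t ^ l) <= (\<Sum>l<k. exp 1 * T ^ k)"
   proof (rule sum_norm_le)
    fix l assume l: "l \<in> {..<k}"
    have "cmod (wcoef l z * of_real t ^ l) <= exp 1 * (s ^ (2 * m + 1) / (2 * c)) ^ l * t ^ l"
     unfolding norm_mult norm_power using coef[OF s z, of l] t by (simp add: mult_right_mono)
    also have "... = exp 1 * (T / 2) ^ l" by (simp add: T_def power_mult_distrib power_divide mult_ac)
    also have "... <= exp 1 * T ^ l" using T1 by (intro mult_left_mono power_mono) auto
    also have "... <= exp 1 * T ^ k" using T1 l by (intro mult_left_mono power_increasing) auto
    finally show "cmod (wcoef l z * of_real t ^ l) <= exp 1 * T ^ k" .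
   qed
   also have "... = real k * (exp 1 * T ^ k)" by simp
   also have "... <= real k * (exp 1 * T ^ k) * EE" using EE T0 mult_left_mono[of 1 EE "real k * (exp 1 * T ^ k)"] by simp
   finally have "cmod (?f (of_real t)) + cmod (\<Sum>l<k. wcoef l z * of_real t ^ l) <= EE * (exp 1 * T ^ k) + real k * (exp 1 * T ^ k) * EE"
    using 1 by linarith
   also have "... <= 2 * exp 1 * real (k + 2) * T ^ k * EE"
   proof -
    define Y where "Y = exp 1 * T ^ k * EE"
    have "Y >= 0" using T0 EE by (simp add: Y_def)
    then have "(1 + real k) * Y <= (2 * real (k + 2)) * Y" by (intro mult_right_mono) auto
    then show ?thesis by (simp add: Y_def algebra_simps)
   qed
   finally show ?thesis using norm_triangle_ineq4[of "?f (of_real t)" "\<Sum>l<k. wcoef l z * of_real t ^ l"] by linarith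
  qed
 qed simp
qed

end

section \<open>The homogeneous order\<close>

definition mat_pow :: "real^'d^'d => nat => real^'d^'d" where
 "mat_pow E k = ((%N. E ** N) ^^ k) (mat 1)"

lemma mat_pow_Suc: "mat_pow E (Suc k) = E ** mat_pow E k"
 by (simp add: mat_pow_def)

lemma mat_pow_bound:
 fixes E :: "real^'d^'d"
 defines "K \<equiv> \<Sum>i\<in>UNIV. \<Sum>j\<in>UNIV. \<bar>E $ i $ j\<bar>"
 shows "\<bar>mat_pow E k $ i $ j\<bar> <= K ^ k"
proof (induction k arbitrary: i j)
 case 0
 then show ?case by (simp add: mat_pow_def mat_def)
next
 case (Suc k)
 have K0: "K >= 0" unfolding K_def by (intro sum_nonneg) auto
 have "\<bar>mat_pow E (Suc k) $ i $ j\<bar> <= (\<Sum>l\<in>UNIV. \<bar>E $ i $ l\<bar> * \<bar>mat_pow E k $ l $ j\<bar>)"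
  unfolding mat_pow_Suc matrix_matrix_mult_def by (simp add: order_trans[OF sum_abs] abs_mult)
 also have "... <= (\<Sum>l\<in>UNIV. \<bar>E $ i $ l\<bar> * K ^ k)"
  by (intro sum_mono mult_left_mono Suc) auto
 also have "... = (\<Sum>l\<in>UNIV. \<bar>E $ i $ l\<bar>) * K ^ k" by (simp add: sum_distrib_right)
 also have "... <= K * K ^ k"
 proof (intro mult_right_mono)
  show "(\<Sum>l\<in>UNIV. \<bar>E $ i $ l\<bar>) <= K"
   unfolding K_def by (rule member_le_sum[of i UNIV "%i. \<Sum>l\<in>UNIV. \<bar>E $ i $ l\<bar>"]) (auto intro: sum_nonneg)
 qed (use K0 in simp)
 finally show ?case by simp
qed

lemma mat_pow_scaleR: "mat_pow (s *\<^sub>R E) k = s ^ k *\<^sub>R mat_pow E k"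
proof (induction k)
 case 0
 show ?case by (simp add: mat_pow_def)
next
 case (Suc k)
 show ?case unfolding mat_pow_Suc Suc
  by (simp add: vec_eq_iff matrix_matrix_mult_def sum_distrib_left mult_ac)
qed

lemma exp_type_series:
 fixes c :: "nat => real"
 assumes c: "!!k. \<bar>c k\<bar> <= K ^ k" and K: "K >= 0"
 shows "summable (%k. c k / fact k * s ^ k)"
  and "((%s. suminf (%k. c k / fact k * s ^ k)) has_real_derivative suminf (%k. c (Suc k) / fact k * s ^ k)) (at s)"
proof -
 have sm: "summable (%k. c k / fact k * s ^ k)" for s
 proof (rule summable_comparison_test'[of "%k. (K * \<bar>s\<bar>) ^ k /\<^sub>R fact k" 0])
  show "summable (%k. (K * \<bar>s\<bar>) ^ k /\<^sub>R fact k)" by (rule summable_exp_generic)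
  show "norm (c k / fact k * s ^ k) <= (K * \<bar>s\<bar>) ^ k /\<^sub>R fact k" for k
  proof -
   have "\<bar>c k\<bar> * \<bar>s\<bar> ^ k <= K ^ k * \<bar>s\<bar> ^ k" by (intro mult_right_mono c) auto
   then have "inverse (fact k) * (\<bar>c k\<bar> * \<bar>s\<bar> ^ k) <= inverse (fact k) * (K ^ k * \<bar>s\<bar> ^ k)"
    by (rule mult_left_mono) simp
   then show ?thesis by (simp add: abs_mult power_abs power_mult_distrib divide_inverse mult_ac)
  qed
 qed
 then show "summable (%k. c k / fact k * s ^ k)" .
 have "DERIV (%s. suminf (%k. c k / fact k * s ^ k)) s :> suminf (%k. diffs (%k. c k / fact k) k * s ^ k)"
  by (rule termdiffs_strong_converges_everywhere) (rule sm)
 also have "diffs (%k. c k / fact k) = (%k. c (Suc k) / fact k)"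
  by (intro ext) (simp add: diffs_def fact_Suc del: of_nat_Suc)
 finally show "((%s. suminf (%k. c k / fact k * s ^ k)) has_real_derivative suminf (%k. c (Suc k) / fact k * s ^ k)) (at s)" .
qed

lemma mat_exp_entry:
 fixes E :: "real^'d^'d"
 shows "mat_exp (s *\<^sub>R E) $ i $ j = suminf (%k. mat_pow E k $ i $ j / fact k * s ^ k)"
proof -
 define f where "f = (%k. (1 / fact k) *\<^sub>R mat_pow (s *\<^sub>R E) k)"
 define X where "X = ((\<chi> i j. suminf (%k. mat_pow E k $ i $ j / fact k * s ^ k)) :: real^'d^'d)"
 have K: "(\<Sum>i\<in>UNIV. \<Sum>j\<in>UNIV. \<bar>E $ i $ j\<bar>) >= 0" by (intro sum_nonneg) auto
 have "(%n. \<Sum>k<n. f k) \<longlonglongrightarrow> X"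
 proof (intro vec_tendstoI)
  fix i j
  have "(%k. mat_pow E k $ i $ j / fact k * s ^ k) sums (X $ i $ j)"
   unfolding X_def using exp_type_series(1)[OF mat_pow_bound K] by (simp add: summable_sums)
  then show "(%n. (\<Sum>k<n. f k) $ i $ j) \<longlonglongrightarrow> X $ i $ j"
   by (simp add: sums_def f_def mat_pow_scaleR mult_ac)
 qed
 then have "f sums X" by (simp add: sums_def)
 then have "mat_exp (s *\<^sub>R E) = X" unfolding mat_exp_def f_def mat_pow_def by (rule sums_unique[symmetric])
 then show ?thesis by (simp add: X_def)
qed

lemma mat_exp_entry_derivative:
 fixes E :: "real^'d^'d"
 shows "((%s. mat_exp (s *\<^sub>R E) $ i $ j) has_real_derivative (E ** mat_exp (s *\<^sub>R E)) $ i $ j) (at s)"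
proof -
 have K: "(\<Sum>i\<in>UNIV. \<Sum>j\<in>UNIV. \<bar>E $ i $ j\<bar>) >= 0" by (intro sum_nonneg) auto
 have ser: "summable (%k. mat_pow E k $ i $ j / fact k * s ^ k)"
  "((%s. suminf (%k. mat_pow E k $ i $ j / fact k * s ^ k)) has_real_derivative suminf (%k. mat_pow E (Suc k) $ i $ j / fact k * s ^ k)) (at s)" for i j s
  by (rule exp_type_series[where c = "%k. mat_pow E k $ i $ j", OF mat_pow_bound K])+
 have "suminf (%k. mat_pow E (Suc k) $ i $ j / fact k * s ^ k)
   = suminf (%k. \<Sum>l\<in>UNIV. E $ i $ l * (mat_pow E k $ l $ j / fact k * s ^ k))"
  by (intro arg_cong[of _ _ suminf] ext)
    (simp add: mat_pow_Suc matrix_matrix_mult_def sum_distrib_left sum_distrib_right divide_inverse mult_ac)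
 also have "... = (\<Sum>l\<in>UNIV. E $ i $ l * suminf (%k. mat_pow E k $ l $ j / fact k * s ^ k))"
  by (subst suminf_sum, rule summable_mult, rule ser(1), simp only: suminf_mult[OF ser(1)])
 also have "... = (E ** mat_exp (s *\<^sub>R E)) $ i $ j"
  by (simp add: matrix_matrix_mult_def mat_exp_entry)
 finally show ?thesis using ser(2)[of i j s] unfolding mat_exp_entry by simp
qed

lemma mat_exp_0: "mat_exp (0 *\<^sub>R E) = mat 1"
 unfolding vec_eq_iff mat_exp_entry
 by (subst powser_zero) (simp add: mat_pow_def)

definition det_deriv :: "real^'d^'d => real^'d^'d => real" where
 "det_deriv X X' = (\<Sum>p | p permutes UNIV. of_int (sign p) * (\<Sum>i\<in>UNIV. X' $ i $ p i * (\<Prod>k\<in>UNIV - {i}. X $ k $ p k)))"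

lemma det_has_derivative:
 fixes X :: "real => real^'d^'d"
 assumes "!!i j. ((%s. X s $ i $ j) has_real_derivative X' $ i $ j) (at s)"
 shows "((%s. det (X s)) has_real_derivative det_deriv (X s) X') (at s)"
 unfolding det_def det_deriv_def
proof (intro DERIV_sum DERIV_cmult)
 fix p :: "'d => 'd"
 have "((%s. \<Prod>i\<in>UNIV. X s $ i $ p i) has_real_derivative (\<Sum>i\<in>UNIV. X' $ i $ p i * (\<Prod>k\<in>UNIV - {i}. X s $ k $ p k))) (at s)"
  by (rule has_field_derivative_prod) (rule assms)
 then show "((%s. \<Prod>i\<in>UNIV. X s $ i $ p i) has_real_derivative (\<Sum>i\<in>UNIV. X' $ i $ p i * (\<Prod>k\<in>UNIV - {i}. X s $ k $ p k))) (at s)" .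
qed

lemma det_deriv_mat_1:
 fixes E :: "real^'d^'d"
 shows "det_deriv (mat 1) E = trace E"
proof -
 have "(\<Sum>i\<in>UNIV. E $ i $ p i * (\<Prod>k\<in>UNIV - {i}. (mat 1 :: real^'d^'d) $ k $ p k)) = 0"
  if p: "p permutes UNIV" "p ~= id" for p :: "'d => 'd"
 proof (rule sum.neutral, rule ballI)
  fix i
  obtain k0 where k0: "p k0 ~= k0" using p(2) by (auto simp: fun_eq_iff)
  have "p (p k0) ~= p k0" using k0 permutes_inj[OF p(1)] by (metis injD)
  then have "\<exists>k. k ~= i \<and> p k ~= k" using k0 by (cases "k0 = i") auto
  then obtain k where k: "k \<in> UNIV - {i}" "p k ~= k" by auto
  then have "(\<Prod>k\<in>UNIV - {i}. (mat 1 :: real^'d^'d) $ k $ p k) = 0"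
   by (intro prod_zero bexI[of _ k]) (auto simp: mat_def)
  then show "E $ i $ p i * (\<Prod>k\<in>UNIV - {i}. (mat 1 :: real^'d^'d) $ k $ p k) = 0" by simp
 qed
 note vanish = this
 have "det_deriv (mat 1) E = (\<Sum>p\<in>{p :: 'd => 'd. p permutes UNIV}. if p = id then trace E else 0)"
  unfolding det_deriv_def
 proof (rule sum.cong[OF refl])
  fix p :: "'d => 'd" assume p: "p \<in> {p. p permutes UNIV}"
  show "of_int (sign p) * (\<Sum>i\<in>UNIV. E $ i $ p i * (\<Prod>k\<in>UNIV - {i}. (mat 1 :: real^'d^'d) $ k $ p k)) = (if p = id then trace E else 0)"
   using vanish[of p] p by (cases "p = id") (simp_all add: trace_def mat_def)
 qed
 then show ?thesis by (simp add: permutes_id finite_permutations)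
qed

text \<open>Both curves pass through \<open>X\<close> with the same velocity.\<close>
lemma det_deriv_mult: "det_deriv X (E ** X) = trace E * det X"
proof -
 have e1: "((%h. (mat 1 + h *\<^sub>R E) $ i $ j) has_real_derivative E $ i $ j) (at 0)" for i j
  by (auto intro!: derivative_eq_intros)
 have e2: "((%h. ((mat 1 + h *\<^sub>R E) ** X) $ i $ j) has_real_derivative (E ** X) $ i $ j) (at 0)" for i j
  unfolding matrix_matrix_mult_def by (auto intro!: derivative_eq_intros)
 have "((%h. det ((mat 1 + h *\<^sub>R E) ** X)) has_real_derivative det_deriv X (E ** X)) (at 0)"
  using det_has_derivative[OF e2] by simp
 moreover have "((%h. det (mat 1 + h *\<^sub>R E) * det X) has_real_derivative trace E * det X) (at 0)"
  using DERIV_cmult_right[OF det_has_derivative[OF e1]] by (simp add: det_deriv_mat_1 mult.commute)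
 ultimately show ?thesis by (simp add: det_mul DERIV_unique)
qed

text \<open>The determinant solves the differential equation \<open>y' = trace E * y\<close>.\<close>
theorem det_mat_exp:
 fixes E :: "real^'d^'d"
 shows "det (mat_exp (s *\<^sub>R E)) = exp (s * trace E)"
proof -
 define g where "g = (%s. det (mat_exp (s *\<^sub>R E)) * exp (- (s * trace E)))"
 have d: "((%s. det (mat_exp (s *\<^sub>R E))) has_real_derivative trace E * det (mat_exp (s *\<^sub>R E))) (at s)" for s
  using det_has_derivative[of "%s. mat_exp (s *\<^sub>R E)" "E ** mat_exp (s *\<^sub>R E)" s, OF mat_exp_entry_derivative]
  by (simp only: det_deriv_mult)
 have "(g has_real_derivative 0) (at s)" for s
  unfolding g_def by (auto intro!: derivative_eq_intros d)
 then have "g s = g 0" by (intro DERIV_isconst_all) auto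
 then have "det (mat_exp (s *\<^sub>R E)) * exp (- (s * trace E)) = 1"
  using mat_exp_0[of E] by (simp add: g_def)
 then show ?thesis by (simp add: exp_minus field_simps)
qed

lemma det_bound:
 fixes X :: "real^'d^'d"
 assumes "!!i j. \<bar>X $ i $ j\<bar> <= L"
 shows "\<bar>det X\<bar> <= real (card {p. p permutes (UNIV :: 'd set)}) * L ^ CARD('d)"
proof -
 have "\<bar>det X\<bar> <= (\<Sum>p | p permutes (UNIV :: 'd set). \<bar>of_int (sign p) * (\<Prod>i\<in>UNIV. X $ i $ p i)\<bar>)"
  unfolding det_def by (rule sum_abs)
 also have "... <= (\<Sum>p | p permutes (UNIV :: 'd set). L ^ CARD('d))"
 proof (intro sum_mono)
  fix p :: "'d => 'd"
  have "\<bar>of_int (sign p) * (\<Prod>i\<in>UNIV. X $ i $ p i)\<bar> = (\<Prod>i\<in>UNIV. \<bar>X $ i $ p i\<bar>)"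
   by (simp add: abs_mult abs_prod sign_def)
  also have "... <= (\<Prod>i\<in>(UNIV :: 'd set). L)" by (intro prod_mono conjI assms) auto
  finally show "\<bar>of_int (sign p) * (\<Prod>i\<in>UNIV. X $ i $ p i)\<bar> <= L ^ CARD('d)" by simp
 qed
 finally show ?thesis by simp
qed

lemma det_diag_scale:
 fixes D :: "'d::finite => real" and X :: "real^'d^'d"
 shows "det (\<chi> i j. D i * X $ i $ j) = (\<Prod>i\<in>UNIV. D i) * det X"
 unfolding det_def sum_distrib_left by (intro sum.cong refl) (simp add: prod.distrib mult_ac)

lemma (in homogeneous_poly) bounded_sublevel:
 obtains L where "!!xi j. Re (poly_eval a xi) <= K ==> \<bar>xi $ j\<bar> <= L"
proof -
 obtain c C where c: "c > 0" "C >= 0"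
  "!!z. (!!j. \<bar>Im (z $ j)\<bar> <= 1) ==> Re (cpoly a z) >= c * qn kap z ^ (2 * m) - C"
  by (rule strip_lower_bound, rule that, assumption, assumption, blast)
 define L0 where "L0 = max 1 ((K + C) / c)"
 have "\<bar>xi $ j\<bar> <= L0 ^ (2 * m)" if K: "Re (poly_eval a xi) <= K" for xi j
 proof -
  define u where "u = qn kap (complex_vec xi)"
  have u0: "u >= 0" unfolding u_def by (rule qn_nonneg)
  have "c * u ^ (2 * m) - C <= K" using c(3)[of "complex_vec xi"] K by (simp add: poly_eval_cpoly u_def)
  then have up: "u ^ (2 * m) <= (K + C) / c" using c(1) by (simp add: field_simps)
  have L0: "L0 >= 1" by (simp add: L0_def)
  have "u <= L0"
  proof (rule ccontr)
   assume "\<not> u <= L0"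
   then have "u > L0" by simp
   then have "u > 1" using L0 by simp
   then have "u ^ 1 <= u ^ (2 * m)" using m_ge by (intro power_increasing) auto
   then show False using up \<open>u > L0\<close> by (simp add: L0_def)
  qed
  have "\<bar>xi $ j\<bar> <= u ^ (kap $ j)" using component_le_qn[of "complex_vec xi" j] by (simp add: u_def)
  also have "... <= L0 ^ (kap $ j)" using \<open>u <= L0\<close> u0 by (intro power_mono) auto
  also have "... <= L0 ^ (2 * m)"
  proof (rule power_increasing)
   show "kap $ j <= 2 * m" using kappa_le[of j] by linarith
  qed (use L0 in auto)
  finally show ?thesis .
 qed
 then show thesis by (rule that)
qed

text \<open>
  The matrices \<open>t\<^sup>-\<^sup>D A\<^sup>-\<^sup>1 t\<^sup>E A\<close>, where \<open>D\<close> is the diagonal exponent, preserve the real part of the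
  polynomial, so their entries and determinants are bounded uniformly in \<open>t\<close>; the determinant
  is a power of \<open>t\<close>, with exponent the difference of the two traces.
\<close>
theorem hom_order_eq:
 fixes A :: "real^'d^'d"
 assumes dil: "homogeneous_poly kap m a"
  and A: "invertible A" and PA: "!!eta. P (A *v eta) = poly_eval a eta" and E: "Exp_set P ~= {}"
 shows "hom_order P = (\<Sum>j\<in>UNIV. real (kap $ j)) / (2 * real m)"
proof -
 interpret homogeneous_poly kap m a by (rule dil)
 define E where "E = (SOME E. E \<in> Exp_set P)"
 have "E \<in> Exp_set P" unfolding E_def using assms(4) by (simp add: some_in_eq)
 then have PE: "complex_of_real (exp s) * P xi = P (mat_exp (s *\<^sub>R E) *v xi)" for s xi
  unfolding Exp_set_def mat_powr_def by (auto dest!: spec[of _ "exp s"])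
 obtain A' where A': "A ** A' = mat 1" "A' ** A = mat 1" using A by (auto simp: invertible_def)
 define T where "T = (\<Sum>j\<in>UNIV. real (kap $ j)) / (2 * real m)"
 define Y where "Y = (%s. A' ** (mat_exp (s *\<^sub>R E) ** A))"
 define e where "e = (%s. exp (- s / (2 * real m)))"
 define D where "D = (%s (j::'d). e s ^ (kap $ j))"
 define X where "X = (%s. (\<chi> i j. D s i * Y s $ i $ j))"
 define K where "K = Max (range (%k. Re (poly_eval a (axis k 1))))"
 obtain L where L: "!!xi j. Re (poly_eval a xi) <= K ==> \<bar>xi $ j\<bar> <= L" by (rule bounded_sublevel, rule that, blast)
 have dY: "X s *v eta = dil kap (e s) (Y s *v eta)" for s eta
  by (simp add: vec_eq_iff X_def D_def matrix_vector_mult_def sum_distrib_left mult_ac)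
 have inv: "poly_eval a (X s *v eta) = poly_eval a eta" for s eta
 proof -
  have "e s ^ (2 * m) = exp (real (2 * m) * (- s / (2 * real m)))"
   unfolding e_def by (rule exp_of_nat_mult[symmetric])
  also have "real (2 * m) * (- s / (2 * real m)) = - s" using m_ge by simp
  finally have "e s ^ (2 * m) = exp (- s)" .
  then have "poly_eval a (X s *v eta) = complex_of_real (exp (- s)) * poly_eval a (Y s *v eta)"
   unfolding dY poly_eval_cpoly complex_vec_dil cpoly_dil by (simp flip: of_real_power)
  also have "poly_eval a (Y s *v eta) = P (A *v (Y s *v eta))" by (simp add: PA)
  also have "A *v (Y s *v eta) = mat_exp (s *\<^sub>R E) *v (A *v eta)"
   by (simp add: Y_def matrix_vector_mul_assoc matrix_mul_assoc A')
  also have "P ... = complex_of_real (exp s) * poly_eval a eta" by (simp add: PE[symmetric] PA)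
  also have "complex_of_real (exp (- s)) * (complex_of_real (exp s) * poly_eval a eta) = poly_eval a eta"
   by (simp add: exp_minus field_simps)
  finally show ?thesis .
 qed
 have entry: "\<bar>X s $ i $ j\<bar> <= L" for s i j
 proof -
  have "Re (poly_eval a (X s *v axis j 1)) <= K"
   unfolding inv K_def by (intro Max_ge) auto
  then have "\<bar>(X s *v axis j 1) $ i\<bar> <= L" by (rule L)
  then show ?thesis by (simp add: matrix_vector_mult_basis column_def)
 qed
 define M where "M = real (card {p. p permutes (UNIV :: 'd set)}) * L ^ CARD('d)"
 have "\<bar>exp (s * (trace E - T))\<bar> <= M" for s
 proof -
  have "det (Y s) = det A' * (det (mat_exp (s *\<^sub>R E)) * det A)" by (simp add: Y_def det_mul)
  also have "det A' * (det (mat_exp (s *\<^sub>R E)) * det A) = (det A' * det A) * exp (s * trace E)"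
   by (simp add: det_mat_exp mult_ac)
  also have "det A' * det A = 1" using A'(2) by (metis det_I det_mul)
  finally have dY1: "det (Y s) = exp (s * trace E)" by simp
  have "(\<Prod>j\<in>UNIV. D s j) = exp (- s * T)"
  proof -
   have "(\<Prod>j\<in>UNIV. D s j) = exp (- s / (2 * real m)) ^ (\<Sum>j\<in>UNIV. kap $ j)"
    by (simp add: D_def e_def power_sum)
   also have "... = exp (real (\<Sum>j\<in>UNIV. kap $ j) * (- s / (2 * real m)))" by (rule exp_of_nat_mult[symmetric])
   also have "real (\<Sum>j\<in>UNIV. kap $ j) * (- s / (2 * real m)) = - s * T" by (simp add: T_def)
   finally show ?thesis .
  qed
  then have "det (X s) = exp (- s * T) * exp (s * trace E)"
   unfolding X_def det_diag_scale dY1 by simp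
  also have "... = exp (s * (trace E - T))" by (simp add: algebra_simps flip: exp_add)
  finally show ?thesis using det_bound[of "X s" L] entry by (simp add: M_def)
 qed
 then have bnd: "exp (s * (trace E - T)) <= M" for s by simp
 have "trace E - T = 0"
 proof (rule ccontr)
  assume nz: "trace E - T ~= 0"
  have "M >= 0" using bnd[of 0] by simp
  have "1 + (M + 1) <= exp (M + 1)" by (rule exp_ge_add_one_self)
  also have "... = exp ((M + 1) / (trace E - T) * (trace E - T))" using nz by simp
  also have "... <= M" by (rule bnd)
  finally show False by simp
 qed
 then show ?thesis unfolding hom_order_def E_def[symmetric] T_def[symmetric] by simp
qed

section \<open>Estimates for the rescaled kernels\<close>

lemma continuous_on_complex_vec: "continuous_on S complex_vec"
 unfolding complex_vec_def by (intro continuous_intros)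

lemma complex_vec_line: "complex_vec (xi + x *\<^sub>R axis j 1) = complex_vec xi + complex_of_real x *s axis j 1"
 by (simp add: vec_eq_iff axis_def)

text \<open>Along a dilation, the power series in several variables becomes a power series in \<open>tau\<close> whose coefficients are its weighted homogeneous parts.\<close>
lemma (in dilation) sums_by_weight:
 fixes b :: "nat^'d => complex"
 assumes s: "((%beta. b beta * mono_eval beta (dil kap tau z)) has_sum S) UNIV"
 shows "(%k. tau ^ k * (\<Sum>beta | wt kap beta = k. b beta * mono_eval beta z)) sums S"
proof -
 define T where "T = (%k. {beta :: nat^'d. wt kap beta = k})"
 have bij: "bij_betw snd (Sigma UNIV T) UNIV"
  by (rule bij_betw_byWitness[of _ "%beta. (wt kap beta, beta)"]) (auto simp: T_def)
 have sig: "((%x. b (snd x) * mono_eval (snd x) (dil kap tau z)) has_sum S) (Sigma UNIV T)"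
  using s has_sum_reindex_bij_betw[OF bij, of "%beta. b beta * mono_eval beta (dil kap tau z)" S] by simp
 have fin: "finite (T k)" for k unfolding T_def by (rule sum_abs_weighted_mono) (rule kappa_ge)
 have "((%k. \<Sum>beta\<in>T k. b beta * mono_eval beta (dil kap tau z)) has_sum S) UNIV"
 proof (rule has_sum_SigmaD[OF sig])
  fix k
  show "((%y. b (snd (k, y)) * mono_eval (snd (k, y)) (dil kap tau z)) has_sum (\<Sum>beta\<in>T k. b beta * mono_eval beta (dil kap tau z))) (T k)"
   using fin by (intro has_sum_finiteI) simp_all
 qed
 then have "(%k. \<Sum>beta\<in>T k. b beta * mono_eval beta (dil kap tau z)) sums S" by (rule has_sum_imp_sums)
 also have "(%k. \<Sum>beta\<in>T k. b beta * mono_eval beta (dil kap tau z)) = (%k. tau ^ k * (\<Sum>beta | wt kap beta = k. b beta * mono_eval beta z))"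
  unfolding T_def sum_distrib_left by (intro ext sum.cong refl) (simp add: mono_eval_dil)
 finally show ?thesis .
qed

lemma one_plus_power_le_exp:
 fixes u e :: real
 assumes u: "u >= 0" and e: "e > 0" and m: "m >= (1::nat)"
 shows "(1 + u) ^ K <= fact K * (1 / e) ^ K * exp (2 * e) * exp (e * u ^ (2 * m))"
proof -
 have "(1 + u) ^ K = (1 / e) ^ K * (e * (1 + u)) ^ K" using e by (simp flip: power_mult_distrib)
 also have "... <= (1 / e) ^ K * (fact K * exp (e * (1 + u)))"
  using e u by (intro mult_left_mono power_le_fact_exp) auto
 also have "exp (e * (1 + u)) <= exp (2 * e + e * u ^ (2 * m))"
 proof -
  have "u <= 1 + u ^ (2 * m)"
  proof (cases "u <= 1")
   case True then show ?thesis using zero_le_power[OF u, of "2 * m"] by linarith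
  next
   case False
   then have "u ^ 1 <= u ^ (2 * m)" using m by (intro power_increasing) auto
   then show ?thesis by simp
  qed
  then have "e * (1 + u) <= e * (2 + u ^ (2 * m))" using e by simp
  then show ?thesis by (simp add: algebra_simps)
 qed
 finally show ?thesis using e by (simp add: exp_add mult_ac mult_left_mono)
qed

text \<open>The surplus \<open>exp (c * qn kap z ^ (2 * m))\<close> pays for the exponential of the remainder, and the powers of \<open>1 + qn kap z\<close> for the coefficients of its expansion.\<close>
lemma (in homogeneous_poly) strip_majorant:
 obtains c where "c > 0" "!!K. \<exists>C\<ge>0. \<forall>xi z. (\<forall>j. cmod (z $ j - complex_vec xi $ j) <= 1) -->
   (1 + qn kap z) ^ K * exp (- Re (cpoly a z)) * exp (c * qn kap z ^ (2 * m))
    <= C * exp (- c * qn kap z ^ (2 * m)) * exp (- c * norm xi)"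
proof -
 obtain c0 C0 where c0: "c0 > 0" "C0 >= 0"
  "!!z. (!!j. \<bar>Im (z $ j)\<bar> <= 1) ==> Re (cpoly a z) >= c0 * qn kap z ^ (2 * m) - C0"
  by (rule strip_lower_bound, rule that, assumption, assumption, blast)
 define D where "D = real CARD('d)"
 have D: "D >= 1" unfolding D_def by (simp add: Suc_le_eq)
 define c where "c = (c0 / 2) / (2 + D)"
 have c: "c > 0" using c0 D by (simp add: c_def)
 have cD: "c0 - 2 * c - c * D = c0 / 2"
 proof -
  have nz: "2 + D ~= 0" using D by linarith
  have "c * (2 + D) = c0 / 2" using nonzero_eq_divide_eq[OF nz, of c "c0 / 2"] c_def by blast
  then show ?thesis by (simp add: algebra_simps)
 qed
 have "\<exists>C\<ge>0. \<forall>xi z. (\<forall>j. cmod (z $ j - complex_vec xi $ j) <= 1) -->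
   (1 + qn kap z) ^ K * exp (- Re (cpoly a z)) * exp (c * qn kap z ^ (2 * m))
    <= C * exp (- c * qn kap z ^ (2 * m)) * exp (- c * norm xi)" for K
 proof -
  define L where "L = fact K * (1 / (c0 / 2)) ^ K * exp (2 * (c0 / 2))"
  have L: "L >= 0" using c0 by (simp add: L_def)
  have main: "(1 + qn kap z) ^ K * exp (- Re (cpoly a z)) * exp (c * qn kap z ^ (2 * m))
    <= (L * exp (C0 + 2 * c * D)) * exp (- c * qn kap z ^ (2 * m)) * exp (- c * norm xi)"
   if near: "\<forall>j. cmod (z $ j - complex_vec xi $ j) <= 1" for xi z
  proof -
   define u where "u = qn kap z"
   have u: "u >= 0" unfolding u_def by (rule qn_nonneg)
   define v where "v = u ^ (2 * m)"
   have "\<bar>Im (z $ j)\<bar> <= 1" for j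
   proof -
    have "\<bar>Im (z $ j - complex_vec xi $ j)\<bar> <= 1" using near abs_Im_le_cmod order_trans by blast
    then show ?thesis by simp
   qed
   then have P: "- Re (cpoly a z) <= C0 - c0 * v" using c0(3)[of z] by (simp add: u_def v_def)
   have "\<bar>xi $ j\<bar> <= 2 + v" for j
   proof -
    have "\<bar>xi $ j\<bar> = cmod (complex_vec xi $ j)" by simp
    also have "... <= cmod (z $ j) + 1"
     using near norm_triangle_ineq4[of "z $ j" "z $ j - complex_vec xi $ j"] by (simp add: order_trans)
    also have "cmod (z $ j) <= u ^ (kap $ j)" unfolding u_def by (rule component_le_qn)
    also have "u ^ (kap $ j) <= 1 + v"
    proof (cases "u <= 1")
     case True
     then have "u ^ (kap $ j) <= 1" using u by (simp add: power_le_one)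
     then show ?thesis using u by (simp add: v_def add_increasing2)
    next
     case False
     then have "u ^ (kap $ j) <= v" unfolding v_def using kappa_le[of j] by (intro power_increasing) auto
     then show ?thesis by simp
    qed
    finally show ?thesis by simp
   qed
   then have "norm xi <= (\<Sum>j\<in>(UNIV :: 'd set). 2 + v)"
    by (intro order_trans[OF norm_le_l1_cart] sum_mono)
   then have nx: "c * norm xi <= c * (D * (2 + v))" using c by (simp add: D_def)
   have "(1 + u) ^ K <= L * exp (c0 / 2 * v)"
    unfolding L_def v_def by (rule one_plus_power_le_exp[OF u _ m_ge]) (use c0 in simp)
   then have "(1 + u) ^ K * exp (- Re (cpoly a z)) * exp (c * v) <= (L * exp (c0 / 2 * v)) * exp (C0 - c0 * v) * exp (c * v)"
    using P L by (intro mult_mono) auto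
   also have "... = L * exp (c0 / 2 * v + (C0 - c0 * v) + c * v)" by (simp only: exp_add mult.assoc)
   also have "c0 / 2 * v + (C0 - c0 * v) + c * v = (C0 + 2 * c * D) + (- c * v) - c * (D * (2 + v))"
    unfolding cD[symmetric] by (simp add: algebra_simps)
   also have "L * exp ((C0 + 2 * c * D) + (- c * v) - c * (D * (2 + v))) <= L * exp ((C0 + 2 * c * D) + (- c * v) + (- c * norm xi))"
    using nx L by (intro mult_left_mono) auto
   also have "... = (L * exp (C0 + 2 * c * D)) * exp (- c * v) * exp (- c * norm xi)" by (simp only: exp_add mult.assoc)
   finally show ?thesis unfolding u_def v_def .
  qed
  show ?thesis
   by (rule exI[of _ "L * exp (C0 + 2 * c * D)"]) (use main L in auto)
 qed
 then show thesis by (rule that[OF c])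
qed

locale local_data = homogeneous_poly kap m a + remainder_series kap m b r B
 for kap :: "nat^'d" and m a b r B +
 fixes Y :: "complex^'d => complex" and U :: "(complex^'d) set"
 assumes U: "open U" "holomorphic_vec_on Y U" "!!z. (!!j. cmod (z $ j) < r) ==> z \<in> U"
  and Ysum: "!!z. (!!j. cmod (z $ j) < r) ==> ((%beta. b beta * mono_eval beta z) has_sum Y z) UNIV"
begin

text \<open>After the substitution the integrand is \<open>exp (- P)\<close> times the exponential of the rescaled remainder. The kernel \<open>aker\<close> keeps the first \<open>N\<close> terms of the expansion of that exponential in powers of \<open>t\<close>, and \<open>hker\<close> is the error.\<close>
definition hker :: "nat => real => complex^'d => complex" where
 "hker N t z = exp (- cpoly a z) * (exp (Y (dil kap (of_real t) z) / of_real (t ^ (2 * m))) - (\<Sum>l<N. wcoef l z * of_real t ^ l))"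

definition aker :: "nat => real => complex^'d => complex" where
 "aker N t z = exp (- cpoly a z) * (\<Sum>l<N. wcoef l z * of_real t ^ l)"

lemma dil_in_polydisc:
 assumes "t > 0" "t * qn kap z < r"
 shows "cmod (dil kap (complex_of_real t) z $ j) < r"
proof -
 have "cmod (dil kap (complex_of_real t) z $ j) <= (t * qn kap z) ^ (kap $ j)"
  using component_le_qn[of "dil kap (complex_of_real t) z" j] assms(1) by (simp add: qn_dil del: dil_nth)
 also have "... <= (t * qn kap z) ^ 1"
  using assms r qn_nonneg[of z] kappa_ge[of j] by (intro power_decreasing) auto
 also have "... < r" using assms by simp
 finally show ?thesis .
qed

lemma eval_Wfps:
 assumes t: "t > 0" and d: "t * qn kap z < r" "2 * t * M * qn kap z <= 1"
 shows "eval_fps (Wfps z) (of_real t) = Y (dil kap (of_real t) z) / of_real (t ^ (2 * m))"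
proof -
 let ?T = "complex_of_real t"
 have "(%k. ?T ^ k * (\<Sum>beta | wt kap beta = k. b beta * mono_eval beta z)) sums Y (dil kap ?T z)"
  by (rule sums_by_weight[OF Ysum]) (rule dil_in_polydisc[OF t d(1)])
 then have s: "(%k. ?T ^ k * V k z) sums Y (dil kap ?T z)" by (simp add: V_def)
 have V0: "V k z = 0" if "k <= 2 * m" for k
  unfolding V_def using b0 that by (intro sum.neutral) auto
 have "(\<Sum>k<2 * m. ?T ^ k * V k z) = 0" by (intro sum.neutral) (simp add: V0)
 then have "(%l. ?T ^ (l + 2 * m) * V (l + 2 * m) z) sums Y (dil kap ?T z)"
  using s by (subst sums_iff_shift) simp
 then have "(%l. ?T ^ (l + 2 * m) * V (l + 2 * m) z / ?T ^ (2 * m)) sums (Y (dil kap ?T z) / ?T ^ (2 * m))"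
  by (rule sums_divide)
 also have "(%l. ?T ^ (l + 2 * m) * V (l + 2 * m) z / ?T ^ (2 * m)) = (%l. W z l * ?T ^ l)"
  using t V0[of "2 * m"] by (auto simp: W_def power_add fun_eq_iff add.commute)
 finally show ?thesis by (simp add: eval_fps_def Wfps_def sums_iff)
qed

lemma polynomial_line_holomorphic:
 "(%w. mono_eval beta (z + w *s axis j 1)) holomorphic_on S"
 unfolding mono_eval_def by (intro holomorphic_intros) (auto simp: axis_def intro!: holomorphic_intros)

lemma cpoly_line_holomorphic: "(%w. cpoly a (z + w *s axis j 1)) holomorphic_on S"
 unfolding cpoly_def by (intro holomorphic_intros polynomial_line_holomorphic)

lemma fps_power_coeff_holomorphic:
 assumes "!!k. (%w. fps_nth (F w) k) holomorphic_on S"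
 shows "(%w. fps_nth (fps_exp 1 oo F w) l) holomorphic_on S"
proof -
 have "(%w. fps_nth (F w ^ i) k) holomorphic_on S" for i k
 proof (induction i arbitrary: k)
  case 0
  show ?case by (cases "k = 0") auto
 next
  case (Suc i)
  show ?case unfolding power_Suc fps_mult_nth by (intro holomorphic_intros assms Suc)
 qed
 then show ?thesis unfolding fps_compose_nth by (intro holomorphic_intros)
qed

lemma wcoef_line_holomorphic: "(%w. wcoef l (z + w *s axis j 1)) holomorphic_on S"
 unfolding wcoef_def
proof (rule fps_power_coeff_holomorphic)
 fix k show "(%w. fps_nth (Wfps (z + w *s axis j 1)) k) holomorphic_on S"
  unfolding Wfps_def W_def V_def fps_nth_Abs_fps
  by (cases "k = 0") (auto intro!: holomorphic_intros polynomial_line_holomorphic)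
qed

lemma aker_line_holomorphic: "(%w. aker N t (z + w *s axis j 1)) holomorphic_on S"
 unfolding aker_def by (intro holomorphic_intros cpoly_line_holomorphic wcoef_line_holomorphic)

lemma hker_line_holomorphic:
 assumes t: "t > 0" and d: "!!w. w \<in> S ==> t * qn kap (z + w *s axis j 1) < r"
 shows "(%w. hker N t (z + w *s axis j 1)) holomorphic_on S"
proof -
 have eq: "dil kap (of_real t) (z + w *s axis j 1) = dil kap (of_real t) z + w *s dil kap (complex_of_real t) (axis j 1)" for w
  by (simp add: vec_eq_iff algebra_simps)
 have "(%w. Y (dil kap (of_real t) z + w *s dil kap (complex_of_real t) (axis j 1))) holomorphic_on S"
 proof (rule holomorphic_vec_on_line[OF U(1,2)])
  fix w assume w: "w \<in> S"
  show "dil kap (of_real t) z + w *s dil kap (complex_of_real t) (axis j 1) \<in> U"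
   unfolding eq[symmetric] by (rule U(3), rule dil_in_polydisc[OF t d[OF w]])
 qed
 then have "(%w. Y (dil kap (of_real t) (z + w *s axis j 1))) holomorphic_on S" unfolding eq .
 then show ?thesis
  unfolding hker_def using t by (intro holomorphic_intros cpoly_line_holomorphic wcoef_line_holomorphic) auto
qed

lemma continuous_on_wcoef: "continuous_on S (wcoef l)"
proof -
 have V: "continuous_on S (%z. fps_nth (Wfps z) k)" for k
  unfolding Wfps_def W_def V_def fps_nth_Abs_fps mono_eval_def by (cases "k = 0") (auto intro!: continuous_intros)
 have "continuous_on S (%z. fps_nth (Wfps z ^ i) k)" for i k
 proof (induction i arbitrary: k)
  case 0
  show ?case by (cases "k = 0") auto
 next
  case (Suc i)
  show ?case unfolding power_Suc fps_mult_nth by (intro continuous_intros V Suc)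
 qed
 then show ?thesis unfolding wcoef_def[abs_def] fps_compose_nth by (intro continuous_intros)
qed

lemma continuous_on_aker: "continuous_on S (%xi. aker N t (complex_vec xi))"
proof -
 have "continuous_on T (aker N t)" for T
  unfolding aker_def[abs_def] by (intro continuous_intros continuous_on_cpoly continuous_on_wcoef)
 from continuous_on_compose2[OF this[of UNIV] continuous_on_complex_vec[of S]] show ?thesis by simp
qed

lemma continuous_on_Y: "continuous_on U Y"
proof -
 have "Y differentiable (at z within U)" if "z \<in> U" for z
  using U(2) that unfolding holomorphic_vec_on_def differentiable_def by blast
 then show ?thesis by (simp add: continuous_on_eq_continuous_within differentiable_imp_continuous_within)
qed

text \<open>A fixed cell around the point, seen in the dilated coordinates: it exhausts the space as \<open>t\<close> tends to \<open>0\<close>.\<close>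
definition box_t :: "real => real => (real^'d) set" where
 "box_t delta t = {xi. \<forall>j. \<bar>xi $ j\<bar> <= (delta / t) ^ (kap $ j)}"

lemma box_t_measurable [measurable]: "box_t delta t \<in> sets borel"
 unfolding box_t_def by measurable

lemma qn_box_t:
 assumes "xi \<in> box_t delta t" "t > 0" "delta > 0"
 shows "t * qn kap (complex_vec xi) <= real CARD('d) * delta"
proof -
 have "root (kap $ j) (cmod (complex_vec xi $ j)) <= delta / t" for j
 proof -
  have "root (kap $ j) (cmod (complex_vec xi $ j)) <= root (kap $ j) ((delta / t) ^ (kap $ j))"
   using assms by (intro real_root_le_mono) (auto simp: box_t_def)
  also have "... = delta / t" using assms by (intro real_root_power_cancel) auto
  finally show ?thesis .
 qed
 then have "qn kap (complex_vec xi) <= (\<Sum>j\<in>(UNIV :: 'd set). delta / t)" unfolding qn_def by (intro sum_mono)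
 then have "qn kap (complex_vec xi) <= real CARD('d) * (delta / t)" by simp
 from mult_left_mono[OF this, of t] assms(2)
 have "t * qn kap (complex_vec xi) <= t * (real CARD('d) * (delta / t))" by simp
 also have "... = real CARD('d) * delta" using assms(2) by simp
 finally show ?thesis .
qed

lemma box_t_qn:
 assumes "t > 0" "t * qn kap (complex_vec xi) <= delta"
 shows "xi \<in> box_t delta t"
 unfolding box_t_def
proof clarify
 fix j
 have "\<bar>xi $ j\<bar> <= qn kap (complex_vec xi) ^ (kap $ j)" using component_le_qn[of "complex_vec xi" j] by simp
 also have "... <= (delta / t) ^ (kap $ j)"
  using assms qn_nonneg by (intro power_mono) (auto simp: field_simps)
 finally show "\<bar>xi $ j\<bar> <= (delta / t) ^ (kap $ j)" .
qed

lemma hker_box_measurable: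
 assumes t: "t > 0" and delta: "delta > 0" "real CARD('d) * delta < r"
 shows "(%xi. indicator (box_t delta t) xi *\<^sub>R hker N t (complex_vec xi)) \<in> borel_measurable borel"
proof (rule borel_measurable_continuous_on_indicator)
 have inU: "dil kap (of_real t) (complex_vec xi) \<in> U" if "xi \<in> box_t delta t" for xi
  by (rule U(3), rule dil_in_polydisc[OF t]) (use qn_box_t[OF that t delta(1)] delta(2) in linarith)
 have "continuous_on (box_t delta t) (%xi. dil kap (complex_of_real t) (complex_vec xi))"
  unfolding dil_def complex_vec_nth by (intro continuous_intros)
 then have "continuous_on (box_t delta t) (%xi. Y (dil kap (of_real t) (complex_vec xi)))"
  by (rule continuous_on_compose2[OF continuous_on_Y]) (use inU in auto)
 moreover have "continuous_on (box_t delta t) (%xi. wcoef l (complex_vec xi))" for l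
  using continuous_on_compose2[OF continuous_on_wcoef[of UNIV] continuous_on_complex_vec] by simp
 moreover have "continuous_on (box_t delta t) (%xi. cpoly a (complex_vec xi))"
  using continuous_on_compose2[OF continuous_on_cpoly[of UNIV] continuous_on_complex_vec] by simp
 ultimately show "continuous_on (box_t delta t) (%xi. hker N t (complex_vec xi))"
  unfolding hker_def using t by (intro continuous_intros) auto
qed measurable

text \<open>For points well inside the box the unit discs stay in the domain of holomorphy and the Taylor remainder supplies the factor \<open>t ^ N\<close>. All other points have quasi-norm at least of order \<open>1 / t\<close>, where the Gaussian factor \<open>exp (- P)\<close> is at most \<open>exp (- c / t ^ (2 * m))\<close>; so the jump of the indicator is harmless.\<close>
theorem kernel_estimates:
 assumes delta0: "delta0 > 0"
 obtains delta c C where "0 < delta" "delta <= delta0" "c > 0" "C >= 0"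
  "!!t y. 0 < t ==> t <= 1 ==> cmod (LINT xi|lborel. (indicator (box_t delta t) xi *\<^sub>R hker N t (complex_vec xi)) * character y xi)
    <= C * (t ^ N * exp (- c * norm y) + exp (- c / t ^ (2 * m)))"
  "!!t y. 0 < t ==> t <= 1 ==> cmod (LINT xi|lborel. aker N t (complex_vec xi) * character y xi) <= C * exp (- c * norm y)"
  "!!t y. 0 < t ==> t <= 1 ==> cmod (LINT xi|lborel. (indicator (- box_t delta t) xi *\<^sub>R aker N t (complex_vec xi)) * character y xi)
    <= C * exp (- c / t ^ (2 * m))"
  "!!t. 0 < t ==> t <= 1 ==> integrable lborel (%xi. indicator (box_t delta t) xi *\<^sub>R hker N t (complex_vec xi))"
  "!!t. 0 < t ==> t <= 1 ==> integrable lborel (%xi. aker N t (complex_vec xi))"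
proof -
 define D where "D = real CARD('d)"
 have D: "D >= 1" unfolding D_def by (simp add: Suc_le_eq)
 obtain c0 where c0: "c0 > 0" and maj: "!!K. \<exists>C\<ge>0. \<forall>xi z. (\<forall>j. cmod (z $ j - complex_vec xi $ j) <= 1) -->
   (1 + qn kap z) ^ K * exp (- Re (cpoly a z)) * exp (c0 * qn kap z ^ (2 * m))
    <= C * exp (- c0 * qn kap z ^ (2 * m)) * exp (- c0 * norm xi)"
  by (rule strip_majorant, rule that, assumption, blast)
 obtain C1 c1 where c1: "c1 > 0" "C1 >= 0"
  and wc: "!!z s l. s >= 1 ==> (!!j. cmod (z $ j) <= s ^ (kap $ j)) ==> cmod (wcoef l z) <= C1 * (s ^ (2 * m + 1) / c1) ^ l"
  and ex: "!!z u s t k. s >= 1 ==> 0 <= u ==> u <= s ==> (!!j. cmod (z $ j) <= u ^ (kap $ j)) ==> 0 <= t ==> 2 * t * M * u <= 1 ==>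
   cmod (exp (eval_fps (Wfps z) (of_real t)) - (\<Sum>l<k. wcoef l z * of_real t ^ l))
    <= C1 * real (k + 2) * (t * s ^ (2 * m + 1) / c1) ^ k * exp (2 * G * (M * u) ^ (2 * m) * (t * M * u))"
  by (rule exp_series_expansion, rule that, assumption, assumption, blast, blast)
 define g where "g = 2 * G * M ^ (2 * m) * M"
 have g: "g >= 0" using G_nonneg M_ge by (simp add: g_def)
 \<comment> \<open>Small enough for the power series, for the expansion of the exponential, and for the exponential of the remainder to be absorbed by the surplus.\<close>
 define delta1 where "delta1 = min (min (r / 2) (1 / (2 * M))) (min (c0 / (g + 1)) delta0)"
 have delta1: "delta1 > 0" "delta1 < r" "2 * delta1 * M <= 1" "g * delta1 <= c0" "delta1 <= delta0"
 proof -
  show "delta1 > 0" using r M_ge c0 g delta0 by (simp add: delta1_def)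
  have "delta1 <= r / 2" unfolding delta1_def by linarith
  then show "delta1 < r" using r by linarith
  have "delta1 <= 1 / (2 * M)" unfolding delta1_def by linarith
  then show "2 * delta1 * M <= 1" using M_ge by (simp add: field_simps)
  have "delta1 <= c0 / (g + 1)" unfolding delta1_def by linarith
  then have "delta1 * (g + 1) <= c0" using g by (simp add: field_simps)
  then show "g * delta1 <= c0" using \<open>delta1 > 0\<close> by (simp add: algebra_simps)
  show "delta1 <= delta0" by (simp add: delta1_def)
 qed
 define delta where "delta = delta1 / D"
 have delta: "delta > 0" "delta <= delta1" "D * delta = delta1" using delta1 D by (auto simp: delta_def field_simps)
 define w where "w = (%xi::real^'d. exp (- c0 * norm xi))"
 have wi: "integrable lborel w" unfolding w_def by (rule integrable_exp_norm[OF c0])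
 have w0: "w xi >= 0" for xi by (simp add: w_def)
 define K where "K = (2 * m + 1) * N"
 obtain C2 where C2: "C2 >= 0" and maj2: "!!xi z. (\<forall>j. cmod (z $ j - complex_vec xi $ j) <= 1) ==>
   (1 + qn kap z) ^ K * exp (- Re (cpoly a z)) * exp (c0 * qn kap z ^ (2 * m))
    <= C2 * exp (- c0 * qn kap z ^ (2 * m)) * w xi"
  using maj[of K] unfolding w_def by blast
 define C3 where "C3 = C1 * real (N + 2) * (1 / c1) ^ N * C2"
 have C3: "C3 >= 0" using c1 C2 by (simp add: C3_def)
 have hb: "cmod (hker N t z) <= C3 * t ^ N * exp (- c0 * qn kap z ^ (2 * m)) * w xi"
  if near: "\<forall>j. cmod (z $ j - complex_vec xi $ j) <= 1" and t: "0 < t" and tq: "t * qn kap z <= delta1" for xi z t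
 proof -
  define u where "u = qn kap z"
  have u: "u >= 0" unfolding u_def by (rule qn_nonneg)
  have tu: "t * u <= delta1" using tq by (simp add: u_def)
  have "2 * t * M * u <= 2 * delta1 * M" using mult_right_mono[OF tu, of "2 * M"] M_ge by (simp add: mult_ac)
  then have tM: "2 * t * M * u <= 1" using delta1(3) by linarith
  have "exp (eval_fps (Wfps z) (of_real t)) = exp (Y (dil kap (of_real t) z) / of_real (t ^ (2 * m)))"
   by (subst eval_Wfps[OF t]) (use tu tM delta1 in \<open>auto simp: u_def\<close>)
  then have "cmod (hker N t z) = exp (- Re (cpoly a z)) * cmod (exp (eval_fps (Wfps z) (of_real t)) - (\<Sum>l<N. wcoef l z * of_real t ^ l))"
   by (simp add: hker_def norm_mult)
  also have "... <= exp (- Re (cpoly a z)) * (C1 * real (N + 2) * (t * (1 + u) ^ (2 * m + 1) / c1) ^ N * exp (c0 * u ^ (2 * m)))"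
  proof (intro mult_left_mono)
   have "cmod (exp (eval_fps (Wfps z) (of_real t)) - (\<Sum>l<N. wcoef l z * of_real t ^ l))
     <= C1 * real (N + 2) * (t * (1 + u) ^ (2 * m + 1) / c1) ^ N * exp (2 * G * (M * u) ^ (2 * m) * (t * M * u))"
    by (rule ex) (use u t tM component_le_qn in \<open>auto simp: u_def\<close>)
   also have "... <= C1 * real (N + 2) * (t * (1 + u) ^ (2 * m + 1) / c1) ^ N * exp (c0 * u ^ (2 * m))"
   proof (intro mult_left_mono)
    have "2 * G * (M * u) ^ (2 * m) * (t * M * u) = g * (t * u) * u ^ (2 * m)" by (simp add: g_def power_mult_distrib mult_ac)
    also have "... <= c0 * u ^ (2 * m)"
    proof (intro mult_right_mono)
     show "g * (t * u) <= c0" using mult_left_mono[OF tu g] delta1(4) by linarith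
    qed (use u in simp)
    finally show "exp (2 * G * (M * u) ^ (2 * m) * (t * M * u)) <= exp (c0 * u ^ (2 * m))" by simp
   qed (use c1 t u in auto)
   finally show "cmod (exp (eval_fps (Wfps z) (of_real t)) - (\<Sum>l<N. wcoef l z * of_real t ^ l))
     <= C1 * real (N + 2) * (t * (1 + u) ^ (2 * m + 1) / c1) ^ N * exp (c0 * u ^ (2 * m))" .
  qed simp
  also have "... = (C1 * real (N + 2) * (1 / c1) ^ N * t ^ N) * ((1 + u) ^ K * exp (- Re (cpoly a z)) * exp (c0 * u ^ (2 * m)))"
   unfolding K_def power_mult by (simp add: power_mult_distrib power_divide mult_ac)
  also have "... <= (C1 * real (N + 2) * (1 / c1) ^ N * t ^ N) * (C2 * exp (- c0 * u ^ (2 * m)) * w xi)"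
   using maj2[OF near] c1 t unfolding u_def by (intro mult_left_mono) auto
  finally show ?thesis unfolding u_def C3_def by (simp only: mult_ac)
 qed
 define C4 where "C4 = real N * (C1 * (1 + 1 / c1) ^ N) * C2"
 have C4: "C4 >= 0" using c1 C2 by (simp add: C4_def)
 have ab: "cmod (aker N t z) <= C4 * exp (- c0 * qn kap z ^ (2 * m)) * w xi"
  if near: "\<forall>j. cmod (z $ j - complex_vec xi $ j) <= 1" and t: "0 < t" "t <= 1" for xi z t
 proof -
  define u where "u = qn kap z"
  have u: "u >= 0" unfolding u_def by (rule qn_nonneg)
  have zs: "cmod (z $ j) <= (1 + u) ^ (kap $ j)" for j
  proof -
   have "u ^ (kap $ j) <= (1 + u) ^ (kap $ j)" using u by (intro power_mono) auto
   with component_le_qn[of z j] show ?thesis unfolding u_def by linarith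
  qed
  have "cmod (\<Sum>l<N. wcoef l z * of_real t ^ l) <= (\<Sum>l<N. C1 * (1 + 1 / c1) ^ N * (1 + u) ^ K)"
  proof (rule sum_norm_le)
   fix l assume l: "l \<in> {..<N}"
   have "cmod (wcoef l z * of_real t ^ l) <= (C1 * ((1 + u) ^ (2 * m + 1) / c1) ^ l) * 1"
    unfolding norm_mult norm_power
   proof (rule mult_mono)
    show "cmod (wcoef l z) <= C1 * ((1 + u) ^ (2 * m + 1) / c1) ^ l" by (rule wc[OF _ zs]) (use u in simp)
    show "cmod (of_real t) ^ l <= 1" using t by (simp add: power_le_one)
   qed (use c1 u in auto)
   also have "... = C1 * ((1 / c1) ^ l * (1 + u) ^ ((2 * m + 1) * l))"
    unfolding power_mult by (simp add: power_divide)
   also have "... <= C1 * ((1 + 1 / c1) ^ N * (1 + u) ^ K)"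
   proof (intro mult_left_mono mult_mono)
    have "(1 / c1) ^ l <= (1 + 1 / c1) ^ l" using c1 by (intro power_mono) auto
    also have "... <= (1 + 1 / c1) ^ N" using c1 l by (intro power_increasing) auto
    finally show "(1 / c1) ^ l <= (1 + 1 / c1) ^ N" .
    have "(2 * m + 1) * l <= K" unfolding K_def using l by (intro mult_le_mono2) simp
    then show "(1 + u) ^ ((2 * m + 1) * l) <= (1 + u) ^ K" using u by (intro power_increasing) auto
   qed (use c1 u in auto)
   finally show "cmod (wcoef l z * of_real t ^ l) <= C1 * (1 + 1 / c1) ^ N * (1 + u) ^ K" by (simp only: mult.assoc)
  qed
  then have "cmod (\<Sum>l<N. wcoef l z * of_real t ^ l) <= real N * (C1 * (1 + 1 / c1) ^ N) * (1 + u) ^ K"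
   by (simp add: mult_ac)
  then have "cmod (aker N t z) <= exp (- Re (cpoly a z)) * (real N * (C1 * (1 + 1 / c1) ^ N) * (1 + u) ^ K)"
   by (simp add: aker_def norm_mult)
  also have "... <= exp (- Re (cpoly a z)) * (real N * (C1 * (1 + 1 / c1) ^ N) * (1 + u) ^ K) * exp (c0 * u ^ (2 * m))"
  proof -
   have "1 <= exp (c0 * u ^ (2 * m))" using c0 u by simp
   moreover have "0 <= exp (- Re (cpoly a z)) * (real N * (C1 * (1 + 1 / c1) ^ N) * (1 + u) ^ K)"
    using c1 u by simp
   ultimately show ?thesis using mult_left_mono by fastforce
  qed
  also have "... = (real N * (C1 * (1 + 1 / c1) ^ N)) * ((1 + u) ^ K * exp (- Re (cpoly a z)) * exp (c0 * u ^ (2 * m)))"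
   by (simp only: mult_ac)
  also have "... <= (real N * (C1 * (1 + 1 / c1) ^ N)) * (C2 * exp (- c0 * u ^ (2 * m)) * w xi)"
   using maj2[OF near] c1 unfolding u_def by (intro mult_left_mono) auto
  finally show ?thesis unfolding u_def C4_def by (simp only: mult_ac)
 qed
 have disc: "\<forall>i. cmod ((complex_vec xi + v *s axis j 1) $ i - complex_vec xi $ i) <= 1" if "cmod v <= 1" for xi v j
  using that by (auto simp: axis_def)
 \<comment> \<open>Off the box the quasi-norm is at least of order \<open>1 / t\<close>; the factor \<open>E\<close> covers those \<open>t\<close> for which this lower bound is not yet effective.\<close>
 define c' where "c' = c0 * (delta / 2) ^ (2 * m)"
 have c': "c' > 0" using c0 delta by (simp add: c'_def)
 define E where "E = exp (c' * (4 * D / delta) ^ (2 * m))"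
 have far: "exp (- c0 * u ^ (2 * m)) <= E * exp (- c' / t ^ (2 * m))" if t: "0 < t" and u: "0 <= u" "delta < t * (u + 2 * D)" for t u
 proof (cases "4 * D <= delta / t")
  case True
  have "delta / t < u + 2 * D" using u t by (simp add: field_simps)
  then have "delta / 2 / t <= u" using True by simp
  then have "(delta / 2 / t) ^ (2 * m) <= u ^ (2 * m)" using t delta by (intro power_mono) auto
  from mult_left_mono[OF this less_imp_le[OF c0]]
  have "c' / t ^ (2 * m) <= c0 * u ^ (2 * m)" by (simp add: c'_def power_divide)
  then have "exp (- c0 * u ^ (2 * m)) <= 1 * exp (- c' / t ^ (2 * m))" by simp
  also have "... <= E * exp (- c' / t ^ (2 * m))"
   unfolding E_def using c' delta D by (intro mult_right_mono) auto
  finally show ?thesis .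
 next
  case False
  then have "1 / t <= 4 * D / delta" using t delta by (simp add: field_simps)
  then have "(1 / t) ^ (2 * m) <= (4 * D / delta) ^ (2 * m)" using t by (intro power_mono) auto
  from mult_left_mono[OF this less_imp_le[OF c']]
  have "c' / t ^ (2 * m) <= c' * (4 * D / delta) ^ (2 * m)" by (simp only: power_one_over times_divide_eq_right mult_1_right)
  then have "1 <= E * exp (- c' / t ^ (2 * m))" unfolding E_def by (simp flip: exp_add)
  moreover have "exp (- c0 * u ^ (2 * m)) <= 1" using c0 u by simp
  ultimately show ?thesis by linarith
 qed
 define k where "k = ln 2 / (4 * pi * D)"
 have k: "k > 0" using D by (simp add: k_def)
 define I where "I = integral\<^sup>L lborel w"
 have I: "I >= 0" unfolding I_def using w0 by simp
 define C where "C = 2 * (C3 + C3 * E + C4 + C4 * E) * I + C4 * E * I"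
 have E0: "E >= 0" by (simp add: E_def)
 have Cge: "2 * C3 * I <= C" "2 * (C3 * E) * I <= C" "2 * C4 * I <= C" "C4 * E * I <= C" "C >= 0"
  using C3 C4 E0 I unfolding C_def by (auto simp: algebra_simps intro!: add_nonneg_nonneg mult_nonneg_nonneg)
 define c where "c = min k c'"
 have c: "c > 0" "c <= k" "c <= c'" using k c' by (auto simp: c_def)
 have expc: "exp (- k * norm y) <= exp (- c * norm y)" for y :: "real^'d"
  using c mult_right_mono[of c k "norm y"] by simp
 have expc': "exp (- c' / t ^ (2 * m)) <= exp (- c / t ^ (2 * m))" if "t > 0" for t
  using c that by (simp add: divide_right_mono)
 have H: "integrable lborel (%xi. indicator (box_t delta t) xi *\<^sub>R hker N t (complex_vec xi))"
   "cmod (LINT xi|lborel. (indicator (box_t delta t) xi *\<^sub>R hker N t (complex_vec xi)) * exp (- (\<i> * complex_of_real (y \<bullet> xi))))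
    <= 2 * (C3 * t ^ N * exp (- (ln 2 / (4 * pi * real CARD('d)) * norm y)) + C3 * E * exp (- c' / t ^ (2 * m))) * integral\<^sup>L lborel w"
  if t: "0 < t" "t <= 1" for t y
 proof -
  note fid = fourier_integral_decay[OF hker_box_measurable[OF t(1) delta(1)] wi w0, of "C3 * t ^ N" "C3 * E * exp (- c' / t ^ (2 * m))"]
  have alt: "(\<exists>f. f holomorphic_on ball 0 1 \<and> (\<forall>u\<in>ball 0 1. cmod (f u) <= C3 * t ^ N * w xi) \<and>
         (\<forall>x. \<bar>x\<bar> <= 1 / 2 --> indicator (box_t delta t) (xi + x *\<^sub>R axis j 1) *\<^sub>R hker N t (complex_vec (xi + x *\<^sub>R axis j 1)) = f (of_real x))) \<or>
       (\<forall>x. \<bar>x\<bar> <= 1 / 2 --> cmod (indicator (box_t delta t) (xi + x *\<^sub>R axis j 1) *\<^sub>R hker N t (complex_vec (xi + x *\<^sub>R axis j 1))) <= C3 * E * exp (- c' / t ^ (2 * m)) * w xi)"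
   for xi j
  proof (cases "t * (qn kap (complex_vec xi) + D) <= delta")
   case True
   let ?f = "%v. hker N t (complex_vec xi + v *s axis j 1)"
   have tq: "t * qn kap (complex_vec xi + v *s axis j 1) <= delta" if "cmod v <= 1" for v
   proof -
    have "qn kap (complex_vec xi + v *s axis j 1) <= qn kap (complex_vec xi) + D"
     unfolding D_def by (rule qn_perturb) (use disc[OF that] in blast)
    then have "t * qn kap (complex_vec xi + v *s axis j 1) <= t * (qn kap (complex_vec xi) + D)" using t by (intro mult_left_mono) auto
    then show ?thesis using True by linarith
   qed
   have "?f holomorphic_on ball 0 1"
   proof (rule hker_line_holomorphic[OF t(1)])
    fix v :: complex assume "v \<in> ball 0 1"
    then show "t * qn kap (complex_vec xi + v *s axis j 1) < r" using tq[of v] delta(2) delta1(2) by simp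
   qed
   moreover have "cmod (?f v) <= C3 * t ^ N * w xi" if "v \<in> ball 0 1" for v
   proof -
    have v: "cmod v <= 1" using that by simp
    have "cmod (?f v) <= C3 * t ^ N * exp (- c0 * qn kap (complex_vec xi + v *s axis j 1) ^ (2 * m)) * w xi"
     by (rule hb[OF disc[OF v] t(1)]) (use tq[OF v] delta(2) in linarith)
    also have "... <= C3 * t ^ N * 1 * w xi"
     using C3 t w0 c0 qn_nonneg by (intro mult_right_mono mult_left_mono) auto
    finally show ?thesis by simp
   qed
   moreover have "indicator (box_t delta t) (xi + x *\<^sub>R axis j 1) *\<^sub>R hker N t (complex_vec (xi + x *\<^sub>R axis j 1)) = ?f (of_real x)"
    if x: "\<bar>x\<bar> <= 1 / 2" for x
   proof -
    have "xi + x *\<^sub>R axis j 1 \<in> box_t delta t"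
     by (rule box_t_qn[OF t(1)]) (use tq[of "of_real x"] x in \<open>simp add: complex_vec_line\<close>)
    then show ?thesis by (simp add: complex_vec_line)
   qed
   ultimately show ?thesis by (intro disjI1 exI[of _ ?f]) auto
  next
   case False
   have "cmod (indicator (box_t delta t) (xi + x *\<^sub>R axis j 1) *\<^sub>R hker N t (complex_vec (xi + x *\<^sub>R axis j 1))) <= C3 * E * exp (- c' / t ^ (2 * m)) * w xi"
    if x: "\<bar>x\<bar> <= 1 / 2" for x
   proof (cases "xi + x *\<^sub>R axis j 1 \<in> box_t delta t")
    case out: False
    then show ?thesis using C3 E0 w0 by simp
   next
    case inbox: True
    let ?z = "complex_vec (xi + x *\<^sub>R axis j 1)"
    have near: "\<forall>i. cmod (?z $ i - complex_vec xi $ i) <= 1"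
     unfolding complex_vec_line using disc[of "of_real x"] x by simp
    have "t * qn kap ?z <= delta1" using qn_box_t[OF inbox t(1) delta(1)] delta(3) by (simp add: D_def)
    then have "cmod (hker N t ?z) <= C3 * t ^ N * exp (- c0 * qn kap ?z ^ (2 * m)) * w xi" by (rule hb[OF near t(1)])
    also have "... <= C3 * 1 * (E * exp (- c' / t ^ (2 * m))) * w xi"
    proof (intro mult_right_mono mult_mono mult_left_mono far t(1) qn_nonneg)
     show "t ^ N <= 1" using t by (simp add: power_le_one)
     have "qn kap (complex_vec xi) <= qn kap ?z + D"
      unfolding D_def by (rule qn_perturb) (use near in \<open>simp add: norm_minus_commute\<close>)
     then have "t * (qn kap (complex_vec xi) + D) <= t * (qn kap ?z + 2 * D)" using t by simp
     then show "delta < t * (qn kap ?z + 2 * D)" using False by linarith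
    qed (use C3 E0 w0 t in auto)
    finally show ?thesis using inbox by (simp add: mult.assoc)
   qed
   then show ?thesis by blast
  qed
  have pre: "real CARD('d) * delta < r" "C3 * t ^ N >= 0" "C3 * E * exp (- c' / t ^ (2 * m)) >= 0"
   using delta(3) delta1(2) C3 E0 t by (auto simp: D_def)
  show "integrable lborel (%xi. indicator (box_t delta t) xi *\<^sub>R hker N t (complex_vec xi))"
   by (rule fid(1)[OF pre(1) pre(2) pre(3) alt])
  show "cmod (LINT xi|lborel. (indicator (box_t delta t) xi *\<^sub>R hker N t (complex_vec xi)) * exp (- (\<i> * complex_of_real (y \<bullet> xi))))
    <= 2 * (C3 * t ^ N * exp (- (ln 2 / (4 * pi * real CARD('d)) * norm y)) + C3 * E * exp (- c' / t ^ (2 * m))) * integral\<^sup>L lborel w"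
   by (rule fid(2)[OF pre(1) pre(2) pre(3) alt])
 qed
 have am: "(%xi. aker N t (complex_vec xi)) \<in> borel_measurable borel" for t
  by (intro borel_measurable_continuous_onI continuous_on_aker)
 have A: "integrable lborel (%xi. aker N t (complex_vec xi))"
   "cmod (LINT xi|lborel. aker N t (complex_vec xi) * exp (- (\<i> * complex_of_real (y \<bullet> xi))))
    <= 2 * (C4 * exp (- (ln 2 / (4 * pi * real CARD('d)) * norm y)) + 0) * integral\<^sup>L lborel w"
  if t: "0 < t" "t <= 1" for t y
 proof -
  note fid = fourier_integral_decay[OF am wi w0, of C4 0]
  have alt: "(\<exists>f. f holomorphic_on ball 0 1 \<and> (\<forall>u\<in>ball 0 1. cmod (f u) <= C4 * w xi) \<and>
         (\<forall>x. \<bar>x\<bar> <= 1 / 2 --> aker N t (complex_vec (xi + x *\<^sub>R axis j 1)) = f (of_real x))) \<or>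
       (\<forall>x. \<bar>x\<bar> <= 1 / 2 --> cmod (aker N t (complex_vec (xi + x *\<^sub>R axis j 1))) <= 0 * w xi)" for xi j
  proof (intro disjI1 exI[of _ "%v. aker N t (complex_vec xi + v *s axis j 1)"] conjI ballI allI impI)
   show "(%v. aker N t (complex_vec xi + v *s axis j 1)) holomorphic_on ball 0 1" by (rule aker_line_holomorphic)
   fix v :: complex assume "v \<in> ball 0 1"
   then have v: "cmod v <= 1" by simp
   have "cmod (aker N t (complex_vec xi + v *s axis j 1)) <= C4 * exp (- c0 * qn kap (complex_vec xi + v *s axis j 1) ^ (2 * m)) * w xi"
    by (rule ab[OF disc[OF v] t])
   also have "... <= C4 * 1 * w xi" using C4 w0 c0 qn_nonneg by (intro mult_right_mono mult_left_mono) auto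
   finally show "cmod (aker N t (complex_vec xi + v *s axis j 1)) <= C4 * w xi" by simp
  qed (simp add: complex_vec_line)
  show "integrable lborel (%xi. aker N t (complex_vec xi))" by (rule fid(1)[OF C4 order_refl alt])
  show "cmod (LINT xi|lborel. aker N t (complex_vec xi) * exp (- (\<i> * complex_of_real (y \<bullet> xi))))
    <= 2 * (C4 * exp (- (ln 2 / (4 * pi * real CARD('d)) * norm y)) + 0) * integral\<^sup>L lborel w"
   by (rule fid(2)[OF C4 order_refl alt])
 qed
 show thesis
 proof (rule that[of delta c C])
  show "0 < delta" "delta <= delta0" "c > 0" "C >= 0" using delta delta1 c Cge by auto
  fix t y assume t: "(0::real) < t" "t <= 1"
  show "integrable lborel (%xi. indicator (box_t delta t) xi *\<^sub>R hker N t (complex_vec xi))" by (rule H(1)[OF t])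
  show "integrable lborel (%xi. aker N t (complex_vec xi))" by (rule A(1)[OF t])
  have "cmod (LINT xi|lborel. (indicator (box_t delta t) xi *\<^sub>R hker N t (complex_vec xi)) * character y xi)
    <= 2 * (C3 * t ^ N * exp (- k * norm y) + C3 * E * exp (- c' / t ^ (2 * m))) * I"
   using H(2)[OF t, of y] by (simp add: character_def k_def I_def D_def)
  also have "... = (2 * C3 * I) * (t ^ N * exp (- k * norm y)) + (2 * (C3 * E) * I) * exp (- c' / t ^ (2 * m))"
   by (simp add: algebra_simps)
  also have "... <= C * (t ^ N * exp (- c * norm y)) + C * exp (- c / t ^ (2 * m))"
   using Cge C3 E0 I t expc[of y] expc'[OF t(1)] by (intro add_mono mult_mono mult_left_mono) auto
  finally show "cmod (LINT xi|lborel. (indicator (box_t delta t) xi *\<^sub>R hker N t (complex_vec xi)) * character y xi)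
    <= C * (t ^ N * exp (- c * norm y) + exp (- c / t ^ (2 * m)))" by (simp only: distrib_left)
  have "cmod (LINT xi|lborel. aker N t (complex_vec xi) * character y xi) <= (2 * C4 * I) * exp (- k * norm y)"
   using A(2)[OF t, of y] by (simp add: character_def k_def I_def D_def mult_ac)
  also have "... <= C * exp (- c * norm y)" using Cge C4 I expc[of y] by (intro mult_mono) auto
  finally show "cmod (LINT xi|lborel. aker N t (complex_vec xi) * character y xi) <= C * exp (- c * norm y)" .
  have pt: "cmod (indicator (- box_t delta t) xi *\<^sub>R aker N t (complex_vec xi) * character y xi) <= C4 * E * exp (- c' / t ^ (2 * m)) * w xi" for xi
  proof (cases "xi \<in> box_t delta t")
   case True
   then show ?thesis using C4 E0 w0 by simp
  next
   case False
   have "\<not> t * qn kap (complex_vec xi) <= delta" using False box_t_qn[OF t(1)] by blast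
   then have "delta < t * (qn kap (complex_vec xi) + 2 * D)"
   proof -
    have "t * qn kap (complex_vec xi) <= t * (qn kap (complex_vec xi) + 2 * D)" using t D by (intro mult_left_mono) auto
    with \<open>\<not> t * qn kap (complex_vec xi) <= delta\<close> show ?thesis by linarith
   qed
   then have f: "exp (- c0 * qn kap (complex_vec xi) ^ (2 * m)) <= E * exp (- c' / t ^ (2 * m))"
    by (rule far[OF t(1) qn_nonneg])
   have "cmod (aker N t (complex_vec xi)) <= C4 * exp (- c0 * qn kap (complex_vec xi) ^ (2 * m)) * w xi"
    by (rule ab[OF _ t]) simp
   also have "... <= C4 * (E * exp (- c' / t ^ (2 * m))) * w xi"
    using f C4 w0 by (intro mult_right_mono mult_left_mono) auto
   finally show ?thesis using False by (simp add: norm_mult mult.assoc)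
  qed
  have "cmod (LINT xi|lborel. (indicator (- box_t delta t) xi *\<^sub>R aker N t (complex_vec xi)) * character y xi)
    <= (LINT xi|lborel. C4 * E * exp (- c' / t ^ (2 * m)) * w xi)"
  proof (rule Bochner_Integration.integral_norm_bound_integral)
   show "integrable lborel (%xi. C4 * E * exp (- c' / t ^ (2 * m)) * w xi)" by (intro integrable_mult_right wi)
   show "integrable lborel (%xi. (indicator (- box_t delta t) xi *\<^sub>R aker N t (complex_vec xi)) * character y xi)"
   proof (rule Bochner_Integration.integrable_bound[OF A(1)[OF t]])
    note am[measurable]
    show "(%xi. (indicator (- box_t delta t) xi *\<^sub>R aker N t (complex_vec xi)) * character y xi) \<in> borel_measurable lborel"
     using am[of t] by measurable
   qed (auto simp: norm_mult indicator_def)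
  qed (rule pt)
  also have "... = (C4 * E * I) * exp (- c' / t ^ (2 * m))" by (simp add: I_def)
  also have "... <= C * exp (- c / t ^ (2 * m))"
   using Cge C4 E0 I expc'[OF t(1)] by (intro mult_mono) auto
  finally show "cmod (LINT xi|lborel. (indicator (- box_t delta t) xi *\<^sub>R aker N t (complex_vec xi)) * character y xi)
    <= C * exp (- c / t ^ (2 * m))" .
 qed
qed

end

section \<open>Data at a point of maximal modulus\<close>

lemma lcm_vec_pos:
 assumes "!!j. mm $ j >= 1"
 shows "lcm_vec mm >= 1"
proof -
 have "lcm_vec mm ~= 0"
 proof
  assume "lcm_vec mm = 0"
  then have "0 \<in> range (%j. mm $ j)" unfolding lcm_vec_def by (simp add: Lcm_0_iff)
  then obtain j where "mm $ j = 0" by (metis rangeE)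
  with assms[of j] show False by simp
 qed
 then show ?thesis by simp
qed

lemma kappa_mult:
 fixes mm :: "nat^'d"
 shows "kappa mm $ j * mm $ j = lcm_vec mm"
proof -
 have "mm $ j dvd lcm_vec mm" unfolding lcm_vec_def by (rule dvd_Lcm) simp
 then show ?thesis by (simp add: kappa_def)
qed

lemma dilation_kappa:
 assumes mm: "!!j. mm $ j >= 1"
 shows "dilation (kappa mm) (lcm_vec mm)"
proof
 fix j
 have "kappa mm $ j * mm $ j ~= 0" unfolding kappa_mult using lcm_vec_pos[OF mm] by simp
 then show "1 <= kappa mm $ j" by simp
 show "kappa mm $ j <= lcm_vec mm" by (simp add: kappa_def)
qed

lemma weighted_length_wt:
 assumes mm: "!!j. mm $ j >= 1"
 shows "real (wt (kappa mm) beta) = real (lcm_vec mm) * weighted_length beta mm"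
proof -
 have "real (beta $ j * kappa mm $ j) = real (lcm_vec mm) * (real (beta $ j) / real (mm $ j))" for j
 proof -
  have "mm $ j ~= 0" using mm[of j] by simp
  moreover have "real (lcm_vec mm) = real (kappa mm $ j) * real (mm $ j)"
   by (simp flip: kappa_mult[of mm j])
  ultimately show ?thesis by simp
 qed
 then show ?thesis by (simp only: wt_def weighted_length_def of_nat_sum sum_distrib_left)
qed

lemma Lambda_index_wt: "Lambda_index mm beta = int (wt (kappa mm) beta) - 2 * int (lcm_vec mm)"
 by (simp add: Lambda_index_def wt_def)

lemma map_matrix_complex_vec:
 "map_matrix complex_of_real A *v complex_vec eta = complex_vec (A *v eta)"
 by (simp add: vec_eq_iff matrix_vector_mult_def map_matrix_def)

lemma holomorphic_vec_on_linear:
 fixes L :: "complex^'d^'d"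
 assumes U: "open U" "holomorphic_vec_on F U"
 shows "open {w. L *v w \<in> U}" "holomorphic_vec_on (%w. F (L *v w)) {w. L *v w \<in> U}"
proof -
 have bl: "bounded_linear ((*v) L)" by simp
 have "continuous_on UNIV ((*v) L)" by (rule linear_continuous_on[OF bl])
 then have "open ((*v) L -` U)" using U(1) open_vimage by blast
 then show op: "open {w. L *v w \<in> U}" by (simp add: vimage_def)
 show "holomorphic_vec_on (%w. F (L *v w)) {w. L *v w \<in> U}"
  unfolding holomorphic_vec_on_def
 proof
  fix w assume "w \<in> {w. L *v w \<in> U}"
  then have w: "L *v w \<in> U" by simp
  obtain c where c: "(F has_derivative (%h. \<Sum>j\<in>UNIV. c $ j * h $ j)) (at (L *v w) within U)"
   using U(2) w unfolding holomorphic_vec_on_def by blast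
  have c': "(F has_derivative (%h. \<Sum>j\<in>UNIV. c $ j * h $ j)) (at (L *v w))"
   using c at_within_open[OF w U(1)] by simp
  have "((%w. F (L *v w)) has_derivative (%h. \<Sum>j\<in>UNIV. c $ j * (L *v h) $ j)) (at w)"
   using has_derivative_compose[OF bounded_linear_imp_has_derivative[OF bl] c'] by simp
  moreover have "(\<Sum>j\<in>UNIV. c $ j * (L *v h) $ j) = (\<Sum>i\<in>UNIV. (\<chi> i. \<Sum>j\<in>UNIV. c $ j * L $ j $ i) $ i * h $ i)" for h
  proof -
   have "(\<Sum>j\<in>UNIV. c $ j * (L *v h) $ j) = (\<Sum>j\<in>UNIV. \<Sum>i\<in>UNIV. c $ j * L $ j $ i * h $ i)"
    by (simp add: matrix_vector_mult_def sum_distrib_left mult.assoc)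
   also have "... = (\<Sum>i\<in>UNIV. \<Sum>j\<in>UNIV. c $ j * L $ j $ i * h $ i)" by (rule sum.swap)
   finally show ?thesis by (simp add: sum_distrib_right)
  qed
  ultimately have "((%w. F (L *v w)) has_derivative (%h. \<Sum>i\<in>UNIV. (\<chi> i. \<Sum>j\<in>UNIV. c $ j * L $ j $ i) $ i * h $ i)) (at w)"
   by (simp only:)
  then have "((%w. F (L *v w)) has_derivative (%h. \<Sum>i\<in>UNIV. (\<chi> i. \<Sum>j\<in>UNIV. c $ j * L $ j $ i) $ i * h $ i)) (at w within {w. L *v w \<in> U})"
   by (rule has_derivative_at_withinI)
  then show "\<exists>c. ((%w. F (L *v w)) has_derivative (%h. \<Sum>j\<in>UNIV. c $ j * h $ j)) (at w within {w. L *v w \<in> U})" by blast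
 qed
qed

text \<open>The first nonvanishing coefficient would dominate the sum near \<open>0\<close>.\<close>
lemma power_series_small_coefficients:
 fixes a :: "nat => complex" and f :: "real => complex"
 assumes s: "!!x. 0 < x ==> x <= 1 ==> (%k. of_real x ^ k * a k) sums f x"
  and small: "!!eps. eps > 0 ==> \<exists>d>0. \<forall>x. 0 < x \<and> x < d --> cmod (f x) <= eps * x ^ n"
  and k: "k <= n"
 shows "a k = 0"
 using k
proof (induction k rule: less_induct)
 case (less k)
 define g where "g = (%x::complex. suminf (%i. a (i + k) * x ^ i))"
 have sm1: "summable (%i. a i * 1 ^ i)" using s[of 1] by (simp add: sums_iff)
 have s1: "summable (%i. a (i + k) * 1 ^ i)" using summable_ignore_initial_segment[OF sm1, of k] by simp
 have sg: "(%i. a (i + k) * x ^ i) sums g x" if "norm x < 1" for x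
  unfolding g_def by (rule summable_sums, rule powser_inside[OF s1]) (use that in simp)
 have "(g \<longlongrightarrow> a (0 + k)) (at 0)" by (rule powser_limit_0[of 1]) (use sg in auto)
 then have lim: "(g \<longlongrightarrow> a k) (at 0)" by simp
 have fg: "f x = of_real x ^ k * g (of_real x)" if x: "0 < x" "x < 1" for x
 proof -
  have "(%i. of_real x ^ k * (a (i + k) * of_real x ^ i)) sums (of_real x ^ k * g (of_real x))"
   using x by (intro sums_mult sg) auto
  then have A: "(%i. of_real x ^ (i + k) * a (i + k)) sums (of_real x ^ k * g (of_real x))"
   by (simp add: power_add mult_ac)
  have "(\<Sum>i<k. complex_of_real x ^ i * a i) = 0" using less by (intro sum.neutral) auto
  then have "(%i. of_real x ^ i * a i) sums (of_real x ^ k * g (of_real x))"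
   using A by (subst (asm) sums_iff_shift) simp
  then show ?thesis using s[of x] x sums_unique2 by auto
 qed
 have "cmod (a k) <= eps" if eps: "eps > 0" for eps
 proof -
  obtain d1 where d1: "d1 > 0" "!!x. 0 < x ==> x < d1 ==> cmod (f x) <= eps / 2 * x ^ n"
   using small[of "eps / 2"] eps by auto
  obtain d2 where d2: "d2 > 0" "!!x. x ~= 0 ==> norm x < d2 ==> cmod (g x - a k) < eps / 2"
  proof -
   have "eps / 2 > 0" using eps by simp
   with lim have "\<exists>s>0. \<forall>x. x ~= 0 \<and> norm (x - 0) < s --> norm (g x - a k) < eps / 2" unfolding LIM_eq by blast
   then obtain s where "s > 0" "\<forall>x. x ~= 0 \<and> norm (x - 0) < s --> norm (g x - a k) < eps / 2" by blast
   with that[of s] show thesis by simp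
  qed
  define x where "x = min (1/2) (min (d1 / 2) (d2 / 2))"
  have x: "0 < x" "x < 1" "x < d1" "x < d2" using d1 d2 by (auto simp: x_def)
  have "x ^ k * cmod (g (of_real x)) <= eps / 2 * x ^ n"
   using d1(2)[of x] x fg[of x] by (simp add: norm_mult norm_power)
  also have "... <= eps / 2 * x ^ k" using x eps less.prems by (intro mult_left_mono power_decreasing) auto
  finally have "x ^ k * cmod (g (of_real x)) <= x ^ k * (eps / 2)" by (simp only: mult.commute)
  then have "cmod (g (of_real x)) <= eps / 2" using x by (simp only: mult_le_cancel_left_pos zero_less_power)
  moreover have "cmod (g (of_real x) - a k) < eps / 2" using d2(2)[of "of_real x"] x by simp
  ultimately show ?thesis using norm_triangle_ineq4[of "g (of_real x)" "g (of_real x) - a k"] by simp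
 qed
 then have "cmod (a k) <= 0 + eps" if "eps > 0" for eps using that by simp
 then have "cmod (a k) <= 0" by (rule field_le_epsilon)
 then show ?case by simp
qed

text \<open>Along a dilation the polynomial is \<open>t ^ (2 * m)\<close> times a constant. Hence the little-o condition annihilates the weighted homogeneous parts of degree at most \<open>2 * m\<close> on an open set of real vectors, and then all their coefficients.\<close>
lemma (in homogeneous_poly) small_remainder_coefficients:
 assumes r: "0 < r" and s: "!!z. (!!j. cmod (z $ j) < r) ==> ((%beta. b beta * mono_eval beta z) has_sum Y z) UNIV"
  and small: "!!eps. eps > 0 ==> \<exists>d>0. \<forall>eta. norm eta < d --> cmod (Y (complex_vec eta)) <= eps * Re (poly_eval a eta)"
  and beta: "wt kap beta <= 2 * m"
 shows "b beta = 0"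
proof -
 define k where "k = wt kap beta"
 define c where "c = (%gam. if wt kap gam = k then b gam else 0)"
 have fin: "finite {gam :: nat^'d. wt kap gam = k}" by (rule sum_abs_weighted_mono) (rule kappa_ge)
 have "c beta = 0"
 proof (rule multi_power_series_unique[OF r])
  fix xi :: "real^'d" assume xi: "!!j. 0 < xi $ j \<and> xi $ j < r"
  have z: "cmod (dil kap (of_real x) (complex_vec xi) $ j) < r" if "0 < x" "x <= 1" for x j
  proof -
   have "x ^ (kap $ j) * xi $ j <= 1 * xi $ j" using that xi[of j] by (intro mult_right_mono power_le_one) auto
   also have "... < r" using xi[of j] by simp
   finally have "x ^ (kap $ j) * xi $ j < r" .
   moreover have "\<bar>x\<bar> = x" "\<bar>xi $ j\<bar> = xi $ j" using that xi[of j] by auto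
   ultimately show ?thesis by (simp add: norm_mult norm_power)
  qed
  have "(\<Sum>gam | wt kap gam = k. b gam * mono_eval gam (complex_vec xi)) = 0"
  proof (rule power_series_small_coefficients)
   show "(%k. of_real x ^ k * (\<Sum>gam | wt kap gam = k. b gam * mono_eval gam (complex_vec xi))) sums Y (dil kap (of_real x) (complex_vec xi))"
    if "0 < x" "x <= 1" for x
    by (rule sums_by_weight, rule s, rule z[OF that])
   show "k <= 2 * m" using beta by (simp add: k_def)
   fix eps :: real assume eps: "eps > 0"
   define p where "p = Re (poly_eval a xi)"
   have p: "p >= 0" using pd by (simp add: p_def positive_definite_def)
   obtain d where d: "d > 0" "!!eta. norm eta < d ==> cmod (Y (complex_vec eta)) <= eps / (p + 1) * Re (poly_eval a eta)"
    using small[of "eps / (p + 1)"] eps p by auto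
   show "\<exists>d>0. \<forall>x. 0 < x \<and> x < d --> cmod (Y (dil kap (of_real x) (complex_vec xi))) <= eps * x ^ (2 * m)"
   proof (intro exI[of _ "min 1 (d / (norm xi + 1))"] conjI allI impI)
    show "0 < min 1 (d / (norm xi + 1))" using d(1) by (simp add: add_nonneg_pos)
    fix x assume x: "0 < x \<and> x < min 1 (d / (norm xi + 1))"
    have np: "norm xi + 1 > 0" by (simp add: add_nonneg_pos)
    have "norm (dil kap x xi) <= x * norm xi"
    proof -
     have "norm (dil kap x xi) <= norm (x *\<^sub>R xi)"
     proof (rule norm_le_componentwise_cart)
      fix j
      have "x ^ (kap $ j) <= x ^ 1" using x kappa_ge[of j] by (intro power_decreasing) auto
      then show "norm (dil kap x xi $ j) <= norm ((x *\<^sub>R xi) $ j)"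
       using x by (simp add: abs_mult mult_right_mono)
     qed
     then show ?thesis using x by simp
    qed
    also have "... <= x * (norm xi + 1)" using x by (intro mult_left_mono) auto
    also have "... < d" using x np by (simp add: less_divide_eq)
    finally have "cmod (Y (complex_vec (dil kap x xi))) <= eps / (p + 1) * Re (poly_eval a (dil kap x xi))" by (rule d(2))
    also have "Re (poly_eval a (dil kap x xi)) = x ^ (2 * m) * p"
    proof -
     have "poly_eval a (dil kap x xi) = complex_of_real (x ^ (2 * m)) * poly_eval a xi"
      by (simp add: poly_eval_cpoly complex_vec_dil cpoly_dil)
     then show ?thesis by (simp add: p_def del: of_real_power)
    qed
    also have "eps / (p + 1) * (x ^ (2 * m) * p) = eps * x ^ (2 * m) * (p / (p + 1))" by simp
    also have "... <= eps * x ^ (2 * m) * 1" using p eps x by (intro mult_left_mono) auto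
    finally show "cmod (Y (dil kap (of_real x) (complex_vec xi))) <= eps * x ^ (2 * m)" by (simp add: complex_vec_dil)
   qed
  qed
  moreover have "((%gam. c gam * mono_eval gam (complex_vec xi)) has_sum (\<Sum>gam | wt kap gam = k. b gam * mono_eval gam (complex_vec xi))) UNIV"
  proof (rule has_sum_finite_neutralI[OF fin])
   show "(\<Sum>gam | wt kap gam = k. b gam * mono_eval gam (complex_vec xi)) = (\<Sum>gam | wt kap gam = k. c gam * mono_eval gam (complex_vec xi))"
    by (rule sum.cong[OF refl]) (simp add: c_def)
  qed (auto simp: c_def)
  ultimately show "((%gam. c gam * mono_eval gam (complex_vec xi)) has_sum 0) UNIV" by simp
 qed
 then show ?thesis by (simp add: c_def k_def)
qed

text \<open>The data of one point of \<open>Omega phi\<close>, with the remainder written in the coordinates in which the polynomial is semi-elliptic.\<close>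
locale point_data = local_data "kappa mm" "lcm_vec mm" a b r B "%w. Ups (map_matrix complex_of_real A *v w)" U
 for mm :: "nat^'d" and a b r B and Ups :: "complex^'d => complex" and A :: "real^'d^'d" and U +
 fixes phi :: "int^'d => complex" and xi\<^sub>0 alpha :: "real^'d" and P :: "real^'d => complex"
 assumes mm: "!!j. mm $ j >= 1" and invA: "invertible A" and PA: "!!eta. P (A *v eta) = poly_eval a eta"
  and b_maclaurin: "b = maclaurin_coeff (%w. Ups (map_matrix complex_of_real A *v w))"
  and Exp_P: "Exp_set P ~= {}" and phi1: "phi \<in> lp_space 1" and xi\<^sub>0: "cmod (fourier phi xi\<^sub>0) = 1"
  and polyP: "polynomial_fun P"
  and Gamma: "\<forall>\<^sub>F xi in nhds 0. Gamma_at phi xi\<^sub>0 xi = \<i> * complex_of_real (alpha \<bullet> xi) - P xi + Ups (complex_vec xi)"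
  and pdP: "positive_definite (%xi. Re (P xi))"
  and small: "(%xi. Ups (complex_vec xi)) \<in> o[at 0](%xi. complex_of_real (Re (P xi)))"

lemma point_data_exists:
 fixes phi :: "int^'d => complex"
 assumes phi: "phi \<in> lp_space 1" and xi: "xi\<^sub>0 \<in> Omega phi" and T: "positive_homogeneous_type phi xi\<^sub>0 alpha P Ups"
  and A: "invertible A" and se: "positive_semi_elliptic mm (%eta. P (A *v eta))"
 shows "\<exists>a b r B U. point_data mm a b r B Ups A U phi xi\<^sub>0 alpha P"
proof -
 have ph: "positive_homogeneous P" and small: "(%xi. Ups (complex_vec xi)) \<in> o[at 0](%xi. complex_of_real (Re (P xi)))"
  and Gam: "\<forall>\<^sub>F xi in nhds 0. Gamma_at phi xi\<^sub>0 xi = \<i> * complex_of_real (alpha \<bullet> xi) - P xi + Ups (complex_vec xi)"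
  using T unfolding positive_homogeneous_type_def by blast+
 obtain U0 where U0: "open U0" "0 \<in> U0" "holomorphic_vec_on Ups U0" using T unfolding positive_homogeneous_type_def by blast
 have pP: "polynomial_fun P" "Exp_set P ~= {}" and pdP: "positive_definite (%xi. Re (P xi))"
  using ph unfolding positive_homogeneous_def by blast+
 have mm: "mm $ j >= 1" for j using se unfolding positive_semi_elliptic_def by blast
 obtain a where a: "(%eta. P (A *v eta)) = poly_eval a" "!!beta. beta \<in> Poly_Mapping.keys a ==> weighted_length beta mm = 2"
  using se unfolding positive_semi_elliptic_def by blast
 have Pa: "P (A *v eta) = poly_eval a eta" for eta using a(1) by (rule fun_cong)
 interpret homogeneous_poly "kappa mm" "lcm_vec mm" a
 proof (rule homogeneous_poly.intro[OF dilation_kappa[OF mm]], rule homogeneous_poly_axioms.intro)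
  fix beta assume "beta \<in> Poly_Mapping.keys a"
  then have "real (wt (kappa mm) beta) = real (lcm_vec mm) * 2" using weighted_length_wt[OF mm] a(2) by simp
  then show "wt (kappa mm) beta = 2 * lcm_vec mm" by linarith
 next
  have "positive_definite (%eta. Re (P (A *v eta)))" using se unfolding positive_semi_elliptic_def by blast
  then show "positive_definite (%xi. Re (poly_eval a xi))" by (simp only: Pa)
 qed
 let ?L = "map_matrix complex_of_real A"
 define Y where "Y = (%w. Ups (?L *v w))"
 define U where "U = {w. ?L *v w \<in> U0}"
 have U: "open U" "holomorphic_vec_on Y U" unfolding Y_def U_def by (rule holomorphic_vec_on_linear[OF U0(1,3)])+
 have U00: "0 \<in> U" using U0(2) by (simp add: U_def)
 obtain r B b where rb: "0 < r" "r <= 1" "B >= 0" "!!z. (!!j. cmod (z $ j) < r) ==> z \<in> U"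
  "!!beta. cmod (b beta) <= B / r ^ (\<Sum>j\<in>UNIV. beta $ j)"
  "!!z. (!!j. cmod (z $ j) < r) ==> ((%beta. b beta * mono_eval beta z) has_sum Y z) UNIV"
  by (rule holomorphic_vec_power_series[OF U U00], rule that, assumption, assumption, assumption, blast, blast, blast)
 have sm: "\<exists>d>0. \<forall>eta. norm eta < d --> cmod (Y (complex_vec eta)) <= eps * Re (poly_eval a eta)" if eps: "eps > 0" for eps
 proof -
  have "\<forall>\<^sub>F xi in at 0. cmod (Ups (complex_vec xi)) <= eps * Re (P xi)"
   using landau_o.smallD[OF small eps] pdP unfolding positive_definite_def by simp
  then obtain d where d: "d > 0" "!!xi. xi ~= 0 ==> norm xi < d ==> cmod (Ups (complex_vec xi)) <= eps * Re (P xi)"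
   unfolding eventually_at by (auto simp: dist_norm)
  obtain K where K: "K > 0" "!!eta. norm (A *v eta) <= norm eta * K"
   using bounded_linear.pos_bounded[OF matrix_vector_mul_bounded_linear[of A]] by blast
  have lim0: "cmod (Ups 0) = 0"
  proof -
   have "isCont (%xi. P xi) 0"
   proof -
    obtain a' where "P = poly_eval a'" using pP(1) unfolding polynomial_fun_def by blast
    then have "continuous_on UNIV P"
     unfolding poly_eval_def[abs_def] mono_eval_def complex_vec_def by (auto intro!: continuous_intros)
    then show ?thesis by (simp add: continuous_on_eq_continuous_at)
   qed
   then have t1: "((%xi. Re (P xi)) \<longlongrightarrow> Re (P 0)) (at 0)" by (intro tendsto_Re) (simp add: isCont_def)
   have "P 0 = 0"
   proof -
    have "P 0 = poly_eval a 0" using Pa[of 0] by simp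
    also have "... = 0" unfolding poly_eval_cpoly
     using cpoly_dil[of 0 "complex_vec 0"] m_ge by (simp add: dil_def complex_vec_def zero_vec_def power_0_left)
    finally show ?thesis .
   qed
   then have t1: "((%xi. 1 * Re (P xi)) \<longlongrightarrow> 0) (at 0)" using t1 by simp
   have "isCont Ups 0"
   proof -
    obtain c where "(Ups has_derivative (%h. \<Sum>j\<in>UNIV. c $ j * h $ j)) (at 0 within U0)"
     using U0 unfolding holomorphic_vec_on_def by blast
    then have "(Ups has_derivative (%h. \<Sum>j\<in>UNIV. c $ j * h $ j)) (at 0)" unfolding at_within_open[OF U0(2,1)] .
    then show ?thesis by (rule has_derivative_continuous)
   qed
   moreover have "isCont complex_vec (0 :: real^'d)"
    using continuous_on_complex_vec[of "UNIV :: (real^'d) set"] by (simp add: continuous_on_eq_continuous_at)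
   moreover have cv0: "complex_vec 0 = (0 :: complex^'d)" by (simp add: complex_vec_def vec_eq_iff)
   ultimately have "isCont (%xi. Ups (complex_vec xi)) 0" by (intro isCont_o2[of "0 :: real^'d" complex_vec Ups]) simp_all
   then have t2: "((%xi. cmod (Ups (complex_vec xi))) \<longlongrightarrow> cmod (Ups 0)) (at 0)"
    using cv0 by (intro tendsto_norm) (simp add: isCont_def)
   have "\<forall>\<^sub>F xi in at 0. cmod (Ups (complex_vec xi)) <= 1 * Re (P xi)"
    using landau_o.smallD[OF small, of 1] pdP unfolding positive_definite_def by simp
   then have "\<forall>\<^sub>F xi in at 0. cmod (Ups (complex_vec xi)) <= 1 * Re (P xi)" .
   from tendsto_le[OF _ t1 t2 this] have "cmod (Ups 0) <= 0" by simp
   then show ?thesis by simp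
  qed
  show ?thesis
  proof (intro exI[of _ "d / K"] conjI allI impI)
   show "d / K > 0" using d K by simp
   fix eta :: "real^'d" assume eta: "norm eta < d / K"
   have Ye: "Y (complex_vec eta) = Ups (complex_vec (A *v eta))" unfolding Y_def map_matrix_complex_vec ..
   have nn: "Re (poly_eval a eta) >= 0" using pd unfolding positive_definite_def by blast
   show "cmod (Y (complex_vec eta)) <= eps * Re (poly_eval a eta)"
   proof (cases "A *v eta = 0")
    case True
    have "complex_vec 0 = (0 :: complex^'d)" by (simp add: complex_vec_def vec_eq_iff)
    then show ?thesis unfolding Ye True using lim0 nn eps by simp
   next
    case False
    have "norm (A *v eta) < d" using K(2)[of eta] eta K(1) by (simp add: less_divide_eq)
    then show ?thesis unfolding Ye using d(2)[OF False] Pa by simp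
   qed
  qed
 qed
 have b0: "b beta = 0" if "wt (kappa mm) beta <= 2 * lcm_vec mm" for beta
  by (rule small_remainder_coefficients[OF rb(1) rb(6) sm that])
 have bm: "b = maclaurin_coeff Y" using maclaurin_coeff_eqI[OF rb(1) rb(6)] by simp
 have rs: "remainder_series (kappa mm) (lcm_vec mm) b r B"
  by (rule remainder_series.intro[OF dilation_kappa[OF mm]], rule remainder_series_axioms.intro) (use rb(1-3,5) b0 in auto)
 have ld: "local_data (kappa mm) (lcm_vec mm) a b r B Y U"
  by (rule local_data.intro[OF homogeneous_poly_axioms rs], rule local_data_axioms.intro) (use U rb in auto)
 have "point_data mm a b r B Ups A U phi xi\<^sub>0 alpha P"
  by (rule point_data.intro[OF ld[unfolded Y_def]], rule point_data_axioms.intro)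
    (use mm A Pa bm pP phi xi Gam pdP small in \<open>auto simp: Y_def Omega_def\<close>)
 then show ?thesis by blast
qed

section \<open>The expansion in rescaled coordinates\<close>

lemma fps_power_dilate:
 fixes c :: complex
 shows "fps_nth (Abs_fps (%r. c ^ r * fps_nth G r) ^ i) k = c ^ k * fps_nth (G ^ i) k"
proof (induction i arbitrary: k)
 case 0
 show ?case by (cases "k = 0") auto
next
 case (Suc i)
 have "(\<Sum>j=0..k. c ^ j * fps_nth G j * (c ^ (k - j) * fps_nth (G ^ i) (k - j))) = (\<Sum>j=0..k. c ^ k * (fps_nth G j * fps_nth (G ^ i) (k - j)))"
 proof (rule sum.cong[OF refl])
  fix j assume "j \<in> {0..k}"
  then have "c ^ j * c ^ (k - j) = c ^ k" by (simp flip: power_add)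
  then show "c ^ j * fps_nth G j * (c ^ (k - j) * fps_nth (G ^ i) (k - j)) = c ^ k * (fps_nth G j * fps_nth (G ^ i) (k - j))"
   by (metis mult.assoc mult.left_commute)
 qed
 then show ?case by (simp only: power_Suc fps_mult_nth fps_nth_Abs_fps Suc sum_distrib_left)
qed

lemma fps_compose_dilate:
 fixes c :: complex
 shows "fps_nth (F oo Abs_fps (%r. c ^ r * fps_nth G r)) k = c ^ k * fps_nth (F oo G) k"
 unfolding fps_compose_nth fps_power_dilate sum_distrib_left by (rule sum.cong[OF refl]) (simp only: mult.left_commute)

lemma one_plus_power_exp_le:
 fixes c :: real assumes c: "c > 0" and x: "x >= 0"
 shows "(1 + x) ^ k * exp (- c * x) <= (2 / c) ^ k * fact k * exp (c / 2) * exp (- (c / 2) * x)"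
proof -
 have e: "2 / c * (c / 2 * (1 + x)) = 1 + x" using c by simp
 have "(1 + x) ^ k = (2 / c) ^ k * (c / 2 * (1 + x)) ^ k" unfolding power_mult_distrib[symmetric] e ..
 also have "... <= (2 / c) ^ k * (fact k * exp (c / 2 * (1 + x)))"
  using c x by (intro mult_left_mono power_le_fact_exp) auto
 finally have "(1 + x) ^ k * exp (- c * x) <= (2 / c) ^ k * (fact k * exp (c / 2 * (1 + x))) * exp (- c * x)"
  by (rule mult_right_mono) simp
 also have "... = (2 / c) ^ k * fact k * exp (c / 2 * (1 + x) + (- c * x))" by (simp only: exp_add mult.assoc)
 also have "c / 2 * (1 + x) + (- c * x) = c / 2 + (- (c / 2) * x)" by (simp add: field_simps)
 finally show ?thesis by (simp only: exp_add mult.assoc)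
qed

context point_data
begin

abbreviation kap where "kap \<equiv> kappa mm"
abbreviation m where "m \<equiv> lcm_vec mm"
definition "Ai = matrix_inv A"
definition tmap :: "real => real^'d => real^'d" where "tmap t zeta = A *v dil kap t zeta"
definition wsum :: nat where "wsum = (\<Sum>j\<in>UNIV. kap $ j)"
definition mu :: real where "mu = hom_order P"
text \<open>The dilation parameter at time \<open>n\<close>, determined by \<open>n * t ^ (2 * m) = 1\<close>.\<close>
definition tn :: "nat => real" where "tn n = real n powr (- 1 / (2 * real m))"

lemma Ai: "A ** Ai = mat 1" "Ai ** A = mat 1"
proof -
 have "\<exists>A'. A ** A' = mat 1 \<and> A' ** A = mat 1" using invA unfolding invertible_def by blast
 from someI_ex[OF this] show "A ** Ai = mat 1" "Ai ** A = mat 1" unfolding Ai_def matrix_inv_def by blast+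
qed

lemma A_Ai: "A *v (Ai *v x) = x" "Ai *v (A *v x) = x"
 using Ai by (simp_all add: matrix_vector_mul_assoc)

lemma tn_facts:
 assumes n: "n >= 1"
 shows "0 < tn n" "tn n <= 1" "real n * tn n ^ (2 * m) = 1" "1 / tn n ^ (2 * m) = real n"
  "tn n ^ k = real n powr (- real k / (2 * real m))"
proof -
 have m0: "real m > 0" using m_ge by simp
 have n0: "real n > 0" using n by simp
 show t: "0 < tn n" using n0 by (simp add: tn_def)
 have "tn n <= real n powr 0" unfolding tn_def using n m0 by (intro powr_mono) (auto simp: divide_nonpos_pos)
 then show "tn n <= 1" using n0 by simp
 show pw: "tn n ^ k = real n powr (- real k / (2 * real m))" for k
  using n0 by (simp add: tn_def powr_realpow[symmetric] powr_powr field_simps)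
 have "tn n ^ (2 * m) = real n powr (- 1)" unfolding pw using m0 by simp
 then show "real n * tn n ^ (2 * m) = 1" using n0 by (simp add: powr_minus_divide)
 then show "1 / tn n ^ (2 * m) = real n" using t by (simp add: field_simps)
qed

lemma mu_eq: "mu = real wsum / (2 * real m)"
 unfolding mu_def wsum_def of_nat_sum by (rule hom_order_eq[OF homogeneous_poly_axioms invA PA Exp_P])

lemma tn_wsum: "n >= 1 ==> tn n ^ wsum = real n powr (- mu)"
 by (simp add: tn_facts(5) mu_eq)

lemma continuous_tmap: "continuous_on S (tmap t)"
proof -
 have "continuous_on S (%zeta::real^'d. dil kap t zeta)" unfolding dil_def by (intro continuous_intros)
 then show ?thesis unfolding tmap_def[abs_def]
  by (rule linear_continuous_on_compose) (simp add: matrix_vector_mul_linear)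
qed

lemma tmap_measurable [measurable]: "tmap t \<in> borel_measurable borel"
 by (rule borel_measurable_continuous_onI[OF continuous_tmap])

lemma scaling_exists:
 "\<exists>J>0. \<forall>t>0. \<forall>g\<in>borel_measurable borel. (\<integral>\<^sup>+x. g x \<partial>lborel) = ennreal (J * t ^ wsum) * (\<integral>\<^sup>+x. g (tmap t x) \<partial>lborel)"
proof -
 obtain J where J: "J > 0" "!!g. g \<in> borel_measurable borel ==> (\<integral>\<^sup>+x. g x \<partial>lborel) = ennreal J * (\<integral>\<^sup>+x. g (A *v x) \<partial>lborel)"
  by (rule nn_integral_linear[of "(*v) A" "(*v) Ai"]) (use A_Ai in \<open>auto simp: matrix_vector_mul_linear\<close>)
 show ?thesis
 proof (intro exI[of _ J] conjI J(1) allI impI ballI)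
  fix t :: real and g :: "real^'d => ennreal" assume t: "t > 0" and g[measurable]: "g \<in> borel_measurable borel"
  have Am[measurable]: "(%x. A *v x) \<in> borel_measurable borel"
   by (intro borel_measurable_continuous_onI linear_continuous_on) simp
  have gA: "(%x. g (A *v x)) \<in> borel_measurable borel" by measurable
  have tp: "t ^ (kap $ j) > 0" for j using t by simp
  have "(\<integral>\<^sup>+x. g (A *v x) \<partial>lborel) = ennreal (\<Prod>j\<in>UNIV. t ^ (kap $ j)) * (\<integral>\<^sup>+x. g (tmap t x) \<partial>lborel)"
   using nn_integral_diag[OF gA tp] by (simp only: tmap_def dil_def)
  then show "(\<integral>\<^sup>+x. g x \<partial>lborel) = ennreal (J * t ^ wsum) * (\<integral>\<^sup>+x. g (tmap t x) \<partial>lborel)"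
   unfolding J(2)[OF g] wsum_def power_sum using J(1) prod_nonneg[of UNIV "%j. t ^ (kap $ j)"] t
   by (simp add: ennreal_mult mult.assoc)
 qed
qed

definition "J0 = (SOME J. J > 0 \<and> (\<forall>t>0. \<forall>g\<in>borel_measurable borel. (\<integral>\<^sup>+x. g x \<partial>lborel) = ennreal (J * t ^ wsum) * (\<integral>\<^sup>+x. g (tmap t x) \<partial>lborel)))"

lemma J0: "J0 > 0" "t > 0 ==> g \<in> borel_measurable borel ==> (\<integral>\<^sup>+x. g x \<partial>lborel) = ennreal (J0 * t ^ wsum) * (\<integral>\<^sup>+x. g (tmap t x) \<partial>lborel)"
proof -
 have J: "J0 > 0 \<and> (\<forall>t>0. \<forall>g\<in>borel_measurable borel. (\<integral>\<^sup>+x. g x \<partial>lborel) = ennreal (J0 * t ^ wsum) * (\<integral>\<^sup>+x. g (tmap t x) \<partial>lborel))"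
  unfolding J0_def by (rule someI_ex[OF scaling_exists])
 then show "J0 > 0" by blast
 show "t > 0 ==> g \<in> borel_measurable borel ==> (\<integral>\<^sup>+x. g x \<partial>lborel) = ennreal (J0 * t ^ wsum) * (\<integral>\<^sup>+x. g (tmap t x) \<partial>lborel)"
  using J by blast
qed

lemma scale_integral:
 fixes f :: "real^'d => complex"
 assumes "t > 0" "f \<in> borel_measurable borel"
 shows "integral\<^sup>L lborel f = (J0 * t ^ wsum) *\<^sub>R (LINT x|lborel. f (tmap t x))"
 by (rule integral_scaling(1)[OF _ tmap_measurable J0(2) assms(2)]) (use J0(1) assms(1) in auto)

text \<open>Since \<open>n = t ^ (- 2 * m)\<close>, the rescaled arguments of the Bell polynomial are the coefficients of the rescaled remainder, each multiplied by the matching power of \<open>t\<close>. The generating series of the Bell polynomials is thus the exponential series of the remainder.\<close>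
lemma Q_symbol_tmap:
 assumes nt: "real n * t ^ (2 * m) = 1"
 shows "Q_symbol Ups A mm l n (tmap t zeta) = of_real (t ^ l) * wcoef l (complex_vec zeta)"
proof -
 have z: "complex_vec (matrix_inv A *v tmap t zeta) = dil kap (of_real t) (complex_vec zeta)"
  using A_Ai(2) by (simp add: tmap_def Ai_def complex_vec_dil)
 have S: "of_nat n * S_poly Ups A mm k (complex_vec (matrix_inv A *v tmap t zeta)) = fact k * (of_real t ^ k * V (2 * m + k) (complex_vec zeta))" for k
 proof -
  have set: "{beta. Lambda_index mm beta = int k} = {beta. wt kap beta = 2 * m + k}" by (auto simp: Lambda_index_wt)
  have "(\<Sum>beta | wt kap beta = 2 * m + k. b beta * mono_eval beta (dil kap (of_real t) (complex_vec zeta)))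
   = of_real t ^ (2 * m + k) * V (2 * m + k) (complex_vec zeta)"
   unfolding V_def sum_distrib_left by (rule sum.cong[OF refl]) (simp add: mono_eval_dil)
  then have "of_nat n * S_poly Ups A mm k (complex_vec (matrix_inv A *v tmap t zeta))
   = of_nat n * (fact k * (of_real t ^ (2 * m + k) * V (2 * m + k) (complex_vec zeta)))"
   unfolding S_poly_def z set b_maclaurin[symmetric] by simp
  also have "... = complex_of_real (real n * t ^ (2 * m)) * (fact k * (of_real t ^ k * V (2 * m + k) (complex_vec zeta)))"
   by (simp add: power_add)
  finally show ?thesis unfolding nt by simp
 qed
 have "Abs_fps (%k. if k = 0 then 0 else of_nat n * S_poly Ups A mm k (complex_vec (matrix_inv A *v tmap t zeta)) / fact k)
   = Abs_fps (%k. of_real t ^ k * fps_nth (Wfps (complex_vec zeta)) k)"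
  unfolding S by (rule arg_cong[of _ _ Abs_fps]) (auto simp: Wfps_def W_def fun_eq_iff)
 then show ?thesis unfolding Q_symbol_def bell_def wcoef_def by (simp add: fps_compose_dilate)
qed

lemma exp_P_bound:
 obtains C c where "c > 0" "C >= 0" "!!xi. exp (- Re (P xi)) <= C * exp (- c * norm xi)"
proof -
 obtain c where c: "c > 0" and maj: "!!K. \<exists>C\<ge>0. \<forall>xi z. (\<forall>j. cmod (z $ j - complex_vec xi $ j) <= 1) -->
   (1 + qn kap z) ^ K * exp (- Re (cpoly a z)) * exp (c * qn kap z ^ (2 * m))
    <= C * exp (- c * qn kap z ^ (2 * m)) * exp (- c * norm xi)"
  by (rule strip_majorant, rule that, assumption, blast)
 obtain C where C: "C >= 0" "\<forall>xi z. (\<forall>j. cmod (z $ j - complex_vec xi $ j) <= 1) -->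
   (1 + qn kap z) ^ 0 * exp (- Re (cpoly a z)) * exp (c * qn kap z ^ (2 * m))
    <= C * exp (- c * qn kap z ^ (2 * m)) * exp (- c * norm xi)" using maj[of 0] by blast
 obtain K where K: "K > 0" "!!eta. norm (A *v eta) <= norm eta * K"
  using bounded_linear.pos_bounded[OF matrix_vector_mul_bounded_linear[of A]] by blast
 show thesis
 proof (rule that[of "c / K" C])
  show "c / K > 0" "C >= 0" using c K C by auto
  fix xi :: "real^'d"
  define eta where "eta = Ai *v xi"
  define v where "v = qn kap (complex_vec eta) ^ (2 * m)"
  have v: "v >= 0" unfolding v_def using qn_nonneg by simp
  have "P xi = cpoly a (complex_vec eta)" using PA[of eta] by (simp add: eta_def A_Ai poly_eval_cpoly)
  then have "exp (- Re (P xi)) * 1 <= exp (- Re (cpoly a (complex_vec eta))) * exp (c * v)"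
   using c v by (intro mult_mono) auto
  also have "... <= C * exp (- c * v) * exp (- c * norm eta)"
   using C(2)[rule_format, of "complex_vec eta" eta] by (simp add: v_def)
  also have "... <= C * 1 * exp (- (c / K) * norm xi)"
  proof (intro mult_mono mult_left_mono)
   have "norm xi <= norm eta * K" using K(2)[of eta] by (simp add: eta_def A_Ai)
   then have "norm xi / K <= norm eta" using K(1) by (simp add: divide_le_eq)
   from mult_left_mono[OF this less_imp_le[OF c]]
   show "exp (- c * norm eta) <= exp (- (c / K) * norm xi)" by simp
  qed (use c v C in auto)
  finally show "exp (- Re (P xi)) <= C * exp (- (c / K) * norm xi)" by simp
 qed
qed

lemma continuous_P: "continuous_on S P"
proof -
 obtain a' where "P = poly_eval a'" using polyP unfolding polynomial_fun_def by blast
 then show ?thesis unfolding poly_eval_def[abs_def] mono_eval_def complex_vec_def by (auto intro!: continuous_intros)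
qed

lemma rapid_gaussian:
 assumes n: "n >= 1"
 shows "rapid (%xi. k * exp (- (complex_of_real (real n) * P xi)))"
 unfolding rapid_def
proof (intro conjI allI)
 have ct: "continuous_on UNIV (%xi. k * exp (- (complex_of_real (real n) * P xi)))" by (intro continuous_intros continuous_P)
 then show mb: "(%xi. k * exp (- (complex_of_real (real n) * P xi))) \<in> borel_measurable borel" by (rule borel_measurable_continuous_onI)
 fix i :: nat
 obtain C c where c: "c > 0" "C >= 0" "!!xi. exp (- Re (P xi)) <= C * exp (- c * norm xi)" by (rule exp_P_bound, rule that, assumption, assumption, blast)
 define L where "L = (2 / c) ^ i * fact i * exp (c / 2)"
 show "integrable lborel (%xi. (1 + norm xi) ^ i * cmod (k * exp (- (complex_of_real (real n) * P xi))))"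
 proof (rule Bochner_Integration.integrable_bound)
  show "integrable lborel (%xi::real^'d. cmod k * C * L * exp (- (c / 2) * norm xi))"
   by (intro integrable_mult_right integrable_exp_norm) (use c in simp)
  show "(%xi. (1 + norm xi) ^ i * cmod (k * exp (- (complex_of_real (real n) * P xi)))) \<in> borel_measurable lborel"
   using mb by measurable
  show "AE xi in lborel. norm ((1 + norm xi) ^ i * cmod (k * exp (- (complex_of_real (real n) * P xi)))) <= norm (cmod k * C * L * exp (- (c / 2) * norm xi))"
  proof (rule AE_I2)
   fix xi :: "real^'d"
   have P0: "Re (P xi) >= 0" using pdP unfolding positive_definite_def by blast
   have "Re (P xi) <= real n * Re (P xi)" using mult_right_mono[of 1 "real n" "Re (P xi)"] P0 n by simp
   then have "exp (- (real n * Re (P xi))) <= exp (- Re (P xi))" by simp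
   also note c(3)
   finally have e: "exp (- (real n * Re (P xi))) <= C * exp (- c * norm xi)" .
   have "(1 + norm xi) ^ i * cmod (k * exp (- (complex_of_real (real n) * P xi))) = cmod k * ((1 + norm xi) ^ i * exp (- (real n * Re (P xi))))"
    by (simp add: norm_mult)
   also have "... <= cmod k * ((1 + norm xi) ^ i * (C * exp (- c * norm xi)))"
    using e by (intro mult_left_mono) auto
   also have "... = cmod k * C * ((1 + norm xi) ^ i * exp (- c * norm xi))" by (simp only: mult_ac)
   also have "... <= cmod k * C * (L * exp (- (c / 2) * norm xi))"
    unfolding L_def using c by (intro mult_left_mono one_plus_power_exp_le) auto
   finally have "(1 + norm xi) ^ i * cmod (k * exp (- (complex_of_real (real n) * P xi))) <= cmod k * C * L * exp (- (c / 2) * norm xi)"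
    by (simp only: mult.assoc)
   then show "norm ((1 + norm xi) ^ i * cmod (k * exp (- (complex_of_real (real n) * P xi)))) <= norm (cmod k * C * L * exp (- (c / 2) * norm xi))"
    by (auto intro: order_trans[OF _ abs_ge_self])
  qed
 qed
qed

lemma character_tmap: "character X (tmap t zeta) = character (dil kap t (X v* A)) zeta"
proof -
 have "X \<bullet> tmap t zeta = (X v* A) \<bullet> dil kap t zeta" by (simp add: tmap_def dot_lmul_matrix)
 also have "... = dil kap t (X v* A) \<bullet> zeta" by (simp add: inner_vec_def mult_ac)
 finally show ?thesis by (simp add: character_def)
qed

lemma nP_tmap:
 assumes nt: "real n * t ^ (2 * m) = 1"
 shows "complex_of_real (real n) * P (tmap t zeta) = cpoly a (complex_vec zeta)"
proof -
 have "P (tmap t zeta) = of_real t ^ (2 * m) * cpoly a (complex_vec zeta)"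
  by (simp add: tmap_def PA poly_eval_cpoly complex_vec_dil cpoly_dil)
 then have "complex_of_real (real n) * P (tmap t zeta) = complex_of_real (real n * t ^ (2 * m)) * cpoly a (complex_vec zeta)" by simp
 then show ?thesis unfolding nt by simp
qed

text \<open>The operators act on the attractor as multipliers of its transform, so that the substitution turns the sum of all terms into a single integral.\<close>
lemma expansion_terms:
 assumes n: "n >= 1"
 shows "complex_of_real ((2 * pi) ^ CARD('d)) * (\<Sum>l = 0..k. Q_op Ups A mm l n (attractor P (real n)) X)
  = (J0 * tn n ^ wsum) *\<^sub>R (LINT zeta|lborel. aker (Suc k) (tn n) (complex_vec zeta) * character (dil kap (tn n) (X v* A)) zeta)"
proof -
 define h where "h = (%xi::real^'d. complex_of_real (1 / (2 * pi) ^ CARD('d)) * exp (- (complex_of_real (real n) * P xi)))"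
 let ?q = "%l. Q_symbol Ups A mm l n"
 have rap: "rapid h" unfolding h_def by (rule rapid_gaussian[OF n])
 have att: "attractor P (real n) = inv_fourier h" unfolding h_def by (rule attractor_inv_fourier)
 have int: "integrable lborel (%xi. ?q l xi * h xi)" for l
  by (rule poly_diff_op_inv_fourier(1)[OF rap polynomial_fun_Q_symbol])
 have op: "Q_op Ups A mm l n (attractor P (real n)) X = (LINT xi|lborel. ?q l xi * h xi * character X xi)" for l
  unfolding Q_op_def att poly_diff_op_inv_fourier(2)[OF rap polynomial_fun_Q_symbol] inv_fourier_def ..
 have cm[measurable]: "character X \<in> borel_measurable borel"
  unfolding character_def[abs_def] by (intro borel_measurable_continuous_onI continuous_intros)
 have int': "integrable lborel (%xi. ?q l xi * h xi * character X xi)" for l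
 proof (rule Bochner_Integration.integrable_bound[OF int[of l]])
  show "(%xi. ?q l xi * h xi * character X xi) \<in> borel_measurable lborel"
   by (rule borel_measurable_times) (use int[of l] cm in auto)
 qed (simp add: norm_mult)
 have "(\<Sum>l = 0..k. Q_op Ups A mm l n (attractor P (real n)) X) = (LINT xi|lborel. (\<Sum>l = 0..k. ?q l xi * h xi * character X xi))"
  unfolding op by (rule Bochner_Integration.integral_sum[symmetric]) (rule int')
 also have "... = (J0 * tn n ^ wsum) *\<^sub>R (LINT zeta|lborel. (\<Sum>l = 0..k. ?q l (tmap (tn n) zeta) * h (tmap (tn n) zeta) * character X (tmap (tn n) zeta)))"
 proof (rule scale_integral[OF tn_facts(1)[OF n]])
  have "integrable lborel (%xi. \<Sum>l = 0..k. ?q l xi * h xi * character X xi)"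
   by (rule Bochner_Integration.integrable_sum) (rule int')
  then show "(%xi. \<Sum>l = 0..k. ?q l xi * h xi * character X xi) \<in> borel_measurable borel" by auto
 qed
 also have "(%zeta. \<Sum>l = 0..k. ?q l (tmap (tn n) zeta) * h (tmap (tn n) zeta) * character X (tmap (tn n) zeta))
   = (%zeta. complex_of_real (1 / (2 * pi) ^ CARD('d)) * (aker (Suc k) (tn n) (complex_vec zeta) * character (dil kap (tn n) (X v* A)) zeta))"
 proof
  fix zeta
  have "?q l (tmap (tn n) zeta) * h (tmap (tn n) zeta) * character X (tmap (tn n) zeta)
   = (wcoef l (complex_vec zeta) * of_real (tn n) ^ l) * (complex_of_real (1 / (2 * pi) ^ CARD('d)) * exp (- cpoly a (complex_vec zeta)) * character (dil kap (tn n) (X v* A)) zeta)" for l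
   unfolding Q_symbol_tmap[OF tn_facts(3)[OF n]] h_def nP_tmap[OF tn_facts(3)[OF n]] character_tmap by (simp only: of_real_power mult_ac)
  then have "(\<Sum>l = 0..k. ?q l (tmap (tn n) zeta) * h (tmap (tn n) zeta) * character X (tmap (tn n) zeta))
   = (\<Sum>l = 0..k. wcoef l (complex_vec zeta) * of_real (tn n) ^ l) * (complex_of_real (1 / (2 * pi) ^ CARD('d)) * exp (- cpoly a (complex_vec zeta)) * character (dil kap (tn n) (X v* A)) zeta)"
   by (simp only: sum_distrib_right)
  moreover have "{0..k} = {..<Suc k}" by auto
  ultimately show "(\<Sum>l = 0..k. ?q l (tmap (tn n) zeta) * h (tmap (tn n) zeta) * character X (tmap (tn n) zeta))
   = complex_of_real (1 / (2 * pi) ^ CARD('d)) * (aker (Suc k) (tn n) (complex_vec zeta) * character (dil kap (tn n) (X v* A)) zeta)"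
   unfolding aker_def by (simp only: mult_ac)
 qed
 also have "(LINT zeta|lborel. complex_of_real (1 / (2 * pi) ^ CARD('d)) * (aker (Suc k) (tn n) (complex_vec zeta) * character (dil kap (tn n) (X v* A)) zeta))
   = complex_of_real (1 / (2 * pi) ^ CARD('d)) * (LINT zeta|lborel. aker (Suc k) (tn n) (complex_vec zeta) * character (dil kap (tn n) (X v* A)) zeta)"
  by (rule integral_mult_right_zero)
 finally show ?thesis by (simp add: scaleR_conv_of_real mult_ac)
qed

end

section \<open>The cell around a point\<close>

context point_data
begin

text \<open>The cell is the image of a box under \<open>A\<close>; the substitution maps it to \<open>box_t\<close>.\<close>
definition cell :: "real => (real^'d) set" where
 "cell delta = {xi. \<forall>j. \<bar>(Ai *v (xi - xi\<^sub>0)) $ j\<bar> <= delta ^ (kap $ j)}"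

definition cell_core :: "real => (real^'d) set" where
 "cell_core delta = {xi. \<forall>j. \<bar>(Ai *v (xi - xi\<^sub>0)) $ j\<bar> < delta ^ (kap $ j)}"

lemma continuous_cell_coord: "continuous_on S (%xi. \<bar>(Ai *v (xi - xi\<^sub>0)) $ j\<bar>)"
proof -
 have "continuous_on S (%xi. Ai *v (xi - xi\<^sub>0))"
  by (rule linear_continuous_on_compose) (auto intro!: continuous_intros simp: matrix_vector_mul_linear)
 then show ?thesis by (intro continuous_intros)
qed

lemma cell_core: "open (cell_core delta)" "delta > 0 ==> xi\<^sub>0 \<in> cell_core delta" "cell_core delta \<subseteq> cell delta"
proof -
 have "open {xi. \<bar>(Ai *v (xi - xi\<^sub>0)) $ j\<bar> < delta ^ (kap $ j)}" for j
  by (rule open_Collect_less[OF continuous_cell_coord continuous_on_const])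
 then have "open (\<Inter>j\<in>UNIV. {xi. \<bar>(Ai *v (xi - xi\<^sub>0)) $ j\<bar> < delta ^ (kap $ j)})" by (intro open_INT) auto
 moreover have "cell_core delta = (\<Inter>j\<in>UNIV. {xi. \<bar>(Ai *v (xi - xi\<^sub>0)) $ j\<bar> < delta ^ (kap $ j)})" by (auto simp: cell_core_def)
 ultimately show "open (cell_core delta)" by simp
qed (auto simp: cell_def cell_core_def less_imp_le)

lemma cell_measurable [measurable]: "cell delta \<in> sets borel"
proof -
 have "closed {xi. \<bar>(Ai *v (xi - xi\<^sub>0)) $ j\<bar> <= delta ^ (kap $ j)}" for j
  by (rule closed_Collect_le[OF continuous_cell_coord continuous_on_const])
 then have "closed (\<Inter>j\<in>UNIV. {xi. \<bar>(Ai *v (xi - xi\<^sub>0)) $ j\<bar> <= delta ^ (kap $ j)})" by (intro closed_INT) auto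
 moreover have "cell delta = (\<Inter>j\<in>UNIV. {xi. \<bar>(Ai *v (xi - xi\<^sub>0)) $ j\<bar> <= delta ^ (kap $ j)})" by (auto simp: cell_def)
 ultimately show ?thesis by simp
qed

lemma cell_small:
 assumes e: "eps > 0"
 obtains delta0 where "delta0 > 0" "!!delta. 0 < delta ==> delta <= delta0 ==> cell delta \<subseteq> ball xi\<^sub>0 eps"
proof -
 obtain K where K: "K > 0" "!!eta. norm (A *v eta) <= norm eta * K"
  using bounded_linear.pos_bounded[OF matrix_vector_mul_bounded_linear[of A]] by blast
 define D where "D = real CARD('d)"
 have D: "D > 0" by (simp add: D_def)
 define delta0 where "delta0 = min 1 (eps / (2 * D * K))"
 show thesis
 proof (rule that)
  show "delta0 > 0" using e D K by (simp add: delta0_def)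
  fix delta assume delta: "0 < delta" "delta <= delta0"
  show "cell delta \<subseteq> ball xi\<^sub>0 eps"
  proof
   fix xi assume xi: "xi \<in> cell delta"
   define eta where "eta = Ai *v (xi - xi\<^sub>0)"
   have d1: "delta <= 1" "delta <= eps / (2 * D * K)" using delta by (auto simp: delta0_def)
   have "\<bar>eta $ j\<bar> <= delta" for j
   proof -
    have "\<bar>eta $ j\<bar> <= delta ^ (kap $ j)" using xi by (simp add: cell_def eta_def)
    also have "... <= delta ^ 1" using delta d1 kappa_ge[of j] by (intro power_decreasing) auto
    finally show ?thesis by simp
   qed
   then have "(\<Sum>j\<in>UNIV. \<bar>eta $ j\<bar>) <= (\<Sum>j\<in>(UNIV::'d set). delta)" by (intro sum_mono)
   then have "norm eta <= D * delta" using norm_le_l1_cart[of eta] by (simp add: D_def)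
   then have "norm eta * K <= D * delta * K" using K by (intro mult_right_mono) auto
   also have "... <= D * (eps / (2 * D * K)) * K" using d1 D K by (intro mult_right_mono mult_left_mono) auto
   also have "... = eps / 2" using D K by simp
   finally have "norm eta * K <= eps / 2" .
   moreover have "xi - xi\<^sub>0 = A *v eta" by (simp add: eta_def A_Ai)
   ultimately have "norm (xi - xi\<^sub>0) <= eps / 2" using K(2)[of eta] by simp
   then show "xi \<in> ball xi\<^sub>0 eps" using e by (simp add: dist_norm norm_minus_commute)
  qed
 qed
qed

lemma tmap_cell:
 assumes t: "t > 0"
 shows "xi\<^sub>0 + tmap t zeta \<in> cell delta \<longleftrightarrow> zeta \<in> box_t delta t"
proof -
 have "\<bar>t ^ (kap $ j) * zeta $ j\<bar> <= delta ^ (kap $ j) \<longleftrightarrow> \<bar>zeta $ j\<bar> <= (delta / t) ^ (kap $ j)" for j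
  using t by (simp add: abs_mult power_divide pos_le_divide_eq mult.commute)
 then show ?thesis by (simp add: cell_def box_t_def tmap_def A_Ai)
qed

text \<open>Near the point the remainder is at most half the real part of the polynomial, which makes the modulus of the transform smaller than \<open>1\<close> off the point itself.\<close>
lemma fourier_near:
 obtains eps where "eps > 0"
  "!!h. norm h < eps ==> fourier phi (xi\<^sub>0 + h) = fourier phi xi\<^sub>0 * exp (\<i> * complex_of_real (alpha \<bullet> h) - P h + Ups (complex_vec h))"
  "!!h. 0 < norm h ==> norm h < eps ==> cmod (fourier phi (xi\<^sub>0 + h)) < 1"
proof -
 obtain e1 where e1: "e1 > 0" "!!h. norm h < e1 ==> Gamma_at phi xi\<^sub>0 h = \<i> * complex_of_real (alpha \<bullet> h) - P h + Ups (complex_vec h)"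
  using Gamma unfolding eventually_nhds_metric by (auto simp: dist_norm)
 have "isCont (fourier phi) xi\<^sub>0" using continuous_on_fourier[OF phi1] by (simp add: continuous_on_eq_continuous_at)
 then obtain e2 where e2: "e2 > 0" "!!xi. dist xi xi\<^sub>0 < e2 ==> dist (fourier phi xi) (fourier phi xi\<^sub>0) < 1"
  unfolding continuous_at_eps_delta by (metis zero_less_one)
 have "\<forall>\<^sub>F xi in at 0. cmod (Ups (complex_vec xi)) <= 1 / 2 * Re (P xi)"
  using landau_o.smallD[OF small, of "1 / 2"] pdP unfolding positive_definite_def by simp
 then obtain e3 where e3: "e3 > 0" "!!xi. xi ~= 0 ==> norm xi < e3 ==> cmod (Ups (complex_vec xi)) <= 1 / 2 * Re (P xi)"
  unfolding eventually_at by (auto simp: dist_norm)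
 define e where "e = min e1 (min e2 e3)"
 have F0: "fourier phi xi\<^sub>0 ~= 0" using xi\<^sub>0 by auto
 have F: "fourier phi (xi\<^sub>0 + h) = fourier phi xi\<^sub>0 * exp (\<i> * complex_of_real (alpha \<bullet> h) - P h + Ups (complex_vec h))" if h: "norm h < e" for h
 proof -
  have "cmod (fourier phi (xi\<^sub>0 + h) - fourier phi xi\<^sub>0) < 1" using e2(2)[of "xi\<^sub>0 + h"] h by (simp add: e_def dist_norm)
  then have "fourier phi (xi\<^sub>0 + h) ~= 0" using xi\<^sub>0 by auto
  then have "exp (Gamma_at phi xi\<^sub>0 h) = fourier phi (xi\<^sub>0 + h) / fourier phi xi\<^sub>0"
   using F0 unfolding Gamma_at_def by (subst exp_Ln) (auto simp: add.commute)
  moreover have "Gamma_at phi xi\<^sub>0 h = \<i> * complex_of_real (alpha \<bullet> h) - P h + Ups (complex_vec h)" using e1(2) h by (simp add: e_def)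
  ultimately show ?thesis using F0 by (simp add: field_simps)
 qed
 show thesis
 proof (rule that[of e])
  show "e > 0" using e1 e2 e3 by (simp add: e_def)
  show "fourier phi (xi\<^sub>0 + h) = fourier phi xi\<^sub>0 * exp (\<i> * complex_of_real (alpha \<bullet> h) - P h + Ups (complex_vec h))" if "norm h < e" for h
   by (rule F[OF that])
  show "cmod (fourier phi (xi\<^sub>0 + h)) < 1" if h: "0 < norm h" "norm h < e" for h
  proof -
   have h0: "h ~= 0" using h by auto
   have "Re (P h) >= 0" "Re (P h) ~= 0" using pdP h0 unfolding positive_definite_def by auto
   then have p: "Re (P h) > 0" by simp
   have "cmod (Ups (complex_vec h)) <= 1 / 2 * Re (P h)" by (rule e3(2)[OF h0]) (use h in \<open>simp add: e_def\<close>)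
   then have "Re (Ups (complex_vec h)) < Re (P h)" using complex_Re_le_cmod[of "Ups (complex_vec h)"] p by linarith
   then show ?thesis unfolding F[OF h(2)] norm_mult xi\<^sub>0 by simp
  qed
 qed
qed

text \<open>The linear term of the logarithm only moves the centre of the character by \<open>n\<close> times the drift.\<close>
lemma power_tmap:
 assumes F: "fourier phi (xi\<^sub>0 + tmap (tn n) zeta) = fourier phi xi\<^sub>0 * exp (\<i> * complex_of_real (alpha \<bullet> tmap (tn n) zeta) - P (tmap (tn n) zeta) + Ups (complex_vec (tmap (tn n) zeta)))"
  and n: "n >= 1"
 shows "fourier phi (xi\<^sub>0 + tmap (tn n) zeta) ^ n * character (real_vec x) (xi\<^sub>0 + tmap (tn n) zeta)
  = (character (real_vec x) xi\<^sub>0 * fourier phi xi\<^sub>0 ^ n) *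
   ((hker N (tn n) (complex_vec zeta) + aker N (tn n) (complex_vec zeta)) * character (dil kap (tn n) ((real_vec x - real n *\<^sub>R alpha) v* A)) zeta)"
proof -
 define h where "h = tmap (tn n) zeta"
 note tf = tn_facts[OF n]
 have U: "of_nat n * Ups (complex_vec h) = Ups (map_matrix complex_of_real A *v dil kap (of_real (tn n)) (complex_vec zeta)) / of_real (tn n ^ (2 * m))"
 proof -
  have "complex_of_real (1 / tn n ^ (2 * m)) = of_nat n" unfolding tf(4) by simp
  then show ?thesis unfolding h_def tmap_def by (simp add: map_matrix_complex_vec[symmetric] complex_vec_dil divide_inverse mult.commute)
 qed
 have nP: "of_nat n * P h = cpoly a (complex_vec zeta)" using nP_tmap[OF tf(3)] by (simp add: h_def)
 have "exp (\<i> * complex_of_real (alpha \<bullet> h) - P h + Ups (complex_vec h)) ^ n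
   = exp (of_nat n * (\<i> * complex_of_real (alpha \<bullet> h) - P h + Ups (complex_vec h)))" by (rule exp_of_nat_mult[symmetric])
 also have "of_nat n * (\<i> * complex_of_real (alpha \<bullet> h) - P h + Ups (complex_vec h))
   = - (\<i> * complex_of_real ((- (real n *\<^sub>R alpha)) \<bullet> h)) + ((- cpoly a (complex_vec zeta)) + Ups (map_matrix complex_of_real A *v dil kap (of_real (tn n)) (complex_vec zeta)) / of_real (tn n ^ (2 * m)))"
  unfolding nP[symmetric] U[symmetric] by (simp add: algebra_simps)
 also have "exp ... = character (- (real n *\<^sub>R alpha)) h * (hker N (tn n) (complex_vec zeta) + aker N (tn n) (complex_vec zeta))"
  unfolding exp_add character_def hker_def aker_def by (simp add: algebra_simps)
 finally have E: "exp (\<i> * complex_of_real (alpha \<bullet> h) - P h + Ups (complex_vec h)) ^ n = character (- (real n *\<^sub>R alpha)) h * (hker N (tn n) (complex_vec zeta) + aker N (tn n) (complex_vec zeta))" .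
 have ch: "character (real_vec x) h * character (- (real n *\<^sub>R alpha)) h = character (dil kap (tn n) ((real_vec x - real n *\<^sub>R alpha) v* A)) zeta"
 proof -
  have "character (real_vec x) h * character (- (real n *\<^sub>R alpha)) h = character (real_vec x + - (real n *\<^sub>R alpha)) h"
   by (rule character_add_left[symmetric])
  also have "real_vec x + - (real n *\<^sub>R alpha) = real_vec x - real n *\<^sub>R alpha" by simp
  finally show ?thesis by (simp only: h_def character_tmap)
 qed
 show ?thesis unfolding F[folded h_def] power_mult_distrib E character_add h_def[symmetric] ch[symmetric] by (simp only: mult_ac)
qed

definition expansion :: "nat => nat => int^'d => complex" where
 "expansion k n x = (\<Sum>l = 0..k. exp (- (\<i> * complex_of_real (real_vec x \<bullet> xi\<^sub>0))) * fourier phi xi\<^sub>0 ^ n *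
    Q_op Ups A mm l n (attractor P (real n)) (real_vec x - real n *\<^sub>R alpha))"

lemma expansion_eq:
 assumes n: "n >= 1"
 shows "complex_of_real ((2 * pi) ^ CARD('d)) * expansion k n x = (character (real_vec x) xi\<^sub>0 * fourier phi xi\<^sub>0 ^ n) *
  ((J0 * tn n ^ wsum) *\<^sub>R (LINT zeta|lborel. aker (Suc k) (tn n) (complex_vec zeta) * character (dil kap (tn n) ((real_vec x - real n *\<^sub>R alpha) v* A)) zeta))"
proof -
 have "complex_of_real ((2 * pi) ^ CARD('d)) * expansion k n x = (character (real_vec x) xi\<^sub>0 * fourier phi xi\<^sub>0 ^ n) *
  (complex_of_real ((2 * pi) ^ CARD('d)) * (\<Sum>l = 0..k. Q_op Ups A mm l n (attractor P (real n)) (real_vec x - real n *\<^sub>R alpha)))"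
  unfolding expansion_def sum_distrib_left character_def by (rule sum.cong[OF refl]) (simp only: mult_ac)
 then show ?thesis by (simp only: expansion_terms[OF n])
qed

lemma cell_integral:
 assumes n: "n >= 1" and eps: "!!h. norm h < eps ==> fourier phi (xi\<^sub>0 + h) = fourier phi xi\<^sub>0 * exp (\<i> * complex_of_real (alpha \<bullet> h) - P h + Ups (complex_vec h))"
  and cell: "cell delta \<subseteq> ball xi\<^sub>0 eps"
 shows "(LINT xi:cell delta|lborel. fourier phi xi ^ n * character (real_vec x) xi) = (character (real_vec x) xi\<^sub>0 * fourier phi xi\<^sub>0 ^ n) *
  ((J0 * tn n ^ wsum) *\<^sub>R (LINT zeta|lborel. (indicator (box_t delta (tn n)) zeta *\<^sub>R (hker N (tn n) (complex_vec zeta) + aker N (tn n) (complex_vec zeta)))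
    * character (dil kap (tn n) ((real_vec x - real n *\<^sub>R alpha) v* A)) zeta))"
proof -
 let ?f = "%xi. indicator (cell delta) xi *\<^sub>R (fourier phi xi ^ n * character (real_vec x) xi)"
 let ?e = "character (real_vec x) xi\<^sub>0 * fourier phi xi\<^sub>0 ^ n"
 note tf = tn_facts[OF n]
 have fm[measurable]: "fourier phi \<in> borel_measurable borel" by (rule fourier_measurable[OF phi1])
 have cm[measurable]: "character (real_vec x) \<in> borel_measurable borel"
  unfolding character_def[abs_def] by (intro borel_measurable_continuous_onI continuous_intros)
 have m1[measurable]: "?f \<in> borel_measurable borel" by measurable
 have m2: "(%h. ?f (h + xi\<^sub>0)) \<in> borel_measurable borel" by measurable
 have "(LINT xi:cell delta|lborel. fourier phi xi ^ n * character (real_vec x) xi) = integral\<^sup>L lborel ?f"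
  by (simp only: set_lebesgue_integral_def)
 also have "... = (LINT h|lborel. ?f (h + xi\<^sub>0))" by (rule lborel_integral_translate(1)[OF m1, symmetric])
 also have "... = (J0 * tn n ^ wsum) *\<^sub>R (LINT zeta|lborel. ?f (tmap (tn n) zeta + xi\<^sub>0))" by (rule scale_integral[OF tf(1) m2])
 also have "(%zeta. ?f (tmap (tn n) zeta + xi\<^sub>0)) = (%zeta. ?e * ((indicator (box_t delta (tn n)) zeta *\<^sub>R (hker N (tn n) (complex_vec zeta) + aker N (tn n) (complex_vec zeta)))
    * character (dil kap (tn n) ((real_vec x - real n *\<^sub>R alpha) v* A)) zeta))"
 proof
  fix zeta
  show "?f (tmap (tn n) zeta + xi\<^sub>0) = ?e * ((indicator (box_t delta (tn n)) zeta *\<^sub>R (hker N (tn n) (complex_vec zeta) + aker N (tn n) (complex_vec zeta)))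
    * character (dil kap (tn n) ((real_vec x - real n *\<^sub>R alpha) v* A)) zeta)"
  proof (cases "zeta \<in> box_t delta (tn n)")
   case False
   then have "tmap (tn n) zeta + xi\<^sub>0 \<notin> cell delta" using tmap_cell[OF tf(1)] by (simp add: add.commute)
   then show ?thesis using False by simp
  next
   case True
   then have c: "xi\<^sub>0 + tmap (tn n) zeta \<in> cell delta" using tmap_cell[OF tf(1)] by simp
   then have "norm (tmap (tn n) zeta) < eps" using cell by (auto simp: dist_norm)
   from power_tmap[OF eps[OF this] n, of x N] show ?thesis using True c by (simp add: add.commute)
  qed
 qed
 also have "(LINT zeta|lborel. ?e * ((indicator (box_t delta (tn n)) zeta *\<^sub>R (hker N (tn n) (complex_vec zeta) + aker N (tn n) (complex_vec zeta)))
    * character (dil kap (tn n) ((real_vec x - real n *\<^sub>R alpha) v* A)) zeta)) = ?e * (LINT zeta|lborel. (indicator (box_t delta (tn n)) zeta *\<^sub>R (hker N (tn n) (complex_vec zeta) + aker N (tn n) (complex_vec zeta)))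
    * character (dil kap (tn n) ((real_vec x - real n *\<^sub>R alpha) v* A)) zeta)"
  by (rule integral_mult_right_zero)
 finally show ?thesis by (simp only: mult_scaleR_right)
qed

text \<open>The dilation contracts, so that the envelope changes by a bounded factor on unit cubes and its lattice sum is controlled by its integral. The latter is the reciprocal Jacobian of the dilation, that is \<open>n powr mu\<close>, times a constant.\<close>
lemma envelope_sum:
 assumes c: "c > 0"
 obtains C where "C >= 0" "!!n. n >= 1 ==> (%x::int^'d. exp (- c * norm (dil kap (tn n) ((real_vec x - real n *\<^sub>R alpha) v* A)))) summable_on UNIV"
  "!!n. n >= 1 ==> infsum (%x::int^'d. exp (- c * norm (dil kap (tn n) ((real_vec x - real n *\<^sub>R alpha) v* A)))) UNIV <= C * real n powr mu"
proof -
 have lin: "linear (%v::real^'d. v v* N)" for N :: "real^'d^'d"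
 proof -
  have "(%v::real^'d. v v* N) = (*v) (transpose N)" by (rule ext) simp
  then show ?thesis by (simp only: matrix_vector_mul_linear)
 qed
 note lA = lin[of A]
 obtain K where K: "K > 0" "!!v. norm (v v* A) <= norm v * K"
  using bounded_linear.pos_bounded[OF lA[unfolded linear_conv_bounded_linear]] by blast
 have inv: "(v v* Ai) v* A = v" "(v v* A) v* Ai = v" for v
  using Ai by (simp_all add: vector_matrix_mul_assoc)
 note lAi = lin[of Ai]
 obtain J where J: "J > 0" "!!g. g \<in> borel_measurable borel ==> (\<integral>\<^sup>+x. g x \<partial>lborel) = ennreal J * (\<integral>\<^sup>+x. g (x v* Ai) \<partial>lborel)"
  by (rule nn_integral_linear[OF lAi lA inv(2) inv(1)], rule that, assumption, blast)
 define I where "I = (LINT x|lborel. exp (- c * norm (x :: real^'d)))"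
 have I: "(\<integral>\<^sup>+x. ennreal (exp (- c * norm (x :: real^'d))) \<partial>lborel) = ennreal I" "I >= 0"
  unfolding I_def using integrable_exp_norm[OF c] by (auto intro!: nn_integral_eq_integral)
 define D where "D = real CARD('d)"
 define C1 where "C1 = exp (c * (D * K))"
 have both: "(%x::int^'d. exp (- c * norm (dil kap (tn n) ((real_vec x - real n *\<^sub>R alpha) v* A)))) summable_on UNIV \<and>
   infsum (%x::int^'d. exp (- c * norm (dil kap (tn n) ((real_vec x - real n *\<^sub>R alpha) v* A)))) UNIV <= C1 * (J * (real n powr mu * I))" if n: "n >= 1" for n
 proof -
  note tf = tn_facts[OF n]
  define t where "t = tn n"
  have t: "0 < t" "t <= 1" using tf by (auto simp: t_def)
  define w where "w = (%xi::real^'d. exp (- c * norm (dil kap t ((xi - real n *\<^sub>R alpha) v* A))))"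
  have cdil: "continuous_on S (%v::real^'d. dil kap t v)" for S unfolding dil_def by (intro continuous_intros)
  have "continuous_on UNIV (%xi::real^'d. (xi - real n *\<^sub>R alpha) v* A)"
   by (rule linear_continuous_on_compose[OF _ lA]) (intro continuous_intros)
  then have "continuous_on UNIV (%xi::real^'d. dil kap t ((xi - real n *\<^sub>R alpha) v* A))"
   by (rule continuous_on_compose2[OF cdil[of UNIV]]) auto
  then have wm: "w \<in> borel_measurable borel" unfolding w_def by (intro borel_measurable_continuous_onI continuous_intros)
  have slow: "w x <= C1 * w y" if xy: "!!j. \<bar>x $ j - y $ j\<bar> <= 1" for x y
  proof -
   have "norm (y - x) <= (\<Sum>j\<in>UNIV. \<bar>(y - x) $ j\<bar>)" by (rule norm_le_l1_cart)
   also have "... <= (\<Sum>j\<in>(UNIV::'d set). 1)" using xy by (intro sum_mono) (simp add: abs_minus_commute)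
   finally have yx: "norm (y - x) <= D" by (simp add: D_def)
   have "norm (dil kap t ((y - x) v* A)) <= norm ((y - x) v* A)"
   proof (rule norm_le_componentwise_cart)
    fix j
    have "t ^ (kap $ j) * \<bar>((y - x) v* A) $ j\<bar> <= 1 * \<bar>((y - x) v* A) $ j\<bar>" using t by (intro mult_right_mono power_le_one) auto
    then show "norm (dil kap t ((y - x) v* A) $ j) <= norm (((y - x) v* A) $ j)" using t by (simp add: abs_mult)
   qed
   also have "... <= norm (y - x) * K" by (rule K(2))
   also have "... <= D * K" using yx K(1) by (intro mult_right_mono) auto
   finally have d: "norm (dil kap t ((y - x) v* A)) <= D * K" .
   have "dil kap t ((y - real n *\<^sub>R alpha) v* A) = dil kap t ((x - real n *\<^sub>R alpha) v* A) + dil kap t ((y - x) v* A)"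
   proof -
    have "(y - real n *\<^sub>R alpha) v* A = (x - real n *\<^sub>R alpha) v* A + (y - x) v* A"
     using linear_add[OF lA, of "x - real n *\<^sub>R alpha" "y - x"] by simp
    then show ?thesis by (simp add: vec_eq_iff distrib_left)
   qed
   then have "norm (dil kap t ((y - real n *\<^sub>R alpha) v* A)) <= norm (dil kap t ((x - real n *\<^sub>R alpha) v* A)) + D * K"
    using norm_triangle_le[of "dil kap t ((x - real n *\<^sub>R alpha) v* A)" "dil kap t ((y - x) v* A)"] d by simp
   from mult_left_mono[OF this less_imp_le[OF c]]
   show ?thesis unfolding w_def C1_def by (simp add: algebra_simps flip: exp_add)
  qed
  have "(\<integral>\<^sup>+xi. ennreal (w xi) \<partial>lborel) = (\<integral>\<^sup>+xi. ennreal (exp (- c * norm (dil kap t (xi v* A)))) \<partial>lborel)"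
  proof -
   have "continuous_on UNIV (%xi::real^'d. xi v* A)" by (rule linear_continuous_on_compose[OF _ lA]) (intro continuous_intros)
   then have "continuous_on UNIV (%xi::real^'d. dil kap t (xi v* A))" by (rule continuous_on_compose2[OF cdil[of UNIV]]) auto
   then have "(%xi::real^'d. exp (- c * norm (dil kap t (xi v* A)))) \<in> borel_measurable borel"
    by (intro borel_measurable_continuous_onI continuous_intros)
   then have "(%xi::real^'d. ennreal (exp (- c * norm (dil kap t (xi v* A))))) \<in> borel_measurable borel" by measurable
   from nn_integral_translate[OF this, of "- (real n *\<^sub>R alpha)"] show ?thesis by (simp add: w_def)
  qed
  also have "... = ennreal J * (\<integral>\<^sup>+v. ennreal (exp (- c * norm (dil kap t v))) \<partial>lborel)"
  proof -
   have "continuous_on UNIV (%xi::real^'d. xi v* A)" by (rule linear_continuous_on_compose[OF _ lA]) (intro continuous_intros)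
   then have "continuous_on UNIV (%xi::real^'d. dil kap t (xi v* A))" by (rule continuous_on_compose2[OF cdil[of UNIV]]) auto
   then have "(%xi::real^'d. exp (- c * norm (dil kap t (xi v* A)))) \<in> borel_measurable borel"
    by (intro borel_measurable_continuous_onI continuous_intros)
   then have "(%xi::real^'d. ennreal (exp (- c * norm (dil kap t (xi v* A))))) \<in> borel_measurable borel" by measurable
   from J(2)[OF this] show ?thesis unfolding inv(1) .
  qed
  also have "(\<integral>\<^sup>+v. ennreal (exp (- c * norm (dil kap t v))) \<partial>lborel)
    = ennreal (\<Prod>j\<in>(UNIV::'d set). (1 / t) ^ (kap $ j)) * (\<integral>\<^sup>+v. ennreal (exp (- c * norm (v :: real^'d))) \<partial>lborel)"
  proof -
   have "(%v::real^'d. exp (- c * norm (dil kap t v))) \<in> borel_measurable borel"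
    by (intro borel_measurable_continuous_onI continuous_intros cdil)
   then have "(%v::real^'d. ennreal (exp (- c * norm (dil kap t v)))) \<in> borel_measurable borel" by measurable
   from nn_integral_diag[OF this, of "%j. (1 / t) ^ (kap $ j)"] t
   have "(\<integral>\<^sup>+v. ennreal (exp (- c * norm (dil kap t v))) \<partial>lborel)
    = ennreal (\<Prod>j\<in>(UNIV::'d set). (1 / t) ^ (kap $ j)) * (\<integral>\<^sup>+v. ennreal (exp (- c * norm (dil kap t (\<chi> j. (1 / t) ^ (kap $ j) * v $ j)))) \<partial>lborel)" by simp
   moreover have "dil kap t (\<chi> j. (1 / t) ^ (kap $ j) * v $ j) = v" for v :: "real^'d"
    using t by (simp add: vec_eq_iff power_one_over)
   ultimately show ?thesis by (simp only:)
  qed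
  also have "(\<Prod>j\<in>(UNIV::'d set). (1 / t) ^ (kap $ j)) = real n powr mu"
  proof -
   have "(\<Prod>j\<in>(UNIV::'d set). (1 / t) ^ (kap $ j)) = (1 / t) ^ wsum" unfolding wsum_def power_sum ..
   also have "... = 1 / t ^ wsum" by (rule power_one_over)
   finally have "(\<Prod>j\<in>(UNIV::'d set). (1 / t) ^ (kap $ j)) = 1 / t ^ wsum" .
   then show ?thesis unfolding t_def tn_wsum[OF n] using n by (simp add: powr_minus_divide)
  qed
  finally have int: "(\<integral>\<^sup>+xi. ennreal (w xi) \<partial>lborel) <= ennreal (J * (real n powr mu * I))"
   unfolding I(1) using J(1) I(2) by (simp add: ennreal_mult)
  have C1: "C1 >= 0" "J * (real n powr mu * I) >= 0" using J I by (auto simp: C1_def)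
  have w0: "w x >= 0" for x by (simp add: w_def)
  from lattice_sum_le_integral[OF wm w0 C1(1) slow int C1(2)] show ?thesis by (simp add: w_def t_def)
 qed
 show thesis
 proof (rule that[of "C1 * (J * I)"])
  show "C1 * (J * I) >= 0" using J I by (auto simp: C1_def)
  fix n :: nat assume n: "n >= 1"
  show "(%x::int^'d. exp (- c * norm (dil kap (tn n) ((real_vec x - real n *\<^sub>R alpha) v* A)))) summable_on UNIV" using both[OF n] by (rule conjunct1)
  have "C1 * (J * (real n powr mu * I)) = C1 * (J * I) * real n powr mu" by (simp only: mult_ac)
  with both[OF n] show "infsum (%x::int^'d. exp (- c * norm (dil kap (tn n) ((real_vec x - real n *\<^sub>R alpha) v* A)))) UNIV <= C1 * (J * I) * real n powr mu" by linarith
 qed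
qed

end

section \<open>The estimate at one point\<close>

lemma exp_neg_power_le:
 fixes s c :: real
 assumes s: "s >= 1" and c: "c > 0" and m: "m >= (1::nat)"
 shows "exp (- c * s ^ m) <= fact N * (1 / c) ^ N * (1 / s) ^ N"
proof -
 have "s ^ N <= (s ^ m) ^ N"
  using s m self_le_power[of s m] by (intro power_mono) auto
 then have "(c * s) ^ N <= (c * s ^ m) ^ N" unfolding power_mult_distrib using c by (intro mult_left_mono) auto
 also have "... <= fact N * exp (c * s ^ m)" using c s by (intro power_le_fact_exp) auto
 finally have "(c * s) ^ N * exp (- c * s ^ m) <= fact N * exp (c * s ^ m) * exp (- c * s ^ m)" by (rule mult_right_mono) simp
 also have "... = fact N" by (simp add: mult.assoc flip: exp_add)
 finally have "exp (- c * s ^ m) <= fact N / (c * s) ^ N" using c s by (simp add: pos_le_divide_eq mult.commute)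
 also have "fact N / (c * s) ^ N = fact N * (1 / c) ^ N * (1 / s) ^ N" by (simp add: power_mult_distrib power_divide)
 finally show ?thesis .
qed

context point_data
begin

text \<open>The difference of the cell integral and the expansion consists of the integral of the error kernel over the box and that of the approximate kernel off the box. Far from the origin, where only an exponential bound for the expansion is available, half of the decay of the envelope is converted into the factor \<open>t ^ (k + 1)\<close>: there the rescaled position is at least of order \<open>t ^ (- m)\<close>.\<close>
theorem point_estimate:
 assumes eps0: "eps0 > 0"
 shows "\<exists>Q W0 E C c R. Q \<in> sets borel \<and> Q \<subseteq> ball xi\<^sub>0 eps0 \<and> open W0 \<and> xi\<^sub>0 \<in> W0 \<and> W0 \<subseteq> Q \<and> C > 0 \<and> c > 0 \<and> R >= 0 \<and>
  (\<forall>n\<ge>1. \<forall>x. 0 <= E n x \<and> E n x <= 1) \<and>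
  (\<forall>n\<ge>1. E n summable_on UNIV \<and> infsum (E n) UNIV <= C * real n powr mu) \<and>
  (\<forall>n\<ge>1. \<forall>x. cmod ((LINT xi:Q|lborel. fourier phi xi ^ n * character (real_vec x) xi) - complex_of_real ((2 * pi) ^ CARD('d)) * expansion k n x)
    <= C * real n powr (- (mu + real (k + 1) / (2 * real m))) * E n x + C * exp (- c * real n)) \<and>
  (\<forall>n\<ge>1. \<forall>x. R * real n <= norm (real_vec x) --> cmod (complex_of_real ((2 * pi) ^ CARD('d)) * expansion k n x)
    <= C * real n powr (- (mu + real (k + 1) / (2 * real m))) * E n x)"
proof -
 let ?N = "Suc k"
 obtain e where e: "e > 0"
  "!!h. norm h < e ==> fourier phi (xi\<^sub>0 + h) = fourier phi xi\<^sub>0 * exp (\<i> * complex_of_real (alpha \<bullet> h) - P h + Ups (complex_vec h))"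
  by (rule fourier_near, rule that, assumption, blast)
 have "min eps0 e > 0" using eps0 e by simp
 from cell_small[OF this] obtain delta0 where delta0: "delta0 > 0" "!!delta. 0 < delta ==> delta <= delta0 ==> cell delta \<subseteq> ball xi\<^sub>0 (min eps0 e)" by blast
 obtain delta c1 C1 where delta: "0 < delta" "delta <= delta0" and c1: "c1 > 0" "C1 >= 0"
  and k1: "!!t y. 0 < t ==> t <= 1 ==> cmod (LINT xi|lborel. (indicator (box_t delta t) xi *\<^sub>R hker ?N t (complex_vec xi)) * character y xi)
    <= C1 * (t ^ ?N * exp (- c1 * norm y) + exp (- c1 / t ^ (2 * m)))"
  and k2: "!!t y. 0 < t ==> t <= 1 ==> cmod (LINT xi|lborel. aker ?N t (complex_vec xi) * character y xi) <= C1 * exp (- c1 * norm y)"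
  and k3: "!!t y. 0 < t ==> t <= 1 ==> cmod (LINT xi|lborel. (indicator (- box_t delta t) xi *\<^sub>R aker ?N t (complex_vec xi)) * character y xi)
    <= C1 * exp (- c1 / t ^ (2 * m))"
  and i1: "!!t. 0 < t ==> t <= 1 ==> integrable lborel (%xi. indicator (box_t delta t) xi *\<^sub>R hker ?N t (complex_vec xi))"
  and i2: "!!t. 0 < t ==> t <= 1 ==> integrable lborel (%xi. aker ?N t (complex_vec xi))"
 proof (rule kernel_estimates[OF delta0(1), where N = ?N], goal_cases)
  case (1 delta c C)
  from 1(2-) show ?case by (rule that[of delta c C])
 qed
 have cell: "cell delta \<subseteq> ball xi\<^sub>0 eps0" "cell delta \<subseteq> ball xi\<^sub>0 e" using delta0(2)[OF delta] by auto
 define y where "y = (%n (x :: int^'d). dil kap (tn n) ((real_vec x - real n *\<^sub>R alpha) v* A))"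
 define E where "E = (%n x. exp (- (c1 / 2) * norm (y n x)))"
 obtain C2 where C2: "C2 >= 0" "!!n. n >= 1 ==> E n summable_on UNIV" "!!n. n >= 1 ==> infsum (E n) UNIV <= C2 * real n powr mu"
 proof -
  have "c1 / 2 > 0" using c1 by simp
  from envelope_sum[OF this] obtain C2 where "C2 >= 0"
   "!!n. n >= 1 ==> (%x::int^'d. exp (- (c1 / 2) * norm (dil kap (tn n) ((real_vec x - real n *\<^sub>R alpha) v* A)))) summable_on UNIV"
   "!!n. n >= 1 ==> infsum (%x::int^'d. exp (- (c1 / 2) * norm (dil kap (tn n) ((real_vec x - real n *\<^sub>R alpha) v* A)))) UNIV <= C2 * real n powr mu"
   by blast
  then show thesis by (intro that[of C2]) (auto simp: E_def y_def)
 qed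
 obtain K where K: "K > 0" "!!v. norm v <= norm (v v* A) * K"
 proof -
  have "(%v::real^'d. v v* Ai) = (*v) (transpose Ai)" by (rule ext) simp
  then have "bounded_linear (%v::real^'d. v v* Ai)" by (simp only: matrix_vector_mul_bounded_linear)
  from bounded_linear.pos_bounded[OF this] obtain K where "K > 0" "!!v. norm (v v* Ai) <= norm v * K" by blast
  moreover have "(v v* A) v* Ai = v" for v using Ai by (simp add: vector_matrix_mul_assoc)
  ultimately show thesis using that[of K] by metis
 qed
 define c4 where "c4 = c1 / 2 / K"
 have c4: "c4 > 0" using c1 K by (simp add: c4_def)
 define C3 where "C3 = fact ?N * (1 / c4) ^ ?N"
 have C3: "C3 >= 0" using c4 by (simp add: C3_def)
 define R where "R = norm alpha + 1"
 have E01: "0 <= E n x" "E n x <= 1" for n x using c1 by (simp_all add: E_def)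
 have EE: "exp (- c1 * norm (y n x)) = E n x * E n x" for n x
 proof -
  have "- c1 * norm (y n x) = - (c1 / 2) * norm (y n x) + - (c1 / 2) * norm (y n x)" by (simp add: field_simps)
  then show ?thesis unfolding E_def by (simp only: exp_add)
 qed
 define C where "C = 1 + 2 * J0 * C1 + J0 * C1 * C3 + C2"
 have Cge: "C > 0" "2 * J0 * C1 <= C" "J0 * C1 * C3 <= C" "C2 <= C" "J0 * C1 <= C"
 proof -
  have "0 <= J0 * C1" "0 <= J0 * C1 * C3" using J0(1) c1 C3 by auto
  then show "C > 0" "2 * J0 * C1 <= C" "J0 * C1 * C3 <= C" "C2 <= C" "J0 * C1 <= C" unfolding C_def using C2(1) by linarith+
 qed
 have scale: "J0 * tn n ^ wsum >= 0" "J0 * tn n ^ wsum * tn n ^ ?N = J0 * real n powr (- (mu + real (k + 1) / (2 * real m)))" "J0 * tn n ^ wsum <= J0"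
  if n: "n >= 1" for n
 proof -
  note tf = tn_facts[OF n]
  show "J0 * tn n ^ wsum >= 0" using J0(1) tf by simp
  have "tn n ^ wsum <= 1" using tf by (intro power_le_one) auto
  then show "J0 * tn n ^ wsum <= J0" using J0(1) by simp
  have "tn n ^ wsum * tn n ^ ?N = real n powr (- mu) * real n powr (- real ?N / (2 * real m))"
   unfolding tn_wsum[OF n] tf(5)[of ?N] ..
  also have "... = real n powr (- mu + - real ?N / (2 * real m))" by (rule powr_add[symmetric])
  also have "- mu + - real ?N / (2 * real m) = - (mu + real (k + 1) / (2 * real m))"
   by (simp only: Suc_eq_plus1 minus_add_distrib minus_divide_left)
  finally show "J0 * tn n ^ wsum * tn n ^ ?N = J0 * real n powr (- (mu + real (k + 1) / (2 * real m)))" by (simp only: mult.assoc)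
 qed
 have cm: "character v \<in> borel_measurable borel" for v :: "real^'d"
  unfolding character_def[abs_def] by (intro borel_measurable_continuous_onI continuous_intros)
 have ic: "integrable lborel (%xi. f xi * character v xi)" if "integrable lborel f" for f and v :: "real^'d"
 proof (rule Bochner_Integration.integrable_bound[OF that])
  show "(%xi. f xi * character v xi) \<in> borel_measurable lborel"
   by (rule borel_measurable_times) (use that cm in auto)
 qed (simp add: norm_mult)
 have unit: "cmod (character (real_vec x) xi\<^sub>0 * fourier phi xi\<^sub>0 ^ n) = 1" for n x
  by (simp add: norm_mult norm_power xi\<^sub>0)
 have main: "cmod ((LINT xi:cell delta|lborel. fourier phi xi ^ n * character (real_vec x) xi) - complex_of_real ((2 * pi) ^ CARD('d)) * expansion k n x)
    <= C * real n powr (- (mu + real (k + 1) / (2 * real m))) * E n x + C * exp (- c1 * real n)" if n: "n >= 1" for n x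
 proof -
  note tf = tn_facts[OF n]
  define t where "t = tn n"
  have t: "0 < t" "t <= 1" using tf by (auto simp: t_def)
  let ?H = "%zeta. indicator (box_t delta t) zeta *\<^sub>R hker ?N t (complex_vec zeta)"
  let ?a = "%zeta. aker ?N t (complex_vec zeta)"
  let ?a1 = "%zeta. indicator (box_t delta t) zeta *\<^sub>R aker ?N t (complex_vec zeta)"
  let ?a2 = "%zeta. indicator (- box_t delta t) zeta *\<^sub>R aker ?N t (complex_vec zeta)"
  let ?c = "character (y n x)"
  have I1: "integrable lborel ?a1" by (rule integrable_mult_indicator[OF _ i2[OF t]]) simp
  have I2: "integrable lborel ?a2" by (rule integrable_mult_indicator[OF _ i2[OF t]]) simp
  have "(LINT zeta|lborel. (indicator (box_t delta t) zeta *\<^sub>R (hker ?N t (complex_vec zeta) + ?a zeta)) * ?c zeta) = (LINT zeta|lborel. ?H zeta * ?c zeta + ?a1 zeta * ?c zeta)"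
   by (simp only: scaleR_add_right distrib_right)
  also have "... = (LINT zeta|lborel. ?H zeta * ?c zeta) + (LINT zeta|lborel. ?a1 zeta * ?c zeta)"
   by (rule Bochner_Integration.integral_add[OF ic[OF i1[OF t]] ic[OF I1]])
  finally have S1: "(LINT zeta|lborel. (indicator (box_t delta t) zeta *\<^sub>R (hker ?N t (complex_vec zeta) + ?a zeta)) * ?c zeta) = (LINT zeta|lborel. ?H zeta * ?c zeta) + (LINT zeta|lborel. ?a1 zeta * ?c zeta)" .
  have "(%zeta. ?a zeta * ?c zeta) = (%zeta. ?a1 zeta * ?c zeta + ?a2 zeta * ?c zeta)"
   by (rule ext) (simp add: indicator_def)
  then have S2: "(LINT zeta|lborel. ?a zeta * ?c zeta) = (LINT zeta|lborel. ?a1 zeta * ?c zeta) + (LINT zeta|lborel. ?a2 zeta * ?c zeta)"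
   using Bochner_Integration.integral_add[OF ic[OF I1] ic[OF I2], of "y n x" "y n x"] by (simp only:)
  have "(LINT xi:cell delta|lborel. fourier phi xi ^ n * character (real_vec x) xi) - complex_of_real ((2 * pi) ^ CARD('d)) * expansion k n x
   = (character (real_vec x) xi\<^sub>0 * fourier phi xi\<^sub>0 ^ n) * ((J0 * t ^ wsum) *\<^sub>R ((LINT zeta|lborel. ?H zeta * ?c zeta) - (LINT zeta|lborel. ?a2 zeta * ?c zeta)))"
  proof -
   have X1: "(LINT xi:cell delta|lborel. fourier phi xi ^ n * character (real_vec x) xi) = (character (real_vec x) xi\<^sub>0 * fourier phi xi\<^sub>0 ^ n) * ((J0 * t ^ wsum) *\<^sub>R (LINT zeta|lborel. (indicator (box_t delta t) zeta *\<^sub>R (hker ?N t (complex_vec zeta) + ?a zeta)) * ?c zeta))"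
    unfolding t_def y_def by (rule cell_integral[OF n _ cell(2)]) (rule e(2))
   have X2: "complex_of_real ((2 * pi) ^ CARD('d)) * expansion k n x = (character (real_vec x) xi\<^sub>0 * fourier phi xi\<^sub>0 ^ n) * ((J0 * t ^ wsum) *\<^sub>R (LINT zeta|lborel. ?a zeta * ?c zeta))"
    unfolding t_def y_def by (rule expansion_eq[OF n])
   have alg: "u * (s *\<^sub>R (v1 + v2)) - u * (s *\<^sub>R (v2 + v3)) = u * (s *\<^sub>R (v1 - v3))" for u v1 v2 v3 :: complex and s :: real
    by (simp add: algebra_simps)
   show ?thesis unfolding X1 X2 S1 S2 by (rule alg)
  qed
  then have "cmod ((LINT xi:cell delta|lborel. fourier phi xi ^ n * character (real_vec x) xi) - complex_of_real ((2 * pi) ^ CARD('d)) * expansion k n x)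
   = (J0 * t ^ wsum) * cmod ((LINT zeta|lborel. ?H zeta * ?c zeta) - (LINT zeta|lborel. ?a2 zeta * ?c zeta))"
   using scale(1)[OF n] by (simp only: norm_mult[of "character (real_vec x) xi\<^sub>0 * fourier phi xi\<^sub>0 ^ n"] unit norm_scaleR t_def abs_of_nonneg mult_1)
  also have "... <= (J0 * t ^ wsum) * (C1 * (t ^ ?N * E n x) + 2 * C1 * exp (- c1 * real n))"
  proof (rule mult_left_mono)
   have en: "exp (- c1 / t ^ (2 * m)) = exp (- c1 * real n)" using tf(4) by (simp add: t_def divide_inverse)
   have "cmod ((LINT zeta|lborel. ?H zeta * ?c zeta) - (LINT zeta|lborel. ?a2 zeta * ?c zeta)) <= C1 * (t ^ ?N * exp (- c1 * norm (y n x)) + exp (- c1 / t ^ (2 * m))) + C1 * exp (- c1 / t ^ (2 * m))"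
    by (rule order_trans[OF norm_triangle_ineq4 add_mono[OF k1[OF t] k3[OF t]]])
   also have "... = C1 * (t ^ ?N * exp (- c1 * norm (y n x))) + 2 * C1 * exp (- c1 * real n)"
    unfolding en by (simp add: algebra_simps)
   also have "C1 * (t ^ ?N * exp (- c1 * norm (y n x))) <= C1 * (t ^ ?N * E n x)"
   proof (intro mult_left_mono)
    show "exp (- c1 * norm (y n x)) <= E n x" unfolding EE using E01 by (simp add: mult_left_le)
   qed (use c1 t in auto)
   finally show "cmod ((LINT zeta|lborel. ?H zeta * ?c zeta) - (LINT zeta|lborel. ?a2 zeta * ?c zeta)) <= C1 * (t ^ ?N * E n x) + 2 * C1 * exp (- c1 * real n)" by simp
   show "0 <= J0 * t ^ wsum" using scale(1)[OF n] by (simp add: t_def)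
  qed
  also have "... = C1 * (J0 * t ^ wsum * t ^ ?N) * E n x + (J0 * t ^ wsum) * (2 * C1 * exp (- c1 * real n))"
   by (simp only: distrib_left mult_ac)
  also have "... <= C * real n powr (- (mu + real (k + 1) / (2 * real m))) * E n x + C * exp (- c1 * real n)"
  proof (rule add_mono)
   have "C1 * (J0 * t ^ wsum * t ^ ?N) * E n x = (J0 * C1) * (real n powr (- (mu + real (k + 1) / (2 * real m))) * E n x)"
    unfolding t_def scale(2)[OF n] by (simp only: mult_ac)
   also have "... <= C * (real n powr (- (mu + real (k + 1) / (2 * real m))) * E n x)"
    using Cge E01 by (intro mult_right_mono) auto
   finally show "C1 * (J0 * t ^ wsum * t ^ ?N) * E n x <= C * real n powr (- (mu + real (k + 1) / (2 * real m))) * E n x" by (simp only: mult.assoc)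
   have "(J0 * t ^ wsum) * (2 * C1 * exp (- c1 * real n)) <= J0 * (2 * C1 * exp (- c1 * real n))"
    using scale(3)[OF n] c1 by (intro mult_right_mono) (auto simp: t_def)
   also have "... = (2 * J0 * C1) * exp (- c1 * real n)" by (simp only: mult_ac)
   also have "... <= C * exp (- c1 * real n)" using Cge by (intro mult_right_mono) auto
   finally show "(J0 * t ^ wsum) * (2 * C1 * exp (- c1 * real n)) <= C * exp (- c1 * real n)" .
  qed
  finally show ?thesis .
 qed
 have far: "cmod (complex_of_real ((2 * pi) ^ CARD('d)) * expansion k n x) <= C * real n powr (- (mu + real (k + 1) / (2 * real m))) * E n x"
  if n: "n >= 1" and x: "R * real n <= norm (real_vec x)" for n x
 proof -
  note tf = tn_facts[OF n]
  define t where "t = tn n"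
  have t: "0 < t" "t <= 1" using tf by (auto simp: t_def)
  define X where "X = real_vec x - real n *\<^sub>R alpha"
  have "norm (real_vec x) <= norm X + real n * norm alpha" using norm_triangle_ineq[of X "real n *\<^sub>R alpha"] by (simp add: X_def)
  then have nX: "real n <= norm X" using x by (simp add: R_def algebra_simps)
  have "norm (t ^ m *\<^sub>R (X v* A)) <= norm (y n x)"
  proof (rule norm_le_componentwise_cart)
   fix j
   have "t ^ m <= t ^ (kap $ j)" using t kappa_le[of j] by (intro power_decreasing) auto
   then have "t ^ m * \<bar>(X v* A) $ j\<bar> <= t ^ (kap $ j) * \<bar>(X v* A) $ j\<bar>" by (rule mult_right_mono) simp
   then show "norm ((t ^ m *\<^sub>R (X v* A)) $ j) <= norm (y n x $ j)" using t by (simp add: y_def X_def t_def abs_mult)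
  qed
  then have ty: "t ^ m * norm (X v* A) <= norm (y n x)" using t by simp
  have tm: "t ^ m * real n = (1 / t) ^ m"
  proof -
   have "real n * (t ^ m * t ^ m) = 1" using tf(3) by (simp add: t_def mult_2 power_add)
   then show ?thesis using t by (simp add: power_one_over field_simps)
  qed
  have "t ^ m * real n <= t ^ m * (norm (X v* A) * K)" using nX K(2)[of X] t by (intro mult_left_mono) auto
  then have "(1 / t) ^ m <= norm (y n x) * K" using mult_right_mono[OF ty less_imp_le[OF K(1)]] tm by (simp add: mult.assoc)
  then have "(1 / t) ^ m / K <= norm (y n x)" using K(1) by (simp only: pos_divide_le_eq)
  from mult_left_mono[OF this, of "c1 / 2"] c1 have "c4 * (1 / t) ^ m <= c1 / 2 * norm (y n x)" by (simp add: c4_def mult_ac)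
  then have "E n x <= exp (- c4 * (1 / t) ^ m)" unfolding E_def by simp
  also have "... <= fact ?N * (1 / c4) ^ ?N * (1 / (1 / t)) ^ ?N" by (rule exp_neg_power_le[OF _ c4 m_ge]) (use t in simp)
  finally have Et: "E n x <= C3 * t ^ ?N" by (simp add: C3_def)
  have "cmod (complex_of_real ((2 * pi) ^ CARD('d)) * expansion k n x)
   = (J0 * t ^ wsum) * cmod (LINT zeta|lborel. aker ?N t (complex_vec zeta) * character (y n x) zeta)"
  proof -
   have "complex_of_real ((2 * pi) ^ CARD('d)) * expansion k n x = (character (real_vec x) xi\<^sub>0 * fourier phi xi\<^sub>0 ^ n) * ((J0 * t ^ wsum) *\<^sub>R (LINT zeta|lborel. aker ?N t (complex_vec zeta) * character (y n x) zeta))"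
    unfolding t_def y_def by (rule expansion_eq[OF n])
   then have "cmod (complex_of_real ((2 * pi) ^ CARD('d)) * expansion k n x) = 1 * (\<bar>J0 * t ^ wsum\<bar> * cmod (LINT zeta|lborel. aker ?N t (complex_vec zeta) * character (y n x) zeta))"
    by (simp only: norm_mult[of "character (real_vec x) xi\<^sub>0 * fourier phi xi\<^sub>0 ^ n"] unit norm_scaleR)
   then show ?thesis using scale(1)[OF n] by (simp only: t_def abs_of_nonneg mult_1)
  qed
  also have "... <= (J0 * t ^ wsum) * (C1 * (E n x * E n x))"
   using k2[OF t, of "y n x"] scale(1)[OF n] unfolding EE by (intro mult_left_mono) (auto simp: t_def)
  also have "... <= (J0 * t ^ wsum) * (C1 * (C3 * t ^ ?N * E n x))"
   using Et E01 c1 scale(1)[OF n] by (intro mult_left_mono mult_right_mono) (auto simp: t_def)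
  also have "... = C1 * C3 * (J0 * t ^ wsum * t ^ ?N) * E n x" by (simp only: mult_ac)
  also have "... = (J0 * C1 * C3) * (real n powr (- (mu + real (k + 1) / (2 * real m))) * E n x)"
   unfolding t_def scale(2)[OF n] by (simp only: mult_ac)
  also have "... <= C * (real n powr (- (mu + real (k + 1) / (2 * real m))) * E n x)"
   using Cge E01 by (intro mult_right_mono) auto
  finally show ?thesis by (simp only: mult.assoc)
 qed
 have sumE: "infsum (E n) UNIV <= C * real n powr mu" if "n >= 1" for n
  by (rule order_trans[OF C2(3)[OF that]], rule mult_right_mono) (use Cge in auto)
 show ?thesis
  by (rule exI[of _ "cell delta"], rule exI[of _ "cell_core delta"], rule exI[of _ E], rule exI[of _ C], rule exI[of _ c1], rule exI[of _ R])
    (intro conjI allI impI cell_measurable cell(1) cell_core(1) cell_core(2)[OF delta(1)] cell_core(3) Cge(1) c1(1) E01 C2(2) sumE main far, simp add: R_def)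
qed

end

section \<open>Decomposition of the torus\<close>

lemma torus_representative_unique:
 assumes "xi \<in> torus" "xi + (2 * pi) *\<^sub>R real_vec l \<in> torus"
 shows "l = 0"
proof -
 have "l $ j = 0" for j
 proof -
  have a: "- pi < xi $ j" "xi $ j <= pi" "- pi < xi $ j + 2 * pi * real_of_int (l $ j)" "xi $ j + 2 * pi * real_of_int (l $ j) <= pi"
   using assms by (auto simp: torus_def)
  have "2 * pi * real_of_int (l $ j) < 2 * pi * 1" "2 * pi * (-1) < 2 * pi * real_of_int (l $ j)" using a by linarith+
  then have "real_of_int (l $ j) < 1" "-1 < real_of_int (l $ j)" by (simp_all only: mult_less_cancel_left_pos pi_gt_zero zero_less_mult_iff zero_less_numeral simp_thms)
  then show ?thesis by linarith
 qed
 then show ?thesis by (simp add: vec_eq_iff)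
qed

text \<open>An accumulation point has a period translate in \<open>Omega phi\<close>, and that translate would not be isolated.\<close>
lemma finite_Omega:
 fixes phi :: "int^'d => complex"
 assumes phi: "phi \<in> lp_space 1"
  and isol: "!!omega. omega \<in> Omega phi ==> \<exists>eps>0. \<forall>h. 0 < norm h --> norm h < eps --> cmod (fourier phi (omega + h)) < 1"
 shows "finite (Omega phi)"
proof (rule ccontr)
 assume inf: "infinite (Omega phi)"
 have "Omega phi \<subseteq> cbox (\<chi> j. - pi) (\<chi> j. pi)" using torus_subset_cbox unfolding Omega_def by blast
 then obtain x where x: "x islimpt Omega phi"
  using Heine_Borel_imp_Bolzano_Weierstrass[OF compact_cbox inf] by blast
 have "closed {xi. cmod (fourier phi xi) = 1}"
  by (rule closed_Collect_eq) (intro continuous_intros continuous_on_fourier[OF phi])+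
 moreover have "Omega phi \<subseteq> {xi. cmod (fourier phi xi) = 1}" by (auto simp: Omega_def)
 ultimately have Fx: "cmod (fourier phi x) = 1" using x islimpt_subset closed_limpt by blast
 obtain l where l: "x + (2 * pi) *\<^sub>R real_vec l \<in> torus" by (rule torus_representative)
 define omega where "omega = x + (2 * pi) *\<^sub>R real_vec l"
 have "omega \<in> Omega phi" using l Fx by (simp add: Omega_def omega_def periodicD[OF periodic_fourier])
 then obtain eps where eps: "eps > 0" "!!h. 0 < norm h ==> norm h < eps ==> cmod (fourier phi (omega + h)) < 1" using isol by blast
 obtain y where y: "y \<in> Omega phi" "y ~= x" "dist y x < eps" using x eps(1) unfolding islimpt_approachable by blast
 have "cmod (fourier phi (omega + (y - x))) < 1" using y by (intro eps(2)) (auto simp: dist_norm)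
 moreover have "omega + (y - x) = y + (2 * pi) *\<^sub>R real_vec l" by (simp add: omega_def)
 ultimately have "cmod (fourier phi y) < 1" by (simp add: periodicD[OF periodic_fourier])
 then show False using y(1) by (simp add: Omega_def)
qed

lemma fourier_le_1:
 fixes phi :: "int^'d => complex"
 assumes phi: "phi \<in> lp_space 1" and sup: "(SUP xi\<in>torus. cmod (fourier phi xi)) = 1"
 shows "cmod (fourier phi xi) <= 1"
proof -
 let ?B = "cbox (\<chi> j. - pi) (\<chi> j. pi) :: (real^'d) set"
 have ne: "?B ~= {}"
 proof -
  have "(0 :: real^'d) \<in> ?B" by (simp add: mem_box_cart)
  then show ?thesis by blast
 qed
 have cont: "continuous_on ?B (%xi. cmod (fourier phi xi))"
  by (intro continuous_on_norm continuous_on_subset[OF continuous_on_fourier[OF phi]]) simp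
 obtain k where k: "k \<in> ?B" "!!xi. xi \<in> ?B ==> cmod (fourier phi xi) <= cmod (fourier phi k)"
  using continuous_attains_sup[OF compact_cbox ne cont] by blast
 have all: "cmod (fourier phi xi) <= cmod (fourier phi k)" for xi
 proof -
  obtain l where "xi + (2 * pi) *\<^sub>R real_vec l \<in> torus" by (rule torus_representative)
  then have "xi + (2 * pi) *\<^sub>R real_vec l \<in> ?B" using torus_subset_cbox by blast
  from k(2)[OF this] show ?thesis by (simp add: periodicD[OF periodic_fourier])
 qed
 obtain l where l: "k + (2 * pi) *\<^sub>R real_vec l \<in> torus" by (rule torus_representative)
 have "(SUP xi\<in>torus. cmod (fourier phi xi)) = cmod (fourier phi k)"
 proof (rule cSup_eq_maximum)
  have "cmod (fourier phi (k + (2 * pi) *\<^sub>R real_vec l)) \<in> (%xi. cmod (fourier phi xi)) ` torus" using l by (rule imageI)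
  then show "cmod (fourier phi k) \<in> (%xi. cmod (fourier phi xi)) ` torus" by (simp only: periodicD[OF periodic_fourier])
 qed (use all in auto)
 then have one: "cmod (fourier phi k) = 1" using sup by simp
 show "cmod (fourier phi xi) <= 1" using all one by simp
qed

text \<open>The cells may stick out of the fundamental cube. Their period translates are pairwise disjoint, because two points of maximal modulus are at least two radii apart. The integral over the torus of the part carried by the translates of one cell is computed on the torus centred at its midpoint, which contains the cell.\<close>
lemma torus_cells:
 fixes phi :: "int^'d => complex" and Q W0 :: "real^'d => (real^'d) set"
 assumes phi: "phi \<in> lp_space 1" and fin: "finite (Omega phi)" and F1: "!!xi. cmod (fourier phi xi) <= 1"
  and eps: "eps < pi"
  and sep: "!!omega h. omega \<in> Omega phi ==> 0 < norm h ==> norm h < 2 * eps ==> cmod (fourier phi (omega + h)) < 1"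
  and Q: "!!omega. omega \<in> Omega phi ==> Q omega \<in> sets borel" "!!omega. omega \<in> Omega phi ==> Q omega \<subseteq> ball omega eps"
  and W: "!!omega. omega \<in> Omega phi ==> open (W0 omega)" "!!omega. omega \<in> Omega phi ==> omega \<in> W0 omega" "!!omega. omega \<in> Omega phi ==> W0 omega \<subseteq> Q omega"
 shows "\<exists>rho\<ge>0. rho < 1 \<and> (\<forall>n x. cmod (torus_integral (%xi. fourier phi xi ^ n * character (real_vec x) xi)
   - (\<Sum>omega\<in>Omega phi. LINT xi:Q omega|lborel. fourier phi xi ^ n * character (real_vec x) xi)) <= rho ^ n * (2 * pi) ^ CARD('d))"
proof -
 note per = periodicD[OF periodic_fourier[of phi]]
 define K where "K = cbox (\<chi> j. - pi) (\<chi> j. pi) \<inter> (\<Inter>omega\<in>Omega phi. \<Inter>l. {xi::real^'d. xi + (2 * pi) *\<^sub>R real_vec l \<in> - W0 omega})"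
 have clK: "closed {xi::real^'d. xi + (2 * pi) *\<^sub>R real_vec l \<in> - W0 omega}" if "omega \<in> Omega phi" for omega l
 proof -
  have "closed ((%xi::real^'d. xi + (2 * pi) *\<^sub>R real_vec l) -` (- W0 omega))"
   by (rule closed_vimage) (use W(1)[OF that] in \<open>auto intro!: continuous_intros\<close>)
  then show ?thesis by (simp add: vimage_def)
 qed
 have cK: "compact K" unfolding K_def by (intro compact_Int_closed compact_cbox closed_INT ballI clK)
 obtain rho where rho: "rho >= 0" "rho < 1" "!!xi. xi \<in> K ==> cmod (fourier phi xi) <= rho"
 proof (cases "K = {}")
  case True
  then show thesis using that[of 0] by simp
 next
  case False
  have "continuous_on K (%xi. cmod (fourier phi xi))"
   by (intro continuous_on_norm continuous_on_subset[OF continuous_on_fourier[OF phi]]) simp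
  from continuous_attains_sup[OF cK False this] obtain k where k: "k \<in> K" "!!xi. xi \<in> K ==> cmod (fourier phi xi) <= cmod (fourier phi k)" by blast
  have "cmod (fourier phi k) ~= 1"
  proof
   assume one: "cmod (fourier phi k) = 1"
   obtain l where l: "k + (2 * pi) *\<^sub>R real_vec l \<in> torus" by (rule torus_representative)
   then have "k + (2 * pi) *\<^sub>R real_vec l \<in> Omega phi" using one by (simp add: Omega_def per)
   then show False using W(2)[of "k + (2 * pi) *\<^sub>R real_vec l"] k(1) unfolding K_def by blast
  qed
  then have "cmod (fourier phi k) < 1" using F1[of k] by linarith
  then show thesis using that[of "cmod (fourier phi k)"] k(2) by simp
 qed
 define QP where "QP = (%omega. \<Union>l. {xi::real^'d. xi + (2 * pi) *\<^sub>R real_vec l \<in> Q omega})"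
 have QPm: "QP omega \<in> sets borel" if "omega \<in> Omega phi" for omega
 proof -
  have "{xi::real^'d. xi + (2 * pi) *\<^sub>R real_vec l \<in> Q omega} \<in> sets borel" for l
   using measurable_sets_borel[OF _ Q(1)[OF that], of "%xi. xi + (2 * pi) *\<^sub>R real_vec l"] by (simp add: vimage_def)
  then show ?thesis unfolding QP_def by (intro sets.countable_UN) auto
 qed
 have disj: "omega = omega'" if o: "omega \<in> Omega phi" "omega' \<in> Omega phi" and x: "xi \<in> QP omega" "xi \<in> QP omega'" for omega omega' xi
 proof -
  obtain l l' where l: "xi + (2 * pi) *\<^sub>R real_vec l \<in> Q omega" "xi + (2 * pi) *\<^sub>R real_vec l' \<in> Q omega'" using x by (auto simp: QP_def)
  define h where "h = omega' + (2 * pi) *\<^sub>R real_vec (l - l') - omega"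
  have d: "norm (xi + (2 * pi) *\<^sub>R real_vec l - omega) < eps" "norm (xi + (2 * pi) *\<^sub>R real_vec l' - omega') < eps"
   using l Q(2)[OF o(1)] Q(2)[OF o(2)] by (auto simp: dist_norm norm_minus_commute subset_iff)
  have "h = (xi + (2 * pi) *\<^sub>R real_vec l - omega) - (xi + (2 * pi) *\<^sub>R real_vec l' - omega')"
   by (simp add: h_def real_vec_simps scaleR_diff_right)
  then have "norm h <= norm (xi + (2 * pi) *\<^sub>R real_vec l - omega) + norm (xi + (2 * pi) *\<^sub>R real_vec l' - omega')"
   by (simp only: norm_triangle_ineq4)
  then have nh: "norm h < 2 * eps" using d by linarith
  have "omega + h = omega' + (2 * pi) *\<^sub>R real_vec (l - l')" by (simp add: h_def)
  then have "cmod (fourier phi (omega + h)) = 1" using o(2) by (simp only: per) (simp add: Omega_def)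
  then have "h = 0" using sep[OF o(1), of h] nh by fastforce
  then have e: "omega = omega' + (2 * pi) *\<^sub>R real_vec (l - l')" by (simp add: h_def)
  have "l - l' = 0" by (rule torus_representative_unique[of omega']) (use o e in \<open>auto simp: Omega_def\<close>)
  then show ?thesis using e by (simp add: real_vec_simps)
 qed
 have bound: "cmod (torus_integral (%xi. fourier phi xi ^ n * character (real_vec x) xi)
   - (\<Sum>omega\<in>Omega phi. LINT xi:Q omega|lborel. fourier phi xi ^ n * character (real_vec x) xi)) <= rho ^ n * (2 * pi) ^ CARD('d)" for n x
 proof -
  define f where "f = (%xi. fourier phi xi ^ n * character (real_vec x) xi)"
  have fm[measurable]: "f \<in> borel_measurable borel"
   unfolding f_def character_def by (intro borel_measurable_continuous_onI continuous_intros continuous_on_fourier[OF phi])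
  have pf: "f (xi + (2 * pi) *\<^sub>R real_vec l) = f xi" for xi l
   unfolding f_def per periodicD[OF periodic_character] ..
  have nf: "cmod (f xi) = cmod (fourier phi xi) ^ n" for xi by (simp add: f_def norm_mult norm_power)
  have f1: "cmod (f xi) <= 1" for xi unfolding nf using F1 by (simp add: power_le_one)
  define g where "g = (%omega xi. indicator (QP omega) xi *\<^sub>R f xi)"
  have gm: "g omega \<in> borel_measurable borel" if "omega \<in> Omega phi" for omega
   unfolding g_def using QPm[OF that] by measurable
  have g1: "cmod (g omega xi) <= 1" for omega xi using f1[of xi] by (simp add: g_def indicator_def)
  have pQ: "xi + (2 * pi) *\<^sub>R real_vec l \<in> QP omega \<longleftrightarrow> xi \<in> QP omega" for xi l omega
  proof
   assume "xi + (2 * pi) *\<^sub>R real_vec l \<in> QP omega"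
   then obtain l' where "xi + (2 * pi) *\<^sub>R real_vec l + (2 * pi) *\<^sub>R real_vec l' \<in> Q omega" by (auto simp: QP_def)
   then have "xi + (2 * pi) *\<^sub>R real_vec (l + l') \<in> Q omega" by (simp add: real_vec_simps scaleR_add_right add.assoc)
   then show "xi \<in> QP omega" unfolding QP_def by blast
  next
   assume "xi \<in> QP omega"
   then obtain l' where "xi + (2 * pi) *\<^sub>R real_vec l' \<in> Q omega" by (auto simp: QP_def)
   then have "xi + (2 * pi) *\<^sub>R real_vec l + (2 * pi) *\<^sub>R real_vec (l' - l) \<in> Q omega" by (simp add: real_vec_simps scaleR_diff_right)
   then show "xi + (2 * pi) *\<^sub>R real_vec l \<in> QP omega" unfolding QP_def by blast
  qed
  have pg: "periodic (g omega)" for omega unfolding periodic_def g_def using pQ by (simp add: pf indicator_def)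
  have cellint: "torus_integral (g omega) = (LINT xi:Q omega|lborel. f xi)" if o: "omega \<in> Omega phi" for omega
  proof -
   have "torus_integral (g omega) = torus_integral (%xi. g omega (xi + omega))"
    by (rule torus_integral_shift[OF gm[OF o] pg g1, symmetric])
   also have "... = (LINT xi|lborel. indicator (Q omega) (xi + omega) *\<^sub>R f (xi + omega))"
    unfolding set_lebesgue_integral_def
   proof (rule Bochner_Integration.integral_cong[OF refl])
    fix xi :: "real^'d"
    have iff: "xi \<in> torus \<and> xi + omega \<in> QP omega \<longleftrightarrow> xi + omega \<in> Q omega"
    proof -
     have small: "zeta \<in> torus" if "zeta + omega \<in> Q omega" for zeta
     proof -
      have n: "norm zeta < pi" using that Q(2)[OF o] eps by (auto simp: dist_norm subset_iff)
      show ?thesis unfolding torus_def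
      proof (intro CollectI allI)
       fix j show "- pi < zeta $ j \<and> zeta $ j <= pi" using component_le_norm_cart[of zeta j] n by linarith
      qed
     qed
     show ?thesis
     proof
      assume a: "xi \<in> torus \<and> xi + omega \<in> QP omega"
      then obtain l where l: "xi + omega + (2 * pi) *\<^sub>R real_vec l \<in> Q omega" by (auto simp: QP_def)
      then have "xi + (2 * pi) *\<^sub>R real_vec l \<in> torus" by (intro small) (simp add: add_ac)
      then have "l = 0" using a torus_representative_unique by blast
      then show "xi + omega \<in> Q omega" using l by (simp add: real_vec_simps)
     next
      assume a: "xi + omega \<in> Q omega"
      then have "xi + omega + (2 * pi) *\<^sub>R real_vec 0 \<in> Q omega" by (simp add: real_vec_simps)
      then show "xi \<in> torus \<and> xi + omega \<in> QP omega" using small[OF a] unfolding QP_def by blast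
     qed
    qed
    show "indicator torus xi *\<^sub>R g omega (xi + omega) = indicator (Q omega) (xi + omega) *\<^sub>R f (xi + omega)"
     using iff by (auto simp: g_def indicator_def)
   qed
   also have "... = (LINT xi|lborel. indicator (Q omega) xi *\<^sub>R f xi)"
    by (rule lborel_integral_translate(1)) (use Q(1)[OF o] in measurable)
   finally show ?thesis by (simp only: set_lebesgue_integral_def)
  qed
  define r where "r = (%xi. f xi - (\<Sum>omega\<in>Omega phi. g omega xi))"
  have rm: "r \<in> borel_measurable borel" unfolding r_def by (intro borel_measurable_diff borel_measurable_sum fm gm)
  have ft: "emeasure lborel (torus :: (real^'d) set) < \<infinity>" by (simp add: emeasure_torus)
  have fi: "integrable lborel (%xi. indicator torus xi *\<^sub>R f xi)"
   using bounded_set_integrable[OF torus_measurable fm ft f1] by (simp only: set_integrable_def)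
  have gi: "integrable lborel (%xi. indicator torus xi *\<^sub>R g omega xi)" if "omega \<in> Omega phi" for omega
   using bounded_set_integrable[OF torus_measurable gm[OF that] ft g1] by (simp only: set_integrable_def)
  have "(\<Sum>omega\<in>Omega phi. LINT xi:Q omega|lborel. f xi) = (\<Sum>omega\<in>Omega phi. LINT xi|lborel. indicator torus xi *\<^sub>R g omega xi)"
   unfolding set_lebesgue_integral_def by (rule sum.cong[OF refl], rule cellint[unfolded set_lebesgue_integral_def, symmetric])
  also have "... = (LINT xi|lborel. (\<Sum>omega\<in>Omega phi. indicator torus xi *\<^sub>R g omega xi))"
   by (rule Bochner_Integration.integral_sum[symmetric]) (rule gi)
  finally have cells: "(\<Sum>omega\<in>Omega phi. LINT xi:Q omega|lborel. f xi) = (LINT xi|lborel. (\<Sum>omega\<in>Omega phi. indicator torus xi *\<^sub>R g omega xi))" .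
  have si: "integrable lborel (%xi. \<Sum>omega\<in>Omega phi. indicator torus xi *\<^sub>R g omega xi)"
   by (rule Bochner_Integration.integrable_sum) (rule gi)
  have "torus_integral f - (\<Sum>omega\<in>Omega phi. LINT xi:Q omega|lborel. f xi)
    = (LINT xi|lborel. indicator torus xi *\<^sub>R f xi - (\<Sum>omega\<in>Omega phi. indicator torus xi *\<^sub>R g omega xi))"
   unfolding cells unfolding set_lebesgue_integral_def by (rule Bochner_Integration.integral_diff[OF fi si, symmetric])
  also have "... = torus_integral r" by (simp only: set_lebesgue_integral_def r_def scaleR_diff_right scaleR_sum_right)
  finally have eq: "torus_integral f - (\<Sum>omega\<in>Omega phi. LINT xi:Q omega|lborel. f xi) = torus_integral r" .
  have rb: "cmod (r xi) <= rho ^ n" if t: "xi \<in> torus" for xi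
  proof (cases "\<exists>omega\<in>Omega phi. xi \<in> QP omega")
   case True
   then obtain omega where o: "omega \<in> Omega phi" "xi \<in> QP omega" by blast
   have z: "g omega' xi = 0" if "omega' \<in> Omega phi - {omega}" for omega'
   proof -
    have "xi \<notin> QP omega'" using disj[OF o(1) _ o(2), of omega'] that by blast
    then show ?thesis by (simp add: g_def)
   qed
   have "(\<Sum>omega'\<in>Omega phi. g omega' xi) = g omega xi + (\<Sum>omega'\<in>Omega phi - {omega}. g omega' xi)" by (rule sum.remove[OF fin o(1)])
   also have "(\<Sum>omega'\<in>Omega phi - {omega}. g omega' xi) = 0" by (rule sum.neutral) (use z in blast)
   finally have "(\<Sum>omega'\<in>Omega phi. g omega' xi) = f xi" using o(2) by (simp add: g_def)
   then show ?thesis using rho(1) by (simp add: r_def)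
  next
   case False
   have "xi + (2 * pi) *\<^sub>R real_vec l \<notin> W0 omega" if "omega \<in> Omega phi" for omega l
    using False W(3)[OF that] that unfolding QP_def by blast
   then have "xi \<in> K" unfolding K_def using t torus_subset_cbox by blast
   then have "cmod (fourier phi xi) ^ n <= rho ^ n" by (intro power_mono rho(3)) auto
   moreover have "(\<Sum>omega\<in>Omega phi. g omega xi) = 0" by (rule sum.neutral) (use False in \<open>auto simp: g_def\<close>)
   ultimately show ?thesis by (simp add: r_def nf)
  qed
  have "cmod (torus_integral r) <= rho ^ n * measure lborel (torus :: (real^'d) set)"
   by (rule set_integral_norm_le[OF torus_measurable rm ft rb])
  then show ?thesis unfolding eq[symmetric] measure_torus f_def .
 qed
 show ?thesis using rho(1,2) bound by blast
qed

section \<open>The remainder estimate\<close>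

lemma powr_le_exp:
 assumes c: "c > 0"
 obtains C where "C > 0" "!!n. n >= (1::nat) ==> exp (- c * real n) <= C * real n powr (- g)"
proof -
 define k where "k = nat \<lceil>g\<rceil>"
 define C where "C = fact k * (1 / c) ^ k"
 show thesis
 proof (rule that[of C])
  show "C > 0" using c by (simp add: C_def)
  fix n :: nat assume n: "n >= 1"
  have "g <= real k" unfolding k_def by linarith
  then have "real n powr g <= real n powr real k" using n by (intro powr_mono) auto
  also have "... = real n ^ k" using n by (simp add: powr_realpow)
  also have "... = (1 / c) ^ k * (c * real n) ^ k" using c by (simp add: power_mult_distrib power_one_over)
  also have "... <= (1 / c) ^ k * (fact k * exp (c * real n))" using c by (intro mult_left_mono power_le_fact_exp) auto
  finally have "real n powr g <= C * exp (c * real n)" by (simp add: C_def mult_ac)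
  then have "real n powr g * exp (- c * real n) <= C * exp (c * real n) * exp (- c * real n)" by (rule mult_right_mono) simp
  also have "... = C" by (simp add: mult.assoc flip: exp_add)
  finally have h: "real n powr g * exp (- c * real n) * real n powr (- g) <= C * real n powr (- g)" by (rule mult_right_mono) simp
  have one: "real n powr g * real n powr (- g) = 1" using n by (simp flip: powr_add)
  have "exp (- c * real n) = exp (- c * real n) * (real n powr g * real n powr (- g))" by (simp only: one mult_1_right)
  also have "... = real n powr g * exp (- c * real n) * real n powr (- g)" by (simp only: mult_ac)
  finally show "exp (- c * real n) <= C * real n powr (- g)" by (rule ord_eq_le_trans[OF _ h])
 qed
qed

text \<open>The conclusion of \<open>point_estimate\<close> as a predicate of its witnesses, so that these can be chosen for all points at once.\<close>
definition local_estimate ::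
 "(int^'d => complex) => (nat => int^'d => complex) => real^'d => real => real => real =>
  (real^'d) set => (real^'d) set => (nat => int^'d => real) => real => real => real => bool" where
 "local_estimate phi X omega eps mu nu Q W0 E C c R \<longleftrightarrow>
  Q \<in> sets borel \<and> Q \<subseteq> ball omega eps \<and> open W0 \<and> omega \<in> W0 \<and> W0 \<subseteq> Q \<and> C > 0 \<and> c > 0 \<and> R >= 0 \<and>
  (\<forall>n\<ge>1. \<forall>x. 0 <= E n x \<and> E n x <= 1) \<and>
  (\<forall>n\<ge>1. E n summable_on UNIV \<and> infsum (E n) UNIV <= C * real n powr mu) \<and>
  (\<forall>n\<ge>1. \<forall>x. cmod ((LINT xi:Q|lborel. fourier phi xi ^ n * character (real_vec x) xi) - complex_of_real ((2 * pi) ^ CARD('d)) * X n x)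
    <= C * real n powr (- nu) * E n x + C * exp (- c * real n)) \<and>
  (\<forall>n\<ge>1. \<forall>x. R * real n <= norm (real_vec x) --> cmod (complex_of_real ((2 * pi) ^ CARD('d)) * X n x)
    <= C * real n powr (- nu) * E n x)"

text \<open>If \<open>x\<close> is at most proportional to \<open>n\<close>, half of the error \<open>exp (- c * n)\<close> pays for the decay in \<open>x\<close>. Otherwise the convolution power and the expansion are small separately.\<close>
theorem pointwise_remainder_bound:
 fixes phi :: "int^'d => complex" and X :: "real^'d => nat => int^'d => complex"
 assumes phi: "phi \<in> H_class" and fin: "finite (Omega phi)" and F1: "!!xi. cmod (fourier phi xi) <= 1"
  and eps: "eps < pi"
  and sep: "!!omega h. omega \<in> Omega phi ==> 0 < norm h ==> norm h < 2 * eps ==> cmod (fourier phi (omega + h)) < 1"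
  and loc: "!!omega. omega \<in> Omega phi ==> local_estimate phi (X omega) omega eps (mu omega) (nu omega) (Q omega) (Wo omega) (E omega) (C omega) (c omega) (R omega)"
 obtains C7 c5 c6 where "C7 > 0" "c5 > 0" "c6 > 0"
  "!!n x. n >= 1 ==> cmod (conv_power phi n x - (\<Sum>omega\<in>Omega phi. X omega n x))
   <= (\<Sum>omega\<in>Omega phi. C omega * real n powr (- nu omega) * E omega n x) + C7 * exp (- c5 * real n) * exp (- c6 * norm (real_vec x))"
proof -
 have phi1: "phi \<in> lp_space 1" using phi by (simp add: H_class_def)
 note l = loc[unfolded local_estimate_def]
 have C0: "C omega > 0" "c omega > 0" "R omega >= 0" if "omega \<in> Omega phi" for omega using l[OF that] by blast+
 have E0: "E omega n x >= 0" if "omega \<in> Omega phi" "n >= 1" for omega n x using l[OF that(1)] that(2) by blast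
 have "\<exists>rho\<ge>0. rho < 1 \<and> (\<forall>n x. cmod (torus_integral (%xi. fourier phi xi ^ n * character (real_vec x) xi)
   - (\<Sum>omega\<in>Omega phi. LINT xi:Q omega|lborel. fourier phi xi ^ n * character (real_vec x) xi)) <= rho ^ n * (2 * pi) ^ CARD('d))"
 proof (rule torus_cells[OF phi1 fin F1 eps sep, of Q Wo])
  fix omega assume "omega \<in> Omega phi"
  from l[OF this] show "Q omega \<in> sets borel" "Q omega \<subseteq> ball omega eps" "open (Wo omega)" "omega \<in> Wo omega" "Wo omega \<subseteq> Q omega" by blast+
 qed
 then obtain rho where rho: "rho >= 0" "rho < 1" "!!n x. cmod (torus_integral (%xi. fourier phi xi ^ n * character (real_vec x) xi)
   - (\<Sum>omega\<in>Omega phi. LINT xi:Q omega|lborel. fourier phi xi ^ n * character (real_vec x) xi)) <= rho ^ n * (2 * pi) ^ CARD('d)" by blast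
 obtain W delta where W: "W >= 1" "delta > 0" "!!n x. n >= 1 ==> cmod (conv_power phi n x) <= W ^ n * exp (- delta * norm (real_vec x))"
  by (rule conv_power_exponential_bound[OF phi], rule that, assumption, assumption, blast)
 define rho' where "rho' = max rho (1 / 2)"
 define cs where "cs = Min (insert (- ln rho') (c ` Omega phi))"
 have rho': "0 < rho'" "rho' < 1" "rho <= rho'" using rho by (auto simp: rho'_def)
 have cs: "cs > 0" "cs <= - ln rho'" "!!omega. omega \<in> Omega phi ==> cs <= c omega"
  unfolding cs_def using fin rho' C0(2) by (auto simp: ln_less_zero)
 define D2 where "D2 = (2 * pi) ^ CARD('d)"
 have D2: "D2 >= 1" unfolding D2_def using pi_ge_two by (intro one_le_power) linarith
 define SC where "SC = sum C (Omega phi)"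
 have SC: "SC >= 0" unfolding SC_def by (rule sum_nonneg) (use C0 in \<open>auto intro: less_imp_le\<close>)
 \<comment> \<open>Beyond this multiple of \<open>n\<close> the spatial decay of the convolution power outweighs \<open>W ^ n\<close>, and all expansions are in their far regime.\<close>
 define Rs where "Rs = sum R (Omega phi) + 2 * ln W / delta + 1"
 have lnW: "ln W >= 0" using W(1) by simp
 have SR: "sum R (Omega phi) >= 0" by (rule sum_nonneg) (use C0 in blast)
 have q: "2 * ln W / delta >= 0" using lnW W(2) by simp
 have Rs: "Rs > 0" "2 * ln W / delta <= Rs" using SR q by (auto simp: Rs_def)
 have RsR: "R omega <= Rs" if "omega \<in> Omega phi" for omega
 proof -
  have "R omega <= sum R (Omega phi)" by (rule member_le_sum[OF that _ fin]) (use C0 in blast)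
  then show ?thesis using q by (simp add: Rs_def)
 qed
 define c5 where "c5 = min (cs / 2) (delta * Rs / 4)"
 define c6 where "c6 = min (cs / (2 * Rs)) (delta / 4)"
 define C7 where "C7 = D2 + SC"
 have pos: "C7 > 0" "c5 > 0" "c6 > 0" using D2 SC cs(1) W(2) Rs by (auto simp: C7_def c5_def c6_def)
 define G where "G = (%omega n. C omega * real n powr (- nu omega))"
 have G0: "G omega n >= 0" if "omega \<in> Omega phi" for omega n using C0(1)[OF that] by (simp add: G_def less_imp_le)
 have main: "cmod (conv_power phi n x - (\<Sum>omega\<in>Omega phi. X omega n x))
   <= (\<Sum>omega\<in>Omega phi. G omega n * E omega n x) + C7 * exp (- c5 * real n) * exp (- c6 * norm (real_vec x))" if n: "n >= 1" for n x
 proof -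
  let ?rem = "conv_power phi n x - (\<Sum>omega\<in>Omega phi. X omega n x)"
  let ?x = "norm (real_vec x)"
  have up: "cmod ?rem <= cmod (complex_of_real D2 * ?rem)"
   using mult_right_mono[OF D2 norm_ge_zero[of ?rem]] D2 by (simp add: norm_mult)
  have ex: "exp (- cs / 2 * real n) * exp (- cs / 2 * real n) = exp (- cs * real n)" by (simp flip: exp_add)
  show ?thesis
  proof (cases "?x <= Rs * real n")
   case True
   have "complex_of_real D2 * ?rem = (torus_integral (%xi. fourier phi xi ^ n * character (real_vec x) xi)
     - (\<Sum>omega\<in>Omega phi. LINT xi:Q omega|lborel. fourier phi xi ^ n * character (real_vec x) xi))
    + (\<Sum>omega\<in>Omega phi. (LINT xi:Q omega|lborel. fourier phi xi ^ n * character (real_vec x) xi) - complex_of_real D2 * X omega n x)"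
    unfolding conv_power_inversion[OF phi1 n, of x, symmetric]
    by (simp add: D2_def sum_subtractf sum_distrib_left right_diff_distrib)
   then have "cmod (complex_of_real D2 * ?rem) <= rho ^ n * D2 + (\<Sum>omega\<in>Omega phi. G omega n * E omega n x + C omega * exp (- cs * real n))"
   proof (simp only:, intro order_trans[OF norm_triangle_ineq] add_mono)
    show "cmod (torus_integral (%xi. fourier phi xi ^ n * character (real_vec x) xi)
     - (\<Sum>omega\<in>Omega phi. LINT xi:Q omega|lborel. fourier phi xi ^ n * character (real_vec x) xi)) <= rho ^ n * D2" unfolding D2_def by (rule rho(3))
    show "cmod (\<Sum>omega\<in>Omega phi. (LINT xi:Q omega|lborel. fourier phi xi ^ n * character (real_vec x) xi) - complex_of_real D2 * X omega n x)
      <= (\<Sum>omega\<in>Omega phi. G omega n * E omega n x + C omega * exp (- cs * real n))"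
    proof (rule sum_norm_le)
     fix omega assume o: "omega \<in> Omega phi"
     have "cmod ((LINT xi:Q omega|lborel. fourier phi xi ^ n * character (real_vec x) xi) - complex_of_real D2 * X omega n x)
       <= G omega n * E omega n x + C omega * exp (- c omega * real n)" using l[OF o] n unfolding D2_def G_def by blast
     also have "exp (- c omega * real n) <= exp (- cs * real n)" using mult_right_mono[OF cs(3)[OF o], of "real n"] by simp
     finally show "cmod ((LINT xi:Q omega|lborel. fourier phi xi ^ n * character (real_vec x) xi) - complex_of_real D2 * X omega n x)
       <= G omega n * E omega n x + C omega * exp (- cs * real n)" using C0(1)[OF o] by (simp add: mult_left_mono)
    qed
   qed
   also have "... = (\<Sum>omega\<in>Omega phi. G omega n * E omega n x) + (rho ^ n * D2 + SC * exp (- cs * real n))"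
    by (simp add: sum.distrib SC_def sum_distrib_right)
   also have "rho ^ n * D2 + SC * exp (- cs * real n) <= C7 * exp (- cs * real n)"
   proof -
    have "rho ^ n <= rho' ^ n" using rho' rho by (intro power_mono) auto
    also have "... = exp (ln rho' * real n)" using rho' by (simp add: exp_of_nat_mult mult.commute)
    also have "... <= exp (- cs * real n)" using mult_right_mono[OF cs(2), of "real n"] by simp
    finally have "rho ^ n * D2 <= exp (- cs * real n) * D2" using D2 by (intro mult_right_mono) auto
    then show ?thesis by (simp add: C7_def distrib_right mult.commute)
   qed
   also have "C7 * exp (- cs * real n) <= C7 * (exp (- c5 * real n) * exp (- c6 * ?x))"
   proof (intro mult_left_mono)
    have "c5 * real n <= cs / 2 * real n" by (intro mult_right_mono) (auto simp: c5_def)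
    then have a: "exp (- cs / 2 * real n) <= exp (- c5 * real n)" by simp
    have "c6 * ?x <= cs / (2 * Rs) * (Rs * real n)" using True cs(1) Rs pos by (intro mult_mono) (auto simp: c6_def)
    also have "... = cs / 2 * real n" using Rs by simp
    finally have b: "exp (- cs / 2 * real n) <= exp (- c6 * ?x)" by simp
    show "exp (- cs * real n) <= exp (- c5 * real n) * exp (- c6 * ?x)" unfolding ex[symmetric] using a b by (intro mult_mono) auto
   qed (use pos in simp)
   finally show ?thesis using up by (simp add: mult.assoc)
  next
   case False
   have far: "cmod (complex_of_real D2 * X omega n x) <= G omega n * E omega n x" if o: "omega \<in> Omega phi" for omega
   proof -
    have "R omega * real n <= Rs * real n" using RsR[OF o] by (intro mult_right_mono) auto
    then have "R omega * real n <= ?x" using False by linarith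
    then show ?thesis using l[OF o] n unfolding D2_def G_def by blast
   qed
   have "complex_of_real D2 * ?rem = complex_of_real D2 * conv_power phi n x - (\<Sum>omega\<in>Omega phi. complex_of_real D2 * X omega n x)"
    by (simp only: right_diff_distrib sum_distrib_left)
   then have "cmod (complex_of_real D2 * ?rem) <= D2 * cmod (conv_power phi n x) + (\<Sum>omega\<in>Omega phi. G omega n * E omega n x)"
   proof (simp only:, intro order_trans[OF norm_triangle_ineq4] add_mono)
    show "cmod (complex_of_real D2 * conv_power phi n x) <= D2 * cmod (conv_power phi n x)" using D2 by (simp add: norm_mult)
    show "cmod (\<Sum>omega\<in>Omega phi. complex_of_real D2 * X omega n x) <= (\<Sum>omega\<in>Omega phi. G omega n * E omega n x)" by (rule sum_norm_le[OF far])
   qed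
   also have "D2 * cmod (conv_power phi n x) <= C7 * (exp (- c5 * real n) * exp (- c6 * ?x))"
   proof (rule mult_mono)
    have "ln W <= delta / 2 * Rs" using Rs(2) W(2) by (simp add: field_simps)
    then have "ln W * real n <= delta / 2 * Rs * real n" by (rule mult_right_mono) simp
    also have "... <= delta / 2 * ?x" using False W(2) by simp
    finally have w: "ln W * real n <= delta / 2 * ?x" .
    have "W ^ n = exp (ln W * real n)" using W(1) by (simp add: exp_of_nat_mult mult.commute)
    then have "cmod (conv_power phi n x) <= exp (ln W * real n) * exp (- delta * ?x)" using W(3)[OF n, of x] by simp
    also have "... <= exp (delta / 2 * ?x) * exp (- delta * ?x)" using w by (intro mult_right_mono) auto
    also have "... = exp (- (delta / 4) * ?x) * exp (- (delta / 4) * ?x)" by (simp flip: exp_add)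
    also have "... <= exp (- c5 * real n) * exp (- c6 * ?x)"
    proof (rule mult_mono)
     have "c5 * real n <= delta * Rs / 4 * real n" by (intro mult_right_mono) (auto simp: c5_def)
     also have "... <= delta / 4 * ?x" using False W(2) by simp
     finally show "exp (- (delta / 4) * ?x) <= exp (- c5 * real n)" by simp
     have "c6 * ?x <= delta / 4 * ?x" by (intro mult_right_mono) (auto simp: c6_def)
     then show "exp (- (delta / 4) * ?x) <= exp (- c6 * ?x)" by simp
    qed auto
    finally show "cmod (conv_power phi n x) <= exp (- c5 * real n) * exp (- c6 * ?x)" .
   qed (use D2 SC in \<open>auto simp: C7_def\<close>)
   finally show ?thesis using up by (simp add: mult.assoc)
  qed
 qed
 show thesis by (rule that[OF pos main[unfolded G_def]])
qed

theorem corollary1p14: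
  fixes \<phi> :: "int^'d \<Rightarrow> complex"
    and \<alpha> :: "real^'d \<Rightarrow> real^'d"
    and P :: "real^'d \<Rightarrow> real^'d \<Rightarrow> complex"
    and \<Upsilon> :: "real^'d \<Rightarrow> complex^'d \<Rightarrow> complex"
    and A :: "real^'d \<Rightarrow> real^'d^'d"
    and m :: "real^'d \<Rightarrow> nat^'d"
    and ord :: "real^'d \<Rightarrow> nat"
    and p q :: ennreal
  assumes "\<phi> \<in> H_star"
    and "\<And>\<xi>. \<xi> \<in> Omega \<phi> \<Longrightarrow> positive_homogeneous_type \<phi> \<xi> (\<alpha> \<xi>) (P \<xi>) (\<Upsilon> \<xi>)"
    and "\<And>\<xi>. \<xi> \<in> Omega \<phi> \<Longrightarrow> invertible (A \<xi>)"
    and "\<And>\<xi>. \<xi> \<in> Omega \<phi> \<Longrightarrow> positive_semi_elliptic (m \<xi>) (\<lambda>\<eta>. P \<xi> (A \<xi> *v \<eta>))"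
    and "1 \<le> p" and "p \<le> q"
  shows "\<exists>C>0. \<forall>n\<ge>1. \<forall>u\<in>lp_space p.
           conv (remainder \<phi> \<alpha> P \<Upsilon> A m ord n) u \<in> lp_space q \<and>
           lp_norm q (conv (remainder \<phi> \<alpha> P \<Upsilon> A m ord n) u)
             \<le> C / real n powr decay_exponent \<phi> P m ord p q * lp_norm p u"
proof -
 have Hc: "\<phi> \<in> H_class" and sup: "(SUP \<xi>\<in>torus. cmod (fourier \<phi> \<xi>)) = 1" using assms(1) by (auto simp: H_star_def)
 have \<phi>1: "\<phi> \<in> lp_space 1" using Hc by (simp add: H_class_def)
 note F1 = fourier_le_1[OF \<phi>1 sup]
 have data: "\<exists>a b r B U. point_data (m omega) a b r B (\<Upsilon> omega) (A omega) U \<phi> omega (\<alpha> omega) (P omega)" if "omega \<in> Omega \<phi>" for omega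
  by (rule point_data_exists[OF \<phi>1 that assms(2)[OF that] assms(3)[OF that] assms(4)[OF that]])
 have isol: "\<exists>eps>0. \<forall>h. 0 < norm h --> norm h < eps --> cmod (fourier \<phi> (omega + h)) < 1" if o: "omega \<in> Omega \<phi>" for omega
 proof -
  from data[OF o] obtain a b r B U where "point_data (m omega) a b r B (\<Upsilon> omega) (A omega) U \<phi> omega (\<alpha> omega) (P omega)" by blast
  then interpret point_data "m omega" a b r B "\<Upsilon> omega" "A omega" U \<phi> omega "\<alpha> omega" "P omega" .
  show ?thesis
  proof (rule fourier_near, goal_cases)
   case (1 eps)
   from 1(1,3) show ?case by blast
  qed
 qed
 have fin: "finite (Omega \<phi>)" by (rule finite_Omega[OF \<phi>1 isol])
 have "\<forall>omega\<in>Omega \<phi>. \<exists>eps>0. \<forall>h. 0 < norm h --> norm h < eps --> cmod (fourier \<phi> (omega + h)) < 1" using isol by blast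
 from bchoice[OF this] obtain ep where ep: "!!omega. omega \<in> Omega \<phi> ==> ep omega > (0::real)"
  "!!omega h. omega \<in> Omega \<phi> ==> 0 < norm h ==> norm h < ep omega ==> cmod (fourier \<phi> (omega + h)) < 1" by blast
 \<comment> \<open>Cells of this radius have pairwise disjoint period translates and fit into a fundamental cube.\<close>
 define eps where "eps = Min (insert pi (ep ` Omega \<phi>)) / 3"
 have M: "Min (insert pi (ep ` Omega \<phi>)) > 0" using fin ep(1) by auto
 have eps: "eps > 0" "2 * eps < Min (insert pi (ep ` Omega \<phi>))" using M by (auto simp: eps_def)
 have "Min (insert pi (ep ` Omega \<phi>)) <= pi" using fin by simp
 then have epspi: "eps < pi" using eps by linarith
 have sep: "cmod (fourier \<phi> (omega + h)) < 1" if "omega \<in> Omega \<phi>" "0 < norm h" "norm h < 2 * eps" for omega h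
 proof -
  have "Min (insert pi (ep ` Omega \<phi>)) <= ep omega" using fin that(1) by simp
  then show ?thesis using eps(2) that by (intro ep(2)) auto
 qed
 define X where "X = (%omega n (x :: int^'d). \<Sum>l = 0..ord omega. exp (- (\<i> * complex_of_real (real_vec x \<bullet> omega))) * fourier \<phi> omega ^ n *
    Q_op (\<Upsilon> omega) (A omega) (m omega) l n (attractor (P omega) (real n)) (real_vec x - real n *\<^sub>R \<alpha> omega))"
 define mu where "mu = (%omega. hom_order (P omega))"
 define nu where "nu = (%omega. mu omega + real (ord omega + 1) / (2 * real (lcm_vec (m omega))))"
 define \<Phi> where "\<Phi> = (%omega. local_estimate \<phi> (X omega) omega eps (mu omega) (nu omega))"
 have "\<exists>Q W0 E C c R. \<Phi> omega Q W0 E C c R" if o: "omega \<in> Omega \<phi>" for omega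
 proof -
  from data[OF o] obtain a b r B U where pd: "point_data (m omega) a b r B (\<Upsilon> omega) (A omega) U \<phi> omega (\<alpha> omega) (P omega)" by blast
  from point_data.point_estimate[OF pd eps(1), of "ord omega"] show ?thesis
   unfolding \<Phi>_def local_estimate_def X_def nu_def mu_def point_data.expansion_def[OF pd] point_data.mu_def[OF pd] .
 qed
 then have s: "\<forall>omega\<in>Omega \<phi>. \<exists>Q W0 E C c R. \<Phi> omega Q W0 E C c R" by blast
 from bchoice[OF s] obtain Q where "\<forall>omega\<in>Omega \<phi>. \<exists>W0 E C c R. \<Phi> omega (Q omega) W0 E C c R" by blast
 from bchoice[OF this] obtain W0 where "\<forall>omega\<in>Omega \<phi>. \<exists>E C c R. \<Phi> omega (Q omega) (W0 omega) E C c R" by blast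
 from bchoice[OF this] obtain E where "\<forall>omega\<in>Omega \<phi>. \<exists>C c R. \<Phi> omega (Q omega) (W0 omega) (E omega) C c R" by blast
 from bchoice[OF this] obtain C where "\<forall>omega\<in>Omega \<phi>. \<exists>c R. \<Phi> omega (Q omega) (W0 omega) (E omega) (C omega) c R" by blast
 from bchoice[OF this] obtain c where "\<forall>omega\<in>Omega \<phi>. \<exists>R. \<Phi> omega (Q omega) (W0 omega) (E omega) (C omega) (c omega) R" by blast
 from bchoice[OF this] obtain R where "\<forall>omega\<in>Omega \<phi>. \<Phi> omega (Q omega) (W0 omega) (E omega) (C omega) (c omega) (R omega)" by blast
 then have loc: "local_estimate \<phi> (X omega) omega eps (mu omega) (nu omega) (Q omega) (W0 omega) (E omega) (C omega) (c omega) (R omega)" if "omega \<in> Omega \<phi>" for omega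
  using that by (simp add: \<Phi>_def)
 note l = loc[unfolded local_estimate_def]
 have C0: "C omega > 0" if "omega \<in> Omega \<phi>" for omega using l[OF that] by blast
 have E01: "0 <= E omega n x" "E omega n x <= 1" if "omega \<in> Omega \<phi>" "n >= 1" for omega n x using l[OF that(1)] that(2) by blast+
 have Es: "E omega n summable_on UNIV" "infsum (E omega n) UNIV <= C omega * real n powr mu omega" if "omega \<in> Omega \<phi>" "n >= 1" for omega n
  using l[OF that(1)] that(2) by blast+
 obtain C7 c5 c6 where C7: "C7 > 0" "c5 > 0" "c6 > 0"
  and bound: "!!n x. n >= 1 ==> cmod (conv_power \<phi> n x - (\<Sum>omega\<in>Omega \<phi>. X omega n x))
   <= (\<Sum>omega\<in>Omega \<phi>. C omega * real n powr (- nu omega) * E omega n x) + C7 * exp (- c5 * real n) * exp (- c6 * norm (real_vec x))"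
 proof (rule pointwise_remainder_bound[OF Hc fin F1 epspi, where X = X and mu = mu and nu = nu and Q = Q and Wo = W0 and E = E and C = C and c = c and R = R], goal_cases)
  case (1 omega h)
  from 1(2-4) show ?case by (rule sep)
 next
  case (2 omega)
  from 2(2) show ?case by (rule loc)
 next
  case (3 C7 c5 c6)
  from 3(2-) show ?case by (rule that[of C7 c5 c6])
 qed
 define gam where "gam = decay_exponent \<phi> P m ord p q"
 define theta where "theta = enn2real (1 / p) - enn2real (1 / q)"
 have gam: "gam <= mu omega * theta + (nu omega - mu omega)" if "omega \<in> Omega \<phi>" for omega
  unfolding gam_def decay_exponent_def theta_def nu_def mu_def using fin that by simp
 obtain C8 where C8: "C8 > 0" "!!n. n >= (1::nat) ==> exp (- c5 * real n) <= C8 * real n powr (- gam)"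
  by (rule powr_le_exp[OF C7(2), of gam], rule that, assumption, blast)
 define S6 where "S6 = (\<Sum>\<^sub>\<infinity>x::int^'d. exp (- c6 * norm (real_vec x)))"
 have S6s: "(%x::int^'d. exp (- c6 * norm (real_vec x))) summable_on UNIV" by (rule lattice_exp_summable[OF C7(3)])
 have S6: "S6 >= 0" unfolding S6_def by (rule infsum_nonneg) simp
 \<comment> \<open>The index \<open>None\<close> carries the exponentially small part of the bound.\<close>
 define I where "I = insert None (Some ` Omega \<phi>)"
 have I: "finite I" "I ~= {}" using fin by (auto simp: I_def)
 have sumI: "(\<Sum>i\<in>I. f i) = f None + (\<Sum>omega\<in>Omega \<phi>. f (Some omega))" for f :: "(real^'d) option => real"
  unfolding I_def using fin by (simp add: sum.reindex)
 define T where "T = C7 * (S6 + 1) * C8 + (\<Sum>omega\<in>Omega \<phi>. C omega * C omega powr (1 - theta))"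
 have T: "T >= 0"
  unfolding T_def using C7 C8 S6 by (intro add_nonneg_nonneg sum_nonneg mult_nonneg_nonneg) (use C0 in \<open>auto intro: less_imp_le\<close>)
 define Cf where "Cf = real (card I) ^ 2 * T + 1"
 have Cf: "Cf > 0" using T by (simp add: Cf_def add_nonneg_pos)
 show ?thesis
 proof (intro exI[of _ Cf] conjI Cf allI impI ballI)
  fix n :: nat and u :: "int^'d => complex" assume n: "n >= 1" and u: "u \<in> lp_space p"
  let ?rem = "remainder \<phi> \<alpha> P \<Upsilon> A m ord n"
  have np: "real n > 0" using n by simp
  define K where "K = (%i (x::int^'d). case i of None => C7 * exp (- c5 * real n) * exp (- c6 * norm (real_vec x))
   | Some omega => C omega * real n powr (- nu omega) * E omega n x)"
  define a where "a = case_option (C7 * exp (- c5 * real n) * (S6 + 1)) (%omega. C omega * real n powr (- nu omega))"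
  define b where "b = case_option (C7 * exp (- c5 * real n) * (S6 + 1)) (%omega. C omega * real n powr (- nu omega) * (C omega * real n powr mu omega))"
  have rem: "?rem x = conv_power \<phi> n x - (\<Sum>omega\<in>Omega \<phi>. X omega n x)" for x by (simp only: remainder_def X_def)
  have fK: "cmod (?rem x) <= (\<Sum>i\<in>I. K i x)" for x
   unfolding rem sumI K_def option.case using bound[OF n, of x] by linarith
  have K0: "0 <= K i x" if "i \<in> I" for i x
  proof (cases i)
   case None
   then show ?thesis using C7 by (simp add: K_def)
  next
   case (Some omega)
   then have "omega \<in> Omega \<phi>" using that by (auto simp: I_def)
   then show ?thesis using Some C0 E01(1)[OF _ n] by (simp add: K_def less_imp_le)
  qed
  have Ks: "K i summable_on UNIV \<and> infsum (K i) UNIV <= b i" if "i \<in> I" for i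
  proof (cases i)
   case None
   have "infsum (K i) UNIV = C7 * exp (- c5 * real n) * S6" unfolding None K_def option.case S6_def by (rule infsum_cmult_right) (rule S6s)
   also have "... <= C7 * exp (- c5 * real n) * (S6 + 1)" using C7 by (intro mult_left_mono) auto
   finally have "infsum (K i) UNIV <= b i" by (simp add: None b_def)
   moreover have "K i summable_on UNIV" unfolding None K_def option.case by (rule summable_on_cmult_right[OF S6s])
   ultimately show ?thesis by blast
  next
   case (Some omega)
   then have o: "omega \<in> Omega \<phi>" using that by (auto simp: I_def)
   have "infsum (K i) UNIV = C omega * real n powr (- nu omega) * infsum (E omega n) UNIV" unfolding Some K_def option.case by (rule infsum_cmult_right) (rule Es(1)[OF o n])
   also have "... <= C omega * real n powr (- nu omega) * (C omega * real n powr mu omega)" using C0[OF o] Es(2)[OF o n] by (intro mult_left_mono) auto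
   finally have "infsum (K i) UNIV <= b i" by (simp add: Some b_def)
   moreover have "K i summable_on UNIV" unfolding Some K_def option.case by (rule summable_on_cmult_right[OF Es(1)[OF o n]])
   ultimately show ?thesis by blast
  qed
  have ab: "0 < a i \<and> 0 < b i \<and> (\<forall>x. K i x <= a i)" if "i \<in> I" for i
  proof (cases i)
   case None
   have "exp (- c6 * norm (real_vec x)) <= S6 + 1" for x :: "int^'d"
   proof -
    have "exp (- c6 * norm (real_vec x)) <= 1" using C7 by simp
    then show ?thesis using S6 by linarith
   qed
   then have "K i x <= a i" for x unfolding None K_def a_def option.case using C7 by (intro mult_left_mono) auto
   then show ?thesis using C7 S6 by (simp add: None a_def b_def)
  next
   case (Some omega)
   then have o: "omega \<in> Omega \<phi>" using that by (auto simp: I_def)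
   have "K i x <= a i" for x unfolding Some K_def a_def option.case using E01(2)[OF o n, of x] C0[OF o] by (simp add: mult_left_le)
   then show ?thesis using C0[OF o] np by (simp add: Some a_def b_def)
  qed
  have each: "a None powr theta * b None powr (1 - theta) <= C7 * (S6 + 1) * C8 * real n powr (- gam)"
  proof -
   have a0: "a None > 0" using ab[of None] by (simp add: I_def)
   have bn: "b None = a None" by (simp add: a_def b_def)
   have "a None powr theta * b None powr (1 - theta) = a None powr (theta + (1 - theta))" unfolding bn by (rule powr_add[symmetric])
   also have "... = a None" using a0 by simp
   also have "... = C7 * (S6 + 1) * exp (- c5 * real n)" by (simp add: a_def)
   also have "... <= C7 * (S6 + 1) * (C8 * real n powr (- gam))" using C7 S6 C8(2)[OF n] by (intro mult_left_mono) auto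
   finally show ?thesis by (simp only: mult.assoc)
  qed
  \<comment> \<open>The supremum and the sum of a kernel differ by the factor \<open>n powr mu\<close>, of which interpolation leaves the power \<open>1 - theta\<close>.\<close>
  have each': "a (Some omega) powr theta * b (Some omega) powr (1 - theta) <= C omega * C omega powr (1 - theta) * real n powr (- gam)" if o: "omega \<in> Omega \<phi>" for omega
  proof -
   have a0: "a (Some omega) > 0" using ab[of "Some omega"] o by (simp add: I_def)
   have b: "b (Some omega) = a (Some omega) * (C omega * real n powr mu omega)" by (simp add: a_def b_def)
   have "a (Some omega) powr theta * b (Some omega) powr (1 - theta)
    = a (Some omega) powr (theta + (1 - theta)) * (C omega powr (1 - theta) * real n powr (mu omega * (1 - theta)))"
    unfolding b powr_add using a0 C0[OF o] np by (simp add: powr_mult powr_powr)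
   also have "... = C omega * C omega powr (1 - theta) * (real n powr (- nu omega) * real n powr (mu omega * (1 - theta)))"
    using a0 by (simp add: a_def)
   also have "real n powr (- nu omega) * real n powr (mu omega * (1 - theta)) = real n powr (- nu omega + mu omega * (1 - theta))" by (rule powr_add[symmetric])
   also have "... <= real n powr (- gam)"
    using gam[OF o] n by (intro powr_mono) (auto simp: algebra_simps)
   finally show ?thesis using C0[OF o] by (simp add: mult_left_mono)
  qed
  have S: "(\<Sum>i\<in>I. a i powr theta * b i powr (1 - theta)) <= T * real n powr (- gam)"
   unfolding sumI T_def distrib_right sum_distrib_right by (intro add_mono each sum_mono each')
  note Y = young_dominated[of I ?rem K b a p q u, OF I fK K0 _ _ _ _ _ assms(5) assms(6) u]
  show "conv ?rem u \<in> lp_space q" by (rule Y(1)) (use Ks ab in blast)+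
  have nn: "lp_norm p u >= 0"
  proof (cases "p = \<infinity>")
   case True
   have "bounded (range u)" using u True by (simp add: lp_space_def)
   then have "bdd_above (range (%x. cmod (u x)))" by (auto simp: bounded_iff bdd_above_def)
   then have "cmod (u 0) <= (SUP x. cmod (u x))" by (rule cSUP_upper[rotated]) simp
   then have "0 <= (SUP x. cmod (u x))" by (rule order_trans[OF norm_ge_zero])
   then show ?thesis using True by (simp add: lp_norm_def)
  next
   case False
   then show ?thesis by (simp add: lp_norm_def)
  qed
  have "lp_norm q (conv ?rem u) <= real (card I) ^ 2 * (\<Sum>i\<in>I. a i powr theta * b i powr (1 - theta)) * lp_norm p u"
   unfolding theta_def by (rule Y(2)) (use Ks ab in blast)+
  also have "... <= real (card I) ^ 2 * (T * real n powr (- gam)) * lp_norm p u"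
   using S nn by (intro mult_right_mono mult_left_mono) auto
  also have "... = (real (card I) ^ 2 * T) * (real n powr (- gam) * lp_norm p u)" by (simp only: mult_ac)
  also have "... <= Cf * (real n powr (- gam) * lp_norm p u)" using nn by (intro mult_right_mono) (auto simp: Cf_def)
  also have "... = Cf / real n powr gam * lp_norm p u" by (simp add: powr_minus_divide)
  finally show "lp_norm q (conv ?rem u) <= Cf / real n powr decay_exponent \<phi> P m ord p q * lp_norm p u" unfolding gam_def .
 qed
qed

end
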